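(* Let $f\in H^{\kappa-1}(D)$, and let $u$ be the unique element of $L^\infty_{\mathbb P_{\mathbf y}}(\square;H^1_0(D))$ satisfying $$(\mathbf A[\mathbf y]\nabla_{\mathbf x}u[\mathbf y],\nabla_{\mathbf x}v)_{L^2(D;\mathbb R^d)}=(f,v)_{L^2(D)}\quad\text{for almost every }\mathbf y\in\square\text{ and all }v\in H^1_0(D).$$ Then for every $\boldsymbol\alpha\in\mathbb N^M$ the derivatives of $u$ in $\mathbf y$ satisfy $$|\!|\!|\partial_{\mathbf y}^{\boldsymbol\alpha}u|\!|\!|_{\kappa+1,2,D}\le|\boldsymbol\alpha|!\,\boldsymbol\mu_\kappa^{\boldsymbol\alpha}\Big(\max\big\{2,\;2C_{\kappa,er}\kappa^2d^2k_{\kappa,\mathbf A},\;C_{\kappa,er}\|f\|_{\kappa-1,2,D}\big\}\Big)^{|\boldsymbol\alpha|+1},$$ where $\boldsymbol\mu_\kappa^{\boldsymbol\alpha}=\prod_{k=1}^M\mu_{\kappa,k}^{\alpha_k}$ with $\mu_{\kappa,k}=\frac{4c_{\boldsymbol\gamma_\kappa}^2}{\underline a^2\log 2}\gamma_{\kappa,k}$, $$k_{\kappa,\mathbf A}=\Big[(\kappa+1)\overline a\Big(\tfrac{2c_{\boldsymbol\gamma_\kappa}^2}{\underline a^2}\Big)^\kappa+\overline a\Big]\,3(\kappa+1)\tfrac1{\underline a^2}\Big(\tfrac{2c_{\boldsymbol\gamma_\kappa}^2}{\underline a^2}\Big)^\kappa c_{\boldsymbol\gamma_\kappa}^2+\overline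 a,$$ and $C_{\kappa,er}=\max_{0\le s\le\|\mathbf A\|_{L^\infty_{\mathbb P_{\mathbf y}}(\square;\mathcal R_\kappa)}}C_{\kappa,er}(D,s)$.
   Context: $\mathbb N$ includes $0$. $D\subset\mathbb R^d$ ($d\ge1$) is a Lipschitz domain, $\kappa\ge1$ and $M$ are positive integers, and $\square=[-1,1]^M$ with $\mathbb P_{\mathbf y}$ the uniform product probability measure on $\square$. $\mathbb R^d$ carries the Euclidean norm $\|\cdot\|_2$ and $\mathbb R^{d\times d}$ the induced matrix norm. Norms: for a Banach space $\mathcal X$, $\|v\|_{\eta,p,D;\mathcal X}:=\sum_{|\boldsymbol\alpha|\le\eta}\frac1{\boldsymbol\alpha!}\|\partial_{\mathbf x}^{\boldsymbol\alpha}v\|_{L^p(D;\mathcal X)}$ is the norm used on $W^{\eta,p}(D;\mathcal X)$ (also for $H^\eta=W^{\eta,2}$), and $|\!|\!|v|\!|\!|_{\eta,p,D;\mathcal X}:=\operatorname{ess\,sup}_{\mathbf y\in\square}\|v[\mathbf y]\|_{\eta,p,D;\mathcal X}$ is the norm of $L^\infty_{\mathbb P_{\mathbf y}}(\square;W^{\eta,p}(D;\mathcal X))$; $\mathcal X$ is omitted when it is $\mathbb R,\mathbb R^d,\mathbb R^{d\times d}$. Vector field: $\mathbf V[\mathbf y](\mathbf x)=\boldsymbol\psi_0(\mathbf x)+\sum_{k=1}^M\sigma_k\boldsymbol\psi_k(\mathbf x)y_k$ with $\sigma_k\in\mathbb R$, $\sigma_0:=1$, $\boldsymbol\psi_k\in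 W^{\kappa,\infty}(D;\mathbb R^d)$ for $0\le k\le M$. Put $\gamma_{\kappa,k}:=\|\sigma_k\boldsymbol\psi_k\|_{W^{\kappa,\infty}(D;\mathbb R^d)}$, $c_{\boldsymbol\gamma_\kappa}:=\max\{\sum_{k=0}^M\gamma_{\kappa,k},2\}$. There are constants $0<\underline a\le1\le\overline a<\infty$ with $\underline a\le\|\mathbf V[\mathbf y](\mathbf x)\|_2\le\overline a$ for almost every $\mathbf y\in\square$, $\mathbf x\in D$; $a\in[\underline a,\overline a]$ is a fixed number. Diffusion coefficient: $\mathbf A[\mathbf y](\mathbf x):=a\mathbf I+(\|\mathbf V[\mathbf y](\mathbf x)\|_2-a)\frac{\mathbf V[\mathbf y](\mathbf x)\mathbf V^{\mathsf T}[\mathbf y](\mathbf x)}{\mathbf V^{\mathsf T}[\mathbf y](\mathbf x)\mathbf V[\mathbf y](\mathbf x)}$. Elliptic regularity assumption: $\mathcal R_\kappa$ is a Banach space with norm $\|\cdot\|_{\mathcal R_\kappa}$ such that for every (symmetric) $\mathbf A_0\in W^{\kappa,\infty}(D;\mathbb R^{d\times d})\cap\mathcal R_\kappa$ whose eigenvalues lie in $[\underline a,\overline a]$ a.e. in $D$, and every $h\in H^{\kappa-1}(D)$, the problem of finding $w\in H^1_0(D)$ with $(\mathbf A_0\nabla w,\nabla v)_{L^2(D;\mathbb R^d)}=(h,v)_{L^2(D)}$ for all $v\in H^1_0(D)$ has a unique solution, which lies in $H^{\kappa+1}(D)$ and satisfies $\|w\|_{\kappa+1,2,D}\le C_{\kappa,er}(D,\|\mathbf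 A_0\|_{\mathcal R_\kappa})\|h\|_{\kappa-1,2,D}$, where $C_{\kappa,er}(D,s)$ depends only on $D$ and continuously on $s\ge0$. It is assumed that $\mathbf A\in L^\infty_{\mathbb P_{\mathbf y}}(\square;\mathcal R_\kappa)$. *)

theory Defs
  imports "HOL-Analysis.Analysis" "HOL-Probability.Essential_Supremum"
begin

text \<open>
  Elements of \<open>L\<^sup>p\<close>, Sobolev and Bochner spaces are represented by functions. Whatever is
  defined below depends only on their restrictions to the domain, up to null sets.
\<close>

subsection \<open>Multi-indices\<close>

definition mi_size :: "nat^'n::finite \<Rightarrow> nat" where
  "mi_size \<alpha> = (\<Sum>i\<in>UNIV. \<alpha> $ i)"

definition mi_fact :: "nat^'n::finite \<Rightarrow> nat" where
  "mi_fact \<alpha> = (\<Prod>i\<in>UNIV. fact (\<alpha> $ i))"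

definition mi_power :: "('n::finite \<Rightarrow> real) \<Rightarrow> nat^'n \<Rightarrow> real" where
  "mi_power \<mu> \<alpha> = (\<Prod>i\<in>UNIV. \<mu> i ^ (\<alpha> $ i))"

subsection \<open>Lipschitz domains\<close>

text \<open>
  Near each boundary point \<open>p\<close>, in the cylinder with axis \<open>n\<close>, the domain is the set below
  the graph of a Lipschitz function on the hyperplane orthogonal to \<open>n\<close>. Boundedness is
  not required.
\<close>

definition lipschitz_domain :: "(real^'d::finite) set \<Rightarrow> bool" where
  "lipschitz_domain D \<longleftrightarrow> open D \<and> connected D \<and> D \<noteq> {} \<and>
     (\<forall>p\<in>frontier D. \<exists>n g L r h.
        norm n = 1 \<and> L-lipschitz_on {z. z \<bullet> n = 0} g \<and> 0 < r \<and> 0 < h \<and>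
        (\<forall>z t. z \<bullet> n = 0 \<and> norm z < r \<and> \<bar>t\<bar> < h \<longrightarrow>
           (p + z + t *\<^sub>R n \<in> D \<longleftrightarrow> t < g z) \<and>
           (p + z + t *\<^sub>R n \<in> frontier D \<longleftrightarrow> t = g z)))"

subsection \<open>Test functions and weak derivatives\<close>

definition partial :: "'d::finite \<Rightarrow> (real^'d \<Rightarrow> real) \<Rightarrow> real^'d \<Rightarrow> real" where
  "partial i \<phi> x = frechet_derivative \<phi> (at x) (axis i 1)"

primrec Ck :: "nat \<Rightarrow> (real^'d::finite \<Rightarrow> real) \<Rightarrow> bool" where
  "Ck 0 \<phi> \<longleftrightarrow> continuous_on UNIV \<phi>"
| "Ck (Suc n) \<phi> \<longleftrightarrow> (\<forall>x. \<phi> differentiable (at x)) \<and> (\<forall>i. Ck n (partial i \<phi>))"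

definition test_fun :: "(real^'d::finite) set \<Rightarrow> (real^'d \<Rightarrow> real) \<Rightarrow> bool" where
  "test_fun D \<phi> \<longleftrightarrow> (\<forall>n. Ck n \<phi>) \<and> compact (closure {x. \<phi> x \<noteq> 0}) \<and> closure {x. \<phi> x \<noteq> 0} \<subseteq> D"

text \<open>
  The list enumerates the coordinate directions with multiplicities \<open>\<alpha>\<close>. The order is
  immaterial for the smooth functions to which this is applied.
\<close>

definition mi_partial :: "nat^'d::finite \<Rightarrow> (real^'d \<Rightarrow> real) \<Rightarrow> real^'d \<Rightarrow> real" where
  "mi_partial \<alpha> \<phi> = foldr partial (SOME is. \<forall>i. count_list is i = \<alpha> $ i) \<phi>"

definition locally_integrable :: "(real^'d::finite) set \<Rightarrow> (real^'d \<Rightarrow> 'b::euclidean_space) \<Rightarrow> bool" where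
  "locally_integrable D f \<longleftrightarrow> (\<forall>K. compact K \<and> K \<subseteq> D \<longrightarrow> integrable (lebesgue_on K) f)"

definition is_weak_deriv ::
    "(real^'d::finite) set \<Rightarrow> nat^'d \<Rightarrow> (real^'d \<Rightarrow> 'b::euclidean_space) \<Rightarrow> (real^'d \<Rightarrow> 'b) \<Rightarrow> bool" where
  "is_weak_deriv D \<alpha> f g \<longleftrightarrow> locally_integrable D f \<and> locally_integrable D g \<and>
     (\<forall>\<phi>. test_fun D \<phi> \<longrightarrow>
        (\<integral>x. mi_partial \<alpha> \<phi> x *\<^sub>R f x \<partial>lebesgue_on D) =
        (-1) ^ mi_size \<alpha> *\<^sub>R (\<integral>x. \<phi> x *\<^sub>R g x \<partial>lebesgue_on D))"

definition weak_deriv ::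
    "(real^'d::finite) set \<Rightarrow> nat^'d \<Rightarrow> (real^'d \<Rightarrow> 'b::euclidean_space) \<Rightarrow> real^'d \<Rightarrow> 'b" where
  "weak_deriv D \<alpha> f = (SOME g. is_weak_deriv D \<alpha> f g)"

definition weak_grad :: "(real^'d::finite) set \<Rightarrow> (real^'d \<Rightarrow> real) \<Rightarrow> real^'d \<Rightarrow> real^'d" where
  "weak_grad D w x = (\<chi> i. weak_deriv D (axis i 1) w x)"

subsection \<open>Lebesgue and Sobolev spaces\<close>

definition Lp_space :: "(real^'d::finite) set \<Rightarrow> ereal \<Rightarrow> (real^'d \<Rightarrow> 'b::euclidean_space) set" where
  "Lp_space D p = {f. f \<in> borel_measurable (lebesgue_on D) \<and>
     (if p = \<infinity> then esssup (lebesgue_on D) (\<lambda>x. ereal (norm (f x))) < \<infinity>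
      else integrable (lebesgue_on D) (\<lambda>x. norm (f x) powr real_of_ereal p))}"

definition Lp_norm :: "(real^'d::finite) set \<Rightarrow> ereal \<Rightarrow> (real^'d \<Rightarrow> 'b::euclidean_space) \<Rightarrow> real" where
  "Lp_norm D p f =
     (if p = \<infinity> then real_of_ereal (esssup (lebesgue_on D) (\<lambda>x. ereal (norm (f x))))
      else (\<integral>x. norm (f x) powr real_of_ereal p \<partial>lebesgue_on D) powr (1 / real_of_ereal p))"

definition sobolev :: "(real^'d::finite) set \<Rightarrow> nat \<Rightarrow> ereal \<Rightarrow> (real^'d \<Rightarrow> 'b::euclidean_space) set" where
  "sobolev D \<eta> p = {v. \<forall>\<alpha>. mi_size \<alpha> \<le> \<eta> \<longrightarrow> (\<exists>g\<in>Lp_space D p. is_weak_deriv D \<alpha> v g)}"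

text \<open>
  For matrix-valued functions \<^const>\<open>norm\<close> is the Frobenius norm. Only the set
  \<^const>\<open>sobolev\<close> is used for these, and it does not depend on the choice of matrix norm.
\<close>

definition sob_norm :: "(real^'d::finite) set \<Rightarrow> nat \<Rightarrow> ereal \<Rightarrow> (real^'d \<Rightarrow> 'b::euclidean_space) \<Rightarrow> real" where
  "sob_norm D \<eta> p v =
     (\<Sum>\<alpha> | mi_size \<alpha> \<le> \<eta>. 1 / real (mi_fact \<alpha>) * Lp_norm D p (weak_deriv D \<alpha> v))"

definition H10 :: "(real^'d::finite) set \<Rightarrow> (real^'d \<Rightarrow> real) set" where
  "H10 D = {v \<in> sobolev D 1 2. \<exists>\<phi>. (\<forall>n. test_fun D (\<phi> n)) \<and>
     (\<lambda>n. sob_norm D 1 2 (\<lambda>x. v x - \<phi> n x)) \<longlonglongrightarrow> 0}"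

subsection \<open>The parameter domain and Bochner spaces\<close>

definition param_box :: "(real^'m::finite) set" where
  "param_box = cbox (\<chi> k. -1) (\<chi> k. 1)"

text \<open>
  The uniform measure on the box is the (completed) product of the uniform measures on
  \<open>[-1, 1]\<close>. It is derived from Lebesgue measure on the box, not \<^const>\<open>lborel\<close>, so that the measure is complete:
  \<^const>\<open>esssup\<close> is infinite by convention for functions that are not measurable.
\<close>

definition param_measure :: "(real^'m::finite) measure" where
  "param_measure = uniform_measure (lebesgue_on param_box) param_box"

text \<open>
  The Banach space in which a Bochner function takes its values is given by its carrier \<open>S\<close>,
  a set of functions representing equivalence classes, and its norm \<open>N\<close>.
\<close>

definition strongly_measurable ::
    "'y measure \<Rightarrow> ('x \<Rightarrow> 'b::real_vector) set \<Rightarrow> (('x \<Rightarrow> 'b) \<Rightarrow> real) \<Rightarrow> ('y \<Rightarrow> 'x \<Rightarrow> 'b) \<Rightarrow> bool" where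
  "strongly_measurable P S N v \<longleftrightarrow>
     (\<exists>s. (\<forall>n. simple_function P (s n) \<and> (\<forall>y\<in>space P. s n y \<in> S)) \<and>
          (AE y in P. v y \<in> S \<and> (\<lambda>n. N (\<lambda>x. s n y x - v y x)) \<longlonglongrightarrow> 0))"

definition Linf_space ::
    "'y measure \<Rightarrow> ('x \<Rightarrow> 'b::real_vector) set \<Rightarrow> (('x \<Rightarrow> 'b) \<Rightarrow> real) \<Rightarrow> ('y \<Rightarrow> 'x \<Rightarrow> 'b) set" where
  "Linf_space P S N = {v. strongly_measurable P S N v \<and> esssup P (\<lambda>y. ereal (N (v y))) < \<infinity>}"

definition Linf_norm :: "'y measure \<Rightarrow> (('x \<Rightarrow> 'b) \<Rightarrow> real) \<Rightarrow> ('y \<Rightarrow> 'x \<Rightarrow> 'b) \<Rightarrow> real" where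
  "Linf_norm P N v = real_of_ereal (esssup P (\<lambda>y. ereal (N (v y))))"

definition banach_fun_space ::
    "(real^'d::finite) set \<Rightarrow> (real^'d \<Rightarrow> 'b::euclidean_space) set \<Rightarrow> ((real^'d \<Rightarrow> 'b) \<Rightarrow> real) \<Rightarrow> bool" where
  "banach_fun_space D S N \<longleftrightarrow>
     (\<lambda>x. 0) \<in> S \<and>
     (\<forall>F\<in>S. \<forall>G\<in>S. (\<lambda>x. F x + G x) \<in> S \<and> N (\<lambda>x. F x + G x) \<le> N F + N G) \<and>
     (\<forall>c. \<forall>F\<in>S. (\<lambda>x. c *\<^sub>R F x) \<in> S \<and> N (\<lambda>x. c *\<^sub>R F x) = \<bar>c\<bar> * N F) \<and>
     (\<forall>F\<in>S. \<forall>G. (AE x in lebesgue_on D. F x = G x) \<longrightarrow> G \<in> S) \<and>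
     (\<forall>F\<in>S. 0 \<le> N F \<and> (N F = 0 \<longleftrightarrow> (AE x in lebesgue_on D. F x = 0))) \<and>
     (\<forall>F. (\<forall>n. F n \<in> S) \<and>
          (\<forall>\<epsilon>>0. \<exists>n0::nat. \<forall>m\<ge>n0. \<forall>n\<ge>n0. N (\<lambda>x. F m x - F n x) < \<epsilon>) \<longrightarrow>
          (\<exists>G\<in>S. (\<lambda>n. N (\<lambda>x. F n x - G x)) \<longlonglongrightarrow> 0))"

subsection \<open>The diffusion problem\<close>

definition vector_field ::
    "(real^'d::finite \<Rightarrow> real^'d) \<Rightarrow> ('m::finite \<Rightarrow> real) \<Rightarrow> ('m \<Rightarrow> real^'d \<Rightarrow> real^'d) \<Rightarrow>
     real^'m \<Rightarrow> real^'d \<Rightarrow> real^'d" where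
  "vector_field \<psi>0 \<sigma> \<psi> y x = \<psi>0 x + (\<Sum>k\<in>UNIV. (\<sigma> k * y $ k) *\<^sub>R \<psi> k x)"

definition diffusion_matrix :: "real \<Rightarrow> real^'d::finite \<Rightarrow> real^'d^'d" where
  "diffusion_matrix a v =
     a *\<^sub>R mat 1 + (norm v - a) *\<^sub>R ((1 / (v \<bullet> v)) *\<^sub>R (\<chi> i j. v $ i * v $ j))"

definition weak_solution ::
    "(real^'d::finite) set \<Rightarrow> (real^'d \<Rightarrow> real^'d^'d) \<Rightarrow> (real^'d \<Rightarrow> real) \<Rightarrow> (real^'d \<Rightarrow> real) \<Rightarrow> bool" where
  "weak_solution D A h w \<longleftrightarrow> w \<in> H10 D \<and>
     (\<forall>v\<in>H10 D. (\<integral>x. (A x *v weak_grad D w x) \<bullet> weak_grad D v x \<partial>lebesgue_on D) =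
                (\<integral>x. h x * v x \<partial>lebesgue_on D))"

definition elliptic_regularity ::
    "(real^'d::finite) set \<Rightarrow> nat \<Rightarrow> real \<Rightarrow> real \<Rightarrow> (real^'d \<Rightarrow> real^'d^'d) set \<Rightarrow>
     ((real^'d \<Rightarrow> real^'d^'d) \<Rightarrow> real) \<Rightarrow> (real \<Rightarrow> real) \<Rightarrow> bool" where
  "elliptic_regularity D \<kappa> a_lo a_hi R normR C \<longleftrightarrow>
     banach_fun_space D R normR \<and> continuous_on {0..} C \<and>
     (\<forall>A0 h. A0 \<in> sobolev D \<kappa> \<infinity> \<and> A0 \<in> R \<and>
        (AE x in lebesgue_on D. transpose (A0 x) = A0 x \<and>
           (\<forall>\<theta> e. e \<noteq> 0 \<and> A0 x *v e = \<theta> *\<^sub>R e \<longrightarrow> \<theta> \<in> {a_lo..a_hi})) \<and>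
        h \<in> sobolev D (\<kappa> - 1) 2 \<longrightarrow>
        (\<exists>w. weak_solution D A0 h w) \<and>
        (\<forall>w w'. weak_solution D A0 h w \<and> weak_solution D A0 h w' \<longrightarrow>
           (AE x in lebesgue_on D. w x = w' x)) \<and>
        (\<forall>w. weak_solution D A0 h w \<longrightarrow> w \<in> sobolev D (\<kappa> + 1) 2 \<and>
           sob_norm D (\<kappa> + 1) 2 w \<le> C (normR A0) * sob_norm D (\<kappa> - 1) 2 h))"

text \<open>
  \<open>U \<alpha>\<close> is the partial derivative of order \<open>\<alpha>\<close> with respect to the parameter of the
  \<open>H\<^sup>1\<^sub>0\<close>-valued map \<open>u\<close>: limits of difference quotients in the norm of \<open>H\<^sup>1\<close>, one-sided on
  the faces of the box. As \<open>u\<close> is given up to a null set of parameters, the map that is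
  differentiated is a representative \<open>U 0\<close> of \<open>u\<close>; two representatives that are
  differentiable along the coordinate directions agree at every parameter.
\<close>

definition param_derivs ::
    "(real^'d::finite) set \<Rightarrow> (real^'m::finite \<Rightarrow> real^'d \<Rightarrow> real) \<Rightarrow>
     (nat^'m \<Rightarrow> real^'m \<Rightarrow> real^'d \<Rightarrow> real) \<Rightarrow> bool" where
  "param_derivs D u U \<longleftrightarrow>
     (AE y in param_measure. AE x in lebesgue_on D. U 0 y x = u y x) \<and>
     (\<forall>\<alpha>. \<forall>y\<in>param_box. U \<alpha> y \<in> H10 D) \<and>
     (\<forall>\<alpha> k. \<forall>y\<in>param_box.
        ((\<lambda>t. sob_norm D 1 2
                (\<lambda>x. (U \<alpha> (y + t *\<^sub>R axis k 1) x - U \<alpha> y x) / t - U (\<alpha> + axis k 1) y x))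
           \<longlongrightarrow> 0) (at 0 within {t. y + t *\<^sub>R axis k 1 \<in> param_box}))"

subsection \<open>Constants in the regularity estimate\<close>

definition gamma0_const :: "(real^'d::finite) set \<Rightarrow> nat \<Rightarrow> (real^'d \<Rightarrow> real^'d) \<Rightarrow> real" where
  "gamma0_const D \<kappa> \<psi>0 = sob_norm D \<kappa> \<infinity> \<psi>0"

definition gamma_const ::
    "(real^'d::finite) set \<Rightarrow> nat \<Rightarrow> ('m \<Rightarrow> real) \<Rightarrow> ('m \<Rightarrow> real^'d \<Rightarrow> real^'d) \<Rightarrow> 'm \<Rightarrow> real" where
  "gamma_const D \<kappa> \<sigma> \<psi> k = sob_norm D \<kappa> \<infinity> (\<lambda>x. \<sigma> k *\<^sub>R \<psi> k x)"

definition k_const :: "nat \<Rightarrow> real \<Rightarrow> real \<Rightarrow> real \<Rightarrow> real" where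
  "k_const \<kappa> a_lo a_hi c =
     ((real \<kappa> + 1) * a_hi * (2 * c\<^sup>2 / a_lo\<^sup>2) ^ \<kappa> + a_hi) *
       (3 * (real \<kappa> + 1) * (1 / a_lo\<^sup>2) * (2 * c\<^sup>2 / a_lo\<^sup>2) ^ \<kappa> * c\<^sup>2) + a_hi"

end

theory Submission
 imports Defs
begin

text \<open>
 The coefficient depends on \<open>y\<close> through the affine field \<open>V\<close>, so its entries are real analytic in
 \<open>y\<close>. The weighted norms \<open>\<Sum>\<^sub>I \<theta>\<^sup>|\<^sup>I\<^sup>| \<parallel>\<partial>\<^sup>I f\<parallel>\<^sub>\<infinity> / I!\<close> are submultiplicative, and for
 \<open>\<theta> = a_lo\<^sup>2 / (2 c\<^sup>2)\<close> the differential equation of a power, read coefficientwise, bounds \<open>1 / |V|\<close> by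
 \<open>2 / a_lo\<close>. The same recursion in \<open>y\<close>, started from the majorant \<open>c\<^sup>2 + 2 c z + z\<^sup>2\<close> of \<open>V \<bullet> V\<close>, bounds
 the Taylor coefficients \<open>A\<^sub>J\<close> of the matrix. The Taylor coefficients \<open>u\<^sub>I\<close> of the solution satisfy
 \<open>div (A \<nabla>u\<^sub>I) = - \<Sum>\<^sub>J div (A\<^sub>J \<nabla>u\<^sub>I\<^sub>-\<^sub>J)\<close>, the sum being over \<open>0 < J \<le> I\<close>, and elliptic regularity turns this
 into a recursive bound. Regularity is assumed for almost every \<open>y\<close> only; it extends to
 every \<open>y\<close> because \<open>A\<close> is Lipschitz in \<open>y\<close> with values in \<open>W\<^sup>\<kappa>\<^sup>,\<^sup>\<infinity>\<close> and \<open>H\<^sup>\<kappa>\<^sup>+\<^sup>1\<close> is complete. A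
 second order estimate for \<open>u\<^sub>I\<close> along the coordinate directions, by induction on \<open>I\<close>, identifies
 the derivatives.
\<close>

section \<open>Smooth functions\<close>

text \<open>The domain may be unbounded, so no Poincare inequality is available: coercivity only
  forces the gradient of a difference of solutions to vanish, and uniqueness at an arbitrary y is
  borrowed from one parameter where it is assumed. Right hand sides are kept as functionals on H10
  represented by an H^(\<kappa>-1) function, the form that the regularity assumption accepts. Origin
  of the constants: with L = 3 c^2 / (a_lo^2 ln 2) the recursion for 1/|V| closes, because ln 2 <
  7/10 and c \<ge> 2 give 2 c / L + 1 / L^2 \<le> a_lo^2 / 4. Squaring 1/|V| costs a factor n + 1 at
  order n, and the rate 4/3 L behind \<mu> leaves (3/4)^n to absorb it. Removing the weight \<theta>
  costs (2 c^2 / a_lo^2)^\<kappa>, and the two derivatives in a divergence cost d^2 \<kappa>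
  (\<kappa> + 1). The constant \<open>k_const\<close> contains that power twice, which leaves room
  for the numerical factors. The 2 in the maximum makes the geometric sum in the recursion for the
  solution at most twice its largest term.\<close>

lemma partial_eqI: "(f has_derivative f') (at x) ==> partial i f x = f' (axis i 1)"
 unfolding partial_def by (metis frechet_derivative_at)

lemma has_derivative_partial:
 assumes "f differentiable (at x)"
 shows "(f has_derivative frechet_derivative f (at x)) (at x)"
 using assms frechet_derivative_works by blast

text \<open>Along a coordinate line a partial derivative is an ordinary one, which makes
  \<open>MVT2\<close> applicable to second differences and to difference quotients.\<close>

lemma partial_line_deriv:
 assumes "!!x. f differentiable (at x)"
 shows "((\<lambda>t. f (p + t *\<^sub>R axis i 1)) has_real_derivative partial i f (p + t *\<^sub>R axis i 1)) (at t)"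
proof -
 let ?D = "frechet_derivative f (at (p + t *\<^sub>R axis i 1))"
 have "((\<lambda>t. f (p + t *\<^sub>R axis i 1)) has_derivative (\<lambda>s. ?D (s *\<^sub>R axis i 1))) (at t)"
  by (rule has_derivative_compose[of "\<lambda>t. p + t *\<^sub>R axis i 1" "\<lambda>s. s *\<^sub>R axis i 1" t UNIV f ?D])
   (auto intro!: derivative_eq_intros has_derivative_partial assms)
 moreover have "?D (s *\<^sub>R axis i 1) = partial i f (p + t *\<^sub>R axis i 1) * s" for s
  using linear_frechet_derivative[OF assms] unfolding partial_def
  by (simp add: linear_cmul mult.commute)
 ultimately show ?thesis by (simp add: has_field_derivative_def mult_commute_abs)
qed

section \<open>Closure properties of the classes \<open>Ck\<close>\<close>

lemma Ck_Suc_imp: "Ck (Suc n) f ==> Ck n f"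
proof (induction n arbitrary: f)
 case 0
 then show ?case
  by (auto intro!: continuous_at_imp_continuous_on differentiable_imp_continuous_within)
next
 case (Suc n)
 then show ?case by (metis Ck.simps(2))
qed

lemma Ck_const: "Ck n (\<lambda>x::real^'d::finite. c)"
proof (induction n arbitrary: c)
 case (Suc n)
 have "partial i (\<lambda>x::real^'d. c) = (\<lambda>x. 0)" for i
  by (rule ext, subst partial_eqI[of _ "\<lambda>_. 0"]) auto
 then show ?case using Suc by simp
qed simp

lemma partial_add:
 assumes "f differentiable (at x)" "g differentiable (at x)"
 shows "partial i (\<lambda>x. f x + g x) x = partial i f x + partial i g x"
proof -
 have "((\<lambda>x. f x + g x) has_derivative
   (\<lambda>h. frechet_derivative f (at x) h + frechet_derivative g (at x) h)) (at x)"
  by (intro derivative_intros has_derivative_partial assms)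
 from partial_eqI[OF this] show ?thesis by (simp add: partial_def)
qed

lemma partial_mult:
 assumes "f differentiable (at x)" "g differentiable (at x)"
 shows "partial i (\<lambda>x. f x * g x) x = partial i f x * g x + f x * partial i g x"
proof -
 have "((\<lambda>x. f x * g x) has_derivative
   (\<lambda>h. f x * frechet_derivative g (at x) h + frechet_derivative f (at x) h * g x)) (at x)"
  by (intro derivative_intros has_derivative_partial assms)
 from partial_eqI[OF this] show ?thesis by (simp add: partial_def)
qed

lemma Ck_add: "Ck n f ==> Ck n g ==> Ck n (\<lambda>x. f x + g x)"
proof (induction n arbitrary: f g)
 case (Suc n)
 then have "partial i (\<lambda>x. f x + g x) = (\<lambda>x. partial i f x + partial i g x)" for i
  by (auto intro!: ext partial_add)
 then show ?case using Suc by auto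
qed (auto intro: continuous_intros)

lemma Ck_mult: "Ck n f ==> Ck n g ==> Ck n (\<lambda>x. f x * g x)"
proof (induction n arbitrary: f g)
 case (Suc n)
 then have "partial i (\<lambda>x. f x * g x) = (\<lambda>x. partial i f x * g x + f x * partial i g x)" for i
  by (auto intro!: ext partial_mult)
 moreover have "Ck n f" "Ck n g" using Suc.prems Ck_Suc_imp by blast+
 ultimately show ?case using Suc by (auto intro!: Ck_add)
qed (auto intro: continuous_intros)

lemma partial_nth: "partial i (\<lambda>x. x $ j) x = (if i = j then 1 else 0)"
proof -
 have "((\<lambda>x::real^'a. x $ j) has_derivative (\<lambda>h. h $ j)) (at x)"
  by (intro bounded_linear_imp_has_derivative bounded_linear_vec_nth)
 from partial_eqI[OF this, of i] show ?thesis by (auto simp: axis_def)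
qed

lemma Ck_nth: "Ck n (\<lambda>x. x $ j)"
proof (cases n)
 case 0
 then show ?thesis by (auto intro!: continuous_intros)
next
 case (Suc k)
 have "partial i (\<lambda>x. x $ j) = (\<lambda>x. if i = j then 1 else 0)" for i
  by (rule ext) (rule partial_nth)
 moreover have "(\<lambda>x::real^'a. x $ j) differentiable (at x)" for x
  by (intro bounded_linear_imp_differentiable bounded_linear_vec_nth)
 ultimately show ?thesis using Suc by (simp add: Ck_const)
qed

lemma partial_affine:
 assumes "!!x. f differentiable (at x)"
 shows "partial i (\<lambda>x. f (c *\<^sub>R x + z)) x = c * partial i f (c *\<^sub>R x + z)"
  and "(\<lambda>x. f (c *\<^sub>R x + z)) differentiable (at x)"
proof -
 let ?D = "frechet_derivative f (at (c *\<^sub>R x + z))"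
 have *: "((\<lambda>x. f (c *\<^sub>R x + z)) has_derivative (\<lambda>h. ?D (c *\<^sub>R h))) (at x)"
  by (rule has_derivative_compose[of "\<lambda>x. c *\<^sub>R x + z" "\<lambda>h. c *\<^sub>R h" x UNIV f ?D])
   (auto intro!: derivative_eq_intros has_derivative_partial assms)
 then show "(\<lambda>x. f (c *\<^sub>R x + z)) differentiable (at x)"
  by (auto simp: differentiable_def)
 from partial_eqI[OF *, of i] linear_frechet_derivative[OF assms]
 show "partial i (\<lambda>x. f (c *\<^sub>R x + z)) x = c * partial i f (c *\<^sub>R x + z)"
  by (simp add: partial_def linear_cmul)
qed

lemma Ck_affine: "Ck n f ==> Ck n (\<lambda>x. f (c *\<^sub>R x + z))"
proof (induction n arbitrary: f)
 case 0
 then have f: "continuous_on UNIV f" by simp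
 have "continuous_on UNIV (f \<circ> (\<lambda>x. c *\<^sub>R x + z))"
  by (intro continuous_on_compose continuous_intros continuous_on_subset[OF f]) auto
 then show ?case by (simp add: o_def)
next
 case (Suc n)
 then have d: "f differentiable (at x)" for x by simp
 have "partial i (\<lambda>x. f (c *\<^sub>R x + z)) = (\<lambda>x. c * partial i f (c *\<^sub>R x + z))" for i
  using partial_affine(1)[OF d] by auto
 then show ?case using Suc partial_affine(2)[OF d] by (auto intro!: Ck_mult Ck_const)
qed

text \<open>The mean value theorem is applied twice: to the increment of f in direction j as a
  function along i, then to the i-th partial derivative along j. The second difference is symmetric
  in i and j, so the same number is also expressed by the other mixed derivative.\<close>

lemma partial_second_difference:
 assumes f: "Ck 2 f" and h: "h > 0"
 shows "\<exists>\<xi>. norm (\<xi> - x) \<le> 2 * h \<and>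
  f (x + h *\<^sub>R axis i 1 + h *\<^sub>R axis j 1) - f (x + h *\<^sub>R axis i 1) - f (x + h *\<^sub>R axis j 1) + f x
   = h * h * partial j (partial i f) \<xi>"
proof -
 have d: "f differentiable (at x)" for x using f by (simp add: numeral_2_eq_2)
 have dd: "partial i f differentiable (at x)" for x using f by (simp add: numeral_2_eq_2)
 define G where "G s = f (x + h *\<^sub>R axis j 1 + s *\<^sub>R axis i 1) - f (x + s *\<^sub>R axis i 1)" for s
 have "\<exists>s>0. s < h \<and> G h - G 0 = (h - 0) *
   (partial i f (x + h *\<^sub>R axis j 1 + s *\<^sub>R axis i 1) - partial i f (x + s *\<^sub>R axis i 1))"
  unfolding G_def
  by (intro MVT2 h DERIV_diff partial_line_deriv d)
 then obtain s where s: "0 < s" "s < h" and Gs: "G h - G 0 = h *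
   (partial i f (x + h *\<^sub>R axis j 1 + s *\<^sub>R axis i 1) - partial i f (x + s *\<^sub>R axis i 1))"
  by auto
 have "\<exists>t>0. t < h \<and> partial i f ((x + s *\<^sub>R axis i 1) + h *\<^sub>R axis j 1) -
   partial i f ((x + s *\<^sub>R axis i 1) + 0 *\<^sub>R axis j 1) =
   (h - 0) * partial j (partial i f) ((x + s *\<^sub>R axis i 1) + t *\<^sub>R axis j 1)"
  by (intro MVT2 h partial_line_deriv dd)
 then obtain t where t: "0 < t" "t < h" and Gt: "partial i f ((x + s *\<^sub>R axis i 1) + h *\<^sub>R axis j 1) -
   partial i f (x + s *\<^sub>R axis i 1) =
   h * partial j (partial i f) ((x + s *\<^sub>R axis i 1) + t *\<^sub>R axis j 1)"
  by auto
 let ?\<xi> = "(x + s *\<^sub>R axis i 1) + t *\<^sub>R axis j 1"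
 have "norm (s *\<^sub>R axis i (1::real) + t *\<^sub>R axis j 1 :: real^'a) \<le> s + t"
  using s t by (intro norm_triangle_le) (simp add: norm_axis_1)
 then have "norm (?\<xi> - x) \<le> 2 * h" using s t by (simp add: add.commute add.left_commute)
 moreover have "x + h *\<^sub>R axis j 1 + s *\<^sub>R axis i 1 = x + s *\<^sub>R axis i 1 + h *\<^sub>R axis j (1::real)"
  by (simp add: algebra_simps)
 then have "G h - G 0 = h * h * partial j (partial i f) ?\<xi>" using Gs Gt by (simp only: mult.assoc)
 moreover have "G h - G 0 = f (x + h *\<^sub>R axis i 1 + h *\<^sub>R axis j 1) - f (x + h *\<^sub>R axis i 1) - f (x + h *\<^sub>R axis j 1) + f x"
  by (simp add: G_def algebra_simps)
 ultimately show ?thesis by metis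
qed

text \<open>Both mixed derivatives represent the same second difference at points within 2 h of x;
  as h tends to 0, their continuity gives equality at x.\<close>

lemma partial_commute:
 assumes f: "Ck 2 f"
 shows "partial i (partial j f) x = partial j (partial i f) x"
proof -
 have c: "continuous_on UNIV (partial i (partial j f))" "continuous_on UNIV (partial j (partial i f))"
  using f by (auto simp: numeral_2_eq_2)
 define h where "h n = inverse (real (Suc n))" for n
 have h: "h n > 0" for n by (simp add: h_def)
 have hl: "(\<lambda>n. 2 * h n) \<longlonglongrightarrow> 0"
  unfolding h_def using tendsto_mult_right_zero[OF LIMSEQ_inverse_real_of_nat] by simp
 have ex: "\<forall>n. \<exists>\<xi>. norm (\<xi> - x) \<le> 2 * h n \<and>
  f (x + h n *\<^sub>R axis i 1 + h n *\<^sub>R axis j 1) - f (x + h n *\<^sub>R axis i 1) - f (x + h n *\<^sub>R axis j 1) + f x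
   = h n * h n * partial j (partial i f) \<xi>" for i j
  using partial_second_difference[OF f h] by blast
 obtain \<xi> where \<xi>: "!!n. norm (\<xi> n - x) \<le> 2 * h n"
  "!!n. f (x + h n *\<^sub>R axis i 1 + h n *\<^sub>R axis j 1) - f (x + h n *\<^sub>R axis i 1) - f (x + h n *\<^sub>R axis j 1) + f x
   = h n * h n * partial j (partial i f) (\<xi> n)"
  using choice[OF ex[of i j]] by blast
 obtain H where H: "!!n. norm (H n - x) \<le> 2 * h n"
  "!!n. f (x + h n *\<^sub>R axis j 1 + h n *\<^sub>R axis i 1) - f (x + h n *\<^sub>R axis j 1) - f (x + h n *\<^sub>R axis i 1) + f x
   = h n * h n * partial i (partial j f) (H n)"
  using choice[OF ex[of j i]] by blast
 have "partial j (partial i f) (\<xi> n) = partial i (partial j f) (H n)" for n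
  using \<xi>(2)[of n] H(2)[of n] h[of n] by (simp add: algebra_simps)
 moreover have "(\<lambda>n. \<xi> n - x) \<longlonglongrightarrow> 0" "(\<lambda>n. H n - x) \<longlonglongrightarrow> 0"
  using \<xi>(1) H(1) by (auto intro: Lim_null_comparison[OF always_eventually hl])
 then have l: "\<xi> \<longlonglongrightarrow> x" "H \<longlonglongrightarrow> x"
  by (simp_all add: LIM_zero_cancel)
 have "(\<lambda>n. partial j (partial i f) (\<xi> n)) \<longlonglongrightarrow> partial j (partial i f) x"
  "(\<lambda>n. partial i (partial j f) (H n)) \<longlonglongrightarrow> partial i (partial j f) x"
  by (rule continuous_on_tendsto_compose[OF c(2) l(1)] continuous_on_tendsto_compose[OF c(1) l(2)]; simp)+
 ultimately show ?thesis using LIMSEQ_unique[of "\<lambda>n. partial i (partial j f) (H n)"] by simp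
qed

definition smooth :: "(real^'d::finite => real) => bool" where
 "smooth f \<longleftrightarrow> (\<forall>n. Ck n f)"

lemma smooth_differentiable: "smooth f ==> f differentiable (at x)"
 unfolding smooth_def by (metis Ck.simps(2))

lemma smooth_continuous: "smooth f ==> continuous_on UNIV f"
 unfolding smooth_def by (metis Ck.simps(1))

lemma smooth_partial: "smooth f ==> smooth (partial i f)"
 unfolding smooth_def by (metis Ck.simps(2))

lemma smooth_partial_commute: "smooth f ==> partial i (partial j f) = partial j (partial i f)"
 unfolding smooth_def using partial_commute by blast

lemma smooth_const: "smooth (\<lambda>x. c)"
 unfolding smooth_def using Ck_const by blast

lemma smooth_add: "smooth f ==> smooth g ==> smooth (\<lambda>x. f x + g x)"
 unfolding smooth_def using Ck_add by blast

lemma smooth_mult: "smooth f ==> smooth g ==> smooth (\<lambda>x. f x * g x)"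
 unfolding smooth_def using Ck_mult by blast

lemma smooth_affine: "smooth f ==> smooth (\<lambda>x. f (c *\<^sub>R x + z))"
 unfolding smooth_def using Ck_affine by blast

lemma foldr_partial_smooth: "smooth f ==> smooth (foldr partial is f)"
 by (induction "is") (auto intro: smooth_partial)

lemma foldr_partial_middle:
 "smooth f ==> foldr partial (xs @ x # ys) f = partial x (foldr partial (xs @ ys) f)"
proof (induction xs)
 case (Cons a xs)
 then show ?case using smooth_partial_commute[OF foldr_partial_smooth[of f "xs @ ys"]] by simp
qed simp

text \<open>\<open>mi_partial\<close> enumerates the directions by a \<open>SOME\<close>-chosen
  list; this makes the choice irrelevant for smooth functions.\<close>

lemma foldr_partial_mset:
 "smooth f ==> mset xs = mset ys ==> foldr partial xs f = foldr partial ys f"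
proof (induction xs arbitrary: ys)
 case (Cons x xs)
 then have "x \<in> set ys" by (metis list.set_intros(1) mset_eq_setD)
 then obtain ys1 ys2 where ys: "ys = ys1 @ x # ys2" by (meson split_list)
 with Cons.prems have "mset xs = mset (ys1 @ ys2)" by simp
 with Cons have "foldr partial xs f = foldr partial (ys1 @ ys2) f" by blast
 then show ?case using foldr_partial_middle[OF Cons.prems(1)] ys by simp
qed simp

lemma ex_list_counts: "\<exists>is. \<forall>i. count_list is i = I $ (i::'n::finite)"
proof -
 define M where "M = Abs_multiset (\<lambda>i. I $ i)"
 have "count M i = I $ i" for i unfolding M_def by (subst count_Abs_multiset) auto
 moreover obtain "is" where "mset is = M" using ex_mset by blast
 ultimately show ?thesis by (metis count_mset)
qed

lemma mi_partial_list:
 assumes "smooth f" "!!i. count_list is i = I $ i"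
 shows "mi_partial I f = foldr partial is f"
proof -
 have "\<forall>i. count_list (SOME is. \<forall>i. count_list is i = I $ i) i = I $ i"
  by (rule someI_ex) (rule ex_list_counts)
 then show ?thesis unfolding mi_partial_def using assms
  by (intro foldr_partial_mset) (auto intro!: multiset_eqI simp: count_mset)
qed

lemma mi_partial_0: "smooth f ==> mi_partial 0 f = f"
 using mi_partial_list[of f "[]" 0] by simp

lemma mi_partial_add_axis:
 assumes "smooth f"
 shows "mi_partial (I + axis i 1) f = partial i (mi_partial I f)"
proof -
 obtain js where js: "!!j. count_list js j = I $ j" using ex_list_counts by blast
 have *: "count_list (i # js) j = (I + axis i 1) $ j" for j by (simp add: js axis_def)
 show ?thesis unfolding mi_partial_list[OF assms js] mi_partial_list[OF assms *] by simp
qed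

text \<open>Here the new derivative acts first. Weak derivatives are composed in both orders and
  each order needs its own form; \<open>is_weak_deriv_compose\<close> uses this one.\<close>

lemma mi_partial_add_axis':
 assumes "smooth f"
 shows "mi_partial (I + axis i 1) f = mi_partial I (partial i f)"
proof -
 obtain js where js: "!!j. count_list js j = I $ j" using ex_list_counts by blast
 have *: "count_list (js @ [i]) j = (I + axis i 1) $ j" for j by (simp add: js axis_def)
 show ?thesis
  unfolding mi_partial_list[OF smooth_partial[OF assms] js] mi_partial_list[OF assms *] by simp
qed

lemma mi_partial_axis:
 assumes "smooth f"
 shows "mi_partial (axis i 1) f = partial i f"
proof -
 have *: "count_list [i] j = axis i 1 $ j" for j by (simp add: axis_def)
 show ?thesis unfolding mi_partial_list[OF assms *] by simp
qed

lemma smooth_mi_partial: "smooth f ==> smooth (mi_partial I f)"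
 unfolding mi_partial_def by (rule foldr_partial_smooth)

text \<open>The derivatives of \<open>exp (-1/t)\<close> are combinations of these functions.\<close>

definition flat :: "nat => real => real" where
 "flat k t = (if t > 0 then inverse t ^ k * exp (- inverse t) else 0)"

lemma flat_deriv: "(flat k has_real_derivative (flat (k + 2) t - real k * flat (k + 1) t)) (at t)"
proof -
 consider "t > 0" | "t < 0" | "t = 0" by linarith
 then show ?thesis
 proof cases
  case 1
  have "((\<lambda>t. inverse t ^ k * exp (- inverse t)) has_real_derivative
   (flat (k + 2) t - real k * flat (k + 1) t)) (at t)"
   using 1 by (auto intro!: derivative_eq_intros simp: flat_def power2_eq_square algebra_simps)
    (cases k; simp add: field_simps)
  then show ?thesis
   by (rule has_field_derivative_transform_within_open[where S = "{0<..}"])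
    (use 1 in \<open>auto simp: flat_def\<close>)
 next
  case 2
  have "((\<lambda>t. 0) has_real_derivative (flat (k + 2) t - real k * flat (k + 1) t)) (at t)"
   using 2 by (simp add: flat_def)
  then show ?thesis
   by (rule has_field_derivative_transform_within_open[where S = "{..<0}"])
    (use 2 in \<open>auto simp: flat_def\<close>)
 next
  case 3
  \<comment> \<open>With s = 1/h the right-hand difference quotient \<open>flat k h / h\<close> is
    s^(k+1) / e^s.\<close>
  have "((\<lambda>h. inverse h ^ Suc k / exp (inverse h)) \<longlongrightarrow> 0) (at_right (0::real))"
   by (rule filterlim_compose[OF tendsto_power_div_exp_0 filterlim_inverse_at_top_right])
  then have "((\<lambda>h. flat k h / h) \<longlongrightarrow> 0) (at_right 0)"
   by (rule Lim_transform_eventually)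
    (auto simp: flat_def eventually_at_filter exp_minus field_simps)
  moreover have "((\<lambda>h. flat k h / h) \<longlongrightarrow> 0) (at_left 0)"
   by (rule Lim_transform_eventually[of "\<lambda>_. 0"])
    (auto simp: flat_def eventually_at_filter)
  ultimately have "((\<lambda>h. flat k h / h) \<longlongrightarrow> 0) (at 0)"
   by (simp add: filterlim_split_at)
  then have "(flat k has_real_derivative 0) (at 0)"
   by (simp add: DERIV_def flat_def)
  with 3 show ?thesis by (simp add: flat_def)
 qed
qed

lemma partial_flat:
 fixes x :: "real^'d::finite"
 shows "partial i (\<lambda>x. flat k (1 - x \<bullet> x)) x =
  (flat (k + 2) (1 - x \<bullet> x) + (- real k) * flat (k + 1) (1 - x \<bullet> x)) * ((- 2) * x $ i)"
  and "(\<lambda>x::real^'d. flat k (1 - x \<bullet> x)) differentiable (at x)"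
proof -
 let ?c = "flat (k + 2) (1 - x \<bullet> x) - real k * flat (k + 1) (1 - x \<bullet> x)"
 have "((\<lambda>x::real^'d. flat k (1 - x \<bullet> x)) has_derivative (\<lambda>h. ?c * (- (x \<bullet> h + h \<bullet> x)))) (at x)"
  by (rule has_derivative_compose[where f = "\<lambda>x. 1 - x \<bullet> x" and g = "flat k" and g' = "\<lambda>s. ?c * s"])
   (use flat_deriv[of k] in \<open>auto intro!: derivative_eq_intros has_field_derivative_imp_has_derivative\<close>)
 from partial_eqI[OF this, of i] this
 show "partial i (\<lambda>x. flat k (1 - x \<bullet> x)) x =
  (flat (k + 2) (1 - x \<bullet> x) + (- real k) * flat (k + 1) (1 - x \<bullet> x)) * ((- 2) * x $ i)"
  and "(\<lambda>x::real^'d. flat k (1 - x \<bullet> x)) differentiable (at x)"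
  by (auto simp: inner_axis inner_axis' differentiable_def)
qed

text \<open>A partial derivative is a polynomial combination of \<open>flat (k + 2)\<close> and
  \<open>flat (k + 1)\<close> at the same argument, so the induction on n runs for all k at
  once.\<close>

lemma Ck_flat: "Ck n (\<lambda>x::real^'d::finite. flat k (1 - x \<bullet> x))"
proof (induction n arbitrary: k)
 case 0
 have "continuous (at x) (\<lambda>x::real^'d::finite. flat k (1 - x \<bullet> x))" for x
  using partial_flat(2) differentiable_imp_continuous_within by blast
 then show ?case by (auto intro: continuous_at_imp_continuous_on)
next
 case (Suc n)
 have "partial i (\<lambda>x. flat k (1 - x \<bullet> x)) = (\<lambda>x::real^'d.
  (flat (k + 2) (1 - x \<bullet> x) + (- real k) * flat (k + 1) (1 - x \<bullet> x)) * ((- 2) * x $ i))" for i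
  by (rule ext) (rule partial_flat)
 moreover have "Ck n (\<lambda>x::real^'d.
  (flat (k + 2) (1 - x \<bullet> x) + (- real k) * flat (k + 1) (1 - x \<bullet> x)) * ((- 2) * x $ i))" for i
  by (intro Ck_mult Ck_add Ck_const Ck_nth Suc)
 ultimately show ?case by (simp only: Ck.simps partial_flat(2) simp_thms)
qed

text \<open>The kernel exp (-1 / (1 - |w/E|^2)) of the ball of radius E. It is left unnormalised:
  \<open>bump_concentration\<close> only uses that it is nonnegative, vanishes off the ball and has
  positive integral.\<close>

definition bump :: "real => real^'d::finite => real" where
 "bump E w = flat 0 (1 - ((1 / E) *\<^sub>R w) \<bullet> ((1 / E) *\<^sub>R w))"

lemma smooth_bump: "smooth (bump E)"
 unfolding bump_def using smooth_affine[of "\<lambda>x. flat 0 (1 - x \<bullet> x)" "1 / E" 0]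
 by (simp add: smooth_def Ck_flat)

lemma bump_nonneg: "0 \<le> bump E w" and bump_le_1: "bump E w \<le> 1"
 by (auto simp: bump_def flat_def)

lemma bump_pos_iff: "E > 0 ==> 0 < bump E w \<longleftrightarrow> norm w < E"
proof -
 assume e: "E > 0"
 have "0 < bump E w \<longleftrightarrow> (norm w / E)\<^sup>2 < 1"
  by (auto simp: bump_def flat_def power2_norm_eq_inner[symmetric] power_divide power2_eq_square field_simps)
 also have "\<dots> \<longleftrightarrow> norm w < E" using e by (simp add: power_less_one_iff abs_square_less_1)
 finally show ?thesis .
qed

lemma bump_zero: "E > 0 ==> norm w \<ge> E ==> bump E w = 0"
 using bump_pos_iff[of E w] bump_nonneg[of E w] by linarith

lemma smooth_bump_shift: "smooth (\<lambda>z. bump E (x - z))" "smooth (\<lambda>x. bump E (x - z))"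
 using smooth_affine[OF smooth_bump, of E "-1" x] smooth_affine[OF smooth_bump, of E 1 "- z"] by simp_all

text \<open>The opposite signs make the x- and z-derivatives of the kernel cancel, which is the
  cancellation behind the product rule for weak derivatives.\<close>

lemma partial_bump_shift:
 "partial i (\<lambda>z. bump E (x - z)) z = - partial i (bump E) (x - z)"
 "partial i (\<lambda>x. bump E (x - z)) x = partial i (bump E) (x - z)"
 using partial_affine(1)[OF smooth_differentiable[OF smooth_bump], of i E "-1" x z]
  partial_affine(1)[OF smooth_differentiable[OF smooth_bump], of i E 1 "- z" x] by simp_all

section \<open>Test functions\<close>

lemma test_fun_smooth: "test_fun D \<phi> ==> smooth \<phi>"
 by (simp add: test_fun_def smooth_def)

lemma test_funI:
 assumes "smooth \<phi>" "compact K" "K \<subseteq> D" "!!x. x \<notin> K ==> \<phi> x = 0"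
 shows "test_fun D \<phi>"
proof -
 have "{x. \<phi> x ~= 0} \<subseteq> K" using assms(4) by blast
 then have "closure {x. \<phi> x ~= 0} \<subseteq> K" using assms(2) by (simp add: closure_minimal compact_imp_closed)
 moreover from this have "compact (closure {x. \<phi> x ~= 0})"
  using assms(2) compact_closure by (metis bounded_subset closure_subset compact_imp_bounded subset_trans)
 ultimately show ?thesis using assms by (auto simp: test_fun_def smooth_def)
qed

lemma test_funE:
 assumes "test_fun D \<phi>"
 obtains K where "compact K" "K \<subseteq> D" "!!x. x \<notin> K ==> \<phi> x = 0"
proof (rule that[of "closure {x. \<phi> x ~= 0}"])
 show "\<phi> x = 0" if "x \<notin> closure {x. \<phi> x ~= 0}" for x
  using that closure_subset[of "{x. \<phi> x ~= 0}"] by auto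
qed (use assms in \<open>auto simp: test_fun_def\<close>)

lemma partial_zero_outside:
 assumes "closed K" "!!x. x \<notin> K ==> \<phi> x = 0" "x \<notin> K"
 shows "partial i \<phi> x = 0"
proof -
 have "(\<phi> has_derivative (\<lambda>h. 0)) (at x)"
  by (rule has_derivative_transform_within_open[of "\<lambda>_. 0" _ _ _ "- K"]) (use assms in auto)
 from partial_eqI[OF this] show ?thesis .
qed

lemma test_fun_partial:
 assumes "test_fun D \<phi>"
 shows "test_fun D (partial i \<phi>)"
proof -
 obtain K where "compact K" "K \<subseteq> D" "!!x. x \<notin> K ==> \<phi> x = 0" using test_funE[OF assms] by blast
 then show ?thesis
  by (intro test_funI[of _ K] smooth_partial test_fun_smooth[OF assms] partial_zero_outside[of K])
   (auto intro: compact_imp_closed)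
qed

lemma test_fun_mi_partial: "test_fun D \<phi> ==> test_fun D (mi_partial I \<phi>)"
proof -
 have "test_fun D \<phi> ==> test_fun D (foldr partial is \<phi>)" for "is"
  by (induction "is") (auto intro: test_fun_partial)
 then show "test_fun D \<phi> ==> test_fun D (mi_partial I \<phi>)" unfolding mi_partial_def by blast
qed

lemma test_fun_add:
 assumes "test_fun D \<phi>" "test_fun D \<psi>"
 shows "test_fun D (\<lambda>x. \<phi> x + \<psi> x)"
proof -
 obtain K where "compact K" "K \<subseteq> D" "!!x. x \<notin> K ==> \<phi> x = 0" using test_funE[OF assms(1)] by blast
 moreover obtain L where "compact L" "L \<subseteq> D" "!!x. x \<notin> L ==> \<psi> x = 0" using test_funE[OF assms(2)] by blast
 ultimately show ?thesis using assms
  by (intro test_funI[of _ "K \<union> L"] smooth_add assms[THEN test_fun_smooth] compact_Un) auto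
qed

lemma test_fun_smooth_mult:
 assumes "smooth \<psi>" "test_fun D \<phi>"
 shows "test_fun D (\<lambda>x. \<psi> x * \<phi> x)"
proof -
 obtain K where "compact K" "K \<subseteq> D" "!!x. x \<notin> K ==> \<phi> x = 0" using test_funE[OF assms(2)] by blast
 then show ?thesis using assms
  by (intro test_funI[of _ K] smooth_mult test_fun_smooth[OF assms(2)]) auto
qed

lemma test_fun_scale: "test_fun D \<phi> ==> test_fun D (\<lambda>x. c * \<phi> x)"
 using test_fun_smooth_mult[OF smooth_const] .

lemma test_fun_zero: "test_fun D (\<lambda>x. 0)"
 by (rule test_funI[of _ "{}"]) (auto intro: smooth_const)

lemma test_fun_bump:
 assumes "E > 0" "cball x E \<subseteq> D"
 shows "test_fun D (\<lambda>z. bump E (x - z))"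
 by (rule test_funI[of _ "cball x E"])
  (use assms in \<open>auto intro: smooth_bump_shift bump_zero simp: dist_norm\<close>)

lemma smooth_borel: "smooth \<phi> ==> \<phi> \<in> borel_measurable borel"
 by (simp add: borel_measurable_continuous_onI smooth_continuous)

lemma test_fun_borel: "test_fun D \<phi> ==> \<phi> \<in> borel_measurable borel"
 by (simp add: smooth_borel test_fun_smooth)

lemma test_fun_bounded:
 assumes "test_fun D \<phi>"
 obtains B where "B > 0" "!!x. \<bar>\<phi> x\<bar> \<le> B"
proof -
 obtain K where K: "compact K" "K \<subseteq> D" "!!x. x \<notin> K ==> \<phi> x = 0" using test_funE[OF assms] by blast
 have "bounded (\<phi> ` K)"
  using K(1) assms smooth_continuous[OF test_fun_smooth[OF assms]]
  by (intro compact_imp_bounded compact_continuous_image) (auto intro: continuous_on_subset)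
 then obtain B where "!!x. x \<in> K ==> \<bar>\<phi> x\<bar> \<le> B" by (auto simp: bounded_iff)
 then have *: "\<bar>\<phi> x\<bar> \<le> max B 1" for x
  using K(3)[of x] by (cases "x \<in> K") (force simp: le_max_iff_disj)+
 show ?thesis by (rule that[OF _ *]) simp
qed

lemma test_fun_integrable:
 assumes "test_fun D \<phi>"
 shows "integrable lborel \<phi>"
proof -
 obtain K where K: "compact K" "K \<subseteq> D" "!!x. x \<notin> K ==> \<phi> x = 0" using test_funE[OF assms] by blast
 have "integrable lborel (\<lambda>x. indicator K x *\<^sub>R \<phi> x)"
  using K assms smooth_continuous[OF test_fun_smooth[OF assms]]
  by (intro borel_integrable_compact) (auto intro: continuous_on_subset)
 also have "(\<lambda>x. indicator K x *\<^sub>R \<phi> x) = \<phi>"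
 proof
  show "indicator K x *\<^sub>R \<phi> x = \<phi> x" for x using K(3)[of x] by (cases "x \<in> K") auto
 qed
 finally show ?thesis .
qed

lemma lborel_integral_translation:
 fixes f :: "'a::euclidean_space => 'b::euclidean_space"
 assumes "f \<in> borel_measurable borel"
 shows "(LINT x|lborel. f (x + a)) = (LINT x|lborel. f x)"
proof -
 have "(LINT x|lborel. f x) = (\<integral>x. f x \<partial>distr lborel borel ((+) a))" by (simp add: lborel_distr_plus)
 also have "\<dots> = (LINT x|lborel. f (a + x))" using assms by (intro integral_distr) auto
 finally show ?thesis by (simp add: add.commute)
qed

lemma lborel_integrable_translation:
 fixes f :: "'a::euclidean_space => 'b::euclidean_space"
 assumes "integrable lborel f"
 shows "integrable lborel (\<lambda>x. f (x + a))"
proof -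
 have "integrable (distr lborel borel ((+) a)) f" using assms by (simp add: lborel_distr_plus)
 then have "integrable lborel (\<lambda>x. f (a + x))" by (rule integrable_distr[rotated]) auto
 then show ?thesis by (simp add: add.commute)
qed

text \<open>Difference quotients of \<phi> integrate to 0 by translation invariance; the mean value
  theorem bounds them, so they converge dominatedly to the derivative.\<close>

lemma integral_partial_test_fun:
 assumes "test_fun D \<phi>"
 shows "(LINT x|lborel. partial i \<phi> x) = 0"
proof -
 obtain K where K: "compact K" "K \<subseteq> D" "!!x. x \<notin> K ==> \<phi> x = 0" using test_funE[OF assms] by blast
 obtain r where r: "!!x. x \<in> K ==> norm x \<le> r" using compact_imp_bounded[OF K(1)] unfolding bounded_iff by blast
 obtain B where B: "B > 0" "!!x. \<bar>partial i \<phi> x\<bar> \<le> B" using test_fun_bounded[OF test_fun_partial[OF assms]] by blast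
 note d = smooth_differentiable[OF test_fun_smooth[OF assms]]
 note [measurable] = test_fun_borel[OF assms]
 define h where "h n = inverse (real (Suc n))" for n
 have h: "h n > 0" "h n \<le> 1" for n by (auto simp: h_def field_simps)
 define q where "q n x = (\<phi> (x + h n *\<^sub>R axis i 1) - \<phi> x) / h n" for n x
 have "(\<lambda>n. LINT x|lborel. q n x) \<longlonglongrightarrow> (LINT x|lborel. partial i \<phi> x)"
 proof (rule integral_dominated_convergence[where w = "\<lambda>x. B * indicator (cball 0 (r + 1)) x"])
  show "partial i \<phi> \<in> borel_measurable lborel" using test_fun_borel[OF test_fun_partial[OF assms]] by simp
  show "q n \<in> borel_measurable lborel" for n unfolding q_def by measurable
  show "integrable lborel (\<lambda>x. B * indicator (cball 0 (r + 1)) x)"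
   by (intro integrable_mult_right integrable_real_indicator) (use emeasure_lborel_cball_finite[of 0 "r + 1"] in \<open>auto simp: infinity_ennreal_def\<close>)
  show "AE x in lborel. (\<lambda>n. q n x) \<longlonglongrightarrow> partial i \<phi> x"
  proof (rule AE_I2)
   fix x
   have "((\<lambda>t. (\<phi> (x + (0 + t) *\<^sub>R axis i 1) - \<phi> (x + 0 *\<^sub>R axis i 1)) / t) \<longlongrightarrow> partial i \<phi> (x + 0 *\<^sub>R axis i 1)) (at 0)"
    using partial_line_deriv[OF d, of x i 0] unfolding DERIV_def .
   moreover have "filterlim h (at 0) sequentially"
    unfolding h_def filterlim_at using LIMSEQ_inverse_real_of_nat by auto
   ultimately show "(\<lambda>n. q n x) \<longlonglongrightarrow> partial i \<phi> x"
    unfolding q_def by (auto dest: filterlim_compose)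
  qed
  show "AE x in lborel. norm (q n x) \<le> B * indicator (cball 0 (r + 1)) x" for n
  proof (rule AE_I2)
   fix x
   have "\<exists>s>0. s < h n \<and> \<phi> (x + h n *\<^sub>R axis i 1) - \<phi> (x + 0 *\<^sub>R axis i 1) =
    (h n - 0) * partial i \<phi> (x + s *\<^sub>R axis i 1)"
    by (intro MVT2 h partial_line_deriv d)
   then have *: "norm (q n x) \<le> B" using B h[of n] by (auto simp: q_def abs_mult)
   show "norm (q n x) \<le> B * indicator (cball 0 (r + 1)) x"
   \<comment> \<open>The steps h n are at most 1, so outside the ball of radius r + 1 both points of
     the quotient miss the support.\<close>
   proof (cases "norm x \<le> r + 1")
    case False
    then have "norm x > r" by simp
    moreover have "norm (x + h n *\<^sub>R axis i 1) > r"
     using False h[of n] norm_triangle_ineq4[of "x + h n *\<^sub>R axis i 1" "h n *\<^sub>R axis i 1"] by (simp add: norm_axis_1)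
    ultimately have "\<phi> x = 0" "\<phi> (x + h n *\<^sub>R axis i 1) = 0" using K(3) r by (meson not_less)+
    then show ?thesis using B(1) by (simp add: q_def indicator_def)
   qed (use * in auto)
  qed
 qed
 moreover have "(LINT x|lborel. q n x) = 0" for n
  unfolding q_def using test_fun_integrable[OF assms] lborel_integral_translation[of \<phi> "h n *\<^sub>R axis i 1"]
  by (simp add: lborel_integrable_translation)
 ultimately show ?thesis by (simp add: LIMSEQ_const_iff)
qed

section \<open>Averages over small translations\<close>

lemma integral_abs_translation_le:
 fixes f g :: "'a::euclidean_space => real"
 assumes "integrable lborel f" "integrable lborel g"
 shows "(LINT z|lborel. \<bar>f (z + w) - f z\<bar>) \<le>
  2 * (LINT z|lborel. \<bar>f z - g z\<bar>) + (LINT z|lborel. \<bar>g (z + w) - g z\<bar>)"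
proof -
 have i: "integrable lborel (\<lambda>z. f (z + w))" "integrable lborel (\<lambda>z. g (z + w))"
  using assms by (auto intro: lborel_integrable_translation)
 have "(LINT z|lborel. \<bar>f (z + w) - f z\<bar>) \<le>
   (LINT z|lborel. (\<bar>f (z + w) - g (z + w)\<bar> + \<bar>f z - g z\<bar>) + \<bar>g (z + w) - g z\<bar>)"
  using assms i by (intro integral_mono) (auto intro!: Bochner_Integration.integrable_add)
 also have "\<dots> = (LINT z|lborel. \<bar>f (z + w) - g (z + w)\<bar>) + (LINT z|lborel. \<bar>f z - g z\<bar>)
   + (LINT z|lborel. \<bar>g (z + w) - g z\<bar>)"
  using assms i by simp
 also have "(LINT z|lborel. \<bar>f (z + w) - g (z + w)\<bar>) = (LINT z|lborel. \<bar>f z - g z\<bar>)"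
  using assms by (intro lborel_integral_translation[of "\<lambda>z. \<bar>f z - g z\<bar>"]) auto
 finally show ?thesis by simp
qed

text \<open>The error of the approximation counts twice, at z and at the translated point; hence the
  r / 4.\<close>

lemma L1_translation_approx:
 fixes f :: "'a::euclidean_space => real" and w :: "nat => 'a"
 assumes f: "integrable lborel f"
  and g: "!!e. e > 0 ==> \<exists>g. integrable lborel g \<and> (LINT z|lborel. \<bar>f z - g z\<bar>) < e \<and>
   (\<lambda>n. LINT z|lborel. \<bar>g (z + w n) - g z\<bar>) \<longlonglongrightarrow> 0"
 shows "(\<lambda>n. LINT z|lborel. \<bar>f (z + w n) - f z\<bar>) \<longlonglongrightarrow> 0"
proof (rule LIMSEQ_I)
 fix r :: real assume r: "r > 0"
 obtain g where g: "integrable lborel g" "(LINT z|lborel. \<bar>f z - g z\<bar>) < r / 4"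
   "(\<lambda>n. LINT z|lborel. \<bar>g (z + w n) - g z\<bar>) \<longlonglongrightarrow> 0"
  using g[of "r / 4"] r by auto
 obtain n0 where n0: "!!n. n \<ge> n0 ==> norm ((LINT z|lborel. \<bar>g (z + w n) - g z\<bar>) - 0) < r / 2"
  using LIMSEQ_D[OF g(3), of "r / 2"] r by auto
 have "norm ((LINT z|lborel. \<bar>f (z + w n) - f z\<bar>) - 0) < r" if "n \<ge> n0" for n
 proof -
  have "0 \<le> (LINT z|lborel. \<bar>f (z + w n) - f z\<bar>)" by simp
  moreover have "(LINT z|lborel. \<bar>f (z + w n) - f z\<bar>) < r"
   using integral_abs_translation_le[OF f g(1), of "w n"] g(2) n0[OF that] by (simp add: abs_less_iff)
  ultimately show ?thesis by simp
 qed
 then show "\<exists>no. \<forall>n\<ge>no. norm ((LINT z|lborel. \<bar>f (z + w n) - f z\<bar>) - 0) < r" by blast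
qed

text \<open>For reals |p - q| = 2 max 0 (q - p) + (p - q), and the last term integrates to 0 by
  translation invariance. What remains is dominated by the indicator of U itself, whatever the
  translation, and tends to 0 pointwise because U is open.\<close>

lemma L1_translation_open:
 fixes U :: "'a::euclidean_space set"
 assumes U: "open U" "emeasure lborel U < \<infinity>" and w: "w \<longlonglongrightarrow> 0"
 shows "(\<lambda>n. LINT z|lborel. \<bar>indicator U (z + w n) - indicator U z :: real\<bar>) \<longlonglongrightarrow> 0"
proof -
 let ?f = "indicator U :: 'a => real"
 have f: "integrable lborel ?f" using U by (intro integrable_real_indicator) auto
 have i: "integrable lborel (\<lambda>z. ?f (z + w n))" for n using lborel_integrable_translation[OF f] .
 have eq: "(LINT z|lborel. \<bar>?f (z + w n) - ?f z\<bar>) = 2 * (LINT z|lborel. max 0 (?f z - ?f (z + w n)))" for n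
 proof -
  have "(LINT z|lborel. \<bar>?f (z + w n) - ?f z\<bar>) =
    (LINT z|lborel. 2 * max 0 (?f z - ?f (z + w n)) + (?f (z + w n) - ?f z))"
   by (intro Bochner_Integration.integral_cong refl) (simp add: max_def abs_real_def)
  also have "\<dots> = (LINT z|lborel. 2 * max 0 (?f z - ?f (z + w n))) + ((LINT z|lborel. ?f (z + w n)) - (LINT z|lborel. ?f z))"
   using f i[of n] by (subst Bochner_Integration.integral_add) auto
  also have "(LINT z|lborel. ?f (z + w n)) = (LINT z|lborel. ?f z)"
   using U by (intro lborel_integral_translation) auto
  finally show ?thesis by simp
 qed
 have "(\<lambda>n. LINT z|lborel. max 0 (?f z - ?f (z + w n))) \<longlonglongrightarrow> (\<integral>z. (0::real) \<partial>(lborel :: 'a measure))"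
 proof (rule integral_dominated_convergence[where w = ?f])
  show "AE z in lborel. (\<lambda>n. max 0 (?f z - ?f (z + w n))) \<longlonglongrightarrow> 0"
  proof (rule AE_I2)
   fix z
   show "(\<lambda>n. max 0 (?f z - ?f (z + w n))) \<longlonglongrightarrow> 0"
   proof (cases "z \<in> U")
    case True
    have "(\<lambda>n. z + w n) \<longlonglongrightarrow> z" using tendsto_add[OF tendsto_const w] by simp
    then have "\<forall>\<^sub>F n in sequentially. z + w n \<in> U" using topological_tendstoD[OF _ U(1) True] by blast
    then have "\<forall>\<^sub>F n in sequentially. max 0 (?f z - ?f (z + w n)) = 0"
     by eventually_elim (simp add: indicator_def)
    then show ?thesis by (rule tendsto_eventually)
   next
    case False
    then have "max 0 (?f z - ?f (z + w n)) = 0" for n by (simp add: indicator_def)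
    then show ?thesis by simp
   qed
  qed
  have m: "?f \<in> borel_measurable borel" using U by simp
  have m2: "(\<lambda>z. ?f (z + w n)) \<in> borel_measurable borel" for n
   using i[of n] by (simp add: borel_measurable_integrable)
  show "(\<lambda>z. max 0 (?f z - ?f (z + w n))) \<in> borel_measurable lborel" for n
   using m m2[of n] by simp
  show "AE z in lborel. norm (max 0 (?f z - ?f (z + w n))) \<le> ?f z" for n
   by (rule AE_I2) (simp add: indicator_def)
 qed (use f in auto)
 from tendsto_mult[OF tendsto_const[of 2] this] show ?thesis unfolding eq by simp
qed

text \<open>Indicators of Borel sets are approximated from outside by those of open sets, for which
  \<open>L1_translation_open\<close> has already done the limit; the other cases of
  \<open>integrable_induct\<close> are approximation again.\<close>

lemma L1_translation_continuous:
 fixes f :: "'a::euclidean_space => real"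
 assumes f: "integrable lborel f" and w: "w \<longlonglongrightarrow> 0"
 shows "(\<lambda>n. LINT z|lborel. \<bar>f (z + w n) - f z\<bar>) \<longlonglongrightarrow> 0"
 using f
proof (induction rule: integrable_induct)
 case (base A c)
 have A: "A \<in> sets lebesgue" using base by auto
 have ind: "(\<lambda>n. LINT z|lborel. \<bar>indicator A (z + w n) - indicator A z :: real\<bar>) \<longlonglongrightarrow> 0"
 proof (rule L1_translation_approx)
  show "integrable lborel (indicator A :: 'a => real)" using base by (intro integrable_real_indicator) auto
  fix e :: real assume e: "e > 0"
  obtain U where U: "open U" "A \<subseteq> U" "U - A \<in> lmeasurable" "emeasure lebesgue (U - A) < ennreal e"
   using sets_lebesgue_outer_open[OF A e] by blast
  have sUA: "U - A \<in> sets borel" using U base by auto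
  have mUA: "emeasure lborel (U - A) < ennreal e" using U sUA by simp
  have "emeasure lborel U \<le> emeasure lborel A + emeasure lborel (U - A)"
   using U base sUA emeasure_subadditive[of A lborel "U - A"] by (simp add: Un_absorb1)
  also have "\<dots> < \<infinity>" using base mUA by (auto simp: ennreal_add_less_top less_top intro: less_trans)
  finally have mU: "emeasure lborel U < \<infinity>" .
  have "(LINT z|lborel. \<bar>indicator A z - indicator U z :: real\<bar>) = (LINT z|lborel. indicator (U - A) z)"
   using U(2) by (intro Bochner_Integration.integral_cong) (auto simp: indicator_def)
  also have "\<dots> = measure lborel (U - A)" using sUA by simp
  also have "\<dots> < e" using mUA e unfolding measure_def
   by (metis enn2real_eq_posreal_iff enn2real_less_iff ennreal_less_top less_trans top.not_eq_extremum order_less_imp_le)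
  finally have "(LINT z|lborel. \<bar>indicator A z - indicator U z :: real\<bar>) < e" .
  moreover have "integrable lborel (indicator U :: 'a => real)"
   using U mU by (intro integrable_real_indicator) auto
  ultimately show "\<exists>g. integrable lborel g \<and> (LINT z|lborel. \<bar>indicator A z - g z\<bar>) < e \<and>
   (\<lambda>n. LINT z|lborel. \<bar>g (z + w n) - g z :: real\<bar>) \<longlonglongrightarrow> 0"
   using L1_translation_open[OF U(1) mU w] by blast
 qed
 have "(LINT z|lborel. \<bar>indicator A (z + w n) *\<^sub>R c - indicator A z *\<^sub>R c\<bar>) =
  \<bar>c\<bar> * (LINT z|lborel. \<bar>indicator A (z + w n) - indicator A z :: real\<bar>)" for n
  by (subst integral_mult_right_zero[symmetric])
   (auto intro!: Bochner_Integration.integral_cong simp: abs_mult[symmetric] algebra_simps)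
 then show ?case using tendsto_mult[OF tendsto_const[of "\<bar>c\<bar>"] ind] by simp
next
 case (add f g)
 have "(\<lambda>n. LINT z|lborel. \<bar>f (z + w n) - f z\<bar> + \<bar>g (z + w n) - g z\<bar>) \<longlonglongrightarrow> 0"
  using tendsto_add[OF add.IH] add.hyps by (simp add: lborel_integrable_translation)
 then show ?case
 proof (rule Lim_null_comparison[rotated], intro always_eventually allI)
  fix n
  have i: "integrable lborel (\<lambda>z. f (z + w n))" "integrable lborel (\<lambda>z. g (z + w n))"
   using add.hyps by (auto intro: lborel_integrable_translation)
  have "(LINT z|lborel. \<bar>f (z + w n) + g (z + w n) - (f z + g z)\<bar>) \<le>
    (LINT z|lborel. \<bar>f (z + w n) - f z\<bar> + \<bar>g (z + w n) - g z\<bar>)"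
   using i add.hyps by (intro integral_mono) auto
  then show "norm (LINT z|lborel. \<bar>f (z + w n) + g (z + w n) - (f z + g z)\<bar>) \<le>
    (LINT z|lborel. \<bar>f (z + w n) - f z\<bar> + \<bar>g (z + w n) - g z\<bar>)" by simp
 qed
next
 case (lim f s)
 show ?case
 proof (rule L1_translation_approx[OF lim.hyps(4)])
  fix e :: real assume e: "e > 0"
  have "(\<lambda>i. LINT z|lborel. \<bar>f z - s i z\<bar>) \<longlonglongrightarrow> (\<integral>z. (0::real) \<partial>(lborel :: 'a measure))"
  proof (rule integral_dominated_convergence[where w = "\<lambda>z. 3 * norm (f z)"])
   show "AE z in lborel. (\<lambda>i. \<bar>f z - s i z\<bar>) \<longlonglongrightarrow> 0"
    using lim.hyps(2) by (auto intro!: AE_I2 tendsto_eq_intros)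
   show "AE z in lborel. norm \<bar>f z - s i z\<bar> \<le> 3 * norm (f z)" for i
   proof (rule AE_I2)
    fix z show "norm \<bar>f z - s i z\<bar> \<le> 3 * norm (f z)"
     using lim.hyps(3)[of z i] abs_triangle_ineq4[of "f z" "s i z"] by simp
   qed
  qed (use lim.hyps in auto)
  then obtain i where "(LINT z|lborel. \<bar>f z - s i z\<bar>) < e"
   using order_tendstoD(2)[of _ 0 sequentially e] e eventually_happens[of _ sequentially] by fastforce
  then show "\<exists>g. integrable lborel g \<and> (LINT z|lborel. \<bar>f z - g z\<bar>) < e \<and>
   (\<lambda>n. LINT z|lborel. \<bar>g (z + w n) - g z :: real\<bar>) \<longlonglongrightarrow> 0"
   using lim.hyps(1) lim.IH by blast
 qed
qed

text \<open>F is bounded but need not be continuous; translation invariance moves the shift to the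
  integrable factor H, where \<open>L1_translation_continuous\<close> applies.\<close>

lemma continuous_correlation:
 fixes F H :: "'a::euclidean_space => real"
 assumes F: "F \<in> borel_measurable borel" "!!x. \<bar>F x\<bar> \<le> B" and H: "integrable lborel H"
 shows "continuous (at 0) (\<lambda>w. LINT z|lborel. F (z + w) * H z)"
 unfolding continuous_at_sequentially
proof (intro allI impI)
 fix w :: "nat => 'a" assume w: "w \<longlonglongrightarrow> 0"
 have B: "B \<ge> 0" using F(2)[of 0] by linarith
 note [measurable] = F(1) borel_measurable_integrable[OF H]
 have bi: "integrable lborel (\<lambda>z. F z * G z)" if G: "integrable lborel G" for G
 proof (rule Bochner_Integration.integrable_bound[where f = "\<lambda>z. B * G z"])
  show "(\<lambda>z. F z * G z) \<in> borel_measurable lborel" using borel_measurable_integrable[OF G] by simp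
  show "AE z in lborel. norm (F z * G z) \<le> norm (B * G z)"
   using F(2) B by (intro AE_I2) (auto simp: abs_mult intro: mult_right_mono)
 qed (use G in simp)
 have iH: "integrable lborel (\<lambda>z. H (z - w n))" for n
  using lborel_integrable_translation[OF H, of "- w n"] by simp
 have sh: "(LINT z|lborel. F (z + w n) * H z) = (LINT z|lborel. F z * H (z - w n))" for n
  using lborel_integral_translation[of "\<lambda>z. F z * H (z - w n)" "w n"] by simp
 have "(\<lambda>n. (LINT z|lborel. F (z + w n) * H z) - (LINT z|lborel. F z * H z)) \<longlonglongrightarrow> 0"
 proof (rule Lim_null_comparison)
  have "(\<lambda>n. - w n) \<longlonglongrightarrow> 0" using tendsto_minus[OF w] by simp
  from tendsto_mult[OF tendsto_const[of B] L1_translation_continuous[OF H this]]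
  show "(\<lambda>n. B * (LINT z|lborel. \<bar>H (z - w n) - H z\<bar>)) \<longlonglongrightarrow> 0" by simp
  show "\<forall>\<^sub>F n in sequentially. norm ((LINT z|lborel. F (z + w n) * H z) - (LINT z|lborel. F z * H z))
    \<le> B * (LINT z|lborel. \<bar>H (z - w n) - H z\<bar>)"
  proof (intro always_eventually allI)
   fix n
   have "(LINT z|lborel. F (z + w n) * H z) - (LINT z|lborel. F z * H z) =
     (LINT z|lborel. F z * H (z - w n) - F z * H z)"
    unfolding sh by (rule Bochner_Integration.integral_diff[symmetric]) (intro bi iH H)+
   also have "norm \<dots> \<le> (LINT z|lborel. norm (F z * H (z - w n) - F z * H z))" by (rule integral_norm_bound)
   also have "\<dots> \<le> (LINT z|lborel. B * \<bar>H (z - w n) - H z\<bar>)"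
   proof (rule integral_mono)
    show "integrable lborel (\<lambda>z. norm (F z * H (z - w n) - F z * H z))"
     by (intro integrable_norm Bochner_Integration.integrable_diff bi iH H)
    show "integrable lborel (\<lambda>z. B * \<bar>H (z - w n) - H z\<bar>)"
     by (intro integrable_mult_right integrable_abs Bochner_Integration.integrable_diff iH H)
    show "norm (F z * H (z - w n) - F z * H z) \<le> B * \<bar>H (z - w n) - H z\<bar>" for z
     using F(2)[of z] by (auto simp: right_diff_distrib[symmetric] abs_mult intro: mult_right_mono)
   qed
   also have "\<dots> = B * (LINT z|lborel. \<bar>H (z - w n) - H z\<bar>)" by simp
   finally show "norm ((LINT z|lborel. F (z + w n) * H z) - (LINT z|lborel. F z * H z))
    \<le> B * (LINT z|lborel. \<bar>H (z - w n) - H z\<bar>)" .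
  qed
 qed
 then show "((\<lambda>w. LINT z|lborel. F (z + w) * H z) \<circ> w) \<longlonglongrightarrow> (LINT z|lborel. F (z + 0) * H z)"
  by (simp add: o_def LIM_zero_iff)
qed

section \<open>Averages against bumps and Fubini for kernels\<close>

lemma bump_integral_pos:
 assumes "E > 0"
 shows "integrable lborel (bump E :: real^'d::finite => real)" "(LINT w|lborel. bump E (w :: real^'d)) > 0"
proof -
 have t: "test_fun UNIV (bump E :: real^'d => real)"
  by (rule test_funI[of _ "cball 0 E"]) (use assms in \<open>auto intro: smooth_bump bump_zero\<close>)
 show i: "integrable lborel (bump E :: real^'d => real)" by (rule test_fun_integrable[OF t])
 show "(LINT w|lborel. bump E (w :: real^'d)) > 0"
 proof (rule ccontr)
  assume "\<not> ?thesis"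
  moreover have "(LINT w|lborel. bump E (w :: real^'d)) \<ge> 0" by (simp add: bump_nonneg)
  ultimately have "(LINT w|lborel. bump E (w :: real^'d)) = 0" by simp
  then have "AE w in lborel. bump E (w :: real^'d) = 0"
   using integral_nonneg_eq_0_iff_AE[OF i] by (simp add: bump_nonneg)
  moreover have "bump E w ~= 0" if "w \<in> ball 0 E" for w :: "real^'d"
   using that bump_pos_iff[OF assms, of w] by auto
  ultimately have "AE w in lborel. (w :: real^'d) \<notin> ball 0 E" by (auto elim: eventually_mono)
  then have "emeasure lborel (ball (0::real^'d) E) = 0"
   by (subst (asm) AE_iff_measurable[of "ball 0 E"]) auto
  then have "measure lborel (ball (0::real^'d) E) = 0" by (simp add: measure_def)
  then show False using content_ball_pos[OF assms, of "0::real^'d"] by simp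
 qed
qed

text \<open>If P 0 were nonzero, P would keep its sign on a small ball and the average over that
  ball could not vanish. This stands in for the limit along an approximate identity.\<close>

lemma bump_concentration:
 fixes P :: "real^'d::finite => real"
 assumes "E0 > 0" and P: "continuous (at 0) P"
  and i: "!!E. 0 < E ==> E < E0 ==> integrable lborel (\<lambda>w. bump E w * P w)"
  and z: "!!E. 0 < E ==> E < E0 ==> (LINT w|lborel. bump E w * P w) = 0"
 shows "P 0 = 0"
proof (rule ccontr)
 assume n: "P 0 ~= 0"
 obtain A where A: "A > 0" "!!w. dist w 0 < A ==> dist (P w) (P 0) < \<bar>P 0\<bar> / 2"
  using P n unfolding continuous_at_eps_delta by (auto dest!: spec[of _ "\<bar>P 0\<bar> / 2"])
 define E where "E = min A E0 / 2"
 have e: "0 < E" "E < E0" "E < A" using A assms(1) by (auto simp: E_def)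
 have "(LINT w|lborel. bump E (w::real^'d) * (\<bar>P 0\<bar> / 2)) \<le> (LINT w|lborel. sgn (P 0) * (bump E w * P w))"
 proof (rule integral_mono)
  show "integrable lborel (\<lambda>w::real^'d. bump E w * (\<bar>P 0\<bar> / 2))" by (rule integrable_mult_left) (rule bump_integral_pos(1)[OF e(1)])
  show "integrable lborel (\<lambda>w. sgn (P 0) * (bump E w * P w))" using i[OF e(1,2)] by simp
  fix w :: "real^'d"
  show "bump E w * (\<bar>P 0\<bar> / 2) \<le> sgn (P 0) * (bump E w * P w)"
  proof (cases "norm w < E")
   case True
   then have "\<bar>P w - P 0\<bar> < \<bar>P 0\<bar> / 2" using A(2)[of w] e by (simp add: dist_norm)
   then have "\<bar>P 0\<bar> / 2 \<le> sgn (P 0) * P w" using n by (cases "P 0 > 0") (simp_all add: abs_if split: if_splits)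
   then have "bump E w * (\<bar>P 0\<bar> / 2) \<le> bump E w * (sgn (P 0) * P w)"
    by (intro mult_left_mono bump_nonneg)
   then show ?thesis by (simp add: mult.left_commute)
  next
   case False
   then show ?thesis using bump_zero[OF e(1), of w] by simp
  qed
 qed
 also have "\<dots> = 0" using z[OF e(1,2)] by simp
 also have "(LINT w|lborel. bump E (w::real^'d) * (\<bar>P 0\<bar> / 2)) = (LINT w|lborel. bump E (w::real^'d)) * (\<bar>P 0\<bar> / 2)" by simp
 finally show False using bump_integral_pos(2)[OF e(1), where 'd = 'd] n by (simp add: mult_le_0_iff)
qed

text \<open>The bound on the kernel reduces joint integrability to the product of two L^1
  norms.\<close>

lemma double_integral_kernel:
 fixes F H :: "'a::euclidean_space => real" and k :: "'a => 'a => real"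
 assumes F: "integrable lborel F" and H: "integrable lborel H"
  and k: "case_prod k \<in> borel_measurable (borel \<Otimes>\<^sub>M borel)" "!!x z. \<bar>k x z\<bar> \<le> C"
 shows "integrable (lborel \<Otimes>\<^sub>M lborel) (\<lambda>(x, z). F x * k x z * H z)"
  and "(LINT z|lborel. (LINT x|lborel. F x * k x z * H z)) = (LINT x|lborel. (LINT z|lborel. F x * k x z * H z))"
proof -
 note [measurable] = borel_measurable_integrable[OF F] borel_measurable_integrable[OF H] k(1)


 show i: "integrable (lborel \<Otimes>\<^sub>M lborel) (\<lambda>(x, z). F x * k x z * H z)"
 proof (rule lborel_pair.Fubini_integrable)
  show "(\<lambda>(x, z). F x * k x z * H z) \<in> borel_measurable (lborel \<Otimes>\<^sub>M lborel)" by measurable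
  have iz: "integrable lborel (\<lambda>z. F x * k x z * H z)" for x
  proof (rule Bochner_Integration.integrable_bound[where f = "\<lambda>z. F x * C * H z"])
   show "AE z in lborel. norm (F x * k x z * H z) \<le> norm (F x * C * H z)"
   proof (rule AE_I2)
    fix z
    have "\<bar>k x z\<bar> \<le> \<bar>C\<bar>" using k(2)[of x z] by simp
    then show "norm (F x * k x z * H z) \<le> norm (F x * C * H z)"
     by (simp add: abs_mult mult_left_mono mult_right_mono)
   qed
  qed (use H in auto)
  then show "AE x in lborel. integrable lborel (\<lambda>y. case (x, y) of (x, z) => F x * k x z * H z)"
   by simp
  show "integrable lborel (\<lambda>x. LINT y|lborel. norm (case (x, y) of (x, z) => F x * k x z * H z))"
  proof (rule Bochner_Integration.integrable_bound[where f = "\<lambda>x. \<bar>F x\<bar> * (C * (LINT z|lborel. \<bar>H z\<bar>))"])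
   show "(\<lambda>x. LINT y|lborel. norm (case (x, y) of (x, z) => F x * k x z * H z)) \<in> borel_measurable lborel"
    by measurable
   show "AE x in lborel. norm (LINT y|lborel. norm (case (x, y) of (x, z) => F x * k x z * H z))
     \<le> norm (\<bar>F x\<bar> * (C * (LINT z|lborel. \<bar>H z\<bar>)))"
   proof (rule AE_I2)
    fix x
    have C: "C \<ge> 0" using k(2)[of 0 0] by linarith
    have "(LINT z|lborel. \<bar>F x * k x z * H z\<bar>) \<le> (LINT z|lborel. \<bar>F x\<bar> * (C * \<bar>H z\<bar>))"
    proof (rule integral_mono)
     fix z show "\<bar>F x * k x z * H z\<bar> \<le> \<bar>F x\<bar> * (C * \<bar>H z\<bar>)"
      using k(2)[of x z] by (simp add: abs_mult mult_left_mono mult_right_mono mult.assoc)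
    qed (use iz[of x] H in auto)
    also have "\<dots> = \<bar>F x\<bar> * (C * (LINT z|lborel. \<bar>H z\<bar>))" by simp
    also have "\<dots> = norm (\<bar>F x\<bar> * (C * (LINT z|lborel. \<bar>H z\<bar>)))" using C by (simp add: abs_mult)
    finally show "norm (LINT y|lborel. norm (case (x, y) of (x, z) => F x * k x z * H z))
     \<le> norm (\<bar>F x\<bar> * (C * (LINT z|lborel. \<bar>H z\<bar>)))" by simp
   qed
  qed (use F in auto)
 qed
 show "(LINT z|lborel. (LINT x|lborel. F x * k x z * H z)) = (LINT x|lborel. (LINT z|lborel. F x * k x z * H z))"
  using lborel_pair.Fubini_integral[of "\<lambda>x z. F x * k x z * H z"] i by simp
qed

text \<open>The substitution x = z + w turns a double integral against k (x - z) into an average of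
  the correlation of F and H, the form on which \<open>bump_concentration\<close> acts.\<close>

lemma double_integral_correlation:
 fixes F H k :: "'a::euclidean_space => real"
 assumes F: "integrable lborel F" "!!x. \<bar>F x\<bar> \<le> B" and H: "integrable lborel H"
  and k: "integrable lborel k" "!!w. \<bar>k w\<bar> \<le> C"
 shows "integrable lborel (\<lambda>w. k w * (LINT z|lborel. F (z + w) * H z))"
  and "(LINT z|lborel. (LINT x|lborel. F x * k (x - z) * H z)) = (LINT w|lborel. k w * (LINT z|lborel. F (z + w) * H z))"
proof -
 note [measurable] = borel_measurable_integrable[OF F(1)] borel_measurable_integrable[OF H] borel_measurable_integrable[OF k(1)]
 have sh: "(LINT x|lborel. F x * k (x - z) * H z) = (LINT w|lborel. k w * F (z + w) * H z)" for z
  using lborel_integral_translation[of "\<lambda>x. F x * k (x - z) * H z" z] by (simp add: ac_simps)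
 have B: "B \<ge> 0" using F(2)[of 0] by linarith
 have i: "integrable (lborel \<Otimes>\<^sub>M lborel) (\<lambda>(w, z). k w * F (z + w) * H z)"
 proof -
  have "(\<lambda>(w, z). F (z + w)) \<in> borel_measurable (borel \<Otimes>\<^sub>M borel)" by measurable
  from double_integral_kernel(1)[OF k(1) H this F(2)] show ?thesis .
 qed
 show "integrable lborel (\<lambda>w. k w * (LINT z|lborel. F (z + w) * H z))"
  using lborel_pair.integrable_fst'[OF i] by (simp add: mult.assoc)
 have "(LINT z|lborel. (LINT w|lborel. k w * F (z + w) * H z)) = (LINT w|lborel. (LINT z|lborel. k w * F (z + w) * H z))"
  using lborel_pair.Fubini_integral[of "\<lambda>w z. k w * F (z + w) * H z"] i by simp
 then show "(LINT z|lborel. (LINT x|lborel. F x * k (x - z) * H z)) = (LINT w|lborel. k w * (LINT z|lborel. F (z + w) * H z))"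
  unfolding sh by (simp add: mult.assoc)
qed

section \<open>Locally integrable functions\<close>

lemma compact_neighbourhood:
 fixes K :: "'a::euclidean_space set"
 assumes "compact K" "open D" "K \<subseteq> D"
 obtains e L where "e > 0" "compact L" "L \<subseteq> D" "K \<subseteq> L" "!!x. x \<in> K ==> cball x e \<subseteq> L"
proof -
 obtain e where e: "e > 0" "(\<Union>x\<in>K. cball x e) \<subseteq> D"
  using compact_subset_open_imp_cball_epsilon_subset[OF assms] by blast
 \<comment> \<open>The union of the balls, written as a Minkowski sum so that
   \<open>compact_sums\<close> applies.\<close>
 let ?L = "{x + y | x y. x \<in> K \<and> y \<in> cball 0 e}"
 have L: "?L = (\<Union>x\<in>K. cball x e)"
 proof (intro equalityI subsetI)
  fix v assume "v \<in> (\<Union>x\<in>K. cball x e)"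
  then obtain x where "x \<in> K" "dist x v \<le> e" by auto
  then have "v = x + (v - x)" "v - x \<in> cball 0 e" by (auto simp: dist_norm norm_minus_commute)
  with \<open>x \<in> K\<close> show "v \<in> ?L" by blast
 next
  fix v assume "v \<in> ?L"
  then obtain x y where "v = x + y" "x \<in> K" "norm y \<le> e" by auto
  then show "v \<in> (\<Union>x\<in>K. cball x e)" by (intro UN_I[of x]) (auto simp: dist_norm)
 qed
 show ?thesis
 proof (rule that[of e ?L])
  show "compact ?L" using compact_sums[OF assms(1) compact_cball] .
  show "?L \<subseteq> D" "!!x. x \<in> K ==> cball x e \<subseteq> ?L" unfolding L using e by auto
  show "K \<subseteq> ?L" unfolding L using e(1) by force
 qed (fact e(1))
qed

lemma locally_integrable_compact:
 fixes f :: "real^'d::finite => 'b::euclidean_space"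
 assumes "locally_integrable D f" "compact K" "K \<subseteq> D"
 shows "integrable lebesgue (\<lambda>x. indicator K x *\<^sub>R f x)"
proof -
 have "K \<inter> space lebesgue \<in> sets lebesgue" using assms(2) by (simp add: borel_compact)
 then show ?thesis using assms integrable_restrict_space[of K lebesgue f]
  unfolding locally_integrable_def by blast
qed

lemma locally_integrableI:
 fixes f :: "real^'d::finite => 'b::euclidean_space"
 assumes "!!K. compact K ==> K \<subseteq> D ==> integrable lebesgue (\<lambda>x. indicator K x *\<^sub>R f x)"
 shows "locally_integrable D f"
 unfolding locally_integrable_def
proof (intro allI impI)
 fix K assume K: "compact K \<and> K \<subseteq> D"
 then have "K \<inter> space lebesgue \<in> sets lebesgue" by (simp add: borel_compact)
 then show "integrable (lebesgue_on K) f" using assms[of K] K integrable_restrict_space[of K lebesgue f] by blast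
qed

lemma lebesgue_on_open_integral:
 fixes f :: "real^'d::finite => 'b::euclidean_space"
 assumes "open D"
 shows "integrable (lebesgue_on D) f \<longleftrightarrow> integrable lebesgue (\<lambda>x. indicator D x *\<^sub>R f x)"
  and "(LINT x|lebesgue_on D. f x) = (LINT x|lebesgue. indicator D x *\<^sub>R f x)"
 using assms by (intro integrable_restrict_space integral_restrict_space; simp add: borel_open)+

lemma integrable_test_times:
 fixes f :: "real^'d::finite => 'b::euclidean_space"
 assumes D: "open D" and f: "locally_integrable D f" and \<phi>: "test_fun D \<phi>"
 shows "integrable (lebesgue_on D) (\<lambda>x. \<phi> x *\<^sub>R f x)"
proof -
 obtain K where K: "compact K" "K \<subseteq> D" "!!x. x \<notin> K ==> \<phi> x = 0" using test_funE[OF \<phi>] by blast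
 obtain B where B: "B > 0" "!!x. \<bar>\<phi> x\<bar> \<le> B" using test_fun_bounded[OF \<phi>] by blast
 note i = locally_integrable_compact[OF f K(1,2)]
 have eq: "indicator D x *\<^sub>R \<phi> x *\<^sub>R f x = \<phi> x *\<^sub>R (indicator K x *\<^sub>R f x)" for x
  using K(2) K(3)[of x] by (cases "x \<in> K") (auto simp: indicator_def)
 have "integrable lebesgue (\<lambda>x. \<phi> x *\<^sub>R (indicator K x *\<^sub>R f x))"
 proof (rule Bochner_Integration.integrable_bound[where f = "\<lambda>x. B *\<^sub>R (indicator K x *\<^sub>R f x)"])
  show "integrable lebesgue (\<lambda>x. B *\<^sub>R (indicator K x *\<^sub>R f x))" using i by (rule integrable_scaleR_right)
  have "\<phi> \<in> borel_measurable lebesgue" using test_fun_borel[OF \<phi>] by (intro measurable_completion) simp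
  then show "(\<lambda>x. \<phi> x *\<^sub>R (indicator K x *\<^sub>R f x)) \<in> borel_measurable lebesgue"
   using borel_measurable_integrable[OF i] by (rule borel_measurable_scaleR)
  show "AE x in lebesgue. norm (\<phi> x *\<^sub>R (indicator K x *\<^sub>R f x)) \<le> norm (B *\<^sub>R (indicator K x *\<^sub>R f x))"
  proof (rule AE_I2)
   fix x
   have "\<bar>\<phi> x\<bar> * norm (indicator K x *\<^sub>R f x) \<le> B * norm (indicator K x *\<^sub>R f x)"
    by (intro mult_right_mono B) simp
   then show "norm (\<phi> x *\<^sub>R (indicator K x *\<^sub>R f x)) \<le> norm (B *\<^sub>R (indicator K x *\<^sub>R f x))"
    using B(1) by (simp add: abs_mult mult.assoc)
  qed
 qed
 then show ?thesis unfolding lebesgue_on_open_integral(1)[OF D] eq .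
qed

text \<open>Weak derivatives are defined with Lebesgue measure, while translations and Fubini are
  available for \<open>lborel\<close>. A Borel representative that vanishes off a compact K carries
  the integrals from one to the other.\<close>

lemma locally_integrable_borel:
 fixes f :: "real^'d::finite => real"
 assumes f: "locally_integrable D f" and D: "open D" and K: "compact K" "K \<subseteq> D"
 shows "\<exists>F. integrable lborel F \<and> (\<forall>x. x \<notin> K --> F x = 0) \<and> (AE x in lborel. x \<in> K --> F x = f x) \<and>
  (\<forall>\<psi>. \<psi> \<in> borel_measurable borel --> (\<forall>x. x \<notin> K --> \<psi> x = 0) -->
    (LINT x|lebesgue_on D. \<psi> x * f x) = (LINT x|lborel. \<psi> x * F x))"
proof -
 note i = locally_integrable_compact[OF f K]
 then have "(\<lambda>x. indicator K x *\<^sub>R f x) \<in> borel_measurable (completion lborel)"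
  by (rule borel_measurable_integrable)
 from completion_ex_borel_measurable_real[OF this]
 obtain F0 where F0: "F0 \<in> borel_measurable lborel" "AE x in lborel. indicator K x *\<^sub>R f x = F0 x" by blast
 define F where "F = (\<lambda>x. indicator K x * F0 x)"
 have m: "F \<in> borel_measurable lborel" unfolding F_def
  using F0(1) K(1) by (intro borel_measurable_times borel_measurable_indicator) (auto intro: borel_compact)
 have ae: "AE x in lborel. indicator K x *\<^sub>R f x = F x"
  using F0(2) by eventually_elim (auto simp: F_def indicator_def)
 have ael: "AE x in lebesgue. indicator K x *\<^sub>R f x = F x" using ae by (rule AE_completion)
 have ml: "F \<in> borel_measurable lebesgue" using m by (rule measurable_completion)
 have "integrable lebesgue F" using i ml ael borel_measurable_integrable[OF i] integrable_cong_AE by blast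
 then have iF: "integrable lborel F" using integrable_completion[OF m] by blast
 show ?thesis
 proof (intro exI[of _ F] conjI iF allI impI)
  show "F x = 0" if "x \<notin> K" for x using that by (simp add: F_def)
  show "AE x in lborel. x \<in> K --> F x = f x" using ae by eventually_elim auto
  fix \<psi> :: "real^'d => real" assume \<psi>: "\<psi> \<in> borel_measurable borel" "\<forall>x. x \<notin> K --> \<psi> x = 0"
  have eq: "indicator D x *\<^sub>R (\<psi> x * f x) = \<psi> x * (indicator K x *\<^sub>R f x)" for x
   using K(2) \<psi>(2) by (cases "x \<in> K") (auto simp: indicator_def)
  have m\<psi>: "\<psi> \<in> borel_measurable lebesgue" using \<psi>(1) by (intro measurable_completion) simp
  have "(LINT x|lebesgue_on D. \<psi> x * f x) = (LINT x|lebesgue. \<psi> x * (indicator K x *\<^sub>R f x))"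
   unfolding lebesgue_on_open_integral(2)[OF D] eq ..
  also have "\<dots> = (LINT x|lebesgue. \<psi> x * F x)"
  proof (rule integral_cong_AE)
   show "(\<lambda>x. \<psi> x * (indicator K x *\<^sub>R f x)) \<in> borel_measurable lebesgue"
    by (intro borel_measurable_times m\<psi> borel_measurable_integrable[OF i])
   show "(\<lambda>x. \<psi> x * F x) \<in> borel_measurable lebesgue" by (intro borel_measurable_times m\<psi> ml)
   show "AE x in lebesgue. \<psi> x * (indicator K x *\<^sub>R f x) = \<psi> x * F x" using ael by eventually_elim simp
  qed
  also have "\<dots> = (LINT x|lborel. \<psi> x * F x)"
   by (intro integral_completion borel_measurable_times m) (use \<psi>(1) in simp)
  finally show "(LINT x|lebesgue_on D. \<psi> x * f x) = (LINT x|lborel. \<psi> x * F x)" .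
 qed
qed

section \<open>Weak derivatives\<close>

lemma AE_lebesgue_on_open:
 assumes "open D"
 shows "(AE x in lebesgue_on D. P x) \<longleftrightarrow> (AE x in lborel. x \<in> D --> P x)"
 using assms by (subst AE_restrict_space_iff) (auto simp: AE_completion_iff borel_open)

lemma bump_minus: "bump E (- w) = bump E w"
 by (simp add: bump_def)

lemma test_fun_bump_shift:
 assumes "E > 0" "cball z E \<subseteq> D"
 shows "test_fun D (\<lambda>x. bump E (x - z))"
proof -
 have "(\<lambda>x. bump E (x - z)) = (\<lambda>x. bump E (z - x))"    by (rule ext, subst bump_minus[symmetric]) simp
 then show ?thesis using test_fun_bump[OF assms] by simp
qed

lemma bump_shift_borel: "(\<lambda>(x, z). bump E (x - z)) \<in> borel_measurable (borel \<Otimes>\<^sub>M borel)"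
proof -
 have [measurable]: "bump E \<in> borel_measurable borel" by (rule smooth_borel[OF smooth_bump])
 show ?thesis by measurable
qed

lemma bump_abs_le: "\<bar>bump E w\<bar> \<le> 1"
 using bump_nonneg[of E w] bump_le_1[of E w] by simp

text \<open>The fundamental lemma of the calculus of variations. The sign of f on K is averaged
  against f with bump kernels: every average vanishes, since the bump around a point of K is a test
  function, while the limit is the integral of |f| over K.\<close>

lemma locally_integrable_eq_zero:
 fixes f :: "real^'d::finite => real"
 assumes D: "open D" and f: "locally_integrable D f"
  and z: "!!\<phi>. test_fun D \<phi> ==> (LINT x|lebesgue_on D. \<phi> x * f x) = 0"
 shows "AE x in lebesgue_on D. f x = 0"
proof -
 have compact_case: "AE x in lborel. x \<in> K --> f x = 0" if K: "compact K" "K \<subseteq> D" for K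
 proof -
  obtain e L where L: "e > 0" "compact L" "L \<subseteq> D" "K \<subseteq> L" "!!x. x \<in> K ==> cball x e \<subseteq> L"
   using compact_neighbourhood[OF K(1) D K(2)] by blast
  obtain G where G: "integrable lborel G" "!!x. x \<notin> L ==> G x = 0" "AE x in lborel. x \<in> L --> G x = f x"
   "!!\<psi>. \<psi> \<in> borel_measurable borel ==> (!!x. x \<notin> L ==> \<psi> x = 0) ==>
    (LINT x|lebesgue_on D. \<psi> x * f x) = (LINT x|lborel. \<psi> x * G x)"
   using locally_integrable_borel[OF f D L(2,3)] by auto
  have Gm: "G \<in> borel_measurable borel" using borel_measurable_integrable[OF G(1)] by simp
  have Kb: "K \<in> sets borel" using K(1) by (rule borel_compact)
  define F where "F x = indicator K x * sgn (G x)" for x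
  have Fm: "F \<in> borel_measurable borel" unfolding F_def using Gm Kb by measurable
  have Fb: "\<bar>F x\<bar> \<le> 1" for x by (simp add: F_def indicator_def abs_sgn_eq)
  have "emeasure lborel K < \<infinity>" using K(1) by (rule emeasure_compact_finite)
  then have iK: "integrable lborel (indicator K :: _ => real)" using Kb by (intro integrable_real_indicator) auto
  have iF: "integrable lborel F"
   by (rule Bochner_Integration.integrable_bound[OF iK])
    (use Fm in \<open>auto simp: F_def indicator_def abs_sgn_eq intro!: AE_I2\<close>)
  let ?P = "\<lambda>w. \<integral>z. F (z + w) * G z \<partial>lborel"
  have "?P 0 = 0"
  proof (rule bump_concentration[OF L(1) continuous_correlation[OF Fm Fb G(1)]])
   fix E :: real assume e: "0 < E" "E < e"
   show "integrable lborel (\<lambda>w. bump E w * ?P w)"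
    by (rule double_integral_correlation(1)[OF iF Fb G(1) bump_integral_pos(1)[OF e(1)] bump_abs_le])
   have "(LINT z|lborel. F x * bump E (x - z) * G z) = 0" for x
   proof (cases "x \<in> K")
    case True
    then have c: "cball x E \<subseteq> L" using L(5)[OF True] e by (auto simp: subset_iff)
    then have t: "test_fun D (\<lambda>z. bump E (x - z))" using L(3) by (intro test_fun_bump e) auto
    have "(LINT z|lborel. bump E (x - z) * G z) = (LINT z|lebesgue_on D. bump E (x - z) * f z)"
    proof (rule G(4)[symmetric])
     show "bump E (x - z) = 0" if "z \<notin> L" for z
     proof (rule bump_zero[OF e(1)])
      have "z \<notin> cball x E" using c that by blast
      then show "norm (x - z) \<ge> E" by (simp add: dist_norm)
     qed
    qed (rule test_fun_borel[OF t])
    also have "\<dots> = 0" by (rule z[OF t])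
    finally show ?thesis by (simp add: mult.assoc)
   qed (simp add: F_def)
   then have "(LINT z|lborel. (LINT x|lborel. F x * bump E (x - z) * G z)) = 0"
    using double_integral_kernel(2)[OF iF G(1) bump_shift_borel bump_abs_le] by simp
   then show "(LINT w|lborel. bump E w * ?P w) = 0"
    using double_integral_correlation(2)[OF iF Fb G(1) bump_integral_pos(1)[OF e(1)] bump_abs_le] by simp
  qed
  moreover have FG: "F x * G x = indicator K x * \<bar>G x\<bar>" for x by (simp add: F_def abs_sgn)
  ultimately have "(LINT x|lborel. indicator K x * \<bar>G x\<bar>) = 0" by simp
  moreover have "integrable lborel (\<lambda>x. indicator K x * \<bar>G x\<bar>)"
   using integrable_abs[OF G(1)] Kb integrable_mult_indicator[of K lborel "\<lambda>x. \<bar>G x\<bar>"] by simp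
  ultimately have "AE x in lborel. indicator K x * \<bar>G x\<bar> = 0"
   by (subst (asm) integral_nonneg_eq_0_iff_AE) auto
  with G(3) show ?thesis by eventually_elim (use L(4) in auto)
 qed
 \<comment> \<open>Countably many boxes exhaust D, so the null sets of the compact case can be
   united.\<close>
 have "\<exists>\<C>. countable \<C> \<and> \<C> \<subseteq> Pow D \<and> (\<forall>X\<in>\<C>. \<exists>a b. X = cbox a b) \<and> \<Union>\<C> = D"
 proof (rule open_countable_Union_open_cbox[OF D], goal_cases)
  case (1 \<D>)
  then show ?case by (intro exI[of _ \<D>] conjI ballI)
 qed
 then obtain \<C> where C: "countable \<C>" "\<C> \<subseteq> Pow D" "\<forall>X\<in>\<C>. \<exists>a b. X = cbox a b" "\<Union>\<C> = D"
  by (elim exE conjE)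
 have "AE x in lborel. \<forall>X\<in>\<C>. x \<in> X --> f x = 0"
 proof (subst AE_ball_countable[OF C(1)], intro ballI compact_case)
  fix X assume X: "X \<in> \<C>"
  then obtain a b where "X = cbox a b" using C(3) by blast
  then show "compact X" by simp
  show "X \<subseteq> D" using C(2) X by blast
 qed
 then show ?thesis unfolding AE_lebesgue_on_open[OF D]
  by eventually_elim (use C(4) in blast)
qed

section \<open>Linearity, uniqueness, composition and limits of weak derivatives\<close>

lemma locally_integrable_linear:
 "bounded_linear T ==> locally_integrable D f ==> locally_integrable D (\<lambda>x. T (f x))"
 unfolding locally_integrable_def using integrable_bounded_linear by blast

lemma locally_integrable_add:
 "locally_integrable D f ==> locally_integrable D g ==> locally_integrable D (\<lambda>x. f x + g x)"
 unfolding locally_integrable_def using Bochner_Integration.integrable_add by blast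

lemma locally_integrable_diff:
 "locally_integrable D f ==> locally_integrable D g ==> locally_integrable D (\<lambda>x. f x - g x)"
 unfolding locally_integrable_def using Bochner_Integration.integrable_diff by blast

lemma locally_integrable_zero: "locally_integrable D (\<lambda>x. 0)"
 unfolding locally_integrable_def by simp

lemma is_weak_deriv_linear:
 assumes D: "open D" and T: "bounded_linear T" and w: "is_weak_deriv D I f g"
 shows "is_weak_deriv D I (\<lambda>x. T (f x)) (\<lambda>x. T (g x))"
proof -
 have l: "locally_integrable D f" "locally_integrable D g" using w by (auto simp: is_weak_deriv_def)
 interpret T: bounded_linear T by fact
 have e: "(LINT x|lebesgue_on D. \<psi> x *\<^sub>R T (h x)) = T (LINT x|lebesgue_on D. \<psi> x *\<^sub>R h x)"
  if "test_fun D \<psi>" "locally_integrable D h" for \<psi> h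
  using integral_bounded_linear[OF T integrable_test_times[OF D that(2,1)]] by (simp add: T.scaleR)
 show ?thesis unfolding is_weak_deriv_def
 proof (intro conjI locally_integrable_linear[OF T] l allI impI)
  fix \<phi> assume \<phi>: "test_fun D \<phi>"
  then have "(LINT x|lebesgue_on D. mi_partial I \<phi> x *\<^sub>R f x) = (- 1) ^ mi_size I *\<^sub>R (LINT x|lebesgue_on D. \<phi> x *\<^sub>R g x)"
   using w by (simp add: is_weak_deriv_def)
  then show "(LINT x|lebesgue_on D. mi_partial I \<phi> x *\<^sub>R T (f x)) =
    (- 1) ^ mi_size I *\<^sub>R (LINT x|lebesgue_on D. \<phi> x *\<^sub>R T (g x))"
   by (simp add: e[OF \<phi> l(2)] e[OF test_fun_mi_partial[OF \<phi>] l(1)] T.scaleR)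
 qed
qed

lemma is_weak_deriv_add:
 assumes D: "open D" and w: "is_weak_deriv D I f g" "is_weak_deriv D I f' g'"
 shows "is_weak_deriv D I (\<lambda>x. f x + f' x) (\<lambda>x. g x + g' x)"
proof -
 have l: "locally_integrable D f" "locally_integrable D g" "locally_integrable D f'" "locally_integrable D g'"
  using w by (auto simp: is_weak_deriv_def)
 show ?thesis unfolding is_weak_deriv_def
 proof (intro conjI locally_integrable_add l allI impI)
  fix \<phi> assume \<phi>: "test_fun D \<phi>"
  note i = integrable_test_times[OF D _ \<phi>] integrable_test_times[OF D _ test_fun_mi_partial[OF \<phi>]]
  show "(LINT x|lebesgue_on D. mi_partial I \<phi> x *\<^sub>R (f x + f' x)) =
    (- 1) ^ mi_size I *\<^sub>R (LINT x|lebesgue_on D. \<phi> x *\<^sub>R (g x + g' x))"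
   using w \<phi> by (simp add: scaleR_add_right i l is_weak_deriv_def)
 qed
qed

lemma is_weak_deriv_scaleR:
 "open D ==> is_weak_deriv D I f g ==> is_weak_deriv D I (\<lambda>x. c *\<^sub>R f x) (\<lambda>x. c *\<^sub>R g x)"
 by (rule is_weak_deriv_linear[OF _ bounded_linear_scaleR_right])

lemma is_weak_deriv_zero: "is_weak_deriv D I (\<lambda>x. 0) (\<lambda>x. 0)"
 by (simp add: is_weak_deriv_def locally_integrable_zero)

lemma is_weak_deriv_diff:
 assumes D: "open D" and w: "is_weak_deriv D I f g" "is_weak_deriv D I f' g'"
 shows "is_weak_deriv D I (\<lambda>x. f x - f' x) (\<lambda>x. g x - g' x)"
 using is_weak_deriv_add[OF D w(1) is_weak_deriv_scaleR[OF D w(2), of "-1"]] by simp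

lemma is_weak_deriv_sum:
 assumes D: "open D" and "finite S" "!!s. s \<in> S ==> is_weak_deriv D I (f s) (g s)"
 shows "is_weak_deriv D I (\<lambda>x. \<Sum>s\<in>S. f s x) (\<lambda>x. \<Sum>s\<in>S. g s x)"
 using assms(2,3) by (induction rule: finite_induct) (simp_all add: is_weak_deriv_zero is_weak_deriv_add[OF D])

lemma integral_test_cong_AE:
 fixes f f' :: "real^'d::finite => 'b::euclidean_space"
 assumes D: "open D" and l: "locally_integrable D f" "locally_integrable D f'" and \<phi>: "test_fun D \<phi>"
  and ae: "AE x in lebesgue_on D. f x = f' x"
 shows "(LINT x|lebesgue_on D. \<phi> x *\<^sub>R f x) = (LINT x|lebesgue_on D. \<phi> x *\<^sub>R f' x)"
proof (rule integral_cong_AE)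
 show "(\<lambda>x. \<phi> x *\<^sub>R f x) \<in> borel_measurable (lebesgue_on D)" "(\<lambda>x. \<phi> x *\<^sub>R f' x) \<in> borel_measurable (lebesgue_on D)"
  using integrable_test_times[OF D _ \<phi>] l borel_measurable_integrable by blast+
 show "AE x in lebesgue_on D. \<phi> x *\<^sub>R f x = \<phi> x *\<^sub>R f' x" using ae by eventually_elim simp
qed

lemma is_weak_deriv_cong_AE:
 assumes D: "open D" and w: "is_weak_deriv D I f g" and l: "locally_integrable D f'" "locally_integrable D g'"
  and ae: "AE x in lebesgue_on D. f x = f' x" "AE x in lebesgue_on D. g x = g' x"
 shows "is_weak_deriv D I f' g'"
proof -
 have "locally_integrable D f" "locally_integrable D g" using w by (auto simp: is_weak_deriv_def)
 then have "(LINT x|lebesgue_on D. \<phi> x *\<^sub>R g x) = (LINT x|lebesgue_on D. \<phi> x *\<^sub>R g' x)"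
  "(LINT x|lebesgue_on D. mi_partial I \<phi> x *\<^sub>R f x) = (LINT x|lebesgue_on D. mi_partial I \<phi> x *\<^sub>R f' x)"
  if "test_fun D \<phi>" for \<phi>
  using integral_test_cong_AE[OF D _ l(2) that ae(2)]
   integral_test_cong_AE[OF D _ l(1) test_fun_mi_partial[OF that] ae(1)] by auto
 then show ?thesis using w l unfolding is_weak_deriv_def by auto
qed

lemma is_weak_deriv_unique:
 fixes f :: "real^'d::finite => 'b::euclidean_space"
 assumes D: "open D" and w: "is_weak_deriv D I f g" "is_weak_deriv D I f g'"
 shows "AE x in lebesgue_on D. g x = g' x"
proof -
 have "AE x in lebesgue_on D. (g x - g' x) \<bullet> b = 0" if b: "b \<in> Basis" for b
 proof (rule locally_integrable_eq_zero[OF D])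
  have l: "locally_integrable D (\<lambda>x. g x - g' x)" "locally_integrable D g" "locally_integrable D g'"
   using w by (auto simp: is_weak_deriv_def intro: locally_integrable_diff)
  then show "locally_integrable D (\<lambda>x. (g x - g' x) \<bullet> b)"
   by (intro locally_integrable_linear[OF bounded_linear_inner_left])
  fix \<phi> assume \<phi>: "test_fun D \<phi>"
  have "(-1::real) ^ mi_size I *\<^sub>R (LINT x|lebesgue_on D. \<phi> x *\<^sub>R g x) =
    (-1) ^ mi_size I *\<^sub>R (LINT x|lebesgue_on D. \<phi> x *\<^sub>R g' x)"
   using w \<phi> unfolding is_weak_deriv_def by simp
  then have "(LINT x|lebesgue_on D. \<phi> x *\<^sub>R g x) = (LINT x|lebesgue_on D. \<phi> x *\<^sub>R g' x)"
   by simp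
  then have "(LINT x|lebesgue_on D. \<phi> x *\<^sub>R (g x - g' x)) = 0"
   by (simp add: scaleR_diff_right integrable_test_times[OF D _ \<phi>] l)
  moreover have "(LINT x|lebesgue_on D. (\<phi> x *\<^sub>R (g x - g' x)) \<bullet> b) = (LINT x|lebesgue_on D. \<phi> x *\<^sub>R (g x - g' x)) \<bullet> b"
   by (rule integral_inner_left) (use integrable_test_times[OF D l(1) \<phi>] in blast)
  ultimately show "(LINT x|lebesgue_on D. \<phi> x * ((g x - g' x) \<bullet> b)) = 0" by simp
 qed
 then have "AE x in lebesgue_on D. \<forall>b\<in>Basis. (g x - g' x) \<bullet> b = 0"
  by (subst AE_ball_countable) (auto intro: countable_finite)
 then show ?thesis
 proof eventually_elim
  case (elim x)
  then have "g x - g' x = 0" using euclidean_all_zero_iff by blast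
  then show ?case by simp
 qed
qed

lemma mi_size_add: "mi_size (I + J) = mi_size I + mi_size J"
 by (simp add: mi_size_def sum.distrib)

lemma mi_size_axis: "mi_size (axis i 1) = 1"
 by (simp add: mi_size_def axis_def)

lemma is_weak_deriv_compose:
 assumes "is_weak_deriv D I f h" "is_weak_deriv D (axis i 1) h g"
 shows "is_weak_deriv D (I + axis i 1) f g"
 unfolding is_weak_deriv_def
proof (intro conjI allI impI)
 fix \<phi> assume \<phi>: "test_fun D \<phi>"
 note s = test_fun_smooth[OF \<phi>]
 have "(LINT x|lebesgue_on D. mi_partial (I + axis i 1) \<phi> x *\<^sub>R f x) =
  (LINT x|lebesgue_on D. mi_partial I (partial i \<phi>) x *\<^sub>R f x)" unfolding mi_partial_add_axis'[OF s] ..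
 also have "\<dots> = (- 1) ^ mi_size I *\<^sub>R (LINT x|lebesgue_on D. mi_partial (axis i 1) \<phi> x *\<^sub>R h x)"
  unfolding mi_partial_axis[OF s] using assms(1) test_fun_partial[OF \<phi>] by (simp add: is_weak_deriv_def)
 also have "\<dots> = (- 1) ^ mi_size (I + axis i 1) *\<^sub>R (LINT x|lebesgue_on D. \<phi> x *\<^sub>R g x)"
 proof -
  have "(LINT x|lebesgue_on D. mi_partial (axis i 1) \<phi> x *\<^sub>R h x) = (- 1) ^ mi_size (axis i (1::nat)) *\<^sub>R (LINT x|lebesgue_on D. \<phi> x *\<^sub>R g x)"
   using assms(2) \<phi> unfolding is_weak_deriv_def by blast
  then show ?thesis unfolding mi_size_add power_add by (simp only: scaleR_scaleR)
 qed
 finally show "(LINT x|lebesgue_on D. mi_partial (I + axis i 1) \<phi> x *\<^sub>R f x) =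
  (- 1) ^ mi_size (I + axis i 1) *\<^sub>R (LINT x|lebesgue_on D. \<phi> x *\<^sub>R g x)" .
qed (use assms in \<open>auto simp: is_weak_deriv_def\<close>)

lemma is_weak_deriv_compose':
 assumes "is_weak_deriv D (axis i 1) f h" "is_weak_deriv D I h g"
 shows "is_weak_deriv D (I + axis i 1) f g"
 unfolding is_weak_deriv_def
proof (intro conjI allI impI)
 fix \<phi> assume \<phi>: "test_fun D \<phi>"
 note s = test_fun_smooth[OF \<phi>]
 have "(LINT x|lebesgue_on D. mi_partial (I + axis i 1) \<phi> x *\<^sub>R f x) =
  (LINT x|lebesgue_on D. mi_partial (axis i 1) (mi_partial I \<phi>) x *\<^sub>R f x)"
  unfolding mi_partial_add_axis[OF s] mi_partial_axis[OF smooth_mi_partial[OF s]] ..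
 also have "\<dots> = (- 1) ^ mi_size (axis i (1::nat)) *\<^sub>R (LINT x|lebesgue_on D. mi_partial I \<phi> x *\<^sub>R h x)"
  using assms(1) test_fun_mi_partial[OF \<phi>] unfolding is_weak_deriv_def by blast
 also have "\<dots> = (- 1) ^ mi_size (I + axis i 1) *\<^sub>R (LINT x|lebesgue_on D. \<phi> x *\<^sub>R g x)"
 proof -
  have "(LINT x|lebesgue_on D. mi_partial I \<phi> x *\<^sub>R h x) = (- 1) ^ mi_size I *\<^sub>R (LINT x|lebesgue_on D. \<phi> x *\<^sub>R g x)"
   using assms(2) \<phi> unfolding is_weak_deriv_def by blast
  then show ?thesis unfolding mi_size_add add.commute[of "mi_size I"] power_add by (simp only: scaleR_scaleR)
 qed
 finally show "(LINT x|lebesgue_on D. mi_partial (I + axis i 1) \<phi> x *\<^sub>R f x) =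
  (- 1) ^ mi_size (I + axis i 1) *\<^sub>R (LINT x|lebesgue_on D. \<phi> x *\<^sub>R g x)" .
qed (use assms in \<open>auto simp: is_weak_deriv_def\<close>)

text \<open>The converse of composition: as h is already the derivative of f of order I, testing h
  with \<open>partial i \<phi>\<close> is testing f with the derivative of \<phi> of order I +
  e_i.\<close>

lemma is_weak_deriv_step:
 assumes "is_weak_deriv D I f h" "is_weak_deriv D (I + axis i 1) f g"
 shows "is_weak_deriv D (axis i 1) h g"
 unfolding is_weak_deriv_def
proof (intro conjI allI impI)
 fix \<phi> assume \<phi>: "test_fun D \<phi>"
 note s = test_fun_smooth[OF \<phi>]
 have "(- 1) ^ mi_size I *\<^sub>R (LINT x|lebesgue_on D. partial i \<phi> x *\<^sub>R h x) =
  (LINT x|lebesgue_on D. mi_partial (I + axis i 1) \<phi> x *\<^sub>R f x)"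
  unfolding mi_partial_add_axis'[OF s] using assms(1) test_fun_partial[OF \<phi>] by (simp add: is_weak_deriv_def)
 also have "\<dots> = (- 1) ^ mi_size (I + axis i 1) *\<^sub>R (LINT x|lebesgue_on D. \<phi> x *\<^sub>R g x)"
  using assms(2) \<phi> unfolding is_weak_deriv_def by blast
 also have "\<dots> = (- 1) ^ mi_size I *\<^sub>R ((- 1) ^ mi_size (axis i (1::nat)) *\<^sub>R (LINT x|lebesgue_on D. \<phi> x *\<^sub>R g x))"
  by (simp add: mi_size_add power_add)
 finally show "(LINT x|lebesgue_on D. mi_partial (axis i 1) \<phi> x *\<^sub>R h x) =
  (- 1) ^ mi_size (axis i (1::nat)) *\<^sub>R (LINT x|lebesgue_on D. \<phi> x *\<^sub>R g x)"
  unfolding mi_partial_axis[OF s] by (simp del: scaleR_scaleR)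
qed (use assms in \<open>auto simp: is_weak_deriv_def\<close>)

text \<open>Only the integrals against each single test function have to converge. This covers the
  uniform limits of the chain rule as well as the L^2 limits in \<open>Hs_complete\<close>.\<close>

lemma is_weak_deriv_limit:
 assumes l: "locally_integrable D f" "locally_integrable D g" and w: "!!n. is_weak_deriv D I (F n) (G n)"
  and lim: "!!\<psi>. test_fun D \<psi> ==> (\<lambda>n. LINT x|lebesgue_on D. \<psi> x *\<^sub>R F n x) \<longlonglongrightarrow> (LINT x|lebesgue_on D. \<psi> x *\<^sub>R f x)"
   "!!\<psi>. test_fun D \<psi> ==> (\<lambda>n. LINT x|lebesgue_on D. \<psi> x *\<^sub>R G n x) \<longlonglongrightarrow> (LINT x|lebesgue_on D. \<psi> x *\<^sub>R g x)"
 shows "is_weak_deriv D I f g"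
 unfolding is_weak_deriv_def
proof (intro conjI l allI impI)
 fix \<phi> assume \<phi>: "test_fun D \<phi>"
 have "(\<lambda>n. (- 1) ^ mi_size I *\<^sub>R (LINT x|lebesgue_on D. \<phi> x *\<^sub>R G n x)) \<longlonglongrightarrow>
   (- 1) ^ mi_size I *\<^sub>R (LINT x|lebesgue_on D. \<phi> x *\<^sub>R g x)"
  by (intro tendsto_scaleR tendsto_const lim(2)[OF \<phi>])
 moreover have "(LINT x|lebesgue_on D. mi_partial I \<phi> x *\<^sub>R F n x) = (- 1) ^ mi_size I *\<^sub>R (LINT x|lebesgue_on D. \<phi> x *\<^sub>R G n x)" for n
  using w[of n] \<phi> unfolding is_weak_deriv_def by blast
 ultimately show "(LINT x|lebesgue_on D. mi_partial I \<phi> x *\<^sub>R f x) = (- 1) ^ mi_size I *\<^sub>R (LINT x|lebesgue_on D. \<phi> x *\<^sub>R g x)"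
  using LIMSEQ_unique[OF lim(1)[OF test_fun_mi_partial[OF \<phi>]]] by simp
qed

lemma locally_integrable_mult:
 fixes f g :: "real^'d::finite => real"
 assumes D: "open D" and l: "locally_integrable D f" "locally_integrable D g" and B: "AE x in lebesgue_on D. \<bar>f x\<bar> \<le> B"
 shows "locally_integrable D (\<lambda>x. f x * g x)"
 unfolding locally_integrable_def
proof (intro allI impI)
 fix K assume K: "compact K \<and> K \<subseteq> D"
 have f: "integrable (lebesgue_on K) f" and g: "integrable (lebesgue_on K) g" using l K by (auto simp: locally_integrable_def)
 have Kl: "K \<inter> space lebesgue \<in> sets lebesgue" using K by (simp add: borel_compact)
 have "AE x in lborel. x \<in> D --> \<bar>f x\<bar> \<le> B" using B unfolding AE_lebesgue_on_open[OF D] .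
 then have "AE x in lebesgue. x \<in> D --> \<bar>f x\<bar> \<le> B" by (rule AE_completion)
 then have "AE x in lebesgue. x \<in> K --> \<bar>f x\<bar> \<le> B" by eventually_elim (use K in auto)
 then have b: "AE x in lebesgue_on K. \<bar>f x\<bar> \<le> B" using AE_restrict_space_iff[OF Kl] by blast
 show "integrable (lebesgue_on K) (\<lambda>x. f x * g x)"
 proof (rule Bochner_Integration.integrable_bound[where f = "\<lambda>x. B * g x"])
  show "(\<lambda>x. f x * g x) \<in> borel_measurable (lebesgue_on K)"
   using borel_measurable_integrable[OF f] borel_measurable_integrable[OF g] by (rule borel_measurable_times)
  show "AE x in lebesgue_on K. norm (f x * g x) \<le> norm (B * g x)"
   using b by eventually_elim (auto simp: abs_mult intro!: mult_right_mono)
 qed (use g in simp)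
qed

text \<open>\<open>continuous_correlation\<close> wants a bound at every point, so the Borel
  representative is cut off where it exceeds the essential bound.\<close>

lemma locally_integrable_bounded_borel:
 fixes f :: "real^'d::finite => real"
 assumes f: "locally_integrable D f" and D: "open D" and K: "compact K" "K \<subseteq> D" and B: "AE x in lebesgue_on D. \<bar>f x\<bar> \<le> B"
 shows "\<exists>F. integrable lborel F \<and> (\<forall>x. \<bar>F x\<bar> \<le> \<bar>B\<bar>) \<and> (AE x in lborel. x \<in> K --> F x = f x) \<and>
  (\<forall>\<psi>. \<psi> \<in> borel_measurable borel --> (\<forall>x. x \<notin> K --> \<psi> x = 0) -->
    (LINT x|lebesgue_on D. \<psi> x * f x) = (LINT x|lborel. \<psi> x * F x))"
proof -
 obtain F where F: "integrable lborel F" "!!x. x \<notin> K ==> F x = 0" "AE x in lborel. x \<in> K --> F x = f x"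
  "!!\<psi>. \<psi> \<in> borel_measurable borel ==> (!!x. x \<notin> K ==> \<psi> x = 0) ==>
    (LINT x|lebesgue_on D. \<psi> x * f x) = (LINT x|lborel. \<psi> x * F x)"
  using locally_integrable_borel[OF f D K] by auto
 have "AE x in lborel. x \<in> D --> \<bar>f x\<bar> \<le> B" using B unfolding AE_lebesgue_on_open[OF D] .
 with F(3) have ae: "AE x in lborel. \<bar>F x\<bar> \<le> \<bar>B\<bar>"
 proof eventually_elim
  case (elim x)
  then show ?case using F(2)[of x] K(2) by (cases "x \<in> K") auto
 qed
 define G where "G x = (if \<bar>F x\<bar> \<le> \<bar>B\<bar> then F x else 0)" for x
 have Fm: "F \<in> borel_measurable borel" using borel_measurable_integrable[OF F(1)] by simp
 then have Gm: "G \<in> borel_measurable borel" unfolding G_def by measurable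
 have FG: "AE x in lborel. F x = G x" using ae by eventually_elim (simp add: G_def)
 show ?thesis
 proof (intro exI[of _ G] conjI allI impI)
  show "integrable lborel G" using F(1) by (rule Bochner_Integration.integrable_bound) (use Gm in \<open>auto simp: G_def\<close>)
  show "\<bar>G x\<bar> \<le> \<bar>B\<bar>" for x by (simp add: G_def)
  show "AE x in lborel. x \<in> K --> G x = f x" using F(3) FG by eventually_elim simp
  fix \<psi> :: "real^'d => real" assume \<psi>: "\<psi> \<in> borel_measurable borel" "\<forall>x. x \<notin> K --> \<psi> x = 0"
  have "(LINT x|lborel. \<psi> x * F x) = (LINT x|lborel. \<psi> x * G x)"
  proof (rule integral_cong_AE)
   show "AE x in lborel. \<psi> x * F x = \<psi> x * G x" using FG by eventually_elim simp
  qed (use \<psi>(1) Fm Gm in auto)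
  then show "(LINT x|lebesgue_on D. \<psi> x * f x) = (LINT x|lborel. \<psi> x * G x)" using F(4)[OF \<psi>(1)] \<psi>(2) by simp
 qed
qed

lemma is_weak_deriv_axisD:
 fixes f g :: "real^'d::finite => real"
 assumes "is_weak_deriv D (axis i 1) f g" "test_fun D \<phi>"
 shows "(LINT x|lebesgue_on D. partial i \<phi> x * f x) = - (LINT x|lebesgue_on D. \<phi> x * g x)"
proof -
 have "(LINT x|lebesgue_on D. mi_partial (axis i 1) \<phi> x *\<^sub>R f x) =
  (- 1) ^ mi_size (axis i (1::nat)) *\<^sub>R (LINT x|lebesgue_on D. \<phi> x *\<^sub>R g x)"
  using assms unfolding is_weak_deriv_def by blast
 then show ?thesis unfolding mi_size_axis mi_partial_axis[OF test_fun_smooth[OF assms(2)]] by simp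
qed

lemma is_weak_deriv_axisI:
 fixes f g :: "real^'d::finite => real"
 assumes "locally_integrable D f" "locally_integrable D g"
  "!!\<phi>. test_fun D \<phi> ==> (LINT x|lebesgue_on D. partial i \<phi> x * f x) = - (LINT x|lebesgue_on D. \<phi> x * g x)"
 shows "is_weak_deriv D (axis i 1) f g"
 unfolding is_weak_deriv_def mi_size_axis
proof (intro conjI allI impI assms(1,2))
 fix \<phi> assume \<phi>: "test_fun D \<phi>"
 show "(LINT x|lebesgue_on D. mi_partial (axis i 1) \<phi> x *\<^sub>R f x) = (- 1) ^ 1 *\<^sub>R (LINT x|lebesgue_on D. \<phi> x *\<^sub>R g x)"
  unfolding mi_partial_axis[OF test_fun_smooth[OF \<phi>]] using assms(3)[OF \<phi>] by simp
qed

text \<open>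
 For \<open>E\<close> small the kernel \<open>bump E (x - z)\<close> is a test function in each variable, and
 \<open>(\<partial>\<^sub>x + \<partial>\<^sub>z) (bump E (x - z) \<phi> z) = bump E (x - z) \<partial> \<phi> z\<close>. Integrating against \<open>f x * g z\<close>
 gives the product rule up to an error that vanishes with \<open>E\<close>.
\<close>

lemma is_weak_deriv_mult:
 fixes f g :: "real^'d::finite => real"
 assumes D: "open D" and wf: "is_weak_deriv D (axis i 1) f f1" and wg: "is_weak_deriv D (axis i 1) g g1"
  and B: "AE x in lebesgue_on D. \<bar>f x\<bar> \<le> B" and B1: "AE x in lebesgue_on D. \<bar>f1 x\<bar> \<le> B1"
 shows "is_weak_deriv D (axis i 1) (\<lambda>x. f x * g x) (\<lambda>x. f1 x * g x + f x * g1 x)"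
proof (rule is_weak_deriv_axisI)
 have l: "locally_integrable D f" "locally_integrable D f1" "locally_integrable D g" "locally_integrable D g1"
  using wf wg by (auto simp: is_weak_deriv_def)
 show lfg: "locally_integrable D (\<lambda>x. f x * g x)" by (rule locally_integrable_mult[OF D l(1,3) B])
 show lfg1: "locally_integrable D (\<lambda>x. f1 x * g x + f x * g1 x)"
  by (rule locally_integrable_add[OF locally_integrable_mult[OF D l(2,3) B1] locally_integrable_mult[OF D l(1,4) B]])
 fix \<phi> assume \<phi>: "test_fun D \<phi>"
 obtain K where K: "compact K" "K \<subseteq> D" "!!x. x \<notin> K ==> \<phi> x = 0" using test_funE[OF \<phi>] by blast
 obtain e L where L: "e > 0" "compact L" "L \<subseteq> D" "K \<subseteq> L" "!!x. x \<in> K ==> cball x e \<subseteq> L"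
  using compact_neighbourhood[OF K(1) D K(2)] by blast
 have \<phi>L: "\<phi> x = 0" if "x \<notin> L" for x using K(3) L(4) that by blast
 have d\<phi>L: "partial i \<phi> x = 0" if "x \<notin> L" for x
  using partial_zero_outside[OF compact_imp_closed[OF L(2)] \<phi>L that] .
 have \<phi>m: "\<phi> \<in> borel_measurable borel" "partial i \<phi> \<in> borel_measurable borel"
  using test_fun_borel[OF \<phi>] test_fun_borel[OF test_fun_partial[OF \<phi>]] by auto
 obtain C where C: "!!x. \<bar>\<phi> x\<bar> \<le> C" using test_fun_bounded[OF \<phi>] by blast
 obtain C1 where C1: "!!x. \<bar>partial i \<phi> x\<bar> \<le> C1" using test_fun_bounded[OF test_fun_partial[OF \<phi>]] by blast
 obtain F where F: "integrable lborel F" "!!x. \<bar>F x\<bar> \<le> \<bar>B\<bar>" "AE x in lborel. x \<in> L --> F x = f x"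
  "!!\<psi>. \<psi> \<in> borel_measurable borel ==> \<forall>x. x \<notin> L --> \<psi> x = 0 ==>
    (LINT x|lebesgue_on D. \<psi> x * f x) = (LINT x|lborel. \<psi> x * F x)"
  using locally_integrable_bounded_borel[OF l(1) D L(2,3) B] by auto
 obtain F1 where F1: "integrable lborel F1" "!!x. \<bar>F1 x\<bar> \<le> \<bar>B1\<bar>" "AE x in lborel. x \<in> L --> F1 x = f1 x"
  "!!\<psi>. \<psi> \<in> borel_measurable borel ==> \<forall>x. x \<notin> L --> \<psi> x = 0 ==>
    (LINT x|lebesgue_on D. \<psi> x * f1 x) = (LINT x|lborel. \<psi> x * F1 x)"
  using locally_integrable_bounded_borel[OF l(2) D L(2,3) B1] by auto
 obtain G where G: "integrable lborel G" "AE x in lborel. x \<in> L --> G x = g x"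
  "!!\<psi>. \<psi> \<in> borel_measurable borel ==> \<forall>x. x \<notin> L --> \<psi> x = 0 ==>
    (LINT x|lebesgue_on D. \<psi> x * g x) = (LINT x|lborel. \<psi> x * G x)"
  using locally_integrable_borel[OF l(3) D L(2,3)] by auto
 obtain G1 where G1: "integrable lborel G1" "AE x in lborel. x \<in> L --> G1 x = g1 x"
  "!!\<psi>. \<psi> \<in> borel_measurable borel ==> \<forall>x. x \<notin> L --> \<psi> x = 0 ==>
    (LINT x|lebesgue_on D. \<psi> x * g1 x) = (LINT x|lborel. \<psi> x * G1 x)"
  using locally_integrable_borel[OF l(4) D L(2,3)] by auto
 have m[measurable]: "F \<in> borel_measurable borel" "F1 \<in> borel_measurable borel" "G \<in> borel_measurable borel" "G1 \<in> borel_measurable borel"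
  using F(1) F1(1) G(1) G1(1) by (auto dest: borel_measurable_integrable)
 note [measurable] = \<phi>m
 have im: "integrable lborel (\<lambda>z. \<psi> z * H z)"
  if "\<psi> \<in> borel_measurable borel" "!!x. \<bar>\<psi> x\<bar> \<le> c" "integrable lborel H" for \<psi> H :: "real^'d => real" and c
 proof (rule Bochner_Integration.integrable_bound[where f = "\<lambda>z. c * H z"])
  show "(\<lambda>z. \<psi> z * H z) \<in> borel_measurable lborel" using that(1) borel_measurable_integrable[OF that(3)] by simp
  show "AE z in lborel. norm (\<psi> z * H z) \<le> norm (c * H z)"
  proof (rule AE_I2)
   fix z have "\<bar>\<psi> z\<bar> \<le> \<bar>c\<bar>" using that(2)[of z] by simp
   then show "norm (\<psi> z * H z) \<le> norm (c * H z)" by (simp add: abs_mult mult_right_mono)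
  qed
 qed (use that(3) in simp)
 define H1 where "H1 z = partial i \<phi> z * G z" for z
 define H2 where "H2 z = \<phi> z * G1 z" for z
 define H3 where "H3 z = \<phi> z * G z" for z
 have H: "integrable lborel H1" "integrable lborel H2" "integrable lborel H3"
  unfolding H1_def H2_def H3_def by (rule im[OF \<phi>m(2) C1 G(1)] im[OF \<phi>m(1) C G1(1)] im[OF \<phi>m(1) C G(1)])+
 \<comment> \<open>At w = 0 this is the integral of f g \<partial>\<phi> + f g1 \<phi> + f1 g
   \<phi>, so that \<open>?P 0 = 0\<close> is the product rule.\<close>
 let ?P = "\<lambda>w. (LINT z|lborel. F (z + w) * H1 z) + (LINT z|lborel. F (z + w) * H2 z) + (LINT z|lborel. F1 (z + w) * H3 z)"
 have "?P 0 = 0"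
 proof (rule bump_concentration[OF L(1), where P = ?P])
  show "continuous (at 0) ?P"
   by (intro continuous_add continuous_correlation[OF m(1) F(2)] continuous_correlation[OF m(2) F1(2)] H)
  fix E :: real assume e: "0 < E" "E < e"
  note bi = bump_integral_pos(1)[OF e(1), where 'd = 'd]
  note c1 = double_integral_correlation[OF F(1,2) H(1) bi bump_abs_le]
  note c2 = double_integral_correlation[OF F(1,2) H(2) bi bump_abs_le]
  note c3 = double_integral_correlation[OF F1(1,2) H(3) bi bump_abs_le]
  show "integrable lborel (\<lambda>w. bump E w * ?P w)"
   unfolding distrib_left by (intro Bochner_Integration.integrable_add c1(1) c2(1) c3(1))
  have eq: "(LINT w|lborel. bump E w * ?P w) = (LINT z|lborel. (LINT x|lborel. F x * bump E (x - z) * H1 z)) +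
   (LINT z|lborel. (LINT x|lborel. F x * bump E (x - z) * H2 z)) + (LINT z|lborel. (LINT x|lborel. F1 x * bump E (x - z) * H3 z))"
   unfolding c1(2) c2(2) c3(2) distrib_left
   by (simp only: Bochner_Integration.integral_add Bochner_Integration.integrable_add c1(1) c2(1) c3(1))
  let ?b = "bump E :: real^'d => real" and ?d = "partial i (bump E :: real^'d => real)"
  have tb: "test_fun UNIV ?b"
   by (rule test_funI[of _ "cball 0 E"]) (use e in \<open>auto intro: smooth_bump bump_zero\<close>)
  obtain M where M: "!!w. \<bar>?d w\<bar> \<le> M" using test_fun_bounded[OF test_fun_partial[OF tb]] by blast
  have bm[measurable]: "?b \<in> borel_measurable borel" "?d \<in> borel_measurable borel"
   using test_fun_borel[OF tb] test_fun_borel[OF test_fun_partial[OF tb]] by auto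
  have dk: "(\<lambda>(x, z). ?d (x - z)) \<in> borel_measurable (borel \<Otimes>\<^sub>M borel)" by measurable
  \<comment> \<open>The weak derivative of f, tested in x with the bump around z.\<close>
  have A1: "(LINT x|lborel. F x * ?d (x - z) * H3 z) = - (LINT x|lborel. F1 x * ?b (x - z) * H3 z)" for z
  proof (cases "z \<in> K")
   case True
   have c: "cball z E \<subseteq> L" using L(5)[OF True] e by (auto simp: subset_iff)
   then have t: "test_fun D (\<lambda>x. ?b (x - z))" using L(3) by (intro test_fun_bump_shift e) auto
   have z0: "?b (x - z) = 0" if "x \<notin> cball z E" for x
    by (rule bump_zero[OF e(1)]) (use that in \<open>simp add: dist_norm norm_minus_commute\<close>)
   have pz: "partial i (\<lambda>x. ?b (x - z)) = (\<lambda>x. ?d (x - z))" by (rule ext) (rule partial_bump_shift)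
   have d0: "?d (x - z) = 0" if "x \<notin> cball z E" for x
    using partial_zero_outside[of "cball z E" "\<lambda>x. ?b (x - z)" x i] z0 that by (simp add: partial_bump_shift)
   have "(LINT x|lborel. ?d (x - z) * F x) = (LINT x|lebesgue_on D. ?d (x - z) * f x)"
   proof (rule F(4)[symmetric])
    show "\<forall>x. x \<notin> L --> ?d (x - z) = 0" using d0 c by blast
   qed measurable
   also have "\<dots> = - (LINT x|lebesgue_on D. ?b (x - z) * f1 x)"
    using is_weak_deriv_axisD[OF wf t] unfolding pz .
   also have "(LINT x|lebesgue_on D. ?b (x - z) * f1 x) = (LINT x|lborel. ?b (x - z) * F1 x)"
   proof (rule F1(4))
    show "\<forall>x. x \<notin> L --> ?b (x - z) = 0" using z0 c by blast
   qed measurable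
   finally show ?thesis by (simp add: mult.commute[of "F _"] mult.commute[of "F1 _"])
  qed (simp add: H3_def K)
  \<comment> \<open>The weak derivative of g, tested in z with bump times \<phi>. Both identities
    contain the same double integral of the differentiated kernel, once in each order of
    integration, and Fubini eliminates it.\<close>
  have A2: "(LINT z|lborel. F x * ?d (x - z) * H3 z) =
    (LINT z|lborel. F x * ?b (x - z) * H1 z) + (LINT z|lborel. F x * ?b (x - z) * H2 z)" for x
  proof -
   let ?\<psi> = "\<lambda>z. ?b (x - z) * \<phi> z"
   have t: "test_fun D ?\<psi>" by (intro test_fun_smooth_mult smooth_bump_shift \<phi>)
   have p: "partial i ?\<psi> z = - ?d (x - z) * \<phi> z + ?b (x - z) * partial i \<phi> z" for z
    unfolding partial_bump_shift(1)[symmetric]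
    by (rule partial_mult[OF smooth_differentiable[OF smooth_bump_shift(1)] smooth_differentiable[OF test_fun_smooth[OF \<phi>]]])
   have "(LINT z|lborel. partial i ?\<psi> z * G z) = (LINT z|lebesgue_on D. partial i ?\<psi> z * g z)"
    by (rule G(3)[symmetric]) (use \<phi>L d\<phi>L p in \<open>auto intro: test_fun_borel[OF test_fun_partial[OF t]]\<close>)
   also have "\<dots> = - (LINT z|lebesgue_on D. ?\<psi> z * g1 z)" by (rule is_weak_deriv_axisD[OF wg t])
   also have "(LINT z|lebesgue_on D. ?\<psi> z * g1 z) = (LINT z|lborel. ?\<psi> z * G1 z)"
    by (rule G1(3)) (use \<phi>L in \<open>auto intro: test_fun_borel[OF t]\<close>)
   finally have "(LINT z|lborel. ?b (x - z) * H1 z - ?d (x - z) * H3 z) = - (LINT z|lborel. ?b (x - z) * H2 z)"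
    unfolding p H1_def H2_def H3_def by (simp add: algebra_simps)
   moreover have "integrable lborel (\<lambda>z. ?b (x - z) * H1 z)" "integrable lborel (\<lambda>z. ?d (x - z) * H3 z)"
    by (rule im[OF _ bump_abs_le H(1)] im[OF _ M H(3)]; measurable)+
   ultimately have "(LINT z|lborel. ?d (x - z) * H3 z) =
    (LINT z|lborel. ?b (x - z) * H1 z) + (LINT z|lborel. ?b (x - z) * H2 z)" by simp
   then show ?thesis by (simp add: mult.assoc distrib_left)
  qed
  note k1 = double_integral_kernel[OF F(1) H(1) bump_shift_borel[of E] bump_abs_le]
  note k2 = double_integral_kernel[OF F(1) H(2) bump_shift_borel[of E] bump_abs_le]
  note k3 = double_integral_kernel[OF F(1) H(3) dk M]
  have "(LINT z|lborel. (LINT x|lborel. F1 x * ?b (x - z) * H3 z)) = - (LINT z|lborel. (LINT x|lborel. F x * ?d (x - z) * H3 z))"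
   unfolding A1 by simp
  also have "\<dots> = - (LINT x|lborel. (LINT z|lborel. F x * ?d (x - z) * H3 z))" unfolding k3(2) ..
  also have "\<dots> = - ((LINT x|lborel. (LINT z|lborel. F x * ?b (x - z) * H1 z)) + (LINT x|lborel. (LINT z|lborel. F x * ?b (x - z) * H2 z)))"
   unfolding A2 using lborel_pair.integrable_fst'[OF k1(1)] lborel_pair.integrable_fst'[OF k2(1)] by simp
  finally show "(LINT w|lborel. bump E w * ?P w) = 0" unfolding eq k1(2) k2(2) by simp
 qed
 then have P0: "(LINT z|lborel. F z * H1 z) + (LINT z|lborel. F z * H2 z) + (LINT z|lborel. F1 z * H3 z) = 0" by simp
 have iF: "integrable lborel (\<lambda>z. F z * H1 z)" "integrable lborel (\<lambda>z. F z * H2 z)" "integrable lborel (\<lambda>z. F1 z * H3 z)"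
  by (rule im[OF m(1) F(2) H(1)] im[OF m(1) F(2) H(2)] im[OF m(2) F1(2) H(3)])+
 obtain Q where Q: "integrable lborel Q" "AE x in lborel. x \<in> L --> Q x = f x * g x"
  "!!\<psi>. \<psi> \<in> borel_measurable borel ==> \<forall>x. x \<notin> L --> \<psi> x = 0 ==>
    (LINT x|lebesgue_on D. \<psi> x * (f x * g x)) = (LINT x|lborel. \<psi> x * Q x)"
  using locally_integrable_borel[OF lfg D L(2,3)] by auto
 obtain Q1 where Q1: "integrable lborel Q1" "AE x in lborel. x \<in> L --> Q1 x = f1 x * g x + f x * g1 x"
  "!!\<psi>. \<psi> \<in> borel_measurable borel ==> \<forall>x. x \<notin> L --> \<psi> x = 0 ==>
    (LINT x|lebesgue_on D. \<psi> x * (f1 x * g x + f x * g1 x)) = (LINT x|lborel. \<psi> x * Q1 x)"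
  using locally_integrable_borel[OF lfg1 D L(2,3)] by auto
 have Qm[measurable]: "Q \<in> borel_measurable borel" "Q1 \<in> borel_measurable borel"
  using Q(1) Q1(1) by (auto dest: borel_measurable_integrable)
 have "(LINT x|lebesgue_on D. partial i \<phi> x * (f x * g x)) = (LINT x|lborel. partial i \<phi> x * Q x)"
  by (rule Q(3)[OF \<phi>m(2)]) (use d\<phi>L in blast)
 also have "\<dots> = (LINT z|lborel. F z * H1 z)"
 proof (rule integral_cong_AE)
  show "AE x in lborel. partial i \<phi> x * Q x = F x * H1 x"
   using Q(2) F(3) G(2)
  proof eventually_elim
   case (elim x)
   then show ?case by (cases "x \<in> L") (auto simp: H1_def d\<phi>L)
  qed
 qed (use iF in auto)
 also have "\<dots> = - ((LINT z|lborel. F z * H2 z) + (LINT z|lborel. F1 z * H3 z))" using P0 by linarith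
 also have "(LINT z|lborel. F z * H2 z) + (LINT z|lborel. F1 z * H3 z) = (LINT z|lborel. F z * H2 z + F1 z * H3 z)"
  using iF by simp
 also have "\<dots> = (LINT x|lborel. \<phi> x * Q1 x)"
 proof (rule integral_cong_AE)
  show "AE x in lborel. F x * H2 x + F1 x * H3 x = \<phi> x * Q1 x"
   using Q1(2) F(3) G(2) F1(3) G1(2)
  proof eventually_elim
   case (elim x)
   then show ?case by (cases "x \<in> L") (auto simp: H2_def H3_def \<phi>L algebra_simps)
  qed
 qed (use iF in auto)
 also have "\<dots> = (LINT x|lebesgue_on D. \<phi> x * (f1 x * g x + f x * g1 x))"
  by (rule Q1(3)[OF \<phi>m(1), symmetric]) (use \<phi>L in blast)
 finally show "(LINT x|lebesgue_on D. partial i \<phi> x * (f x * g x)) = - (LINT x|lebesgue_on D. \<phi> x * (f1 x * g x + f x * g1 x))" .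
qed

lemma is_weak_deriv_test_fun:
 fixes \<phi> :: "real^'d::finite => real"
 assumes D: "open D" and \<phi>: "test_fun D \<phi>"
 shows "is_weak_deriv D (axis i 1) \<phi> (partial i \<phi>)"
proof (rule is_weak_deriv_axisI)
 have il: "integrable lebesgue \<psi>" and l: "locally_integrable D \<psi>" if "test_fun D \<psi>" for \<psi>
 proof -
  show il: "integrable lebesgue \<psi>"
   using integrable_completion[of \<psi> lborel] test_fun_borel[OF that] test_fun_integrable[OF that] by simp
  show "locally_integrable D \<psi>"
  proof (rule locally_integrableI)
   fix K assume "compact K" "K \<subseteq> D"
   then show "integrable lebesgue (\<lambda>x. indicator K x *\<^sub>R \<psi> x)"
    by (intro integrable_mult_indicator il) (simp add: borel_compact)
  qed
 qed
 show "locally_integrable D \<phi>" "locally_integrable D (partial i \<phi>)"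
  by (intro l \<phi> test_fun_partial)+
 have D_eq: "(LINT x|lebesgue_on D. \<psi> x) = (LINT x|lborel. \<psi> x)" if \<psi>: "test_fun D \<psi>" for \<psi>
 proof -
  obtain K where K: "compact K" "K \<subseteq> D" "!!x. x \<notin> K ==> \<psi> x = 0" using test_funE[OF \<psi>] by blast
  have "(LINT x|lebesgue_on D. \<psi> x) = (LINT x|lebesgue. \<psi> x)" unfolding lebesgue_on_open_integral(2)[OF D]
  proof (rule Bochner_Integration.integral_cong)
   fix x show "indicator D x *\<^sub>R \<psi> x = \<psi> x" using K(2) K(3)[of x] by (cases "x \<in> D") auto
  qed simp
  also have "\<dots> = (LINT x|lborel. \<psi> x)" using test_fun_borel[OF \<psi>] by (intro integral_completion) simp
  finally show ?thesis .
 qed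
 fix \<psi> assume \<psi>: "test_fun D \<psi>"
 have t: "test_fun D (\<lambda>x. partial i \<psi> x * \<phi> x)" "test_fun D (\<lambda>x. \<psi> x * partial i \<phi> x)" "test_fun D (\<lambda>x. \<psi> x * \<phi> x)"
  using \<phi> \<psi> by (auto intro!: test_fun_smooth_mult test_fun_partial test_fun_smooth[of D] smooth_partial)
 have "partial i (\<lambda>x. \<psi> x * \<phi> x) = (\<lambda>x. partial i \<psi> x * \<phi> x + \<psi> x * partial i \<phi> x)"
  by (rule ext) (intro partial_mult smooth_differentiable test_fun_smooth[OF \<phi>] test_fun_smooth[OF \<psi>])
 then have "(LINT x|lborel. partial i \<psi> x * \<phi> x + \<psi> x * partial i \<phi> x) = 0"
  using integral_partial_test_fun[OF t(3), of i] by simp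
 then show "(LINT x|lebesgue_on D. partial i \<psi> x * \<phi> x) = - (LINT x|lebesgue_on D. \<psi> x * partial i \<phi> x)"
  unfolding D_eq[OF t(1)] D_eq[OF t(2)] using t(1,2)[THEN test_fun_integrable] by simp
qed

lemma integral_test_fun_lebesgue_on:
 fixes \<psi> :: "real^'d::finite => real"
 assumes D: "open D" and \<psi>: "test_fun D \<psi>"
 shows "(LINT x|lebesgue_on D. \<psi> x) = (LINT x|lborel. \<psi> x)"
proof -
 obtain K where K: "compact K" "K \<subseteq> D" "!!x. x \<notin> K ==> \<psi> x = 0" using test_funE[OF \<psi>] by blast
 have "(LINT x|lebesgue_on D. \<psi> x) = (LINT x|lebesgue. \<psi> x)" unfolding lebesgue_on_open_integral(2)[OF D]
 proof (rule Bochner_Integration.integral_cong)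
  fix x show "indicator D x *\<^sub>R \<psi> x = \<psi> x" using K(2) K(3)[of x] by (cases "x \<in> D") auto
 qed simp
 also have "\<dots> = (LINT x|lborel. \<psi> x)" using test_fun_borel[OF \<psi>] by (intro integral_completion) simp
 finally show ?thesis .
qed

lemma AE_lebesgue_on_subset:
 assumes D: "open D" and K: "compact K" "K \<subseteq> D" and ae: "AE x in lebesgue_on D. P x"
 shows "AE x in lebesgue_on K. P x"
proof -
 have Kl: "K \<inter> space lebesgue \<in> sets lebesgue" using K by (simp add: borel_compact)
 have "AE x in lborel. x \<in> D --> P x" using ae unfolding AE_lebesgue_on_open[OF D] .
 then have "AE x in lebesgue. x \<in> D --> P x" by (rule AE_completion)
 then have "AE x in lebesgue. x \<in> K --> P x" by eventually_elim (use K in auto)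
 then show ?thesis using AE_restrict_space_iff[OF Kl] by blast
qed

lemma integrable_const_compact:
 "compact K ==> integrable (lebesgue_on K) (\<lambda>x::'a::euclidean_space. c::real)"
 by (intro finite_measure.integrable_const finite_measure_lebesgue_on) (simp add: lmeasurable_compact)

lemma locally_integrable_bounded:
 fixes f :: "real^'d::finite => real"
 assumes D: "open D" and m: "!!K. compact K ==> K \<subseteq> D ==> f \<in> borel_measurable (lebesgue_on K)"
  and B: "AE x in lebesgue_on D. \<bar>f x\<bar> \<le> B"
 shows "locally_integrable D f"
 unfolding locally_integrable_def
proof (intro allI impI)
 fix K assume K: "compact K \<and> K \<subseteq> D"
 show "integrable (lebesgue_on K) f"
 proof (rule Bochner_Integration.integrable_bound[OF integrable_const_compact])
  show "compact K" "f \<in> borel_measurable (lebesgue_on K)" using K m by auto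
  have "AE x in lebesgue_on K. \<bar>f x\<bar> \<le> B" using AE_lebesgue_on_subset[OF D _ _ B] K by blast
  then show "AE x in lebesgue_on K. norm (f x) \<le> norm B" by eventually_elim auto
 qed
qed

lemma is_weak_deriv_const:
 assumes D: "open D"
 shows "is_weak_deriv D (axis i 1) (\<lambda>x::real^'d::finite. c::real) (\<lambda>x. 0)"
proof (rule is_weak_deriv_axisI)
 show "locally_integrable D (\<lambda>x::real^'d. c)"
  by (rule locally_integrable_bounded[OF D, where B = "\<bar>c\<bar>"]) auto
 fix \<phi> assume \<phi>: "test_fun D \<phi>"
 show "(LINT x|lebesgue_on D. partial i \<phi> x * c) = - (LINT x|lebesgue_on D. \<phi> x * 0)"
  using integral_test_fun_lebesgue_on[OF D test_fun_partial[OF \<phi>], of i] integral_partial_test_fun[OF \<phi>, of i] by simp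
qed (rule locally_integrable_zero)

section \<open>The chain rule for weak derivatives\<close>

lemma is_weak_deriv_pow:
 fixes s :: "real^'d::finite => real"
 assumes D: "open D" and w: "is_weak_deriv D (axis i 1) s s1"
  and B: "AE x in lebesgue_on D. \<bar>s x\<bar> \<le> B" and B1: "AE x in lebesgue_on D. \<bar>s1 x\<bar> \<le> B1"
 shows "is_weak_deriv D (axis i 1) (\<lambda>x. s x ^ Suc k) (\<lambda>x. real (Suc k) * s x ^ k * s1 x)"
proof (induction k)
 case 0
 then show ?case using w by simp
next
 case (Suc k)
 from is_weak_deriv_mult[OF D w Suc B B1] show ?case by (simp add: algebra_simps)
qed

lemma integral_test_uniform_limit:
 fixes f :: "real^'d::finite => real"
 assumes D: "open D" and l: "locally_integrable D f" "!!n. locally_integrable D (F n)"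
  and c: "c \<longlonglongrightarrow> 0" and ae: "!!n. AE x in lebesgue_on D. \<bar>F n x - f x\<bar> \<le> c n" and \<psi>: "test_fun D \<psi>"
 shows "(\<lambda>n. LINT x|lebesgue_on D. \<psi> x *\<^sub>R F n x) \<longlonglongrightarrow> (LINT x|lebesgue_on D. \<psi> x *\<^sub>R f x)"
proof -
 have one: "locally_integrable D (\<lambda>x::real^'d. 1::real)"
  by (rule locally_integrable_bounded[OF D, where B = 1]) auto
 have i1: "integrable (lebesgue_on D) \<psi>" using integrable_test_times[OF D one \<psi>] by simp
 note i = integrable_test_times[OF D l(1) \<psi>] and iF = integrable_test_times[OF D l(2) \<psi>]
 have "(\<lambda>n. (LINT x|lebesgue_on D. \<psi> x *\<^sub>R F n x) - (LINT x|lebesgue_on D. \<psi> x *\<^sub>R f x)) \<longlonglongrightarrow> 0"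
 proof (rule Lim_null_comparison)
  from tendsto_mult[OF c tendsto_const[of "\<integral>x. \<bar>\<psi> x\<bar> \<partial>lebesgue_on D"]]
  show "(\<lambda>n. c n * (LINT x|lebesgue_on D. \<bar>\<psi> x\<bar>)) \<longlonglongrightarrow> 0" by simp
  show "\<forall>\<^sub>F n in sequentially. norm ((LINT x|lebesgue_on D. \<psi> x *\<^sub>R F n x) - (LINT x|lebesgue_on D. \<psi> x *\<^sub>R f x))
    \<le> c n * (LINT x|lebesgue_on D. \<bar>\<psi> x\<bar>)"
  proof (intro always_eventually allI)
   fix n
   have "(LINT x|lebesgue_on D. \<psi> x *\<^sub>R F n x) - (LINT x|lebesgue_on D. \<psi> x *\<^sub>R f x) =
    (LINT x|lebesgue_on D. \<psi> x *\<^sub>R F n x - \<psi> x *\<^sub>R f x)" using i iF by simp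
   also have "norm \<dots> \<le> (LINT x|lebesgue_on D. norm (\<psi> x *\<^sub>R F n x - \<psi> x *\<^sub>R f x))" by (rule integral_norm_bound)
   also have "\<dots> \<le> (LINT x|lebesgue_on D. c n * \<bar>\<psi> x\<bar>)"
   proof (rule integral_mono_AE)
    show "AE x in lebesgue_on D. norm (\<psi> x *\<^sub>R F n x - \<psi> x *\<^sub>R f x) \<le> c n * \<bar>\<psi> x\<bar>"
     using ae[of n]
    proof eventually_elim
     case (elim x)
     have "norm (\<psi> x *\<^sub>R F n x - \<psi> x *\<^sub>R f x) = \<bar>\<psi> x\<bar> * \<bar>F n x - f x\<bar>"
      by (simp add: right_diff_distrib[symmetric] abs_mult)
     also have "\<dots> \<le> \<bar>\<psi> x\<bar> * c n" by (rule mult_left_mono[OF elim]) simp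
     finally show ?case by (simp add: mult.commute)
    qed
   qed (use i[THEN Bochner_Integration.integrable_diff[OF iF[of n]]] i1 in auto)
   also have "\<dots> = c n * (LINT x|lebesgue_on D. \<bar>\<psi> x\<bar>)" by simp
   finally show "norm ((LINT x|lebesgue_on D. \<psi> x *\<^sub>R F n x) - (LINT x|lebesgue_on D. \<psi> x *\<^sub>R f x))
    \<le> c n * (LINT x|lebesgue_on D. \<bar>\<psi> x\<bar>)" .
  qed
 qed
 then show ?thesis by (simp only: LIM_zero_iff)
qed

text \<open>For polynomials the chain rule follows from the product rule. In general F' is
  approximated uniformly on the range of s by polynomials; their antiderivatives approximate F
  uniformly, and the weak derivative passes to the limit.\<close>

lemma is_weak_deriv_chain:
 fixes s :: "real^'d::finite => real"
 assumes D: "open D" and w: "is_weak_deriv D (axis i 1) s s1"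
  and s: "AE x in lebesgue_on D. s x \<in> {A..M}" and B1: "AE x in lebesgue_on D. \<bar>s1 x\<bar> \<le> B1"
  and F: "!!t. t \<in> {A..M} ==> (F has_real_derivative F' t) (at t within {A..M})" "continuous_on {A..M} F'"
  and m: "F \<in> borel_measurable borel" "F' \<in> borel_measurable borel"
 shows "is_weak_deriv D (axis i 1) (\<lambda>x. F (s x)) (\<lambda>x. F' (s x) * s1 x)"
proof -
 have ls: "locally_integrable D s" "locally_integrable D s1" using w by (auto simp: is_weak_deriv_def)
 have ms: "s \<in> borel_measurable (lebesgue_on K)" if "compact K" "K \<subseteq> D" for K
  using ls(1) that unfolding locally_integrable_def by (blast intro: borel_measurable_integrable)
 have B: "AE x in lebesgue_on D. \<bar>s x\<bar> \<le> \<bar>A\<bar> + \<bar>M\<bar>" using s by eventually_elim auto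
 have cF: "continuous_on {A..M} F" using F(1) by (rule DERIV_continuous_on)
 have lb: "locally_integrable D (\<lambda>x. H (s x)) \<and> (\<exists>C. AE x in lebesgue_on D. \<bar>H (s x)\<bar> \<le> C)"
  if H: "continuous_on {A..M} H" "H \<in> borel_measurable borel" for H :: "real => real"
 proof -
  have "bounded (H ` {A..M})" by (intro compact_imp_bounded compact_continuous_image H(1) compact_Icc)
  then obtain C where C: "\<forall>t\<in>{A..M}. \<bar>H t\<bar> \<le> C" unfolding bounded_iff real_norm_def ball_simps by blast
  have ae: "AE x in lebesgue_on D. \<bar>H (s x)\<bar> \<le> C" using s by eventually_elim (rule C[rule_format])
  moreover have "locally_integrable D (\<lambda>x. H (s x))"
   by (rule locally_integrable_bounded[OF D measurable_compose[OF ms H(2)] ae])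
  ultimately show ?thesis by blast
 qed
 have l: "locally_integrable D (\<lambda>x. F (s x))" "locally_integrable D (\<lambda>x. F' (s x) * s1 x)"
  using lb[OF cF m(1)] lb[OF F(2) m(2)] locally_integrable_mult[OF D _ ls(2)] by blast+
 define B2 where "B2 = max B1 0"
 have B2: "AE x in lebesgue_on D. \<bar>s1 x\<bar> \<le> B2" using B1 by eventually_elim (simp add: B2_def)
 define \<Phi> where "\<Phi> E P p \<longleftrightarrow> is_weak_deriv D (axis i 1) (\<lambda>x. P (s x)) (\<lambda>x. p (s x) * s1 x) \<and>
  (\<forall>t\<in>{A..M}. \<bar>F t - P t\<bar> \<le> E * (M - A)) \<and> (\<forall>t\<in>{A..M}. \<bar>F' t - p t\<bar> \<le> E)" for E P p
 have "\<exists>P p. \<Phi> E P p" if E: "E > 0" for E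
 proof -
  obtain p where p: "real_polynomial_function p" "!!t. t \<in> {A..M} ==> \<bar>F' t - p t\<bar> < E"
   using Stone_Weierstrass_real_polynomial_function[OF compact_Icc F(2) E] by blast
  obtain a n where a: "p = (\<lambda>t. \<Sum>k\<le>n. a k * t ^ k)" using p(1) unfolding real_polynomial_function_iff_sum by blast
  define Q where "Q t = (\<Sum>k\<le>n. a k / real (Suc k) * t ^ Suc k)" for t
  \<comment> \<open>The constant makes P agree with F at A, so that the bound on F' - p integrates
    to a bound on F - P.\<close>
  define P where "P t = (F A - Q A) + Q t" for t
  have dP: "(P has_real_derivative p t) (at t within {A..M})" for t
   unfolding P_def Q_def a
   by (auto intro!: derivative_eq_intros sum.cong simp del: power_Suc of_nat_Suc)
  have "is_weak_deriv D (axis i 1) (\<lambda>x. (F A - Q A) + (\<Sum>k\<le>n. (a k / real (Suc k)) *\<^sub>R s x ^ Suc k))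
    (\<lambda>x. 0 + (\<Sum>k\<le>n. (a k / real (Suc k)) *\<^sub>R (real (Suc k) * s x ^ k * s1 x)))"
   by (intro is_weak_deriv_add[OF D] is_weak_deriv_const[OF D] is_weak_deriv_sum[OF D] is_weak_deriv_scaleR[OF D]
     is_weak_deriv_pow[OF D w B B1] finite_atMost)
  also have "(\<lambda>x. (F A - Q A) + (\<Sum>k\<le>n. (a k / real (Suc k)) *\<^sub>R s x ^ Suc k)) = (\<lambda>x. P (s x))"
   by (simp add: P_def Q_def)
  also have "(\<lambda>x. 0 + (\<Sum>k\<le>n. (a k / real (Suc k)) *\<^sub>R (real (Suc k) * s x ^ k * s1 x))) = (\<lambda>x. p (s x) * s1 x)"
   by (simp add: a sum_distrib_right mult.assoc del: of_nat_Suc)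
  finally have wP: "is_weak_deriv D (axis i 1) (\<lambda>x. P (s x)) (\<lambda>x. p (s x) * s1 x)" .
  have "\<bar>F t - P t\<bar> \<le> E * (M - A)" if t: "t \<in> {A..M}" for t
  proof -
   have "norm ((F t - P t) - (F A - P A)) \<le> E * norm (t - A)"
   proof (rule field_differentiable_bound[where S = "{A..M}" and f' = "\<lambda>t. F' t - p t"])
    show "((\<lambda>t. F t - P t) has_field_derivative F' t - p t) (at t within {A..M})" if "t \<in> {A..M}" for t
     by (intro derivative_intros F(1) that dP)
   qed (use p(2) t in \<open>auto intro: less_imp_le\<close>)
   also have "\<dots> \<le> E * (M - A)" using t E by (auto intro!: mult_left_mono)
   finally show ?thesis by (simp add: P_def)
  qed
  then show ?thesis using wP p(2) unfolding \<Phi>_def by (intro exI[of _ P] exI[of _ p]) (auto intro: less_imp_le)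
 qed
 then have "\<forall>n. \<exists>P p. \<Phi> (inverse (real (Suc n))) P p" by simp
 then obtain P p where Pp: "!!n. \<Phi> (inverse (real (Suc n))) (P n) (p n)" by metis
 then have P: "!!n. is_weak_deriv D (axis i 1) (\<lambda>x. P n (s x)) (\<lambda>x. p n (s x) * s1 x)"
  "!!n t. t \<in> {A..M} ==> \<bar>F t - P n t\<bar> \<le> inverse (real (Suc n)) * (M - A)"
  "!!n t. t \<in> {A..M} ==> \<bar>F' t - p n t\<bar> \<le> inverse (real (Suc n))"
  unfolding \<Phi>_def by blast+
 have lP: "locally_integrable D (\<lambda>x. P n (s x))" "locally_integrable D (\<lambda>x. p n (s x) * s1 x)" for n
  using P(1)[of n] by (auto simp: is_weak_deriv_def)
 show ?thesis
 proof (rule is_weak_deriv_limit[OF l P(1)])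
  fix \<psi> :: "real^'d => real" assume \<psi>: "test_fun D \<psi>"
  show "(\<lambda>n. LINT x|lebesgue_on D. \<psi> x *\<^sub>R P n (s x)) \<longlonglongrightarrow> (LINT x|lebesgue_on D. \<psi> x *\<^sub>R F (s x))"
  proof (rule integral_test_uniform_limit[OF D l(1) lP(1) _ _ \<psi>])
   show "(\<lambda>n. inverse (real (Suc n)) * (M - A)) \<longlonglongrightarrow> 0"
    using tendsto_mult[OF LIMSEQ_inverse_real_of_nat tendsto_const[of "M - A"]] by simp
   show "AE x in lebesgue_on D. \<bar>P n (s x) - F (s x)\<bar> \<le> inverse (real (Suc n)) * (M - A)" for n
    using s
   proof eventually_elim
    case (elim x)
    show ?case using P(2)[OF elim, of n] by (simp only: abs_minus_commute)
   qed
  qed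
  show "(\<lambda>n. LINT x|lebesgue_on D. \<psi> x *\<^sub>R (p n (s x) * s1 x)) \<longlonglongrightarrow> (LINT x|lebesgue_on D. \<psi> x *\<^sub>R (F' (s x) * s1 x))"
  proof (rule integral_test_uniform_limit[OF D l(2) lP(2) _ _ \<psi>])
   show "(\<lambda>n. inverse (real (Suc n)) * B2) \<longlonglongrightarrow> 0"
    using tendsto_mult[OF LIMSEQ_inverse_real_of_nat tendsto_const[of B2]] by simp
   show "AE x in lebesgue_on D. \<bar>p n (s x) * s1 x - F' (s x) * s1 x\<bar> \<le> inverse (real (Suc n)) * B2" for n
    using s B2
   proof eventually_elim
    case (elim x)
    have "\<bar>p n (s x) * s1 x - F' (s x) * s1 x\<bar> = \<bar>F' (s x) - p n (s x)\<bar> * \<bar>s1 x\<bar>"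
     by (simp add: left_diff_distrib[symmetric] abs_mult abs_minus_commute)
    also have "\<dots> \<le> inverse (real (Suc n)) * B2"
     using P(3)[OF elim(1), of n] elim(2) by (intro mult_mono) auto
    finally show ?case .
   qed
  qed
 qed
qed

section \<open>Sums over antidiagonals of multi-indices\<close>

definition antidiag :: "nat^'n::finite => ((nat^'n) \<times> (nat^'n)) set" where
 "antidiag J = {p. fst p + snd p = J}"

lemma finite_mi_bounded: "finite {I::nat^'n::finite. \<forall>i. I $ i \<le> n}"
proof -
 have "vec_nth ` {I::nat^'n. \<forall>i. I $ i \<le> n} \<subseteq> (UNIV::'n set) \<rightarrow>\<^sub>E {..n}" by auto
 then have "finite (vec_nth ` {I::nat^'n. \<forall>i. I $ i \<le> n})" by (rule finite_subset) (auto intro: finite_PiE)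
 then show ?thesis by (rule finite_imageD) (auto intro: inj_onI simp: vec_nth_inject)
qed

lemma mi_nth_le_size: "I $ i \<le> mi_size I"
 unfolding mi_size_def by (rule member_le_sum) auto

lemma finite_mi_size: "finite {I::nat^'n::finite. mi_size I \<le> n}"
 by (rule finite_subset[OF _ finite_mi_bounded[of n]]) (auto intro: order_trans[OF mi_nth_le_size])

lemma finite_antidiag: "finite (antidiag (J :: nat^'n::finite))"
proof (rule finite_subset)
 show "antidiag J \<subseteq> {I. mi_size I \<le> mi_size J} \<times> {I. mi_size I \<le> mi_size J}"
  by (auto simp: antidiag_def mi_size_add)
qed (intro finite_cartesian_product finite_mi_size)

lemma mi_size_0 [simp]: "mi_size 0 = 0"
 by (simp add: mi_size_def)

lemma mi_size_eq_0: "mi_size I = 0 \<longleftrightarrow> I = 0"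
 by (simp add: mi_size_def vec_eq_iff)

lemma antidiag_0: "antidiag (0 :: nat^'n::finite) = {(0, 0)}"
proof -
 have *: "x = 0 \<and> y = 0" if "x + y = (0::nat^'n)" for x y
  using that by (simp add: vec_eq_iff)
 show ?thesis
 proof (intro equalityI subsetI)
  fix p :: "(nat^'n) \<times> (nat^'n)" assume "p \<in> antidiag 0"
  then have "fst p + snd p = 0" by (simp add: antidiag_def)
  then have "fst p = 0 \<and> snd p = 0" by (rule *)
  then show "p \<in> {(0, 0)}" by (simp add: prod_eq_iff)
 qed (simp add: antidiag_def)
qed

lemma mi_decompose:
 assumes "I $ i ~= 0"
 obtains J where "I = J + axis i (1::nat)"
proof
 show "I = (I - axis i 1) + axis i 1" using assms by (auto simp: vec_eq_iff axis_def)
qed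

lemma mi_induct [case_names zero step]:
 assumes "P 0" "!!I i. P I ==> P (I + axis i (1::nat))"
 shows "P (I :: nat^'n::finite)"
proof (induction "mi_size I" arbitrary: I)
 case 0
 then show ?case using assms(1) mi_size_eq_0[of I] by simp
next
 case (Suc n)
 then have "I ~= 0" by auto
 then obtain i where "I $ i ~= 0" by (auto simp: vec_eq_iff)
 then obtain J where "I = J + axis i 1" by (rule mi_decompose)
 moreover have "mi_size J = n" using Suc(2) \<open>I = J + axis i 1\<close> by (simp add: mi_size_add mi_size_axis[simplified])
 ultimately show ?case using Suc(1) assms(2) by blast
qed

lemma mi_fact_add_axis: "mi_fact (I + axis i 1) = (I $ i + 1) * mi_fact I"
proof -
 have "mi_fact (I + axis i 1) = (\<Prod>j\<in>UNIV. (if j = i then I $ i + 1 else 1) * fact (I $ j))"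
  unfolding mi_fact_def by (intro prod.cong) (auto simp: axis_def)
 also have "\<dots> = (I $ i + 1) * mi_fact I" unfolding prod.distrib mi_fact_def by simp
 finally show ?thesis .
qed

lemma mi_fact_pos: "mi_fact I > 0"
 unfolding mi_fact_def by (simp add: prod_pos)

lemma mi_fact_0: "mi_fact 0 = 1"
 by (simp add: mi_fact_def)

text \<open>The factor A_k removes the pairs with A_k = 0; the remaining ones are the pairs of J
  with the first entry raised by e_k.\<close>

lemma sum_antidiag_fst:
 fixes h :: "nat^'n::finite => nat^'n => 'c::real_vector"
 shows "(\<Sum>(A, E)\<in>antidiag (J + axis k 1). real (A $ k) *\<^sub>R h A E) =
  (\<Sum>(A, E)\<in>antidiag J. real (A $ k + 1) *\<^sub>R h (A + axis k 1) E)"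
proof -
 let ?f = "\<lambda>(A::nat^'n, E::nat^'n). (A + axis k 1, E)"
 have inj: "inj_on ?f (antidiag J)" by (auto intro: inj_onI)
 have "(\<Sum>(A, E)\<in>antidiag J. real (A $ k + 1) *\<^sub>R h (A + axis k 1) E) =
   (\<Sum>(A, E)\<in>?f ` antidiag J. real (A $ k) *\<^sub>R h A E)"
  by (subst sum.reindex[OF inj]) (auto intro!: sum.cong simp: axis_def)
 also have "\<dots> = (\<Sum>(A, E)\<in>antidiag (J + axis k 1). real (A $ k) *\<^sub>R h A E)"
 proof (rule sum.mono_neutral_left[OF finite_antidiag])
  show "?f ` antidiag J \<subseteq> antidiag (J + axis k 1)" by (auto simp: antidiag_def algebra_simps)
  show "\<forall>p\<in>antidiag (J + axis k 1) - ?f ` antidiag J. (case p of (A, E) => real (A $ k) *\<^sub>R h A E) = 0"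
  proof
   fix p assume p: "p \<in> antidiag (J + axis k 1) - ?f ` antidiag J"
   obtain A E where pe: "p = (A, E)" by (cases p)
   have "A $ k = 0"
   proof (rule ccontr)
    assume "A $ k ~= 0"
    then obtain A' where d: "A = A' + axis k 1" by (rule mi_decompose)
    have "A' + E + axis k 1 = J + axis k 1" using p pe d by (simp add: antidiag_def algebra_simps)
    then have "A' + E = J" by simp
    then have "p \<in> ?f ` antidiag J" unfolding pe d by (intro image_eqI[of _ _ "(A', E)"]) (auto simp: antidiag_def)
    then show False using p by blast
   qed
   then show "(case p of (A, E) => real (A $ k) *\<^sub>R h A E) = 0" by (simp add: pe)
  qed
 qed
 finally show ?thesis by simp
qed

lemma sum_antidiag_swap:
 "(\<Sum>(A, E)\<in>antidiag J. h A E) = (\<Sum>(A, E)\<in>antidiag J. h E A)"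
 by (rule sum.reindex_bij_witness[of _ prod.swap prod.swap]) (auto simp: antidiag_def add.commute)

lemma sum_antidiag_snd:
 fixes h :: "nat^'n::finite => nat^'n => 'c::real_vector"
 shows "(\<Sum>(A, E)\<in>antidiag (J + axis k 1). real (E $ k) *\<^sub>R h A E) =
  (\<Sum>(A, E)\<in>antidiag J. real (E $ k + 1) *\<^sub>R h A (E + axis k 1))"
 by (subst (1 2) sum_antidiag_swap) (rule sum_antidiag_fst)

text \<open>The shift \<open>F \<mapsto> (\<lambda>I. (I\<^sub>k + 1) F (I + e\<^sub>k))\<close> is a derivation for the convolution.\<close>

lemma sum_antidiag_derivation:
 fixes h :: "nat^'n::finite => nat^'n => 'c::real_vector"
 shows "real (J $ k + 1) *\<^sub>R (\<Sum>(A, E)\<in>antidiag (J + axis k 1). h A E) =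
  (\<Sum>(A, E)\<in>antidiag J. real (A $ k + 1) *\<^sub>R h (A + axis k 1) E + real (E $ k + 1) *\<^sub>R h A (E + axis k 1))"
proof -
 have "real (J $ k + 1) *\<^sub>R (\<Sum>(A, E)\<in>antidiag (J + axis k 1). h A E) =
  (\<Sum>(A, E)\<in>antidiag (J + axis k 1). real (A $ k) *\<^sub>R h A E + real (E $ k) *\<^sub>R h A E)"
  unfolding scaleR_sum_right
 proof (rule sum.cong[OF refl], clarify)
  fix A E assume "(A, E) \<in> antidiag (J + axis k (1::nat))"
  then have "A + E = J + axis k 1" by (simp add: antidiag_def)
  then have "(A + E) $ k = (J + axis k 1) $ k" by simp
  then have "J $ k + 1 = A $ k + E $ k" by (simp add: axis_def)
  then show "real (J $ k + 1) *\<^sub>R h A E = real (A $ k) *\<^sub>R h A E + real (E $ k) *\<^sub>R h A E"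
   by (simp only: of_nat_add scaleR_add_left)
 qed
 also have "\<dots> = (\<Sum>(A, E)\<in>antidiag (J + axis k 1). real (A $ k) *\<^sub>R h A E) +
   (\<Sum>(A, E)\<in>antidiag (J + axis k 1). real (E $ k) *\<^sub>R h A E)"
  by (simp add: case_prod_unfold sum.distrib)
 also have "\<dots> = (\<Sum>(A, E)\<in>antidiag J. real (A $ k + 1) *\<^sub>R h (A + axis k 1) E + real (E $ k + 1) *\<^sub>R h A (E + axis k 1))"
  unfolding sum_antidiag_fst sum_antidiag_snd by (simp add: case_prod_unfold sum.distrib)
 finally show ?thesis .
qed

lemma sum_antidiag_remove0:
 "(\<Sum>(A, E)\<in>antidiag J. h A E) = h 0 J + (\<Sum>(A, E)\<in>antidiag J - {(0, J)}. h A E)"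
 by (subst sum.remove[OF finite_antidiag, of "(0, J)"]) (auto simp: antidiag_def)

text \<open>Every pair lies on exactly one antidiagonal, so for nonnegative terms a truncated Cauchy
  product is part of the full double sum. Submultiplicativity of the Sobolev norms rests on
  this.\<close>

lemma sum_antidiag_le_prod:
 fixes h :: "nat^'n::finite => nat^'n => real"
 assumes "!!A E. h A E \<ge> 0"
 shows "(\<Sum>J | mi_size J \<le> H. \<Sum>(A, E)\<in>antidiag J. h A E) \<le> (\<Sum>A | mi_size A \<le> H. \<Sum>E | mi_size E \<le> H. h A E)"
proof -
 let ?S = "{J::nat^'n. mi_size J \<le> H}"
 have "(\<Sum>J\<in>?S. \<Sum>(A, E)\<in>antidiag J. h A E) = (\<Sum>(J, p)\<in>Sigma ?S antidiag. case p of (A, E) => h A E)"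
  by (subst sum.Sigma) (auto simp: finite_mi_size finite_antidiag)
 also have "\<dots> = (\<Sum>p\<in>snd ` Sigma ?S antidiag. case p of (A, E) => h A E)"
 proof (subst sum.reindex)
  show "inj_on snd (Sigma ?S antidiag)" by (auto intro!: inj_onI simp: antidiag_def)
 qed (simp add: case_prod_unfold)
 also have "\<dots> \<le> (\<Sum>p\<in>?S \<times> ?S. case p of (A, E) => h A E)"
  by (rule sum_mono2) (use assms in \<open>auto simp: finite_mi_size antidiag_def mi_size_add\<close>)
 also have "\<dots> = (\<Sum>A\<in>?S. \<Sum>E\<in>?S. h A E)" by (simp add: sum.cartesian_product)
 finally show ?thesis .
qed

section \<open>Square integrable functions\<close>

lemma integrable_mult_square:
 fixes a b :: "'a => real"
 assumes m: "a \<in> borel_measurable M" "b \<in> borel_measurable M"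
  and i: "integrable M (\<lambda>x. (a x)\<^sup>2)" "integrable M (\<lambda>x. (b x)\<^sup>2)"
 shows "integrable M (\<lambda>x. a x * b x)"
proof (rule Bochner_Integration.integrable_bound[where f = "\<lambda>x. (a x)\<^sup>2 + (b x)\<^sup>2"])
 show "AE x in M. norm (a x * b x) \<le> norm ((a x)\<^sup>2 + (b x)\<^sup>2)"
 proof (rule AE_I2)
  fix x
  have "2 * (\<bar>a x\<bar> * \<bar>b x\<bar>) \<le> (a x)\<^sup>2 + (b x)\<^sup>2" using sum_squares_bound[of "\<bar>a x\<bar>" "\<bar>b x\<bar>"] by simp
  moreover have "0 \<le> \<bar>a x\<bar> * \<bar>b x\<bar>" by simp
  ultimately have "\<bar>a x\<bar> * \<bar>b x\<bar> \<le> (a x)\<^sup>2 + (b x)\<^sup>2" by linarith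
  then show "norm (a x * b x) \<le> norm ((a x)\<^sup>2 + (b x)\<^sup>2)" by (simp add: abs_mult)
 qed
qed (use m i in auto)

lemma integrable_square_add:
 fixes a b :: "'a => real"
 assumes "a \<in> borel_measurable M" "b \<in> borel_measurable M"
  "integrable M (\<lambda>x. (a x)\<^sup>2)" "integrable M (\<lambda>x. (b x)\<^sup>2)"
 shows "integrable M (\<lambda>x. (a x + b x)\<^sup>2)"
 unfolding power2_sum using assms integrable_mult_square[OF assms] by (simp add: mult.assoc)

lemma Cauchy_Schwarz_integral:
 fixes a b :: "'a => real"
 assumes m: "a \<in> borel_measurable M" "b \<in> borel_measurable M"
  and i: "integrable M (\<lambda>x. (a x)\<^sup>2)" "integrable M (\<lambda>x. (b x)\<^sup>2)"
 shows "\<bar>\<integral>x. a x * b x \<partial>M\<bar> \<le> sqrt (LINT x|M. (a x)\<^sup>2) * sqrt (LINT x|M. (b x)\<^sup>2)"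
proof -
 note iab = integrable_mult_square[OF m i]
 let ?A = "\<integral>x. (a x)\<^sup>2 \<partial>M" and ?B = "\<integral>x. (b x)\<^sup>2 \<partial>M" and ?C = "\<integral>x. a x * b x \<partial>M"
 have q: "0 \<le> ?A + 2 * t * ?C + t\<^sup>2 * ?B" for t
 proof -
  have "0 \<le> (LINT x|M. (a x + t * b x)\<^sup>2)" by simp
  also have "\<dots> = (LINT x|M. ((a x)\<^sup>2 + (2 * t) * (a x * b x)) + t\<^sup>2 * (b x)\<^sup>2)"
   by (intro Bochner_Integration.integral_cong) (auto simp: power2_eq_square algebra_simps)
  also have "\<dots> = ?A + 2 * t * ?C + t\<^sup>2 * ?B" using i iab by simp
  finally show ?thesis .
 qed
 have "?C\<^sup>2 \<le> ?A * ?B"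
 proof (cases "?B = 0")
  case True
  have "?C = 0"
  proof (rule ccontr)
   assume "?C ~= 0"
   \<comment> \<open>With \<open>?B = 0\<close> the quadratic is affine in t, and this t gives it
     the value -1.\<close>
   then show False using q[of "- (?A + 1) / (2 * ?C)"] True by (simp add: field_simps)
  qed
  then show ?thesis using True by simp
 next
  case False
  then have B: "?B > 0" by (simp add: order_less_le)
  have "0 \<le> ?A + 2 * (- ?C / ?B) * ?C + (- ?C / ?B)\<^sup>2 * ?B" by (rule q)
  also have "\<dots> = ?A - ?C\<^sup>2 / ?B" using B by (simp add: power2_eq_square field_simps)
  finally show ?thesis using B by (simp add: field_simps)
 qed
 then have "sqrt (?C\<^sup>2) \<le> sqrt (?A * ?B)" by (rule real_sqrt_le_mono)
 then show ?thesis by (simp add: real_sqrt_mult)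
qed

lemma Minkowski_integral_square:
 fixes a b :: "'a => real"
 assumes m: "a \<in> borel_measurable M" "b \<in> borel_measurable M"
  and i: "integrable M (\<lambda>x. (a x)\<^sup>2)" "integrable M (\<lambda>x. (b x)\<^sup>2)"
 shows "sqrt (LINT x|M. (a x + b x)\<^sup>2) \<le> sqrt (LINT x|M. (a x)\<^sup>2) + sqrt (LINT x|M. (b x)\<^sup>2)"
proof (rule real_le_lsqrt)
 note iab = integrable_mult_square[OF m i]
 let ?A = "\<integral>x. (a x)\<^sup>2 \<partial>M" and ?B = "\<integral>x. (b x)\<^sup>2 \<partial>M" and ?C = "\<integral>x. a x * b x \<partial>M"
 have "(LINT x|M. (a x + b x)\<^sup>2) = (LINT x|M. ((a x)\<^sup>2 + (b x)\<^sup>2) + 2 * (a x * b x))"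
  by (intro Bochner_Integration.integral_cong) (auto simp: power2_eq_square algebra_simps)
 also have "\<dots> = ?A + ?B + 2 * ?C" using i iab by simp
 also have "\<dots> \<le> (sqrt ?A + sqrt ?B)\<^sup>2"
  using Cauchy_Schwarz_integral[OF m i] by (simp add: power2_sum)
 finally show "(LINT x|M. (a x + b x)\<^sup>2) \<le> (sqrt ?A + sqrt ?B)\<^sup>2" .
qed simp_all

lemma L2_sum_bound:
 fixes d :: "nat => 'a => real"
 assumes "!!k. d k \<in> borel_measurable M" "!!k. integrable M (\<lambda>x. (d k x)\<^sup>2)"
 shows "integrable M (\<lambda>x. (\<Sum>k<n. d k x)\<^sup>2) \<and> sqrt (LINT x|M. (\<Sum>k<n. d k x)\<^sup>2) \<le> (\<Sum>k<n. sqrt (LINT x|M. (d k x)\<^sup>2))"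
proof (induction n)
 case (Suc n)
 have m: "(\<lambda>x. \<Sum>k<n. d k x) \<in> borel_measurable M" using assms(1) by simp
 show ?case
  using integrable_square_add[OF m assms(1)[of n] conjunct1[OF Suc] assms(2)[of n]]
   Minkowski_integral_square[OF m assms(1)[of n] conjunct1[OF Suc] assms(2)[of n]] Suc by simp
qed simp

text \<open>Riesz-Fischer: the increments of a rapidly Cauchy subsequence have almost everywhere a
  finite absolute sum, by monotone convergence, and Fatou's lemma passes the Cauchy bounds to the
  pointwise limit.\<close>

lemma L2_complete:
 fixes f :: "nat => 'a => real"
 assumes m: "!!n. f n \<in> borel_measurable M" and i: "!!n. integrable M (\<lambda>x. (f n x)\<^sup>2)"
  and C: "!!e. e > 0 ==> \<exists>N. \<forall>m\<ge>N. \<forall>n\<ge>N. sqrt (LINT x|M. (f m x - f n x)\<^sup>2) < e"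
 shows "\<exists>g. g \<in> borel_measurable M \<and> integrable M (\<lambda>x. (g x)\<^sup>2) \<and>
  (\<lambda>n. sqrt (LINT x|M. (f n x - g x)\<^sup>2)) \<longlonglongrightarrow> 0"
proof -
 have id: "integrable M (\<lambda>x. (f m x - f n x)\<^sup>2)" for m n
  using integrable_square_add[of "f m" M "\<lambda>x. - f n x"] assms(1,2) by simp
 have "\<forall>k. \<exists>N. \<forall>m\<ge>N. \<forall>n\<ge>N. sqrt (LINT x|M. (f m x - f n x)\<^sup>2) < (1/2) ^ k" using C by simp
 then obtain N where N: "!!k m n. m \<ge> N k ==> n \<ge> N k ==> sqrt (LINT x|M. (f m x - f n x)\<^sup>2) < (1/2) ^ k"
  by metis
 \<comment> \<open>Partial sums of N, so that r j is at least N k whenever k \<le> j.\<close>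
 define r where "r k = (\<Sum>j\<le>k. N j)" for k
 have r: "N k \<le> r j" if "k \<le> j" for k j unfolding r_def using that by (intro member_le_sum) auto
 define d where "d k x = \<bar>f (r (Suc k)) x - f (r k) x\<bar>" for k x
 have dm: "d k \<in> borel_measurable M" for k unfolding d_def using m by measurable
 have di: "integrable M (\<lambda>x. (d k x)\<^sup>2)" for k unfolding d_def using id by simp
 have dn: "sqrt (LINT x|M. (d k x)\<^sup>2) \<le> (1/2) ^ k" for k
  unfolding d_def using N[of k "r (Suc k)" "r k"] r[of k k] r[of k "Suc k"] by simp
 define S where "S n x = (\<Sum>k<n. d k x)" for n x
 have Sm: "S n \<in> borel_measurable M" for n unfolding S_def using dm by measurable
 have S0: "0 \<le> S n x" for n x unfolding S_def d_def by (simp add: sum_nonneg)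
 have Sle: "(\<integral>\<^sup>+x. ennreal ((S n x)\<^sup>2) \<partial>M) \<le> 4" for n
 proof -
  have "sqrt (LINT x|M. (S n x)\<^sup>2) \<le> (\<Sum>k<n. (1/2) ^ k)"
   unfolding S_def using order_trans[OF conjunct2[OF L2_sum_bound[of d M, OF dm di]] sum_mono[OF dn]] .
  also have "\<dots> \<le> 2" by (simp add: sum_gp_strict)
  finally have "(LINT x|M. (S n x)\<^sup>2) \<le> 2\<^sup>2" by (rule sqrt_le_D)
  moreover have "integrable M (\<lambda>x. (S n x)\<^sup>2)" unfolding S_def using L2_sum_bound[of d M, OF dm di] by blast
  then have "(\<integral>\<^sup>+x. ennreal ((S n x)\<^sup>2) \<partial>M) = ennreal (LINT x|M. (S n x)\<^sup>2)"
   by (intro nn_integral_eq_integral) auto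
  ultimately show ?thesis by (simp add: ennreal_le_iff2 flip: ennreal_numeral)
 qed
 have "incseq (\<lambda>n x. ennreal ((S n x)\<^sup>2))"
 proof (rule incseq_SucI, rule le_funI)
  fix n x
  have "S n x \<le> S (Suc n) x" by (simp add: S_def d_def)
  then show "ennreal ((S n x)\<^sup>2) \<le> ennreal ((S (Suc n) x)\<^sup>2)" using S0[of n x] by (intro ennreal_leI power_mono)
 qed
 then have "(\<integral>\<^sup>+x. (SUP n. ennreal ((S n x)\<^sup>2)) \<partial>M) = (SUP n. \<integral>\<^sup>+x. ennreal ((S n x)\<^sup>2) \<partial>M)"
  by (rule nn_integral_monotone_convergence_SUP) (use Sm in measurable)
 also have "\<dots> \<le> 4" by (rule SUP_least) (rule Sle)
 finally have "(\<integral>\<^sup>+x. (SUP n. ennreal ((S n x)\<^sup>2)) \<partial>M) ~= \<infinity>" by (auto simp: top_unique)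
 then have fin: "AE x in M. (SUP n. ennreal ((S n x)\<^sup>2)) ~= \<infinity>"
  by (rule nn_integral_PInf_AE[rotated]) (use Sm in measurable)
 define g where "g x = lim (\<lambda>k. f (r k) x)" for x
 have gm: "g \<in> borel_measurable M" unfolding g_def using m by (intro borel_measurable_lim_metric) auto
 have conv: "AE x in M. (\<lambda>k. f (r k) x) \<longlonglongrightarrow> g x"
  using fin
 proof eventually_elim
  case (elim x)
  then obtain c where c: "c \<ge> 0" "(SUP n. ennreal ((S n x)\<^sup>2)) = ennreal c"
   by (cases "SUP n. ennreal ((S n x)\<^sup>2)" rule: ennreal_cases) auto
  have "(S n x)\<^sup>2 \<le> c" for n
  proof -
   have "ennreal ((S n x)\<^sup>2) \<le> ennreal c" unfolding c(2)[symmetric] by (rule SUP_upper) simp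
   then show ?thesis using c(1) by (simp add: ennreal_le_iff)
  qed
  then have "S n x \<le> sqrt c" for n using real_le_rsqrt by blast
  then have "summable (\<lambda>k. d k x)"
   by (intro summableI_nonneg_bounded[where x = "sqrt c"]) (auto simp: S_def d_def)
  then have "summable (\<lambda>k. f (r (Suc k)) x - f (r k) x)"
   unfolding d_def by (rule summable_rabs_cancel)
  then have "convergent (\<lambda>n. \<Sum>k<n. f (r (Suc k)) x - f (r k) x)" by (simp add: summable_iff_convergent)
  then have "convergent (\<lambda>n. f (r n) x - f (r 0) x)" by (simp add: sum_lessThan_telescope[of "\<lambda>k. f (r k) x"])
  then have "convergent (\<lambda>n. (f (r n) x - f (r 0) x) + f (r 0) x)"
   by (intro convergent_add convergent_const)
  then show ?case unfolding g_def by (simp add: convergent_LIMSEQ_iff)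
 qed
 \<comment> \<open>Fatou along the subsequence: f n is within (1/2)^k of f (r j) for all j \<ge> k,
   hence of g.\<close>
 have bnd: "integrable M (\<lambda>x. (f n x - g x)\<^sup>2) \<and> sqrt (LINT x|M. (f n x - g x)\<^sup>2) \<le> (1/2) ^ k" if n: "n \<ge> N k" for n k
 proof -
  have "(\<integral>\<^sup>+x. ennreal ((f n x - g x)\<^sup>2) \<partial>M) = (\<integral>\<^sup>+x. liminf (\<lambda>j. ennreal ((f n x - f (r j) x)\<^sup>2)) \<partial>M)"
  proof (rule nn_integral_cong_AE)
   show "AE x in M. ennreal ((f n x - g x)\<^sup>2) = liminf (\<lambda>j. ennreal ((f n x - f (r j) x)\<^sup>2))"
    using conv
   proof eventually_elim
    case (elim x)
    have "(\<lambda>j. ennreal ((f n x - f (r j) x)\<^sup>2)) \<longlonglongrightarrow> ennreal ((f n x - g x)\<^sup>2)"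
     by (intro tendsto_ennrealI tendsto_power tendsto_diff tendsto_const elim)
    then show ?case by (rule lim_imp_Liminf[OF trivial_limit_sequentially, symmetric])
   qed
  qed
  also have "\<dots> \<le> liminf (\<lambda>j. \<integral>\<^sup>+x. ennreal ((f n x - f (r j) x)\<^sup>2) \<partial>M)"
   by (rule nn_integral_liminf) (use m in measurable)
  also have "\<dots> \<le> limsup (\<lambda>j. \<integral>\<^sup>+x. ennreal ((f n x - f (r j) x)\<^sup>2) \<partial>M)"
   by (rule Liminf_le_Limsup) simp
  also have "\<dots> \<le> ennreal (((1/2) ^ k)\<^sup>2)"
  proof (rule Limsup_bounded)
   show "\<forall>\<^sub>F j in sequentially. (\<integral>\<^sup>+x. ennreal ((f n x - f (r j) x)\<^sup>2) \<partial>M) \<le> ennreal (((1/2) ^ k)\<^sup>2)"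
    unfolding eventually_sequentially
   proof (intro exI[of _ k] allI impI)
    fix j assume "k \<le> j"
    then have "sqrt (LINT x|M. (f n x - f (r j) x)\<^sup>2) \<le> (1/2) ^ k" using N[OF n r[of k j]] by simp
    then have "(LINT x|M. (f n x - f (r j) x)\<^sup>2) \<le> ((1/2) ^ k)\<^sup>2" by (rule sqrt_le_D)
    moreover have "(\<integral>\<^sup>+x. ennreal ((f n x - f (r j) x)\<^sup>2) \<partial>M) = ennreal (LINT x|M. (f n x - f (r j) x)\<^sup>2)"
     using id by (intro nn_integral_eq_integral) auto
    ultimately show "(\<integral>\<^sup>+x. ennreal ((f n x - f (r j) x)\<^sup>2) \<partial>M) \<le> ennreal (((1/2) ^ k)\<^sup>2)"
     by (simp add: ennreal_leI)
   qed
  qed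
  finally have nn: "(\<integral>\<^sup>+x. ennreal ((f n x - g x)\<^sup>2) \<partial>M) \<le> ennreal (((1/2) ^ k)\<^sup>2)" .
  have int: "integrable M (\<lambda>x. (f n x - g x)\<^sup>2)"
  proof (rule integrableI_bounded)
   have "(\<integral>\<^sup>+x. ennreal (norm ((f n x - g x)\<^sup>2)) \<partial>M) \<le> ennreal (((1/2) ^ k)\<^sup>2)" using nn by simp
   also have "\<dots> < \<infinity>" by simp
   finally show "(\<integral>\<^sup>+x. ennreal (norm ((f n x - g x)\<^sup>2)) \<partial>M) < \<infinity>" .
  qed (use m gm in measurable)
  then have "ennreal (LINT x|M. (f n x - g x)\<^sup>2) \<le> ennreal (((1/2) ^ k)\<^sup>2)"
   using nn nn_integral_eq_integral[OF int] by simp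
  then have "(LINT x|M. (f n x - g x)\<^sup>2) \<le> ((1/2) ^ k)\<^sup>2" by (simp add: ennreal_le_iff)
  then have "sqrt (LINT x|M. (f n x - g x)\<^sup>2) \<le> (1/2) ^ k" by (intro real_le_lsqrt) auto
  then show ?thesis using int by blast
 qed
 have "integrable M (\<lambda>x. (f (N 0) x + - (f (N 0) x - g x))\<^sup>2)"
  by (rule integrable_square_add) (use m gm i bnd[of 0 "N 0"] in \<open>auto simp: power2_commute\<close>)
 then have gi: "integrable M (\<lambda>x. (g x)\<^sup>2)" by simp
 have "(\<lambda>n. sqrt (LINT x|M. (f n x - g x)\<^sup>2)) \<longlonglongrightarrow> 0"
 proof (rule LIMSEQ_I)
  fix e :: real assume "e > 0"
  then obtain k where k: "(1/2::real) ^ k < e" using real_arch_pow_inv[of e "1/2"] by auto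
  have "norm (sqrt (LINT x|M. (f n x - g x)\<^sup>2) - 0) < e" if "n \<ge> N k" for n
   using bnd[OF that] k by simp
  then show "\<exists>no. \<forall>n\<ge>no. norm (sqrt (LINT x|M. (f n x - g x)\<^sup>2) - 0) < e" by blast
 qed
 then show ?thesis using gm gi by blast
qed

section \<open>The spaces \<open>L\<^sup>2\<close> and \<open>L\<^sup>\<infinity>\<close>\<close>

text \<open>Completeness of Lebesgue measure: changes on a null set keep preimages
  measurable.\<close>

lemma measurable_lebesgue_on_cong_AE:
 fixes f g :: "real^'d::finite => 'b::euclidean_space"
 assumes D: "open D" and f: "f \<in> borel_measurable (lebesgue_on D)" and ae: "AE x in lebesgue_on D. f x = g x"
 shows "g \<in> borel_measurable (lebesgue_on D)"
proof -
 have Dl: "D \<inter> space lebesgue \<in> sets lebesgue" using D by (simp add: borel_open)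
 note iff = borel_measurable_restrict_space_iff[OF Dl]
 let ?F = "\<lambda>x. indicator D x *\<^sub>R f x" and ?G = "\<lambda>x. indicator D x *\<^sub>R g x"
 have F: "?F \<in> borel_measurable lebesgue" using f iff by blast
 have "AE x in lebesgue. x \<in> D --> f x = g x" using ae unfolding AE_restrict_space_iff[OF Dl] .
 then have FG: "AE x in lebesgue. ?F x = ?G x" by eventually_elim (auto simp: indicator_def)
 have "?G \<in> borel_measurable lebesgue"
 proof (rule measurableI)
  fix S :: "'b set" assume S: "S \<in> sets borel"
  show "?G -` S \<inter> space lebesgue \<in> sets lebesgue"
  proof (rule completion.in_sets_AE)
   show "?F -` S \<inter> space lebesgue \<in> sets lebesgue" using F S by (rule measurable_sets)
   show "AE x in lebesgue. (x \<in> ?F -` S \<inter> space lebesgue) \<longleftrightarrow> (x \<in> ?G -` S \<inter> space lebesgue)"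
    using FG by eventually_elim (simp only: vimage_eq Int_iff)
  qed simp
 qed simp
 then show ?thesis using iff by blast
qed

lemma norm_powr_two: "norm x powr 2 = (norm x)\<^sup>2"
 by (cases "x = 0") (simp_all add: powr_numeral)

lemma Lp_space_2:
 "f \<in> Lp_space D 2 \<longleftrightarrow> f \<in> borel_measurable (lebesgue_on D) \<and> integrable (lebesgue_on D) (\<lambda>x. (norm (f x))\<^sup>2)"
 "f \<in> Lp_space D (ereal 2) \<longleftrightarrow> f \<in> borel_measurable (lebesgue_on D) \<and> integrable (lebesgue_on D) (\<lambda>x. (norm (f x))\<^sup>2)"
 by (simp_all add: Lp_space_def norm_powr_two)

lemma Lp_norm_2:
 "Lp_norm D 2 f = sqrt (LINT x|lebesgue_on D. (norm (f x))\<^sup>2)"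
 "Lp_norm D (ereal 2) f = sqrt (LINT x|lebesgue_on D. (norm (f x))\<^sup>2)"
 by (simp_all add: Lp_norm_def norm_powr_two powr_half_sqrt)

lemma Linf_AE:
 assumes "f \<in> Lp_space D \<infinity>"
 shows "AE x in lebesgue_on D. norm (f x) \<le> Lp_norm D \<infinity> f"
proof -
 let ?e = "esssup (lebesgue_on D) (\<lambda>x. ereal (norm (f x)))"
 have e: "?e < \<infinity>" using assms by (simp add: Lp_space_def)
 have "AE x in lebesgue_on D. ereal (norm (f x)) \<le> ?e" by (rule esssup_AE)
 then show ?thesis
 proof eventually_elim
  case (elim x)
  then show ?case using e by (cases ?e) (auto simp: Lp_norm_def)
 qed
qed

lemma Linf_le:
 assumes "f \<in> borel_measurable (lebesgue_on D)" "AE x in lebesgue_on D. norm (f x) \<le> B" "0 \<le> B"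
 shows "f \<in> Lp_space D \<infinity>" "Lp_norm D \<infinity> f \<le> B"
proof -
 let ?e = "esssup (lebesgue_on D) (\<lambda>x. ereal (norm (f x)))"
 have e: "?e \<le> ereal B" using assms(1,2) by (intro esssup_I) auto
 then have "?e < \<infinity>" by (auto intro: le_less_trans)
 then show "f \<in> Lp_space D \<infinity>" using assms(1) by (simp add: Lp_space_def)
 show "Lp_norm D \<infinity> f \<le> B" using e assms(3) by (cases ?e) (auto simp: Lp_norm_def)
qed

text \<open>True for every f, measurable or not, by default values: \<open>real_of_ereal\<close>
  sends both infinities to 0. A finite negative essential supremum would force the whole domain to
  be a null set, and then the supremum is -\<infinity>.\<close>

lemma Lp_norm_nonneg: "p \<in> {2, \<infinity>} ==> 0 \<le> Lp_norm D p f"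
proof (elim insertE emptyE)
 assume p: "p = \<infinity>"
 let ?e = "esssup (lebesgue_on D) (\<lambda>x. ereal (norm (f x)))"
 show "0 \<le> Lp_norm D p f"
 proof (rule ccontr)
  assume n: "\<not> ?thesis"
  then obtain r where r: "?e = ereal r" "r < 0" using p by (cases ?e) (auto simp: Lp_norm_def)
  have "AE x in lebesgue_on D. ereal (norm (f x)) \<le> ?e" by (rule esssup_AE)
  then have "AE x in lebesgue_on D. False"
  proof eventually_elim
   case (elim x)
   then have "norm (f x) \<le> r" using r by simp
   then show False using r(2) norm_ge_zero[of "f x"] by linarith
  qed
  moreover have "(\<lambda>x. ereal (norm (f x))) \<in> borel_measurable (lebesgue_on D)"
  proof (rule ccontr)
   assume "(\<lambda>x. ereal (norm (f x))) \<notin> borel_measurable (lebesgue_on D)"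
   then have "?e = top" by (rule esssup_non_measurable)
   then show False using r by (simp add: top_ereal_def)
  qed
  ultimately have "?e \<le> - \<infinity>" using \<open>AE x in lebesgue_on D. False\<close> by (intro esssup_I) auto
  then show False using r by simp
 qed
qed (simp add: Lp_norm_2)

lemma Lp_space_measurable: "f \<in> Lp_space D p ==> f \<in> borel_measurable (lebesgue_on D)"
 by (simp add: Lp_space_def)

text \<open>The common reduction for products, linear images and changes of representative at the
  two exponents in use, 2 and \<infinity>.\<close>

lemma Lp_dominated:
 assumes p: "p \<in> {2, \<infinity>}" and f: "f \<in> borel_measurable (lebesgue_on D)" and g: "g \<in> Lp_space D p"
  and le: "AE x in lebesgue_on D. norm (f x) \<le> norm (g x)"
 shows "f \<in> Lp_space D p" "Lp_norm D p f \<le> Lp_norm D p g"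
proof -
 have "f \<in> Lp_space D p \<and> Lp_norm D p f \<le> Lp_norm D p g"
  using p
 proof (elim insertE emptyE)
  assume p: "p = \<infinity>"
  have "AE x in lebesgue_on D. norm (f x) \<le> Lp_norm D p g"
   using le Linf_AE[OF g[unfolded p]] unfolding p by eventually_elim simp
  from Linf_le[OF f this Lp_norm_nonneg] show ?thesis unfolding p by simp
 next
  assume p: "p = 2"
  have gi: "integrable (lebesgue_on D) (\<lambda>x. (norm (g x))\<^sup>2)" using g p by (simp add: Lp_space_2)
  have le2: "AE x in lebesgue_on D. (norm (f x))\<^sup>2 \<le> (norm (g x))\<^sup>2"
   using le by eventually_elim (simp add: power_mono)
  have fi: "integrable (lebesgue_on D) (\<lambda>x. (norm (f x))\<^sup>2)"
   by (rule Bochner_Integration.integrable_bound[OF gi]) (use f le2 in auto)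
  show ?thesis using f fi integral_mono_AE[OF fi gi le2] unfolding p by (simp add: Lp_space_2 Lp_norm_2)
 qed
 then show "f \<in> Lp_space D p" "Lp_norm D p f \<le> Lp_norm D p g" by auto
qed

lemma Lp_norm_cong_AE:
 assumes p: "p \<in> {2, \<infinity>}" and f: "f \<in> Lp_space D p" "g \<in> Lp_space D p" and ae: "AE x in lebesgue_on D. f x = g x"
 shows "Lp_norm D p f = Lp_norm D p g"
proof (rule antisym)
 show "Lp_norm D p f \<le> Lp_norm D p g"
  by (rule Lp_dominated(2)[OF p Lp_space_measurable[OF f(1)] f(2)]) (use ae in eventually_elim, simp)
 show "Lp_norm D p g \<le> Lp_norm D p f"
  by (rule Lp_dominated(2)[OF p Lp_space_measurable[OF f(2)] f(1)]) (use ae in eventually_elim, simp)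
qed

lemma Lp_scaleR:
 assumes p: "p \<in> {2, \<infinity>}" and f: "f \<in> Lp_space D p"
 shows "(\<lambda>x. c *\<^sub>R f x) \<in> Lp_space D p" "Lp_norm D p (\<lambda>x. c *\<^sub>R f x) \<le> \<bar>c\<bar> * Lp_norm D p f"
proof -
 have m: "(\<lambda>x. c *\<^sub>R f x) \<in> borel_measurable (lebesgue_on D)" using Lp_space_measurable[OF f] by simp
 have "(\<lambda>x. c *\<^sub>R f x) \<in> Lp_space D p \<and> Lp_norm D p (\<lambda>x. c *\<^sub>R f x) \<le> \<bar>c\<bar> * Lp_norm D p f"
  using p
 proof (elim insertE emptyE)
  assume p: "p = \<infinity>"
  have "AE x in lebesgue_on D. norm (c *\<^sub>R f x) \<le> \<bar>c\<bar> * Lp_norm D \<infinity> f"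
   using Linf_AE[OF f[unfolded p]] by eventually_elim (simp add: mult_left_mono)
  from Linf_le[OF m this] show ?thesis unfolding p by (simp add: Lp_norm_nonneg)
 next
  assume p: "p = 2"
  show ?thesis using m f unfolding p
   by (simp add: Lp_space_2 Lp_norm_2 power_mult_distrib real_sqrt_mult)
 qed
 then show "(\<lambda>x. c *\<^sub>R f x) \<in> Lp_space D p" "Lp_norm D p (\<lambda>x. c *\<^sub>R f x) \<le> \<bar>c\<bar> * Lp_norm D p f" by auto
qed

lemma Lp_zero:
 "p \<in> {2, \<infinity>} ==> (\<lambda>x. 0 :: 'b::euclidean_space) \<in> Lp_space D p"
 "p \<in> {2, \<infinity>} ==> Lp_norm D p (\<lambda>x. 0 :: 'b) = 0"
proof -
 have a: "(\<lambda>x. 0 :: 'b) \<in> Lp_space D \<infinity>" by (rule Linf_le(1)[of _ _ 0]) auto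
 have b: "Lp_norm D \<infinity> (\<lambda>x. 0 :: 'b) \<le> 0" by (rule Linf_le(2)) auto
 show "p \<in> {2, \<infinity>} ==> (\<lambda>x. 0 :: 'b) \<in> Lp_space D p" "p \<in> {2, \<infinity>} ==> Lp_norm D p (\<lambda>x. 0 :: 'b) = 0"
  using a b Lp_norm_nonneg[of \<infinity> D "\<lambda>x. 0 :: 'b"] by (auto simp: Lp_space_2 Lp_norm_2)
qed

lemma Lp_add:
 assumes p: "p \<in> {2, \<infinity>}" and f: "f \<in> Lp_space D p" and g: "g \<in> Lp_space D p"
 shows "(\<lambda>x. f x + g x) \<in> Lp_space D p" "Lp_norm D p (\<lambda>x. f x + g x) \<le> Lp_norm D p f + Lp_norm D p g"
proof -
 have m: "(\<lambda>x. f x + g x) \<in> borel_measurable (lebesgue_on D)"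
  using Lp_space_measurable[OF f] Lp_space_measurable[OF g] by simp
 have "(\<lambda>x. f x + g x) \<in> Lp_space D p \<and> Lp_norm D p (\<lambda>x. f x + g x) \<le> Lp_norm D p f + Lp_norm D p g"
  using p
 proof (elim insertE emptyE)
  assume p: "p = \<infinity>"
  have "AE x in lebesgue_on D. norm (f x + g x) \<le> Lp_norm D \<infinity> f + Lp_norm D \<infinity> g"
   using Linf_AE[OF f[unfolded p]] Linf_AE[OF g[unfolded p]] by eventually_elim (rule norm_triangle_mono)
  from Linf_le[OF m this] show ?thesis unfolding p by (simp add: Lp_norm_nonneg)
 next
  assume p: "p = 2"
  have a: "(\<lambda>x. norm (f x)) \<in> borel_measurable (lebesgue_on D)" "(\<lambda>x. norm (g x)) \<in> borel_measurable (lebesgue_on D)"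
   "integrable (lebesgue_on D) (\<lambda>x. (norm (f x))\<^sup>2)" "integrable (lebesgue_on D) (\<lambda>x. (norm (g x))\<^sup>2)"
   using f g unfolding p by (auto simp: Lp_space_2)
  have s: "(\<lambda>x. norm (f x) + norm (g x)) \<in> Lp_space D 2"
   using a integrable_square_add[OF a] by (simp add: Lp_space_2)
  have le: "AE x in lebesgue_on D. norm (f x + g x) \<le> norm (norm (f x) + norm (g x))"
   by (rule AE_I2) (simp add: norm_triangle_ineq)
  have "Lp_norm D 2 (\<lambda>x. norm (f x) + norm (g x)) \<le> Lp_norm D 2 f + Lp_norm D 2 g"
   using Minkowski_integral_square[OF a] by (simp add: Lp_norm_2)
  then show ?thesis using Lp_dominated(1)[of 2, OF _ m s le] order_trans[OF Lp_dominated(2)[of 2, OF _ m s le]]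
   unfolding p by blast
 qed
 then show "(\<lambda>x. f x + g x) \<in> Lp_space D p" "Lp_norm D p (\<lambda>x. f x + g x) \<le> Lp_norm D p f + Lp_norm D p g" by auto
qed

lemma Lp_sum:
 assumes p: "p \<in> {2, \<infinity>}" and "finite S" "!!s. s \<in> S ==> f s \<in> Lp_space D p"
 shows "(\<lambda>x. \<Sum>s\<in>S. f s x) \<in> Lp_space D p \<and> Lp_norm D p (\<lambda>x. \<Sum>s\<in>S. f s x) \<le> (\<Sum>s\<in>S. Lp_norm D p (f s))"
 using assms(2,3)
proof (induction rule: finite_induct)
 case empty
 show ?case by (simp add: Lp_zero[OF p])
next
 case (insert s S)
 then have a: "f s \<in> Lp_space D p" "(\<lambda>x. \<Sum>s\<in>S. f s x) \<in> Lp_space D p"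
  "Lp_norm D p (\<lambda>x. \<Sum>s\<in>S. f s x) \<le> (\<Sum>s\<in>S. Lp_norm D p (f s))" by auto
 show ?case using Lp_add[OF p a(1,2)] a(3) insert(1,2) by simp
qed

lemma Lp_mult:
 fixes f g :: "real^'d::finite => real"
 assumes p: "p \<in> {2, \<infinity>}" and f: "f \<in> Lp_space D \<infinity>" and g: "g \<in> Lp_space D p"
 shows "(\<lambda>x. f x * g x) \<in> Lp_space D p" "Lp_norm D p (\<lambda>x. f x * g x) \<le> Lp_norm D \<infinity> f * Lp_norm D p g"
proof -
 have m: "(\<lambda>x. f x * g x) \<in> borel_measurable (lebesgue_on D)"
  using Lp_space_measurable[OF f] Lp_space_measurable[OF g] by simp
 have n: "0 \<le> Lp_norm D \<infinity> f" by (simp add: Lp_norm_nonneg)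
 have le: "AE x in lebesgue_on D. norm (f x * g x) \<le> norm (Lp_norm D \<infinity> f *\<^sub>R g x)"
  using Linf_AE[OF f] by eventually_elim (use n in \<open>simp add: abs_mult mult_right_mono\<close>)
 note d = Lp_dominated[OF p m Lp_scaleR(1)[OF p g] le]
 show "(\<lambda>x. f x * g x) \<in> Lp_space D p" by (rule d(1))
 show "Lp_norm D p (\<lambda>x. f x * g x) \<le> Lp_norm D \<infinity> f * Lp_norm D p g"
  using d(2) Lp_scaleR(2)[OF p g, of "Lp_norm D \<infinity> f"] n by simp
qed

lemma Lp_inner:
 fixes f g :: "real^'d::finite => 'b::euclidean_space"
 assumes f: "f \<in> Lp_space D \<infinity>" and g: "g \<in> Lp_space D \<infinity>"
 shows "(\<lambda>x. f x \<bullet> g x) \<in> Lp_space D \<infinity>" "Lp_norm D \<infinity> (\<lambda>x. f x \<bullet> g x) \<le> Lp_norm D \<infinity> f * Lp_norm D \<infinity> g"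
proof -
 have m: "(\<lambda>x. f x \<bullet> g x) \<in> borel_measurable (lebesgue_on D)"
  using Lp_space_measurable[OF f] Lp_space_measurable[OF g] by simp
 have le: "AE x in lebesgue_on D. norm (f x \<bullet> g x) \<le> Lp_norm D \<infinity> f * Lp_norm D \<infinity> g"
  using Linf_AE[OF f] Linf_AE[OF g]
 proof eventually_elim
  case (elim x)
  have "norm (f x \<bullet> g x) \<le> norm (f x) * norm (g x)" by (simp add: Cauchy_Schwarz_ineq2)
  also have "\<dots> \<le> Lp_norm D \<infinity> f * Lp_norm D \<infinity> g" using elim by (intro mult_mono) (auto simp: Lp_norm_nonneg)
  finally show ?case .
 qed
 show "(\<lambda>x. f x \<bullet> g x) \<in> Lp_space D \<infinity>" "Lp_norm D \<infinity> (\<lambda>x. f x \<bullet> g x) \<le> Lp_norm D \<infinity> f * Lp_norm D \<infinity> g"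
  by (rule Linf_le[OF m le]; simp add: Lp_norm_nonneg)+
qed

lemma Lp_locally_integrable:
 assumes D: "open D" and p: "p \<in> {2, \<infinity>}" and f: "f \<in> Lp_space D p"
 shows "locally_integrable D f"
 unfolding locally_integrable_def
proof (intro allI impI)
 fix K assume K: "compact K \<and> K \<subseteq> D"
 have mK: "f \<in> borel_measurable (lebesgue_on K)"
  by (rule measurable_restrict_mono[OF Lp_space_measurable[OF f]]) (use K in blast)
 show "integrable (lebesgue_on K) f"
  using p
 proof (elim insertE emptyE)
  assume p: "p = \<infinity>"
  have ae: "AE x in lebesgue_on K. norm (f x) \<le> Lp_norm D \<infinity> f"
   using AE_lebesgue_on_subset[OF D _ _ Linf_AE[OF f[unfolded p]]] K by blast
  show ?thesis
  proof (rule Bochner_Integration.integrable_bound[OF integrable_const_compact mK])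
   show "AE x in lebesgue_on K. norm (f x) \<le> norm (Lp_norm D \<infinity> f)"
    using ae by eventually_elim (simp add: Lp_norm_nonneg)
  qed (use K in blast)
 next
  assume p: "p = 2"
  have i: "integrable (lebesgue_on D) (\<lambda>x. (norm (f x))\<^sup>2)" using f p by (simp add: Lp_space_2)
  then have "integrable lebesgue (\<lambda>x. indicator D x *\<^sub>R (norm (f x))\<^sup>2)" unfolding lebesgue_on_open_integral(1)[OF D] .
  from integrable_mult_indicator[OF _ this, of K]
  have "integrable lebesgue (\<lambda>x. indicator K x *\<^sub>R (indicator D x *\<^sub>R (norm (f x))\<^sup>2))" using K by (simp add: borel_compact)
  moreover have eq: "indicator K x *\<^sub>R (indicator D x *\<^sub>R (norm (f x))\<^sup>2) = indicator K x *\<^sub>R (norm (f x))\<^sup>2" for x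
   using K by (auto simp: indicator_def)
  ultimately have i': "integrable lebesgue (\<lambda>x. indicator K x *\<^sub>R (norm (f x))\<^sup>2)" by (simp only: eq)
  have "K \<inter> space lebesgue \<in> sets lebesgue" using K by (simp add: borel_compact)
  then have iK: "integrable (lebesgue_on K) (\<lambda>x. (norm (f x))\<^sup>2)" using integrable_restrict_space i' by blast
  show ?thesis
  proof (rule Bochner_Integration.integrable_bound[OF _ mK])
   \<comment> \<open>On a set of finite measure |f| \<le> 1 + |f|^2 reduces square integrability to
     integrability.\<close>
   show "integrable (lebesgue_on K) (\<lambda>x. 1 + (norm (f x))\<^sup>2)"
    using K by (intro Bochner_Integration.integrable_add integrable_const_compact iK) blast
   show "AE x in lebesgue_on K. norm (f x) \<le> norm (1 + (norm (f x))\<^sup>2)"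
   proof (rule AE_I2)
    fix x
    have "2 * norm (f x) * 1 \<le> (norm (f x))\<^sup>2 + 1\<^sup>2" by (rule sum_squares_bound)
    then show "norm (f x) \<le> norm (1 + (norm (f x))\<^sup>2)" using norm_ge_zero[of "f x"] by (simp del: norm_ge_zero)
   qed
  qed
 qed
qed

section \<open>Weighted Sobolev norms\<close>

text \<open>
 Weighting the derivatives of order \<open>j\<close> with \<open>\<theta>\<^sup>j\<close> keeps the norm submultiplicative; for small
 \<open>\<theta>\<close> the norm of a negative power is controlled by its supremum norm alone.
\<close>

definition wnorm :: "(real^'d::finite) set => nat => ereal => real => (real^'d => 'b::euclidean_space) => real" where
 "wnorm D H p \<theta> v = (\<Sum>I | mi_size I \<le> H. \<theta> ^ mi_size I / real (mi_fact I) * Lp_norm D p (weak_deriv D I v))"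

lemma sob_norm_eq_wnorm: "sob_norm D H p v = wnorm D H p 1 v"
 by (simp add: sob_norm_def wnorm_def)

lemma is_weak_deriv_step':
 assumes "is_weak_deriv D (axis i 1) f h" "is_weak_deriv D (I + axis i 1) f g"
 shows "is_weak_deriv D I h g"
 unfolding is_weak_deriv_def
proof (intro conjI allI impI)
 fix \<phi> assume \<phi>: "test_fun D \<phi>"
 note s = test_fun_smooth[OF \<phi>]
 have "(- 1) ^ mi_size (axis i (1::nat)) *\<^sub>R (LINT x|lebesgue_on D. mi_partial I \<phi> x *\<^sub>R h x) =
  (LINT x|lebesgue_on D. mi_partial (axis i 1) (mi_partial I \<phi>) x *\<^sub>R f x)"
  using assms(1) test_fun_mi_partial[OF \<phi>] unfolding is_weak_deriv_def by simp
 also have "\<dots> = (LINT x|lebesgue_on D. mi_partial (I + axis i 1) \<phi> x *\<^sub>R f x)"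
  unfolding mi_partial_add_axis[OF s] mi_partial_axis[OF smooth_mi_partial[OF s]] ..
 also have "\<dots> = (- 1) ^ mi_size (I + axis i 1) *\<^sub>R (LINT x|lebesgue_on D. \<phi> x *\<^sub>R g x)"
  using assms(2) \<phi> unfolding is_weak_deriv_def by blast
 also have "\<dots> = (- 1) ^ mi_size (axis i (1::nat)) *\<^sub>R ((- 1) ^ mi_size I *\<^sub>R (LINT x|lebesgue_on D. \<phi> x *\<^sub>R g x))"
  by (simp add: mi_size_add power_add)
 finally show "(LINT x|lebesgue_on D. mi_partial I \<phi> x *\<^sub>R h x) =
  (- 1) ^ mi_size I *\<^sub>R (LINT x|lebesgue_on D. \<phi> x *\<^sub>R g x)"
  by (simp del: scaleR_scaleR)
qed (use assms in \<open>auto simp: is_weak_deriv_def\<close>)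

lemma is_weak_deriv_0:
 assumes "locally_integrable D f"
 shows "is_weak_deriv D 0 f f"
 unfolding is_weak_deriv_def
proof (intro conjI allI impI assms)
 fix \<phi> assume \<phi>: "test_fun D \<phi>"
 show "(LINT x|lebesgue_on D. mi_partial 0 \<phi> x *\<^sub>R f x) = (- 1) ^ mi_size (0 :: nat^'a) *\<^sub>R (LINT x|lebesgue_on D. \<phi> x *\<^sub>R f x)"
  unfolding mi_partial_0[OF test_fun_smooth[OF \<phi>]] by simp
qed

locale open_domain =
 fixes D :: "(real^'d::finite) set"
 assumes open_D: "open D"
begin

lemma weak_deriv_works: "is_weak_deriv D I f g ==> is_weak_deriv D I f (weak_deriv D I f)"
 unfolding weak_deriv_def by (rule someI[of "is_weak_deriv D I f"])

lemma weak_deriv_AE: "is_weak_deriv D I f g ==> AE x in lebesgue_on D. weak_deriv D I f x = g x"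
 by (rule is_weak_deriv_unique[OF open_D weak_deriv_works])

lemma Lp_space_cong_AE:
 assumes p: "p \<in> {2, \<infinity>}" and f: "f \<in> Lp_space D p" and ae: "AE x in lebesgue_on D. f x = g x"
 shows "g \<in> Lp_space D p"
 by (rule Lp_dominated(1)[OF p measurable_lebesgue_on_cong_AE[OF open_D Lp_space_measurable[OF f] ae] f])
  (use ae in eventually_elim, simp)

text \<open>\<open>weak_deriv\<close> is a \<open>SOME\<close>-choice; membership in L^p is
  transferred to it from a witness by uniqueness almost everywhere.\<close>

lemma sobolevD:
 assumes p: "p \<in> {2, \<infinity>}" and v: "v \<in> sobolev D H p" and I: "mi_size I \<le> H"
 shows "is_weak_deriv D I v (weak_deriv D I v)" "weak_deriv D I v \<in> Lp_space D p"
proof -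
 obtain g where g: "g \<in> Lp_space D p" "is_weak_deriv D I v g" using v I by (auto simp: sobolev_def)
 show "is_weak_deriv D I v (weak_deriv D I v)" by (rule weak_deriv_works[OF g(2)])
 have "AE x in lebesgue_on D. g x = weak_deriv D I v x" using weak_deriv_AE[OF g(2)] by eventually_elim simp
 from Lp_space_cong_AE[OF p g(1) this] show "weak_deriv D I v \<in> Lp_space D p" .
qed

lemma sobolevI:
 assumes "!!I. mi_size I \<le> H ==> is_weak_deriv D I v (G I)" "!!I. mi_size I \<le> H ==> G I \<in> Lp_space D p"
 shows "v \<in> sobolev D H p"
 using assms by (auto simp: sobolev_def)

lemma wnorm_eqI:
 assumes p: "p \<in> {2, \<infinity>}"
  and "!!I. mi_size I \<le> H ==> is_weak_deriv D I v (G I)" "!!I. mi_size I \<le> H ==> G I \<in> Lp_space D p"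
 shows "wnorm D H p \<theta> v = (\<Sum>I | mi_size I \<le> H. \<theta> ^ mi_size I / real (mi_fact I) * Lp_norm D p (G I))"
 unfolding wnorm_def
proof (intro sum.cong refl arg_cong2[where f = "(*)"])
 fix I :: "nat^'d" assume "I \<in> {I. mi_size I \<le> H}"
 then have I: "mi_size I \<le> H" by simp
 have v: "v \<in> sobolev D H p" using assms by (intro sobolevI)
 show "Lp_norm D p (weak_deriv D I v) = Lp_norm D p (G I)"
  by (rule Lp_norm_cong_AE[OF p sobolevD(2)[OF p v I] assms(3)[OF I] weak_deriv_AE[OF assms(2)[OF I]]])
qed

lemma sobolev_locally_integrable: "v \<in> sobolev D H p ==> locally_integrable D v"
proof -
 assume "v \<in> sobolev D H p"
 then obtain g where "is_weak_deriv D 0 v g" unfolding sobolev_def by (force simp: mi_size_0)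
 then show "locally_integrable D v" by (simp add: is_weak_deriv_def)
qed

lemma sobolev_mono: "v \<in> sobolev D H p ==> H' \<le> H ==> v \<in> sobolev D H' p"
 unfolding sobolev_def by auto

lemma sobolev_Lp:
 assumes p: "p \<in> {2, \<infinity>}" and v: "v \<in> sobolev D H p"
 shows "v \<in> Lp_space D p"
 by (rule Lp_space_cong_AE[OF p sobolevD(2)[OF p v, of 0] weak_deriv_AE[OF is_weak_deriv_0[OF sobolev_locally_integrable[OF v]]]]) simp

lemma wnorm_nonneg: "p \<in> {2, \<infinity>} ==> 0 \<le> \<theta> ==> 0 \<le> wnorm D H p \<theta> v"
 unfolding wnorm_def by (intro sum_nonneg mult_nonneg_nonneg Lp_norm_nonneg) auto

lemma wnorm_mono_order:
 assumes "p \<in> {2, \<infinity>}" "0 \<le> \<theta>" "H' \<le> H"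
 shows "wnorm D H' p \<theta> v \<le> wnorm D H p \<theta> v"
 unfolding wnorm_def
 by (intro sum_mono2 mult_nonneg_nonneg Lp_norm_nonneg finite_mi_size) (use assms in auto)

lemma Lp_norm_le_wnorm:
 assumes p: "p \<in> {2, \<infinity>}" and v: "v \<in> sobolev D H p" and \<theta>: "0 \<le> \<theta>"
 shows "Lp_norm D p v \<le> wnorm D H p \<theta> v"
proof -
 have "Lp_norm D p v = Lp_norm D p (weak_deriv D 0 v)"
  using weak_deriv_AE[OF is_weak_deriv_0[OF sobolev_locally_integrable[OF v]]]
  by (intro Lp_norm_cong_AE[OF p sobolev_Lp[OF p v] sobolevD(2)[OF p v]]) auto
 also have "\<dots> = wnorm D 0 p \<theta> v" by (simp add: wnorm_def mi_size_eq_0 mi_fact_0)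
 also have "\<dots> \<le> wnorm D H p \<theta> v" by (rule wnorm_mono_order[OF p \<theta>]) simp
 finally show ?thesis .
qed

lemma sobolev_scaleR:
 assumes p: "p \<in> {2, \<infinity>}" and v: "v \<in> sobolev D H p"
 shows "(\<lambda>x. c *\<^sub>R v x) \<in> sobolev D H p"
  and "0 \<le> \<theta> ==> wnorm D H p \<theta> (\<lambda>x. c *\<^sub>R v x) \<le> \<bar>c\<bar> * wnorm D H p \<theta> v"
proof -
 have w: "is_weak_deriv D I (\<lambda>x. c *\<^sub>R v x) (\<lambda>x. c *\<^sub>R weak_deriv D I v x)"
  "(\<lambda>x. c *\<^sub>R weak_deriv D I v x) \<in> Lp_space D p" if "mi_size I \<le> H" for I
  using is_weak_deriv_scaleR[OF open_D sobolevD(1)[OF p v that]] Lp_scaleR(1)[OF p sobolevD(2)[OF p v that]] by auto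
 show "(\<lambda>x. c *\<^sub>R v x) \<in> sobolev D H p" using w by (rule sobolevI)
 assume \<theta>: "0 \<le> \<theta>"
 have eq: "wnorm D H p \<theta> (\<lambda>x. c *\<^sub>R v x) = (\<Sum>I | mi_size I \<le> H. \<theta> ^ mi_size I / real (mi_fact I) * Lp_norm D p (\<lambda>x. c *\<^sub>R weak_deriv D I v x))"
  by (rule wnorm_eqI[OF p w])
 show "wnorm D H p \<theta> (\<lambda>x. c *\<^sub>R v x) \<le> \<bar>c\<bar> * wnorm D H p \<theta> v"
  unfolding eq unfolding wnorm_def sum_distrib_left
 proof (rule sum_mono)
  fix I :: "nat^'d" assume "I \<in> {I. mi_size I \<le> H}"
  then have "Lp_norm D p (\<lambda>x. c *\<^sub>R weak_deriv D I v x) \<le> \<bar>c\<bar> * Lp_norm D p (weak_deriv D I v)"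
   using Lp_scaleR(2)[OF p sobolevD(2)[OF p v]] by simp
  then have "\<theta> ^ mi_size I / real (mi_fact I) * Lp_norm D p (\<lambda>x. c *\<^sub>R weak_deriv D I v x) \<le>
    \<theta> ^ mi_size I / real (mi_fact I) * (\<bar>c\<bar> * Lp_norm D p (weak_deriv D I v))"
   using \<theta> by (intro mult_left_mono) auto
  then show "\<theta> ^ mi_size I / real (mi_fact I) * Lp_norm D p (\<lambda>x. c *\<^sub>R weak_deriv D I v x) \<le>
    \<bar>c\<bar> * (\<theta> ^ mi_size I / real (mi_fact I) * Lp_norm D p (weak_deriv D I v))" by (simp only: mult.left_commute)
 qed
qed

lemma sobolev_add:
 assumes p: "p \<in> {2, \<infinity>}" and v: "v \<in> sobolev D H p" and w: "w \<in> sobolev D H p"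
 shows "(\<lambda>x. v x + w x) \<in> sobolev D H p"
  and "0 \<le> \<theta> ==> wnorm D H p \<theta> (\<lambda>x. v x + w x) \<le> wnorm D H p \<theta> v + wnorm D H p \<theta> w"
proof -
 have d: "is_weak_deriv D I (\<lambda>x. v x + w x) (\<lambda>x. weak_deriv D I v x + weak_deriv D I w x)"
  "(\<lambda>x. weak_deriv D I v x + weak_deriv D I w x) \<in> Lp_space D p" if "mi_size I \<le> H" for I
  using is_weak_deriv_add[OF open_D sobolevD(1)[OF p v that] sobolevD(1)[OF p w that]]
   Lp_add(1)[OF p sobolevD(2)[OF p v that] sobolevD(2)[OF p w that]] by auto
 show "(\<lambda>x. v x + w x) \<in> sobolev D H p" using d by (rule sobolevI)
 assume \<theta>: "0 \<le> \<theta>"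
 have eq: "wnorm D H p \<theta> (\<lambda>x. v x + w x) = (\<Sum>I | mi_size I \<le> H. \<theta> ^ mi_size I / real (mi_fact I) * Lp_norm D p (\<lambda>x. weak_deriv D I v x + weak_deriv D I w x))"
  by (rule wnorm_eqI[OF p d])
 show "wnorm D H p \<theta> (\<lambda>x. v x + w x) \<le> wnorm D H p \<theta> v + wnorm D H p \<theta> w"
  unfolding eq unfolding wnorm_def sum.distrib[symmetric] distrib_left[symmetric]
 proof (intro sum_mono mult_left_mono)
  fix I :: "nat^'d" assume "I \<in> {I. mi_size I \<le> H}"
  then show "Lp_norm D p (\<lambda>x. weak_deriv D I v x + weak_deriv D I w x) \<le>
    Lp_norm D p (weak_deriv D I v) + Lp_norm D p (weak_deriv D I w)"
   using Lp_add(2)[OF p sobolevD(2)[OF p v] sobolevD(2)[OF p w]] by simp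
 qed (use \<theta> in auto)
qed

lemma sobolev_zero:
 assumes p: "p \<in> {2, \<infinity>}"
 shows "(\<lambda>x. 0 :: 'b::euclidean_space) \<in> sobolev D H p" "wnorm D H p \<theta> (\<lambda>x. 0 :: 'b) = 0"
proof -
 show "(\<lambda>x. 0 :: 'b) \<in> sobolev D H p"
  by (rule sobolevI[where G = "\<lambda>_ _. 0"]) (auto intro: is_weak_deriv_zero Lp_zero[OF p])
 show "wnorm D H p \<theta> (\<lambda>x. 0 :: 'b) = 0"
  by (subst wnorm_eqI[OF p, where G = "\<lambda>_ _. 0"]) (auto intro: is_weak_deriv_zero simp: Lp_zero[OF p])
qed

lemma sobolev_sum:
 assumes p: "p \<in> {2, \<infinity>}" and \<theta>: "0 \<le> \<theta>" and "finite S" "!!s. s \<in> S ==> v s \<in> sobolev D H p"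
 shows "(\<lambda>x. \<Sum>s\<in>S. v s x) \<in> sobolev D H p \<and> wnorm D H p \<theta> (\<lambda>x. \<Sum>s\<in>S. v s x) \<le> (\<Sum>s\<in>S. wnorm D H p \<theta> (v s))"
 using assms(3,4)
proof (induction rule: finite_induct)
 case empty
 show ?case by (simp add: sobolev_zero[OF p])
next
 case (insert s S)
 then have a: "v s \<in> sobolev D H p" "(\<lambda>x. \<Sum>s\<in>S. v s x) \<in> sobolev D H p"
  "wnorm D H p \<theta> (\<lambda>x. \<Sum>s\<in>S. v s x) \<le> (\<Sum>s\<in>S. wnorm D H p \<theta> (v s))" by auto
 show ?case using sobolev_add(1)[OF p a(1,2)] sobolev_add(2)[OF p a(1,2) \<theta>] a(3) insert(1,2) by simp
qed

lemma sobolev_diff: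
 assumes p: "p \<in> {2, \<infinity>}" and v: "v \<in> sobolev D H p" and w: "w \<in> sobolev D H p"
 shows "(\<lambda>x. v x - w x) \<in> sobolev D H p"
  and "0 \<le> \<theta> ==> wnorm D H p \<theta> (\<lambda>x. v x - w x) \<le> wnorm D H p \<theta> v + wnorm D H p \<theta> w"
 using sobolev_add(1)[OF p v sobolev_scaleR(1)[OF p w, of "-1"]]
  sobolev_add(2)[OF p v sobolev_scaleR(1)[OF p w, of "-1"], of \<theta>] sobolev_scaleR(2)[OF p w, of \<theta> "-1"]
 by simp_all

lemma wnorm_cong_AE:
 assumes p: "p \<in> {2, \<infinity>}" and v: "v \<in> sobolev D H p" and w: "locally_integrable D w"
  and ae: "AE x in lebesgue_on D. v x = w x"
 shows "w \<in> sobolev D H p" "wnorm D H p \<theta> w = wnorm D H p \<theta> v"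
proof -
 have d: "is_weak_deriv D I w (weak_deriv D I v)" "weak_deriv D I v \<in> Lp_space D p" if I: "mi_size I \<le> H" for I
 proof -
  note wv = sobolevD(1)[OF p v I]
  then have "locally_integrable D (weak_deriv D I v)" by (simp add: is_weak_deriv_def)
  from is_weak_deriv_cong_AE[OF open_D wv w this ae] show "is_weak_deriv D I w (weak_deriv D I v)" by simp
 qed (rule sobolevD(2)[OF p v I])
 show "w \<in> sobolev D H p" using d by (rule sobolevI)
 show "wnorm D H p \<theta> w = wnorm D H p \<theta> v" unfolding wnorm_def[of D H p \<theta> v] by (rule wnorm_eqI[OF p d])
qed

lemma sobolev_linear:
 assumes p: "p \<in> {2, \<infinity>}" and v: "v \<in> sobolev D H p" and T: "bounded_linear T" "!!x. norm (T x) \<le> K * norm x"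
 shows "(\<lambda>x. T (v x)) \<in> sobolev D H p"
  and "0 \<le> \<theta> ==> K = 1 ==> wnorm D H p \<theta> (\<lambda>x. T (v x)) \<le> wnorm D H p \<theta> v"
proof -
 have m: "(\<lambda>x. T (weak_deriv D I v x)) \<in> borel_measurable (lebesgue_on D)" if "mi_size I \<le> H" for I
  using measurable_compose[OF Lp_space_measurable[OF sobolevD(2)[OF p v that]], of T borel]
   borel_measurable_continuous_onI[OF linear_continuous_on[OF T(1)]] by simp
 have le: "AE x in lebesgue_on D. norm (T (weak_deriv D I v x)) \<le> norm (K *\<^sub>R weak_deriv D I v x)" for I
 proof (rule AE_I2)
  fix x
  have "K * norm (weak_deriv D I v x) \<le> \<bar>K\<bar> * norm (weak_deriv D I v x)" by (intro mult_right_mono) auto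
  then show "norm (T (weak_deriv D I v x)) \<le> norm (K *\<^sub>R weak_deriv D I v x)"
   using T(2)[of "weak_deriv D I v x"] by simp
 qed
 have d: "is_weak_deriv D I (\<lambda>x. T (v x)) (\<lambda>x. T (weak_deriv D I v x))"
  "(\<lambda>x. T (weak_deriv D I v x)) \<in> Lp_space D p" if I: "mi_size I \<le> H" for I
  using is_weak_deriv_linear[OF open_D T(1) sobolevD(1)[OF p v I]]
   Lp_dominated(1)[OF p m[OF I] Lp_scaleR(1)[OF p sobolevD(2)[OF p v I]] le] by auto
 show "(\<lambda>x. T (v x)) \<in> sobolev D H p" using d by (rule sobolevI)
 assume \<theta>: "0 \<le> \<theta>" and K: "K = 1"
 have eq: "wnorm D H p \<theta> (\<lambda>x. T (v x)) = (\<Sum>I | mi_size I \<le> H. \<theta> ^ mi_size I / real (mi_fact I) * Lp_norm D p (\<lambda>x. T (weak_deriv D I v x)))"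
  by (rule wnorm_eqI[OF p d])
 show "wnorm D H p \<theta> (\<lambda>x. T (v x)) \<le> wnorm D H p \<theta> v"
  unfolding eq unfolding wnorm_def
 proof (intro sum_mono mult_left_mono)
  fix I :: "nat^'d" assume "I \<in> {I. mi_size I \<le> H}"
  then have I: "mi_size I \<le> H" by simp
  show "Lp_norm D p (\<lambda>x. T (weak_deriv D I v x)) \<le> Lp_norm D p (weak_deriv D I v)"
   using Lp_dominated(2)[OF p m[OF I] sobolevD(2)[OF p v I]] le[of I] K by simp
 qed (use \<theta> in auto)
qed

lemma is_weak_deriv_const_mi: "is_weak_deriv D I (\<lambda>x. c::real) (\<lambda>x. if I = 0 then c else 0)"
proof (induction I rule: mi_induct)
 case zero
 have "locally_integrable D (\<lambda>x. c)" using is_weak_deriv_const[OF open_D, of _ c] unfolding is_weak_deriv_def by blast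
 from is_weak_deriv_0[OF this] show ?case by simp
next
 case (step I i)
 have n: "I + axis i 1 ~= 0"
 proof
  assume "I + axis i 1 = 0"
  then have "(I + axis i 1) $ i = 0" by simp
  then show False by (simp add: axis_def)
 qed
 have "is_weak_deriv D (axis i 1) (\<lambda>x. if I = 0 then c else 0) (\<lambda>x. 0)"
  by (rule is_weak_deriv_const[OF open_D])
 from is_weak_deriv_compose[OF step this] show ?case using n by (simp only: if_False)
qed

lemma sobolev_const: "(\<lambda>x. c::real) \<in> sobolev D H \<infinity>"
proof (rule sobolevI)
 show "(\<lambda>x. if I = 0 then c else 0) \<in> Lp_space D \<infinity>" for I :: "nat^'d"
  by (rule Linf_le(1)[where B = "\<bar>c\<bar>"]) auto
qed (rule is_weak_deriv_const_mi)

text \<open>The factor stems from the factorial weights: 1/I! = (I_i + 1) / (I + e_i)!, and I_i + 1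
  \<le> H + 1. Two such steps later produce \<kappa> (\<kappa> + 1).\<close>

lemma sobolev_weak_deriv:
 assumes p: "p \<in> {2, \<infinity>}" and v: "v \<in> sobolev D (Suc H) p"
 shows "weak_deriv D (axis i 1) v \<in> sobolev D H p"
  and "sob_norm D H p (weak_deriv D (axis i 1) v) \<le> real (Suc H) * sob_norm D (Suc H) p v"
proof -
 let ?h = "weak_deriv D (axis i 1) v"
 have s: "mi_size (I + axis i 1) = Suc (mi_size I)" for I :: "nat^'d"
  unfolding mi_size_add mi_size_axis by simp
 have h: "is_weak_deriv D (axis i 1) v ?h" by (rule sobolevD(1)[OF p v]) (simp add: mi_size_axis[simplified])
 have d: "is_weak_deriv D I ?h (weak_deriv D (I + axis i 1) v)" "weak_deriv D (I + axis i 1) v \<in> Lp_space D p"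
  if I: "mi_size I \<le> H" for I
 proof -
  have a: "mi_size (I + axis i 1) \<le> Suc H" unfolding s using I by simp
  show "is_weak_deriv D I ?h (weak_deriv D (I + axis i 1) v)"
   by (rule is_weak_deriv_step'[OF h sobolevD(1)[OF p v a]])
  show "weak_deriv D (I + axis i 1) v \<in> Lp_space D p" by (rule sobolevD(2)[OF p v a])
 qed
 show "?h \<in> sobolev D H p" using d by (rule sobolevI)
 have eq: "wnorm D H p 1 ?h = (\<Sum>I | mi_size I \<le> H. 1 ^ mi_size I / real (mi_fact I) * Lp_norm D p (weak_deriv D (I + axis i 1) v))"
  by (rule wnorm_eqI[OF p d])
 have "sob_norm D H p ?h = (\<Sum>I | mi_size I \<le> H. 1 / real (mi_fact I) * Lp_norm D p (weak_deriv D (I + axis i 1) v))"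
  unfolding sob_norm_eq_wnorm eq by simp
 also have "\<dots> \<le> (\<Sum>I | mi_size I \<le> H. real (Suc H) * (1 / real (mi_fact (I + axis i 1)) * Lp_norm D p (weak_deriv D (I + axis i 1) v)))"
 proof (rule sum_mono)
  fix I :: "nat^'d" assume "I \<in> {I. mi_size I \<le> H}"
  then have "I $ i + 1 \<le> Suc H" using mi_nth_le_size[of I i] by simp
  then have "real (I $ i + 1) \<le> real (Suc H)" by (simp only: of_nat_le_iff)
  moreover have "1 / real (mi_fact I) = real (I $ i + 1) * (1 / real (mi_fact (I + axis i 1)))"
  proof -
   have "1 / F = k * (1 / (k * F))" if "k ~= 0" for k F :: real using that by simp
   then show ?thesis unfolding mi_fact_add_axis of_nat_mult by simp
  qed
  ultimately have "1 / real (mi_fact I) \<le> real (Suc H) * (1 / real (mi_fact (I + axis i 1)))"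
   using mult_right_mono[of "real (I $ i + 1)" "real (Suc H)" "1 / real (mi_fact (I + axis i 1))"] by simp
  then show "1 / real (mi_fact I) * Lp_norm D p (weak_deriv D (I + axis i 1) v) \<le>
   real (Suc H) * (1 / real (mi_fact (I + axis i 1)) * Lp_norm D p (weak_deriv D (I + axis i 1) v))"
   using mult_right_mono[OF _ Lp_norm_nonneg[OF p, of D "weak_deriv D (I + axis i 1) v"]] unfolding mult.assoc[symmetric] by blast
 qed
 also have "\<dots> = real (Suc H) * (\<Sum>J\<in>(\<lambda>I. I + axis i 1) ` {I. mi_size I \<le> H}. 1 / real (mi_fact J) * Lp_norm D p (weak_deriv D J v))"
  by (subst sum.reindex) (auto simp: sum_distrib_left inj_on_def)
 also have "\<dots> \<le> real (Suc H) * sob_norm D (Suc H) p v"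
  unfolding sob_norm_def
 proof (intro mult_left_mono sum_mono2 finite_mi_size)
  show "(\<lambda>I. I + axis i 1) ` {I. mi_size I \<le> H} \<subseteq> {I. mi_size I \<le> Suc H}" using s by force
 qed (simp_all add: Lp_norm_nonneg[OF p])
 finally show "sob_norm D H p ?h \<le> real (Suc H) * sob_norm D (Suc H) p v" .
qed

lemma sobolev_SucI:
 assumes v: "v \<in> Lp_space D p" "locally_integrable D v"
  and g: "!!i. is_weak_deriv D (axis i 1) v (g i)" "!!i. g i \<in> sobolev D H p"
 shows "v \<in> sobolev D (Suc H) p"
 unfolding sobolev_def
proof (intro CollectI allI impI)
 fix I :: "nat^'d" assume I: "mi_size I \<le> Suc H"
 show "\<exists>g\<in>Lp_space D p. is_weak_deriv D I v g"
 proof (cases "I = 0")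
  case True
  then show ?thesis using v is_weak_deriv_0 by blast
 next
  case False
  then obtain i where "I $ i ~= 0" by (auto simp: vec_eq_iff)
  then obtain J where J: "I = J + axis i 1" by (rule mi_decompose)
  then have "mi_size J \<le> H" using I unfolding J mi_size_add mi_size_axis by simp
  then obtain h where "h \<in> Lp_space D p" "is_weak_deriv D J (g i) h" using g(2)[of i] by (auto simp: sobolev_def)
  then show ?thesis unfolding J using is_weak_deriv_compose'[OF g(1)] by blast
 qed
qed

end

section \<open>Products and powers in Sobolev spaces\<close>

text \<open>The Taylor normalisation of a derivative. With it the Leibniz rule is a plain
  convolution over \<open>antidiag\<close>, without binomial coefficients.\<close>

definition nd :: "(real^'d::finite) set => nat^'d => (real^'d => 'b::euclidean_space) => real^'d => 'b" where
 "nd D I f x = (1 / real (mi_fact I)) *\<^sub>R weak_deriv D I f x"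

lemma Lp_norm_scale_pos:
 assumes p: "p \<in> {2, \<infinity>}" and f: "f \<in> Lp_space D p" and c: "c > 0"
 shows "Lp_norm D p (\<lambda>x. c *\<^sub>R f x) = c * Lp_norm D p f"
proof (rule antisym)
 show "Lp_norm D p (\<lambda>x. c *\<^sub>R f x) \<le> c * Lp_norm D p f" using Lp_scaleR(2)[OF p f, of c] c by simp
 have "Lp_norm D p (\<lambda>x. inverse c *\<^sub>R (c *\<^sub>R f x)) \<le> \<bar>inverse c\<bar> * Lp_norm D p (\<lambda>x. c *\<^sub>R f x)"
  by (rule Lp_scaleR(2)[OF p Lp_scaleR(1)[OF p f]])
 then have "Lp_norm D p f \<le> inverse c * Lp_norm D p (\<lambda>x. c *\<^sub>R f x)" using c by simp
 then show "c * Lp_norm D p f \<le> Lp_norm D p (\<lambda>x. c *\<^sub>R f x)" using c by (simp add: field_simps)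
qed

text \<open>Compares coefficients in \<open>s \<partial>\<rho> = q (\<partial>s) \<rho>\<close>, the equation satisfied by \<open>\<rho> = s\<^sup>q\<close>.\<close>

lemma power_coefficient_recursion:
 fixes s \<rho> :: "nat^'n::finite => real"
 assumes ode: "(\<Sum>(A, E)\<in>antidiag J. real (E $ k + 1) * (s A * \<rho> (E + axis k 1))) =
   q * (\<Sum>(A, E)\<in>antidiag J. real (A $ k + 1) * (s (A + axis k 1) * \<rho> E))"
  and b: "b = J + axis k 1"
 shows "s 0 * \<rho> b = (\<Sum>(A, E)\<in>antidiag b - {(0, b)}. ((q * real (A $ k) - real (E $ k)) / real (b $ k)) * (s A * \<rho> E))"
proof -
 have bk: "real (b $ k) > 0" by (simp add: b axis_def)
 have "(\<Sum>(A, E)\<in>antidiag b. real (E $ k) * (s A * \<rho> E)) = q * (\<Sum>(A, E)\<in>antidiag b. real (A $ k) * (s A * \<rho> E))"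
  using ode sum_antidiag_fst[where h = "\<lambda>A E. s A * \<rho> E" and J = J and k = k]
   sum_antidiag_snd[where h = "\<lambda>A E. s A * \<rho> E" and J = J and k = k] unfolding b by simp
 then have "real (b $ k) * (s 0 * \<rho> b) + (\<Sum>(A, E)\<in>antidiag b - {(0, b)}. real (E $ k) * (s A * \<rho> E)) =
   q * (\<Sum>(A, E)\<in>antidiag b - {(0, b)}. real (A $ k) * (s A * \<rho> E))"
  by (subst (asm) (1 2) sum_antidiag_remove0) simp
 then have "real (b $ k) * (s 0 * \<rho> b) =
   (\<Sum>(A, E)\<in>antidiag b - {(0, b)}. (q * real (A $ k) - real (E $ k)) * (s A * \<rho> E))"
  by (simp add: sum_distrib_left case_prod_unfold left_diff_distrib sum_subtractf mult.assoc)
 then have "s 0 * \<rho> b = (\<Sum>(A, E)\<in>antidiag b - {(0, b)}. (q * real (A $ k) - real (E $ k)) * (s A * \<rho> E)) / real (b $ k)"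
  using bk by (simp add: field_simps)
 then show ?thesis by (simp add: sum_divide_distrib case_prod_unfold)
qed

text \<open>As b_k = A_k + E_k, the numerator lies between -b_k and 0 exactly because -1 \<le> q
  \<le> 0. The recursion for such powers therefore has coefficients of modulus at most 1.\<close>

lemma power_coefficient_le:
 assumes "(A, E) \<in> antidiag b" "b $ k ~= 0" "-1 \<le> q" "q \<le> 0"
 shows "\<bar>(q * real (A $ k) - real (E $ k)) / real (b $ k)\<bar> \<le> 1"
proof -
 have "(A + E) $ k = b $ k" using assms(1) by (simp add: antidiag_def)
 then have "real (b $ k) = real (A $ k) + real (E $ k)" by (metis of_nat_add vector_add_component)
 moreover have "- real (A $ k) \<le> q * real (A $ k)" "q * real (A $ k) \<le> 0"
  using assms(3,4) mult_right_mono[of "-1" q "real (A $ k)"] by (auto simp: mult_le_0_iff)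
 ultimately have "\<bar>q * real (A $ k) - real (E $ k)\<bar> \<le> real (b $ k)" by linarith
 then show ?thesis using assms(2) by (simp add: divide_le_eq)
qed

context open_domain
begin

lemma nd_Lp:
 assumes p: "p \<in> {2, \<infinity>}" and f: "f \<in> sobolev D H p" and I: "mi_size I \<le> H"
 shows "nd D I f \<in> Lp_space D p" "Lp_norm D p (nd D I f) = 1 / real (mi_fact I) * Lp_norm D p (weak_deriv D I f)"
 unfolding nd_def[abs_def]
 using Lp_scaleR(1)[OF p sobolevD(2)[OF p f I]] Lp_norm_scale_pos[OF p sobolevD(2)[OF p f I], of "1 / real (mi_fact I)"] mi_fact_pos[of I]
 by auto

lemma wnorm_nd:
 assumes p: "p \<in> {2, \<infinity>}" and f: "f \<in> sobolev D H p"
 shows "wnorm D H p \<theta> f = (\<Sum>I | mi_size I \<le> H. \<theta> ^ mi_size I * Lp_norm D p (nd D I f))"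
 unfolding wnorm_def by (intro sum.cong refl) (simp add: nd_Lp(2)[OF p f])

lemma nd_AE:
 assumes "is_weak_deriv D I f (\<lambda>x. real (mi_fact I) *\<^sub>R g x)"
 shows "AE x in lebesgue_on D. nd D I f x = g x"
 using weak_deriv_AE[OF assms] by eventually_elim (use mi_fact_pos[of I] in \<open>simp add: nd_def\<close>)

lemma nd_0_AE: "locally_integrable D f ==> AE x in lebesgue_on D. nd D 0 f x = f x"
 using nd_AE[of 0 f f] by (simp add: mi_fact_0 is_weak_deriv_0)

lemma nd_step:
 assumes p: "p \<in> {2, \<infinity>}" and f: "f \<in> sobolev D H p" and I: "mi_size I < H"
 shows "is_weak_deriv D (axis k 1) (nd D I f) (\<lambda>x. real (I $ k + 1) *\<^sub>R nd D (I + axis k 1) f x)"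
proof -
 have a: "mi_size (I + axis k 1) \<le> H" unfolding mi_size_add mi_size_axis using I by simp
 have "is_weak_deriv D (axis k 1) (weak_deriv D I f) (weak_deriv D (I + axis k 1) f)"
  by (rule is_weak_deriv_step[OF sobolevD(1)[OF p f] sobolevD(1)[OF p f a]]) (use I in simp)
 from is_weak_deriv_scaleR[OF open_D this, of "1 / real (mi_fact I)"]
 have "is_weak_deriv D (axis k 1) (nd D I f) (\<lambda>x. (1 / real (mi_fact I)) *\<^sub>R weak_deriv D (I + axis k 1) f x)"
  unfolding nd_def[abs_def] .
 moreover have "1 / F = c * (1 / (c * F))" if "c ~= 0" for c F :: real using that by simp
 then have "1 / real (mi_fact I) = real (I $ k + 1) * (1 / real (mi_fact (I + axis k 1)))"
  unfolding mi_fact_add_axis of_nat_mult by simp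
 ultimately show ?thesis unfolding nd_def by simp
qed

text \<open>One more derivative, taken termwise by the product rule, gives two shifted sums which
  \<open>sum_antidiag_derivation\<close> reassembles. Only f must have bounded derivatives; g may
  belong to the L^2 scale.\<close>

lemma is_weak_deriv_Leibniz:
 fixes f g :: "real^'d => real"
 assumes p: "p \<in> {2, \<infinity>}" and f: "f \<in> sobolev D H \<infinity>" and g: "g \<in> sobolev D H p"
 shows "mi_size J \<le> H --> is_weak_deriv D J (\<lambda>x. f x * g x)
  (\<lambda>x. real (mi_fact J) *\<^sub>R (\<Sum>(A, E)\<in>antidiag J. nd D A f x * nd D E g x))"
proof (induction J rule: mi_induct)
 case zero
 have inf: "\<infinity> \<in> {2, \<infinity>::ereal}" by simp
 have lf: "locally_integrable D f" "locally_integrable D g" using f g by (auto intro: sobolev_locally_integrable)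
 have "AE x in lebesgue_on D. \<bar>f x\<bar> \<le> Lp_norm D \<infinity> f" using Linf_AE[OF sobolev_Lp[OF inf f]] by simp
 then have l: "locally_integrable D (\<lambda>x. f x * g x)" by (rule locally_integrable_mult[OF open_D lf])
 have f0: "nd D 0 f \<in> Lp_space D \<infinity>" using nd_Lp(1)[OF inf f, of 0] by simp
 have g0: "nd D 0 g \<in> Lp_space D p" using nd_Lp(1)[OF p g, of 0] by simp
 have l0: "locally_integrable D (\<lambda>x. nd D 0 f x * nd D 0 g x)"
  by (rule Lp_locally_integrable[OF open_D p Lp_mult(1)[OF p f0 g0]])
 have ae: "AE x in lebesgue_on D. f x * g x = nd D 0 f x * nd D 0 g x"
  using nd_0_AE[OF lf(1)] nd_0_AE[OF lf(2)] by eventually_elim simp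
 have "is_weak_deriv D 0 (\<lambda>x. f x * g x) (\<lambda>x. nd D 0 f x * nd D 0 g x)"
  by (rule is_weak_deriv_cong_AE[OF open_D is_weak_deriv_0[OF l] l l0 _ ae]) simp
 then show ?case by (simp add: antidiag_0 mi_fact_0)
next
 case (step J k)
 have inf: "\<infinity> \<in> {2, \<infinity>::ereal}" by simp
 show ?case
 proof
  assume b: "mi_size (J + axis k 1) \<le> H"
  then have J: "mi_size J < H" unfolding mi_size_add mi_size_axis by simp
  have IH: "is_weak_deriv D J (\<lambda>x. f x * g x) (\<lambda>x. real (mi_fact J) *\<^sub>R (\<Sum>(A, E)\<in>antidiag J. nd D A f x * nd D E g x))"
   using step J by simp
  have "is_weak_deriv D (axis k 1) (\<lambda>x. nd D A f x * nd D E g x)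
    (\<lambda>x. (real (A $ k + 1) *\<^sub>R nd D (A + axis k 1) f x) * nd D E g x + nd D A f x * (real (E $ k + 1) *\<^sub>R nd D (E + axis k 1) g x))"
   if "(A, E) \<in> antidiag J" for A E
  proof -
   have s: "mi_size A < H" "mi_size E < H" using that J by (auto simp: antidiag_def mi_size_add)
   have s1: "mi_size (A + axis k 1) \<le> H" unfolding mi_size_add mi_size_axis using s by simp
   have a: "nd D A f \<in> Lp_space D \<infinity>" "(\<lambda>x. real (A $ k + 1) *\<^sub>R nd D (A + axis k 1) f x) \<in> Lp_space D \<infinity>"
    using nd_Lp(1)[OF inf f, of A] Lp_scaleR(1)[OF inf nd_Lp(1)[OF inf f s1]] s by auto
   show ?thesis
    by (rule is_weak_deriv_mult[OF open_D nd_step[OF inf f s(1)] nd_step[OF p g s(2)]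
      Linf_AE[OF a(1), unfolded real_norm_def] Linf_AE[OF a(2), unfolded real_norm_def]])
  qed
  then have "is_weak_deriv D (axis k 1) (\<lambda>x. \<Sum>q\<in>antidiag J. nd D (fst q) f x * nd D (snd q) g x)
    (\<lambda>x. \<Sum>q\<in>antidiag J. (real (fst q $ k + 1) *\<^sub>R nd D (fst q + axis k 1) f x) * nd D (snd q) g x +
     nd D (fst q) f x * (real (snd q $ k + 1) *\<^sub>R nd D (snd q + axis k 1) g x))"
   by (intro is_weak_deriv_sum[OF open_D finite_antidiag]) auto
  from is_weak_deriv_compose[OF IH[unfolded case_prod_unfold] is_weak_deriv_scaleR[OF open_D this]]
  have d: "is_weak_deriv D (J + axis k 1) (\<lambda>x. f x * g x) (\<lambda>x. real (mi_fact J) *\<^sub>R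
    (\<Sum>q\<in>antidiag J. (real (fst q $ k + 1) *\<^sub>R nd D (fst q + axis k 1) f x) * nd D (snd q) g x +
     nd D (fst q) f x * (real (snd q $ k + 1) *\<^sub>R nd D (snd q + axis k 1) g x)))"
   by (simp add: case_prod_unfold)
  have eq: "(\<Sum>q\<in>antidiag J. (real (fst q $ k + 1) *\<^sub>R nd D (fst q + axis k 1) f x) * nd D (snd q) g x +
     nd D (fst q) f x * (real (snd q $ k + 1) *\<^sub>R nd D (snd q + axis k 1) g x)) =
   real (J $ k + 1) *\<^sub>R (\<Sum>(A, E)\<in>antidiag (J + axis k 1). nd D A f x * nd D E g x)" for x
   unfolding sum_antidiag_derivation by (simp add: case_prod_unfold algebra_simps)
  show "is_weak_deriv D (J + axis k 1) (\<lambda>x. f x * g x)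
    (\<lambda>x. real (mi_fact (J + axis k 1)) *\<^sub>R (\<Sum>(A, E)\<in>antidiag (J + axis k 1). nd D A f x * nd D E g x))"
   using d unfolding eq scaleR_scaleR mi_fact_add_axis of_nat_mult by (simp only: mult.commute)
 qed
qed

lemma nd_mult_AE:
 fixes f g :: "real^'d => real"
 assumes p: "p \<in> {2, \<infinity>}" and f: "f \<in> sobolev D H \<infinity>" and g: "g \<in> sobolev D H p" and J: "mi_size J \<le> H"
 shows "AE x in lebesgue_on D. nd D J (\<lambda>x. f x * g x) x = (\<Sum>(A, E)\<in>antidiag J. nd D A f x * nd D E g x)"
 by (rule nd_AE) (use is_weak_deriv_Leibniz[OF p f g] J in blast)

text \<open>The common core of \<open>sobolev_mult\<close> and \<open>sobolev_inner\<close>: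
  whatever product P A E stands in the Leibniz sum, the weight \<theta>^|J| splits over A + E = J,
  and the truncated Cauchy product is at most the full one.\<close>

lemma wnorm_conv_le:
 assumes p: "p \<in> {2, \<infinity>}" and \<theta>: "0 \<le> \<theta>" and h: "h \<in> sobolev D H p"
  and ae: "!!J. mi_size J \<le> H ==> AE x in lebesgue_on D. nd D J h x = (\<Sum>(A, E)\<in>antidiag J. P A E x)"
  and P: "!!A E. mi_size A \<le> H ==> mi_size E \<le> H ==> P A E \<in> Lp_space D p \<and> Lp_norm D p (P A E) \<le> F A * G E"
  and FG: "!!A. F A \<ge> 0" "!!E. G E \<ge> 0"
 shows "wnorm D H p \<theta> h \<le> (\<Sum>A | mi_size A \<le> H. \<theta> ^ mi_size A * F A) * (\<Sum>E | mi_size E \<le> H. \<theta> ^ mi_size E * G E)"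
proof -
 have "wnorm D H p \<theta> h \<le> (\<Sum>J | mi_size J \<le> H. \<Sum>(A, E)\<in>antidiag J. (\<theta> ^ mi_size A * F A) * (\<theta> ^ mi_size E * G E))"
  unfolding wnorm_nd[OF p h]
 proof (rule sum_mono)
  fix J :: "nat^'d" assume "J \<in> {I. mi_size I \<le> H}"
  then have J: "mi_size J \<le> H" by simp
  have q: "mi_size (fst q) \<le> H" "mi_size (snd q) \<le> H" "mi_size (fst q) + mi_size (snd q) = mi_size J" if "q \<in> antidiag J" for q
   using that J by (auto simp: antidiag_def mi_size_add)
  have S: "(\<lambda>x. \<Sum>q\<in>antidiag J. P (fst q) (snd q) x) \<in> Lp_space D p \<and>
    Lp_norm D p (\<lambda>x. \<Sum>q\<in>antidiag J. P (fst q) (snd q) x) \<le> (\<Sum>q\<in>antidiag J. Lp_norm D p (P (fst q) (snd q)))"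
   by (rule Lp_sum[OF p finite_antidiag]) (use P q in blast)
  have "Lp_norm D p (nd D J h) = Lp_norm D p (\<lambda>x. \<Sum>q\<in>antidiag J. P (fst q) (snd q) x)"
   by (rule Lp_norm_cong_AE[OF p nd_Lp(1)[OF p h J] conjunct1[OF S]]) (use ae[OF J] in \<open>simp add: case_prod_unfold\<close>)
  also have "\<dots> \<le> (\<Sum>q\<in>antidiag J. Lp_norm D p (P (fst q) (snd q)))" using S by simp
  also have "\<dots> \<le> (\<Sum>q\<in>antidiag J. F (fst q) * G (snd q))" by (rule sum_mono) (use P q in blast)
  finally have "\<theta> ^ mi_size J * Lp_norm D p (nd D J h) \<le> \<theta> ^ mi_size J * (\<Sum>q\<in>antidiag J. F (fst q) * G (snd q))"
   using \<theta> by (intro mult_left_mono) auto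
  also have "\<dots> = (\<Sum>q\<in>antidiag J. (\<theta> ^ mi_size (fst q) * F (fst q)) * (\<theta> ^ mi_size (snd q) * G (snd q)))"
   unfolding sum_distrib_left
  proof (rule sum.cong[OF refl])
   fix q assume "q \<in> antidiag J"
   then show "\<theta> ^ mi_size J * (F (fst q) * G (snd q)) = (\<theta> ^ mi_size (fst q) * F (fst q)) * (\<theta> ^ mi_size (snd q) * G (snd q))"
    using q(3)[symmetric] by (simp add: power_add mult.commute mult.left_commute)
  qed
  finally show "\<theta> ^ mi_size J * Lp_norm D p (nd D J h) \<le> (\<Sum>(A, E)\<in>antidiag J. (\<theta> ^ mi_size A * F A) * (\<theta> ^ mi_size E * G E))"
   by (simp add: case_prod_unfold)
 qed
 also have "\<dots> \<le> (\<Sum>A | mi_size A \<le> H. \<Sum>E | mi_size E \<le> H. (\<theta> ^ mi_size A * F A) * (\<theta> ^ mi_size E * G E))"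
  by (rule sum_antidiag_le_prod) (use \<theta> FG in auto)
 finally show ?thesis by (simp add: sum_product)
qed

lemma sobolev_mult:
 fixes f g :: "real^'d => real"
 assumes p: "p \<in> {2, \<infinity>}" and f: "f \<in> sobolev D H \<infinity>" and g: "g \<in> sobolev D H p"
 shows "(\<lambda>x. f x * g x) \<in> sobolev D H p"
  and "0 \<le> \<theta> ==> wnorm D H p \<theta> (\<lambda>x. f x * g x) \<le> wnorm D H \<infinity> \<theta> f * wnorm D H p \<theta> g"
proof -
 have inf: "\<infinity> \<in> {2, \<infinity>::ereal}" by simp
 show s: "(\<lambda>x. f x * g x) \<in> sobolev D H p"
 proof (rule sobolevI)
  fix J :: "nat^'d" assume J: "mi_size J \<le> H"
  show "is_weak_deriv D J (\<lambda>x. f x * g x) (\<lambda>x. real (mi_fact J) *\<^sub>R (\<Sum>(A, E)\<in>antidiag J. nd D A f x * nd D E g x))"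
   using is_weak_deriv_Leibniz[OF p f g] J by blast
  have "(\<lambda>x. \<Sum>q\<in>antidiag J. nd D (fst q) f x * nd D (snd q) g x) \<in> Lp_space D p"
  proof (rule conjunct1[OF Lp_sum[OF p finite_antidiag]])
   fix q assume "q \<in> antidiag J"
   then have "mi_size (fst q) \<le> H" "mi_size (snd q) \<le> H" using J by (auto simp: antidiag_def mi_size_add)
   then show "(\<lambda>x. nd D (fst q) f x * nd D (snd q) g x) \<in> Lp_space D p"
    by (intro Lp_mult(1)[OF p] nd_Lp(1)[OF inf f] nd_Lp(1)[OF p g])
  qed
  from Lp_scaleR(1)[OF p this]
  show "(\<lambda>x. real (mi_fact J) *\<^sub>R (\<Sum>(A, E)\<in>antidiag J. nd D A f x * nd D E g x)) \<in> Lp_space D p"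
   by (simp only: case_prod_unfold)
 qed
 assume \<theta>: "0 \<le> \<theta>"
 show "wnorm D H p \<theta> (\<lambda>x. f x * g x) \<le> wnorm D H \<infinity> \<theta> f * wnorm D H p \<theta> g"
  unfolding wnorm_nd[OF inf f] wnorm_nd[OF p g]
  by (rule wnorm_conv_le[OF p \<theta> s nd_mult_AE[OF p f g]])
   (use Lp_mult[OF p nd_Lp(1)[OF inf f] nd_Lp(1)[OF p g]] Lp_norm_nonneg[OF inf] Lp_norm_nonneg[OF p] in auto)
qed

lemma nd_nth_AE:
 fixes f :: "real^'d => real^'n::finite"
 assumes f: "f \<in> sobolev D H \<infinity>" and I: "mi_size I \<le> H"
 shows "AE x in lebesgue_on D. nd D I (\<lambda>x. f x $ i) x = nd D I f x $ i"
proof (rule nd_AE)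
 have "is_weak_deriv D I (\<lambda>x. f x $ i) (\<lambda>x. weak_deriv D I f x $ i)"
  by (rule is_weak_deriv_linear[OF open_D bounded_linear_vec_nth sobolevD(1)[OF _ f I]]) simp
 then show "is_weak_deriv D I (\<lambda>x. f x $ i) (\<lambda>x. real (mi_fact I) *\<^sub>R (nd D I f x $ i))"
  using mi_fact_pos[of I] by (simp add: nd_def)
qed

lemma sobolev_nth:
 fixes f :: "real^'d => real^'n::finite"
 assumes f: "f \<in> sobolev D H \<infinity>"
 shows "(\<lambda>x. f x $ i) \<in> sobolev D H \<infinity>" "0 \<le> \<theta> ==> wnorm D H \<infinity> \<theta> (\<lambda>x. f x $ i) \<le> wnorm D H \<infinity> \<theta> f"
 using sobolev_linear[OF _ f bounded_linear_vec_nth, where K = 1] by (auto simp: component_le_norm_cart)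

text \<open>Going through the components would cost a factor of the dimension. Cauchy-Schwarz on
  each Leibniz term keeps the constant 1, so that V \<bullet> V has norm at most c^2.\<close>

lemma sobolev_inner:
 fixes f g :: "real^'d => real^'n::finite"
 assumes f: "f \<in> sobolev D H \<infinity>" and g: "g \<in> sobolev D H \<infinity>"
 shows "(\<lambda>x. f x \<bullet> g x) \<in> sobolev D H \<infinity>"
  and "0 \<le> \<theta> ==> wnorm D H \<infinity> \<theta> (\<lambda>x. f x \<bullet> g x) \<le> wnorm D H \<infinity> \<theta> f * wnorm D H \<infinity> \<theta> g"
proof -
 have inf: "\<infinity> \<in> {2, \<infinity>::ereal}" by simp
 have eq: "(\<lambda>x. f x \<bullet> g x) = (\<lambda>x. \<Sum>i\<in>UNIV. f x $ i * g x $ i)" by (simp add: inner_vec_def)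
 have m: "(\<lambda>x. f x $ i * g x $ i) \<in> sobolev D H \<infinity>" for i
  by (intro sobolev_mult(1)[OF inf] sobolev_nth f g)
 then show s: "(\<lambda>x. f x \<bullet> g x) \<in> sobolev D H \<infinity>"
  unfolding eq using sobolev_sum[OF inf, of 0 UNIV "\<lambda>i x. f x $ i * g x $ i"] by simp
 have ae: "AE x in lebesgue_on D. nd D J (\<lambda>x. f x \<bullet> g x) x = (\<Sum>(A, E)\<in>antidiag J. nd D A f x \<bullet> nd D E g x)"
  if J: "mi_size J \<le> H" for J
 proof -
  have w: "is_weak_deriv D J (\<lambda>x. f x \<bullet> g x) (\<lambda>x. \<Sum>i\<in>UNIV. weak_deriv D J (\<lambda>x. f x $ i * g x $ i) x)"
   unfolding eq by (rule is_weak_deriv_sum[OF open_D]) (auto intro: sobolevD(1)[OF inf m J])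
  have 1: "AE x in lebesgue_on D. nd D J (\<lambda>x. f x \<bullet> g x) x = (\<Sum>i\<in>UNIV. nd D J (\<lambda>x. f x $ i * g x $ i) x)"
   using weak_deriv_AE[OF w] by eventually_elim (simp add: nd_def sum_divide_distrib)
  have 2: "AE x in lebesgue_on D. \<forall>i\<in>UNIV. nd D J (\<lambda>x. f x $ i * g x $ i) x =
    (\<Sum>(A, E)\<in>antidiag J. nd D A (\<lambda>x. f x $ i) x * nd D E (\<lambda>x. g x $ i) x)"
   by (intro AE_finite_allI) (auto intro!: nd_mult_AE[OF inf _ _ J] sobolev_nth f g)
  have 3: "AE x in lebesgue_on D. \<forall>q\<in>antidiag J. \<forall>i\<in>UNIV. nd D (fst q) (\<lambda>x. f x $ i) x = nd D (fst q) f x $ i \<and>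
    nd D (snd q) (\<lambda>x. g x $ i) x = nd D (snd q) g x $ i"
  proof (intro AE_finite_allI finite_antidiag finite)
   fix q i assume "q \<in> antidiag J"
   then have "mi_size (fst q) \<le> H" "mi_size (snd q) \<le> H" using J by (auto simp: antidiag_def mi_size_add)
   from nd_nth_AE[OF f this(1), of i] nd_nth_AE[OF g this(2), of i]
   show "AE x in lebesgue_on D. nd D (fst q) (\<lambda>x. f x $ i) x = nd D (fst q) f x $ i \<and>
    nd D (snd q) (\<lambda>x. g x $ i) x = nd D (snd q) g x $ i" by eventually_elim simp
  qed
  show ?thesis using 1 2 3
  proof eventually_elim
   case (elim x)
   have "nd D J (\<lambda>x. f x \<bullet> g x) x = (\<Sum>i\<in>UNIV. \<Sum>q\<in>antidiag J. nd D (fst q) f x $ i * nd D (snd q) g x $ i)"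
    using elim by (simp add: case_prod_unfold)
   also have "\<dots> = (\<Sum>q\<in>antidiag J. \<Sum>i\<in>UNIV. nd D (fst q) f x $ i * nd D (snd q) g x $ i)" by (rule sum.swap)
   also have "\<dots> = (\<Sum>(A, E)\<in>antidiag J. nd D A f x \<bullet> nd D E g x)" by (simp add: inner_vec_def case_prod_unfold)
   finally show ?case .
  qed
 qed
 assume \<theta>: "0 \<le> \<theta>"
 show "wnorm D H \<infinity> \<theta> (\<lambda>x. f x \<bullet> g x) \<le> wnorm D H \<infinity> \<theta> f * wnorm D H \<infinity> \<theta> g"
  unfolding wnorm_nd[OF inf f] wnorm_nd[OF inf g]
  by (rule wnorm_conv_le[OF inf \<theta> s ae])
   (use Lp_inner[OF nd_Lp(1)[OF inf f] nd_Lp(1)[OF inf g]] Lp_norm_nonneg[OF inf] in auto)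
qed

text \<open>The derivative of s^q contains s^(q-1), so the induction on the order is over all
  exponents at once.\<close>

lemma sobolev_powr:
 fixes s :: "real^'d => real" and A q :: real
 assumes A: "0 < A"
 shows "s \<in> sobolev D H \<infinity> ==> AE x in lebesgue_on D. A \<le> s x ==> (\<lambda>x. s x powr q) \<in> sobolev D H \<infinity>"
proof (induction H arbitrary: q)
 case 0
 have inf: "\<infinity> \<in> {2, \<infinity>::ereal}" by simp
 let ?M = "Lp_norm D \<infinity> s"
 note sL = sobolev_Lp[OF inf 0(1)]
 have "bounded ((\<lambda>t. t powr q) ` {A..?M})"
  by (intro compact_imp_bounded compact_continuous_image compact_Icc continuous_intros) (use A in auto)
 then obtain C where C: "\<forall>t\<in>{A..?M}. \<bar>t powr q\<bar> \<le> C" unfolding bounded_iff real_norm_def ball_simps by blast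
 have m: "(\<lambda>x. s x powr q) \<in> borel_measurable (lebesgue_on D)" using Lp_space_measurable[OF sL] by simp
 have "AE x in lebesgue_on D. norm (s x powr q) \<le> max C 0"
  using 0(2) Linf_AE[OF sL]
 proof eventually_elim
  case (elim x)
  then have "s x \<in> {A..?M}" by auto
  then show ?case using C by (metis le_max_iff_disj real_norm_def)
 qed
 from Linf_le(1)[OF m this] have L: "(\<lambda>x. s x powr q) \<in> Lp_space D \<infinity>" by simp
 show ?case
 proof (rule sobolevI[where G = "\<lambda>_ x. s x powr q"])
  fix I :: "nat^'d" assume "mi_size I \<le> 0"
  then have "I = 0" by (simp add: mi_size_eq_0)
  then show "is_weak_deriv D I (\<lambda>x. s x powr q) (\<lambda>x. s x powr q)"
   using is_weak_deriv_0 Lp_locally_integrable[OF open_D inf L] by blast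
 qed (rule L)
next
 case (Suc H)
 have inf: "\<infinity> \<in> {2, \<infinity>::ereal}" by simp
 have s: "s \<in> sobolev D H \<infinity>" by (rule sobolev_mono[OF Suc.prems(1)]) simp
 note IH = Suc.IH[OF s Suc.prems(2)]
 have L: "(\<lambda>x. s x powr q) \<in> Lp_space D \<infinity>" by (rule sobolev_Lp[OF inf IH])
 let ?M = "Lp_norm D \<infinity> s"
 have sb: "AE x in lebesgue_on D. s x \<in> {A..?M}"
  using Suc.prems(2) Linf_AE[OF sobolev_Lp[OF inf s]] by eventually_elim auto
 show ?case
 proof (rule sobolev_SucI[OF L Lp_locally_integrable[OF open_D inf L]])
  fix i
  have 1: "mi_size (axis i 1 :: nat^'d) \<le> Suc H" by (simp add: mi_size_axis[simplified])
  note w = sobolevD[OF inf Suc.prems(1) 1]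
  show "is_weak_deriv D (axis i 1) (\<lambda>x. s x powr q) (\<lambda>x. (q * s x powr (q - 1)) * weak_deriv D (axis i 1) s x)"
  proof (rule is_weak_deriv_chain[OF open_D w(1) sb Linf_AE[OF w(2), unfolded real_norm_def]])
   fix t assume t: "t \<in> {A..?M}"
   have "((\<lambda>t. t powr q) has_real_derivative q * t powr (q - 1)) (at t)"
    by (rule has_real_derivative_powr) (use t A in auto)
   then show "((\<lambda>t. t powr q) has_real_derivative q * t powr (q - 1)) (at t within {A..?M})"
    by (rule has_field_derivative_at_within)
  next
   show "continuous_on {A..?M} (\<lambda>t. q * t powr (q - 1))" by (intro continuous_intros) (use A in auto)
  qed auto
  have "(\<lambda>x. (q *\<^sub>R s x powr (q - 1)) * weak_deriv D (axis i 1) s x) \<in> sobolev D H \<infinity>"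
   by (intro sobolev_mult(1)[OF inf] sobolev_scaleR(1)[OF inf] IH sobolev_weak_deriv(1)[OF inf Suc.prems(1)])
  then show "(\<lambda>x. (q * s x powr (q - 1)) * weak_deriv D (axis i 1) s x) \<in> sobolev D H \<infinity>" by simp
 qed
qed

end

context open_domain
begin

text \<open>Removing the weight costs one factor 1/\<theta> per order. With 1/\<theta> = 2 c^2 /
  a_lo^2 this is the source of the power (2 c^2 / a_lo^2)^\<kappa> in the constants.\<close>

lemma wnorm_weight_le:
 assumes p: "p \<in> {2, \<infinity>}" and \<theta>: "0 < \<theta>" "\<theta> \<le> 1"
 shows "wnorm D H p 1 f \<le> (1 / \<theta>) ^ H * wnorm D H p \<theta> f"
 unfolding wnorm_def sum_distrib_left
proof (rule sum_mono)
 fix I :: "nat^'d" assume "I \<in> {I. mi_size I \<le> H}"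
 then have "\<theta> ^ H \<le> \<theta> ^ mi_size I" using \<theta> by (simp add: power_decreasing)
 then have "1 \<le> (1 / \<theta>) ^ H * \<theta> ^ mi_size I" using \<theta> by (simp add: power_divide field_simps)
 from mult_right_mono[OF this, of "1 / real (mi_fact I) * Lp_norm D p (weak_deriv D I f)"]
 show "1 ^ mi_size I / real (mi_fact I) * Lp_norm D p (weak_deriv D I f) \<le>
  (1 / \<theta>) ^ H * (\<theta> ^ mi_size I / real (mi_fact I) * Lp_norm D p (weak_deriv D I f))"
  by (simp add: Lp_norm_nonneg[OF p] mult.assoc)
qed

lemma wnorm_weight_mono:
 assumes p: "p \<in> {2, \<infinity>}" and \<theta>: "0 \<le> \<theta>" "\<theta> \<le> 1"
 shows "wnorm D H p \<theta> f \<le> wnorm D H p 1 f"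
 unfolding wnorm_def
proof (intro sum_mono mult_right_mono divide_right_mono Lp_norm_nonneg[OF p])
 fix I :: "nat^'d"
 show "\<theta> ^ mi_size I \<le> 1 ^ mi_size I" using \<theta> by (simp add: power_le_one)
qed simp

text \<open>Every term of positive order carries at least one factor \<theta>; this smallness lets
  \<open>wnorm_powr_le\<close> absorb the recursion.\<close>

lemma wnorm_minus_zeroth:
 assumes f: "f \<in> sobolev D H \<infinity>" and \<theta>: "0 \<le> \<theta>" "\<theta> \<le> 1"
 shows "(\<Sum>I\<in>{I. mi_size I \<le> H} - {0}. \<theta> ^ mi_size I * Lp_norm D \<infinity> (nd D I f)) \<le> \<theta> * wnorm D H \<infinity> 1 f"
proof -
 have inf: "\<infinity> \<in> {2, \<infinity>::ereal}" by simp
 have "(\<Sum>I\<in>{I. mi_size I \<le> H} - {0}. \<theta> ^ mi_size I * Lp_norm D \<infinity> (nd D I f)) \<le>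
   (\<Sum>I\<in>{I. mi_size I \<le> H} - {0}. \<theta> * Lp_norm D \<infinity> (nd D I f))"
 proof (intro sum_mono mult_right_mono Lp_norm_nonneg[OF inf])
  fix I :: "nat^'d" assume "I \<in> {I. mi_size I \<le> H} - {0}"
  then have "mi_size I ~= 0" by (simp add: mi_size_eq_0)
  then have "\<theta> ^ mi_size I \<le> \<theta> ^ 1" using \<theta> by (intro power_decreasing) auto
  then show "\<theta> ^ mi_size I \<le> \<theta>" by simp
 qed
 also have "\<dots> \<le> (\<Sum>I | mi_size I \<le> H. \<theta> * Lp_norm D \<infinity> (nd D I f))"
  by (rule sum_mono2) (use \<theta> in \<open>auto simp: finite_mi_size Lp_norm_nonneg\<close>)
 also have "\<dots> = \<theta> * wnorm D H \<infinity> 1 f" unfolding wnorm_nd[OF inf f] by (simp add: sum_distrib_left)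
 finally show ?thesis .
qed

lemma nd_cong_AE:
 assumes p: "p \<in> {2, \<infinity>}" and f: "f \<in> sobolev D H p" and g: "locally_integrable D g"
  and ae: "AE x in lebesgue_on D. f x = g x" and I: "mi_size I \<le> H"
 shows "AE x in lebesgue_on D. nd D I g x = nd D I f x"
proof -
 have w: "is_weak_deriv D I f (weak_deriv D I f)" by (rule sobolevD(1)[OF p f I])
 then have "locally_integrable D (weak_deriv D I f)" by (simp add: is_weak_deriv_def)
 from is_weak_deriv_cong_AE[OF open_D w g this ae] have "is_weak_deriv D I g (weak_deriv D I f)" by simp
 from weak_deriv_AE[OF this] show ?thesis by eventually_elim (simp add: nd_def)
qed

lemma nd_partial_AE:
 assumes p: "p \<in> {2, \<infinity>}" and f: "f \<in> sobolev D (Suc H) p" and I: "mi_size I \<le> H"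
 shows "AE x in lebesgue_on D. nd D I (weak_deriv D (axis k 1) f) x = real (I $ k + 1) *\<^sub>R nd D (I + axis k 1) f x"
proof (rule nd_AE)
 have 1: "mi_size (axis k 1 :: nat^'d) \<le> Suc H" by (simp add: mi_size_axis[simplified])
 have 2: "mi_size (I + axis k 1) \<le> Suc H" unfolding mi_size_add mi_size_axis using I by simp
 have "is_weak_deriv D I (weak_deriv D (axis k 1) f) (weak_deriv D (I + axis k 1) f)"
  by (rule is_weak_deriv_step'[OF sobolevD(1)[OF p f 1] sobolevD(1)[OF p f 2]])
 moreover have "F * (c * (1 / (c * F))) = 1" if "c ~= 0" "F ~= 0" for c F :: real using that by simp
 then have "real (mi_fact I) * (real (I $ k + 1) * (1 / real (mi_fact (I + axis k 1)))) = 1"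
  unfolding mi_fact_add_axis of_nat_mult using mi_fact_pos[of I] by simp
 ultimately show "is_weak_deriv D I (weak_deriv D (axis k 1) f)
   (\<lambda>x. real (mi_fact I) *\<^sub>R (real (I $ k + 1) *\<^sub>R nd D (I + axis k 1) f x))"
  unfolding nd_def scaleR_scaleR using mi_fact_pos[of I] by simp
qed

text \<open>With b_k nonzero, compare coefficients of index b - e_k in s \<partial>\<rho> = q
  (\<partial>s) \<rho>, where \<partial> is the derivative in direction k. The coefficient of index
  b of \<rho> comes multiplied by s, which is at least A, and the factors of the other terms are at
  most 1 because -1 \<le> q \<le> 0.\<close>

lemma nd_powr_le:
 fixes s :: "real^'d => real" and A q :: real
 assumes A: "0 < A" and s: "s \<in> sobolev D H \<infinity>" and ge: "AE x in lebesgue_on D. A \<le> s x"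
  and q: "-1 \<le> q" "q \<le> 0" and b: "mi_size b \<le> H" "b ~= 0"
 shows "A * Lp_norm D \<infinity> (nd D b (\<lambda>x. s x powr q)) \<le>
  (\<Sum>(d, e)\<in>antidiag b - {(0, b)}. Lp_norm D \<infinity> (nd D d s) * Lp_norm D \<infinity> (nd D e (\<lambda>x. s x powr q)))"
proof -
 have inf: "\<infinity> \<in> {2, \<infinity>::ereal}" by simp
 let ?\<rho> = "\<lambda>x. s x powr q"
 have \<rho>: "?\<rho> \<in> sobolev D H \<infinity>" by (rule sobolev_powr[OF A s ge])
 obtain k where "b $ k ~= 0" using b(2) by (auto simp: vec_eq_iff)
 then obtain J where J: "b = J + axis k 1" by (rule mi_decompose)
 then have "mi_size b = Suc (mi_size J)" unfolding J mi_size_add mi_size_axis by simp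
 then obtain H' where H: "H = Suc H'" "mi_size J \<le> H'" using b(1) by (cases H) auto
 note s' = s[unfolded H] and \<rho>' = \<rho>[unfolded H]
 let ?ds = "weak_deriv D (axis k 1) s" and ?dr = "weak_deriv D (axis k 1) ?\<rho>"
 have 1: "mi_size (axis k 1 :: nat^'d) \<le> Suc H'" by (simp add: mi_size_axis[simplified])
 note w = sobolevD[OF inf s' 1]
 let ?M = "Lp_norm D \<infinity> s"
 have sb: "AE x in lebesgue_on D. s x \<in> {A..?M}"
  using ge Linf_AE[OF sobolev_Lp[OF inf s]] by eventually_elim auto
 have "is_weak_deriv D (axis k 1) ?\<rho> (\<lambda>x. (q * s x powr (q - 1)) * ?ds x)"
 proof (rule is_weak_deriv_chain[OF open_D w(1) sb Linf_AE[OF w(2), unfolded real_norm_def]])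
  fix t assume t: "t \<in> {A..?M}"
  have "((\<lambda>t. t powr q) has_real_derivative q * t powr (q - 1)) (at t)"
   by (rule has_real_derivative_powr) (use t A in auto)
  then show "((\<lambda>t. t powr q) has_real_derivative q * t powr (q - 1)) (at t within {A..?M})"
   by (rule has_field_derivative_at_within)
 next
  show "continuous_on {A..?M} (\<lambda>t. q * t powr (q - 1))" by (intro continuous_intros) (use A in auto)
 qed auto
 \<comment> \<open>The equation of \<rho> = s^q, as an identity of functions whose derivatives of
   order J can be compared.\<close>
 from weak_deriv_AE[OF this] ge have ode: "AE x in lebesgue_on D. s x * ?dr x = q *\<^sub>R (?ds x * ?\<rho> x)"
 proof eventually_elim
  case (elim x)
  then have "s x > 0" using A by linarith
  then have "s x * s x powr (q - 1) = s x powr q" by (simp add: powr_diff)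
  then have "s x * (q * s x powr (q - 1) * ?ds x) = q * ?ds x * (s x powr q)" by (metis mult.assoc mult.commute)
  with elim show ?case by simp
 qed
 have f1: "?ds \<in> sobolev D H' \<infinity>" "?dr \<in> sobolev D H' \<infinity>" "s \<in> sobolev D H' \<infinity>" "?\<rho> \<in> sobolev D H' \<infinity>"
  using sobolev_weak_deriv(1)[OF inf s'] sobolev_weak_deriv(1)[OF inf \<rho>'] sobolev_mono[OF s'] sobolev_mono[OF \<rho>'] by auto
 note L = sobolev_mult(1)[OF inf f1(3) f1(2)] and R = sobolev_mult(1)[OF inf f1(1) f1(4)]
 note R' = sobolev_scaleR(1)[OF inf R, of q]
 have scale: "AE x in lebesgue_on D. nd D J (\<lambda>x. q *\<^sub>R (?ds x * ?\<rho> x)) x = q * nd D J (\<lambda>x. ?ds x * ?\<rho> x) x"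
  using weak_deriv_AE[OF is_weak_deriv_scaleR[OF open_D sobolevD(1)[OF inf R H(2)], of q]]
  by eventually_elim (simp add: nd_def)
 have fin: "AE x in lebesgue_on D. \<forall>e\<in>snd ` antidiag J. nd D e ?dr x = real (e $ k + 1) *\<^sub>R nd D (e + axis k 1) ?\<rho> x"
 proof (rule AE_finite_allI[OF finite_imageI[OF finite_antidiag]])
  fix e assume "e \<in> snd ` antidiag J"
  then have "mi_size e \<le> H'" using H(2) by (auto simp: antidiag_def mi_size_add)
  from nd_partial_AE[OF inf \<rho>' this]
  show "AE x in lebesgue_on D. nd D e ?dr x = real (e $ k + 1) *\<^sub>R nd D (e + axis k 1) ?\<rho> x" .
 qed
 have fin2: "AE x in lebesgue_on D. \<forall>e\<in>fst ` antidiag J. nd D e ?ds x = real (e $ k + 1) *\<^sub>R nd D (e + axis k 1) s x"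
 proof (rule AE_finite_allI[OF finite_imageI[OF finite_antidiag]])
  fix e assume "e \<in> fst ` antidiag J"
  then have "mi_size e \<le> H'" using H(2) by (auto simp: antidiag_def mi_size_add)
  from nd_partial_AE[OF inf s' this]
  show "AE x in lebesgue_on D. nd D e ?ds x = real (e $ k + 1) *\<^sub>R nd D (e + axis k 1) s x" .
 qed
 have rec: "AE x in lebesgue_on D. nd D 0 s x * nd D b ?\<rho> x =
  (\<Sum>(d, e)\<in>antidiag b - {(0, b)}. ((q * real (d $ k) - real (e $ k)) / real (b $ k)) * (nd D d s x * nd D e ?\<rho> x))"
  using nd_mult_AE[OF inf f1(3) f1(2) H(2)] nd_mult_AE[OF inf f1(1) f1(4) H(2)] scale fin fin2
   nd_cong_AE[OF inf L sobolev_locally_integrable[OF R'] ode H(2)]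
 proof eventually_elim
  case (elim x)
  have "(\<Sum>(d, e)\<in>antidiag J. real (e $ k + 1) * (nd D d s x * nd D (e + axis k 1) ?\<rho> x)) =
   (\<Sum>(d, e)\<in>antidiag J. nd D d s x * nd D e ?dr x)"
   using elim(4) by (intro sum.cong) (auto simp: image_iff)
  also have "\<dots> = q * (\<Sum>(d, e)\<in>antidiag J. nd D d ?ds x * nd D e ?\<rho> x)" using elim(1,2,3,6) by simp
  also have "(\<Sum>(d, e)\<in>antidiag J. nd D d ?ds x * nd D e ?\<rho> x) =
   (\<Sum>(d, e)\<in>antidiag J. real (d $ k + 1) * (nd D (d + axis k 1) s x * nd D e ?\<rho> x))"
   using elim(5) by (intro sum.cong) (auto simp: image_iff)
  finally show ?case by (rule power_coefficient_recursion[OF _ J])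
 qed
 have bk: "b $ k ~= 0" by (simp add: J axis_def)
 have ln: "AE x in lebesgue_on D. \<forall>p\<in>antidiag b. \<bar>nd D (fst p) s x\<bar> \<le> Lp_norm D \<infinity> (nd D (fst p) s) \<and>
  \<bar>nd D (snd p) ?\<rho> x\<bar> \<le> Lp_norm D \<infinity> (nd D (snd p) ?\<rho>)"
 proof (rule AE_finite_allI[OF finite_antidiag])
  fix p assume "p \<in> antidiag b"
  then have "mi_size (fst p) \<le> H" "mi_size (snd p) \<le> H" using b(1) by (auto simp: antidiag_def mi_size_add)
  from Linf_AE[OF nd_Lp(1)[OF inf s this(1)]] Linf_AE[OF nd_Lp(1)[OF inf \<rho> this(2)]]
  show "AE x in lebesgue_on D. \<bar>nd D (fst p) s x\<bar> \<le> Lp_norm D \<infinity> (nd D (fst p) s) \<and>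
  \<bar>nd D (snd p) ?\<rho> x\<bar> \<le> Lp_norm D \<infinity> (nd D (snd p) ?\<rho>)" by eventually_elim simp
 qed
 let ?S = "\<Sum>(d, e)\<in>antidiag b - {(0, b)}. Lp_norm D \<infinity> (nd D d s) * Lp_norm D \<infinity> (nd D e ?\<rho>)"
 have S0: "?S \<ge> 0" by (intro sum_nonneg) (auto simp: Lp_norm_nonneg)
 have "AE x in lebesgue_on D. norm (nd D b ?\<rho> x) \<le> ?S / A"
  using rec ln nd_0_AE[OF sobolev_locally_integrable[OF s]] ge
 proof eventually_elim
  case (elim x)
  have "A * \<bar>nd D b ?\<rho> x\<bar> \<le> s x * \<bar>nd D b ?\<rho> x\<bar>" using elim(4) by (intro mult_right_mono) auto
  also have "\<dots> = \<bar>nd D 0 s x * nd D b ?\<rho> x\<bar>" using elim(3,4) A by (simp add: abs_mult)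
  also have "\<dots> \<le> (\<Sum>p\<in>antidiag b - {(0, b)}. \<bar>((q * real (fst p $ k) - real (snd p $ k)) / real (b $ k)) * (nd D (fst p) s x * nd D (snd p) ?\<rho> x)\<bar>)"
   unfolding elim(1) case_prod_unfold by (rule sum_abs)
  also have "\<dots> \<le> (\<Sum>p\<in>antidiag b - {(0, b)}. Lp_norm D \<infinity> (nd D (fst p) s) * Lp_norm D \<infinity> (nd D (snd p) ?\<rho>))"
  proof (rule sum_mono)
   fix p assume p: "p \<in> antidiag b - {(0, b)}"
   then have "(fst p, snd p) \<in> antidiag b" by simp
   note co = power_coefficient_le[OF this bk q]
   have "\<bar>nd D (fst p) s x\<bar> * \<bar>nd D (snd p) ?\<rho> x\<bar> \<le> Lp_norm D \<infinity> (nd D (fst p) s) * Lp_norm D \<infinity> (nd D (snd p) ?\<rho>)"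
    using elim(2) p by (intro mult_mono) (auto simp: Lp_norm_nonneg)
   from mult_mono[OF co this zero_le_one mult_nonneg_nonneg[OF abs_ge_zero abs_ge_zero]]
   have "\<bar>(q * real (fst p $ k) - real (snd p $ k)) / real (b $ k)\<bar> * (\<bar>nd D (fst p) s x\<bar> * \<bar>nd D (snd p) ?\<rho> x\<bar>)
    \<le> 1 * (Lp_norm D \<infinity> (nd D (fst p) s) * Lp_norm D \<infinity> (nd D (snd p) ?\<rho>))" .
   then show "\<bar>((q * real (fst p $ k) - real (snd p $ k)) / real (b $ k)) * (nd D (fst p) s x * nd D (snd p) ?\<rho> x)\<bar>
    \<le> Lp_norm D \<infinity> (nd D (fst p) s) * Lp_norm D \<infinity> (nd D (snd p) ?\<rho>)" by (simp only: abs_mult mult_1)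
  qed
  finally show ?case using A by (simp add: case_prod_unfold field_simps)
 qed
 from Linf_le(2)[OF Lp_space_measurable[OF nd_Lp(1)[OF inf \<rho> b(1)]] this] S0 A
 have "Lp_norm D \<infinity> (nd D b ?\<rho>) \<le> ?S / A" by simp
 then show ?thesis using A by (simp add: field_simps)
qed

text \<open>Summed with weights, \<open>nd_powr_le\<close> bounds A times the positive-order part of
  the norm N by (A/2) N, the factor A/2 bounding the positive-order part of s. Hence N \<le>
  \<open>A powr q\<close> + N/2.\<close>

lemma wnorm_powr_le:
 fixes s :: "real^'d => real" and A q :: real
 assumes A: "0 < A" and s: "s \<in> sobolev D H \<infinity>" and ge: "AE x in lebesgue_on D. A \<le> s x"
  and q: "-1 \<le> q" "q \<le> 0" and \<theta>: "0 \<le> \<theta>" "\<theta> \<le> 1" "\<theta> * wnorm D H \<infinity> 1 s \<le> A / 2"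
 shows "wnorm D H \<infinity> \<theta> (\<lambda>x. s x powr q) \<le> 2 * A powr q"
proof -
 have inf: "\<infinity> \<in> {2, \<infinity>::ereal}" by simp
 let ?\<rho> = "\<lambda>x. s x powr q" and ?I = "{I::nat^'d. mi_size I \<le> H}"
 let ?l = "\<lambda>f. Lp_norm D \<infinity> (f :: real^'d => real)"
 have \<rho>: "?\<rho> \<in> sobolev D H \<infinity>" by (rule sobolev_powr[OF A s ge])
 \<comment> \<open>Zero at d = 0, so that the sum over the punctured antidiagonal extends to the
   whole one.\<close>
 define h where "h d e = (if d = 0 then 0 else (\<theta> ^ mi_size d * ?l (nd D d s)) * (\<theta> ^ mi_size e * ?l (nd D e ?\<rho>)))" for d e
 have h0: "h d e \<ge> 0" for d e unfolding h_def using \<theta> by (auto simp: Lp_norm_nonneg)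
 have step: "A * (\<theta> ^ mi_size b * ?l (nd D b ?\<rho>)) \<le> (\<Sum>(d, e)\<in>antidiag b. h d e)" if b: "b \<in> ?I - {0}" for b
 proof -
  have "A * (\<theta> ^ mi_size b * ?l (nd D b ?\<rho>)) = \<theta> ^ mi_size b * (A * ?l (nd D b ?\<rho>))" by simp
  also have "\<dots> \<le> \<theta> ^ mi_size b * (\<Sum>(d, e)\<in>antidiag b - {(0, b)}. ?l (nd D d s) * ?l (nd D e ?\<rho>))"
   using nd_powr_le[OF A s ge q] b \<theta> by (intro mult_left_mono) auto
  also have "\<dots> = (\<Sum>p\<in>antidiag b - {(0, b)}. h (fst p) (snd p))"
   unfolding sum_distrib_left
  proof (rule sum.cong[OF refl])
   fix p assume "p \<in> antidiag b - {(0, b)}"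
   then have p: "fst p + snd p = b" "p ~= (0, b)" by (auto simp: antidiag_def)
   then have "fst p ~= 0" by (cases p) auto
   moreover have "mi_size b = mi_size (fst p) + mi_size (snd p)" using p by (simp add: mi_size_add[symmetric])
   ultimately show "\<theta> ^ mi_size b * (case p of (d, e) => ?l (nd D d s) * ?l (nd D e ?\<rho>)) = h (fst p) (snd p)"
    by (simp add: h_def case_prod_unfold power_add mult.commute mult.left_commute)
  qed
  also have "\<dots> \<le> (\<Sum>p\<in>antidiag b. h (fst p) (snd p))"
   by (rule sum_mono2[OF finite_antidiag]) (use h0 in auto)
  finally show ?thesis by (simp add: case_prod_unfold)
 qed
 let ?N = "wnorm D H \<infinity> \<theta> ?\<rho>"
 have N0: "?N \<ge> 0" by (rule wnorm_nonneg[OF inf \<theta>(1)])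
 have fI: "finite ?I" by (rule finite_mi_size)
 have N: "?N = ?l (nd D 0 ?\<rho>) + (\<Sum>b\<in>?I - {0}. \<theta> ^ mi_size b * ?l (nd D b ?\<rho>))"
  unfolding wnorm_nd[OF inf \<rho>] by (subst sum.remove[OF fI, of 0]) auto
 have "A * (\<Sum>b\<in>?I - {0}. \<theta> ^ mi_size b * ?l (nd D b ?\<rho>)) \<le> (\<Sum>b\<in>?I - {0}. \<Sum>(d, e)\<in>antidiag b. h d e)"
  unfolding sum_distrib_left by (rule sum_mono) (rule step)
 also have "\<dots> \<le> (\<Sum>b\<in>?I. \<Sum>(d, e)\<in>antidiag b. h d e)"
  by (rule sum_mono2[OF fI]) (use h0 in \<open>auto intro!: sum_nonneg\<close>)
 also have "\<dots> \<le> (\<Sum>d\<in>?I. \<Sum>e\<in>?I. h d e)" by (rule sum_antidiag_le_prod) (rule h0)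
 also have "\<dots> = (\<Sum>d\<in>?I - {0}. \<Sum>e\<in>?I. h d e)" by (subst sum.remove[OF fI, of 0]) (auto simp: h_def)
 also have "\<dots> = (\<Sum>d\<in>?I - {0}. \<Sum>e\<in>?I. (\<theta> ^ mi_size d * ?l (nd D d s)) * (\<theta> ^ mi_size e * ?l (nd D e ?\<rho>)))"
  by (intro sum.cong refl) (simp add: h_def)
 also have "\<dots> = (\<Sum>d\<in>?I - {0}. \<theta> ^ mi_size d * ?l (nd D d s)) * ?N"
  unfolding wnorm_nd[OF inf \<rho>] by (simp add: sum_product)
 also have "\<dots> \<le> (A / 2) * ?N"
  using order_trans[OF wnorm_minus_zeroth[OF s \<theta>(1,2)] \<theta>(3)] N0 by (intro mult_right_mono)
 finally have "A * (\<Sum>b\<in>?I - {0}. \<theta> ^ mi_size b * ?l (nd D b ?\<rho>)) \<le> A * (?N / 2)" by simp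
 then have "(\<Sum>b\<in>?I - {0}. \<theta> ^ mi_size b * ?l (nd D b ?\<rho>)) \<le> ?N / 2" using A by simp
 moreover have "?l (nd D 0 ?\<rho>) \<le> A powr q"
 proof (rule Linf_le(2)[OF Lp_space_measurable[OF nd_Lp(1)[OF inf \<rho>]]])
  show "AE x in lebesgue_on D. norm (nd D 0 ?\<rho> x) \<le> A powr q"
   using ge nd_0_AE[OF sobolev_locally_integrable[OF \<rho>]]
   by eventually_elim (use A q in \<open>auto intro!: powr_mono2'\<close>)
 qed auto
 ultimately show ?thesis using N by linarith
qed

text \<open>C depends on A and K alone, so one constant serves all parameters. The weight is chosen
  with \<theta> K \<le> A/2, the condition of \<open>wnorm_powr_le\<close> for q = -1; K + 1 in the
  denominator covers K = 0.\<close>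

lemma wnorm_inverse_bounded:
 fixes A K :: real
 assumes A: "0 < A" and K: "0 \<le> K"
 shows "\<exists>C. \<forall>g. g \<in> sobolev D H \<infinity> --> (AE x in lebesgue_on D. A \<le> g x) --> wnorm D H \<infinity> 1 g \<le> K -->
  (\<lambda>x. inverse (g x)) \<in> sobolev D H \<infinity> \<and> wnorm D H \<infinity> 1 (\<lambda>x. inverse (g x)) \<le> C"
proof -
 define \<theta> where "\<theta> = min 1 (A / (2 * (K + 1)))"
 have \<theta>: "0 < \<theta>" "\<theta> \<le> 1" using A K by (auto simp: \<theta>_def)
 show ?thesis
 proof (intro exI[of _ "(1 / \<theta>) ^ H * (2 * A powr (-1))"] allI impI)
  fix g assume g: "g \<in> sobolev D H \<infinity>" and ge: "AE x in lebesgue_on D. A \<le> g x" and gK: "wnorm D H \<infinity> 1 g \<le> K"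
  have "\<theta> * wnorm D H \<infinity> 1 g \<le> (A / (2 * (K + 1))) * K"
   using \<theta> gK A K by (intro mult_mono) (auto simp: \<theta>_def wnorm_nonneg)
  also have "\<dots> = (A / 2) * (K / (K + 1))" by simp
  also have "\<dots> \<le> (A / 2) * 1" using A K by (intro mult_left_mono) auto
  finally have t: "\<theta> * wnorm D H \<infinity> 1 g \<le> A / 2" by simp
  have P: "(\<lambda>x. g x powr (-1)) \<in> sobolev D H \<infinity>" by (rule sobolev_powr[OF A g ge])
  have PN: "wnorm D H \<infinity> 1 (\<lambda>x. g x powr (-1)) \<le> (1 / \<theta>) ^ H * (2 * A powr (-1))"
  proof -
   have "wnorm D H \<infinity> 1 (\<lambda>x. g x powr (-1)) \<le> (1 / \<theta>) ^ H * wnorm D H \<infinity> \<theta> (\<lambda>x. g x powr (-1))"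
    by (rule wnorm_weight_le) (use \<theta> in auto)
   also have "\<dots> \<le> (1 / \<theta>) ^ H * (2 * A powr (-1))"
    using wnorm_powr_le[OF A g ge _ _ _ \<theta>(2) t, of "-1"] \<theta> by (intro mult_left_mono) auto
   finally show ?thesis .
  qed
  have inf: "\<infinity> \<in> {2, \<infinity>::ereal}" by simp
  have ae: "AE x in lebesgue_on D. g x powr (-1) = inverse (g x)"
   using ge by eventually_elim (use A in \<open>simp add: powr_minus\<close>)
  have "(\<lambda>x. inverse (g x)) \<in> Lp_space D \<infinity>" by (rule Lp_space_cong_AE[OF inf sobolev_Lp[OF inf P] ae])
  then have l: "locally_integrable D (\<lambda>x. inverse (g x))" by (rule Lp_locally_integrable[OF open_D inf])
  from wnorm_cong_AE[OF inf P l ae] PN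
  show "(\<lambda>x. inverse (g x)) \<in> sobolev D H \<infinity> \<and> wnorm D H \<infinity> 1 (\<lambda>x. inverse (g x)) \<le> (1 / \<theta>) ^ H * (2 * A powr (-1))"
   by simp
 qed
qed

end

section \<open>Majorants in several variables\<close>

text \<open>The coefficient of z^I in (\<Sum> \<gamma>_k z_k)^|I|. A majorant of the form F (|I|)
  times this weight is thus a power series in the single variable s = \<Sum> \<gamma>_k z_k.\<close>

definition mw :: "('n::finite => real) => nat^'n => real" where
 "mw \<gamma> I = fact (mi_size I) / real (mi_fact I) * mi_power \<gamma> I"

lemma mi_power_add_axis: "mi_power \<gamma> (I + axis k 1) = \<gamma> k * mi_power \<gamma> I"
proof -
 have "mi_power \<gamma> (I + axis k 1) = (\<Prod>j\<in>UNIV. (if j = k then \<gamma> k else 1) * \<gamma> j ^ (I $ j))"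
  unfolding mi_power_def by (intro prod.cong) (auto simp: axis_def)
 also have "\<dots> = \<gamma> k * mi_power \<gamma> I" unfolding prod.distrib mi_power_def by simp
 finally show ?thesis .
qed

lemma mw_0 [simp]: "mw \<gamma> 0 = 1"
 by (simp add: mw_def mi_power_def mi_fact_0)

lemma mw_step: "real (I $ k + 1) * mw \<gamma> (I + axis k 1) = real (mi_size I + 1) * (\<gamma> k * mw \<gamma> I)"
proof -
 have s: "mi_size (I + axis k 1) = Suc (mi_size I)" unfolding mi_size_add mi_size_axis by simp
 have "c * (s * f / (c * F) * (g * P)) = s * (g * (f / F * P))" if "c ~= 0" for c s f F g P :: real
  using that by simp
 from this[of "real (I $ k + 1)" "real (mi_size I + 1)"] show ?thesis
  unfolding mw_def mi_power_add_axis s mi_fact_add_axis of_nat_mult fact_Suc by (simp add: add.commute)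
qed

lemma mw_nonneg: "(!!k. \<gamma> k \<ge> 0) ==> mw \<gamma> I \<ge> 0"
 unfolding mw_def mi_power_def by (intro mult_nonneg_nonneg divide_nonneg_nonneg prod_nonneg) auto

text \<open>The rule (f g)' = f' g + f g' for coefficient sequences in one variable, the counterpart
  of \<open>sum_antidiag_derivation\<close>.\<close>

lemma sum_convolution_step:
 fixes f g :: "nat => real"
 shows "(\<Sum>j\<le>n. real (j + 1) * f (j + 1) * g (n - j)) + (\<Sum>j\<le>n. f j * (real (n - j + 1) * g (n - j + 1))) =
  real (n + 1) * (\<Sum>j\<le>n + 1. f j * g (n + 1 - j))"
proof -
 have 1: "(\<Sum>j\<le>n. real (j + 1) * f (j + 1) * g (n - j)) = (\<Sum>j\<le>n + 1. real j * f j * g (n + 1 - j))"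
  using sum.atMost_Suc_shift[of "\<lambda>j. real j * f j * g (n + 1 - j)" n] by simp
 have "(\<Sum>j\<le>n + 1. f j * (real (n + 1 - j) * g (n + 1 - j))) = (\<Sum>j\<le>n. f j * (real (n + 1 - j) * g (n + 1 - j)))" by simp
 also have "\<dots> = (\<Sum>j\<le>n. f j * (real (n - j + 1) * g (n - j + 1)))"
  by (intro sum.cong refl) (simp add: Suc_diff_le)
 finally have 2: "(\<Sum>j\<le>n. f j * (real (n - j + 1) * g (n - j + 1))) = (\<Sum>j\<le>n + 1. f j * (real (n + 1 - j) * g (n + 1 - j)))" ..
 show ?thesis unfolding 1 2 sum.distrib[symmetric] sum_distrib_left
  by (intro sum.cong refl) (auto simp: algebra_simps of_nat_diff)
qed

text \<open>The product of two power series in s = \<Sum> \<gamma>_k z_k is again one, with Cauchy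
  product coefficients. The induction differentiates in z_k; f and g are general because each step
  replaces one of them by its derivative sequence.\<close>

lemma mw_convolution:
 "(\<Sum>(A, E)\<in>antidiag b. (f (mi_size A) * mw \<gamma> A) * (g (mi_size E) * mw \<gamma> E)) =
  (\<Sum>j\<le>mi_size b. f j * g (mi_size b - j)) * mw \<gamma> b"
proof (induction b arbitrary: f g rule: mi_induct)
 case zero
 show ?case by (simp add: antidiag_0)
next
 case (step b k)
 let ?n = "mi_size b"
 have s: "mi_size (I + axis k 1) = mi_size I + 1" for I :: "nat^'a" unfolding mi_size_add mi_size_axis by simp
 let ?h = "\<lambda>A E. (f (mi_size A) * mw \<gamma> A) * (g (mi_size E) * mw \<gamma> E)"
 have a: "real (A $ k + 1) * ?h (A + axis k 1) E =
   \<gamma> k * ((real (mi_size A + 1) * f (mi_size A + 1)) * mw \<gamma> A * (g (mi_size E) * mw \<gamma> E))" for A E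
 proof -
  have "real (A $ k + 1) * ?h (A + axis k 1) E =
   (real (A $ k + 1) * mw \<gamma> (A + axis k 1)) * (f (mi_size A + 1) * (g (mi_size E) * mw \<gamma> E))"
   unfolding s by (simp only: mult_ac)
  then show ?thesis unfolding mw_step by (simp only: mult_ac)
 qed
 have b: "real (E $ k + 1) * ?h A (E + axis k 1) =
   \<gamma> k * (f (mi_size A) * mw \<gamma> A * ((real (mi_size E + 1) * g (mi_size E + 1)) * mw \<gamma> E))" for A E
 proof -
  have "real (E $ k + 1) * ?h A (E + axis k 1) =
   (real (E $ k + 1) * mw \<gamma> (E + axis k 1)) * (f (mi_size A) * mw \<gamma> A * g (mi_size E + 1))"
   unfolding s by (simp only: mult_ac)
  then show ?thesis unfolding mw_step by (simp only: mult_ac)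
 qed
 have "real (b $ k + 1) * (\<Sum>(A, E)\<in>antidiag (b + axis k 1). ?h A E) =
   (\<Sum>(A, E)\<in>antidiag b. real (A $ k + 1) * ?h (A + axis k 1) E + real (E $ k + 1) * ?h A (E + axis k 1))"
  using sum_antidiag_derivation[where h = ?h and J = b and k = k] by (simp only: real_scaleR_def)
 also have "\<dots> = \<gamma> k * ((\<Sum>(A, E)\<in>antidiag b. (real (mi_size A + 1) * f (mi_size A + 1)) * mw \<gamma> A * (g (mi_size E) * mw \<gamma> E)) +
   (\<Sum>(A, E)\<in>antidiag b. f (mi_size A) * mw \<gamma> A * ((real (mi_size E + 1) * g (mi_size E + 1)) * mw \<gamma> E)))"
  unfolding a b by (simp only: case_prod_unfold sum.distrib sum_distrib_left distrib_left)
 also have "\<dots> = \<gamma> k * ((\<Sum>j\<le>?n. real (j + 1) * f (j + 1) * g (?n - j)) * mw \<gamma> b + (\<Sum>j\<le>?n. f j * (real (?n - j + 1) * g (?n - j + 1))) * mw \<gamma> b)"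
  unfolding step[of "\<lambda>j. real (j + 1) * f (j + 1)" g] step[of f "\<lambda>j. real (j + 1) * g (j + 1)"] ..
 also have "\<dots> = (\<Sum>j\<le>?n + 1. f j * g (?n + 1 - j)) * (real (?n + 1) * (\<gamma> k * mw \<gamma> b))"
  unfolding distrib_right[symmetric] sum_convolution_step by (simp only: mult_ac)
 also have "\<dots> = real (b $ k + 1) * ((\<Sum>j\<le>?n + 1. f j * g (?n + 1 - j)) * mw \<gamma> (b + axis k 1))"
  unfolding mw_step[symmetric] by (simp only: mult_ac)
 finally show ?case unfolding s by (simp only: mult_cancel_left) simp
qed

section \<open>Parametric derivatives of the coefficient\<close>

text \<open>
 The entries of the diffusion matrix are expressions in \<open>v \<bullet> w x\<close> and \<open>1 / norm v\<close> at
 \<open>v = V y x\<close>. Since \<open>V\<close> is affine in \<open>y\<close>, with \<open>\<partial>V/\<partial>y\<^sub>k = W k\<close>, the derivative in \<open>y\<^sub>k\<close> of such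
 an expression is again one.
\<close>

datatype ('x, 'v) expr = Con "'x => real" | Dt "'x => 'v" | Rh | Sq
 | Add "('x, 'v) expr" "('x, 'v) expr" | Mul "('x, 'v) expr" "('x, 'v) expr"

primrec ev :: "('x, 'v::real_inner) expr => 'x => 'v => real" where
 "ev (Con f) x v = f x"
| "ev (Dt w) x v = v \<bullet> w x"
| "ev Rh x v = inverse (norm v)"
| "ev Sq x v = v \<bullet> v"
| "ev (Add e f) x v = ev e x v + ev f x v"
| "ev (Mul e f) x v = ev e x v * ev f x v"

primrec Dex :: "('m => 'x => 'v::real_inner) => 'm => ('x, 'v) expr => ('x, 'v) expr" where
 "Dex W k (Con f) = Con (\<lambda>_. 0)"
| "Dex W k (Dt w) = Con (\<lambda>x. W k x \<bullet> w x)"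
| "Dex W k Rh = Mul (Con (\<lambda>_. -1)) (Mul (Mul Rh (Mul Rh Rh)) (Dt (W k)))"
| "Dex W k Sq = Mul (Con (\<lambda>_. 2)) (Dt (W k))"
| "Dex W k (Add e f) = Add (Dex W k e) (Dex W k f)"
| "Dex W k (Mul e f) = Add (Mul (Dex W k e) f) (Mul e (Dex W k f))"

text \<open>Soundness of the symbolic derivative. It yields that \<open>Dex\<close> respects
  semantic equality (\<open>eveq_Dex\<close>), which the syntax does not show.\<close>

lemma ev_has_derivative:
 assumes v: "v ~= 0"
 shows "((\<lambda>t. ev e x (v + t *\<^sub>R W k x)) has_real_derivative ev (Dex W k e) x v) (at 0)"
proof (induction e)
 case (Dt w)
 show ?case by (auto intro!: derivative_eq_intros simp: inner_add_left)
next
 case Rh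
 let ?g = "\<lambda>t. v \<bullet> v + t * (2 * (v \<bullet> W k x)) + t\<^sup>2 * (W k x \<bullet> W k x)"
 have g: "(v + t *\<^sub>R W k x) \<bullet> (v + t *\<^sub>R W k x) = ?g t" for t
  by (simp add: inner_add_left inner_add_right inner_commute power2_eq_square algebra_simps)
 have gp: "?g 0 > 0" using v by simp
 have "(?g has_real_derivative 2 * (v \<bullet> W k x)) (at 0)" by (auto intro!: derivative_eq_intros)
 from DERIV_chain2[OF DERIV_real_sqrt[OF gp] this]
 have "((\<lambda>t. sqrt (?g t)) has_real_derivative inverse (sqrt (?g 0)) / 2 * (2 * (v \<bullet> W k x))) (at 0)" .
 from DERIV_inverse_fun[OF this] have
  "((\<lambda>t. inverse (sqrt (?g t))) has_real_derivative - (inverse (sqrt (?g 0)) / 2 * (2 * (v \<bullet> W k x)) * inverse ((sqrt (?g 0))\<^sup>2))) (at 0)"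
  using v by (simp add: power2_eq_square)
 moreover have "sqrt (?g 0) = norm v" by (simp add: norm_eq_sqrt_inner)
 ultimately have "((\<lambda>t. inverse (sqrt (?g t))) has_real_derivative - (inverse (norm v) / 2 * (2 * (v \<bullet> W k x)) * inverse ((norm v)\<^sup>2))) (at 0)"
  by (simp only:)
 then show ?case unfolding ev.simps Dex.simps norm_eq_sqrt_inner[of "v + _ *\<^sub>R W k x"] g
  by (simp add: power2_eq_square mult_ac)
next
 case Sq
 have g: "(v + t *\<^sub>R W k x) \<bullet> (v + t *\<^sub>R W k x) = v \<bullet> v + t * (2 * (v \<bullet> W k x)) + t\<^sup>2 * (W k x \<bullet> W k x)" for t
  by (simp add: inner_add_left inner_add_right inner_commute power2_eq_square algebra_simps)
 show ?case unfolding ev.simps Dex.simps g by (auto intro!: derivative_eq_intros)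
next
 case (Add e f)
 then show ?case by (auto intro!: derivative_eq_intros)
next
 case (Mul e f)
 then show ?case by (auto intro!: derivative_eq_intros)
qed simp

text \<open>Equality away from v = 0, where the inverse norm is differentiable and identities such
  as (v \<bullet> v) / |v| = |v| can be differentiated.\<close>

definition eveq :: "('x, 'v::real_inner) expr => ('x, 'v) expr => bool" where
 "eveq e f \<longleftrightarrow> (\<forall>x v. v ~= 0 --> ev e x v = ev f x v)"

lemma eveq_trans: "eveq e f ==> eveq f g ==> eveq e g"
 by (simp add: eveq_def)

lemma eveq_sym: "eveq e f ==> eveq f e"
 by (simp add: eveq_def)

lemma eveq_Dex:
 assumes "eveq e f"
 shows "eveq (Dex W k e) (Dex W k f)"
 unfolding eveq_def
proof (intro allI impI)
 fix x v assume v: "(v :: 'b) ~= 0"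
 have "open {t::real. v + t *\<^sub>R W k x ~= 0}" by (intro open_Collect_neq continuous_intros)
 from has_field_derivative_transform_within_open[OF ev_has_derivative[OF v, of e x W k] this]
 have "((\<lambda>t. ev f x (v + t *\<^sub>R W k x)) has_real_derivative ev (Dex W k e) x v) (at 0)"
  using assms v by (simp add: eveq_def)
 then show "ev (Dex W k e) x v = ev (Dex W k f) x v"    by (rule DERIV_unique[OF _ ev_has_derivative[OF v]])
qed

lemma eveq_Dex_commute: "eveq (Dex W j (Dex W k e)) (Dex W k (Dex W j e))"
 unfolding eveq_def by (induction e) (auto simp: inner_commute algebra_simps)

lemma eveq_foldr_Dex: "eveq e f ==> eveq (foldr (Dex W) xs e) (foldr (Dex W) xs f)"
 by (induction xs) (auto intro: eveq_Dex)

lemma eveq_foldr_middle: "eveq (foldr (Dex W) (xs @ k # ys) e) (Dex W k (foldr (Dex W) (xs @ ys) e))"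
proof (induction xs)
 case (Cons a xs)
 from eveq_trans[OF eveq_Dex[OF Cons] eveq_Dex_commute] show ?case by simp
qed (simp add: eveq_def)

lemma eveq_foldr_mset: "mset xs = mset ys ==> eveq (foldr (Dex W) xs e) (foldr (Dex W) ys e)"
proof (induction xs arbitrary: ys)
 case (Cons k xs)
 then have "k \<in> set ys" by (metis list.set_intros(1) mset_eq_setD)
 then obtain ys1 ys2 where ys: "ys = ys1 @ k # ys2" by (meson split_list)
 with Cons.prems have "mset xs = mset (ys1 @ ys2)" by simp
 from eveq_Dex[OF Cons.IH[OF this]] have "eveq (foldr (Dex W) (k # xs) e) (Dex W k (foldr (Dex W) (ys1 @ ys2) e))" by simp
 from eveq_trans[OF this eveq_sym[OF eveq_foldr_middle]] show ?case unfolding ys .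
qed (simp add: eveq_def)

text \<open>Encoded like \<open>mi_partial\<close>, by a \<open>SOME\<close>-chosen list of
  directions; \<open>eveq_foldr_mset\<close> makes the choice irrelevant up to
  \<open>eveq\<close>.\<close>

definition Dmi :: "('m::finite => 'x => 'v::real_inner) => nat^'m => ('x, 'v) expr => ('x, 'v) expr" where
 "Dmi W I e = foldr (Dex W) (SOME is. \<forall>i. count_list is i = I $ i) e"

lemma eveq_Dmi_list:
 assumes "!!i. count_list js i = I $ i"
 shows "eveq (Dmi W I e) (foldr (Dex W) js e)"
proof -
 have "\<forall>i. count_list (SOME is. \<forall>i. count_list is i = I $ i) i = I $ i"
  by (rule someI_ex) (rule ex_list_counts)
 then show ?thesis unfolding Dmi_def using assms
  by (intro eveq_foldr_mset) (auto intro!: multiset_eqI simp: count_mset)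
qed

lemma eveq_Dmi_add_axis:
 "eveq (Dmi W (I + axis k 1) e) (Dex W k (Dmi W I e))"
 "eveq (Dmi W (I + axis k 1) e) (Dmi W I (Dex W k e))"
proof -
 obtain js where js: "!!j. count_list js j = I $ j" using ex_list_counts by blast
 have a: "count_list (k # js) j = (I + axis k 1) $ j" "count_list (js @ [k]) j = (I + axis k 1) $ j" for j
  by (simp_all add: js axis_def)
 have 1: "eveq (Dmi W (I + axis k 1) e) (Dex W k (foldr (Dex W) js e))"
  using eveq_Dmi_list[OF a(1), of W e] by simp
 have 2: "eveq (Dmi W (I + axis k 1) e) (foldr (Dex W) js (Dex W k e))"
  using eveq_Dmi_list[OF a(2), of W e] by simp
 show "eveq (Dmi W (I + axis k 1) e) (Dex W k (Dmi W I e))"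
  by (rule eveq_trans[OF 1 eveq_sym[OF eveq_Dex[OF eveq_Dmi_list[OF js]]]])
 show "eveq (Dmi W (I + axis k 1) e) (Dmi W I (Dex W k e))"
  by (rule eveq_trans[OF 2 eveq_sym[OF eveq_Dmi_list[OF js]]])
qed

text \<open>A Taylor coefficient in the parameter: at v = V y x it is the derivative of order I in y
  of the value of e, divided by I!.\<close>

definition tc :: "('m::finite => 'x => 'v::real_inner) => nat^'m => ('x, 'v) expr => 'x => 'v => real" where
 "tc W I e x v = ev (Dmi W I e) x v / real (mi_fact I)"

lemma tc_0: "tc W 0 e x v = ev e x v"
proof -
 have "(SOME is :: 'a list. \<forall>i. count_list is i = (0 :: nat^'a) $ i) = []"
  by (rule some_equality) (auto simp: count_list_0_iff)
 then show ?thesis by (simp add: tc_def Dmi_def mi_fact_0)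
qed

lemma tc_cong: "eveq e f ==> v ~= 0 ==> tc W I e x v = tc W I f x v"
 using eveq_foldr_Dex[of e f W] by (simp add: tc_def Dmi_def eveq_def)

lemma tc_step:
 assumes "v ~= 0"
 shows "real (I $ k + 1) * tc W (I + axis k 1) e x v = tc W I (Dex W k e) x v"
  and "real (I $ k + 1) * tc W (I + axis k 1) e x v = ev (Dex W k (Dmi W I e)) x v / real (mi_fact I)"
proof -
 have c: "c * (z / (c * F)) = z / F" if "c ~= 0" for c z F :: real using that by simp
 have "real (I $ k + 1) * tc W (I + axis k 1) e x v = ev (Dmi W (I + axis k 1) e) x v / real (mi_fact I)"
  unfolding tc_def mi_fact_add_axis of_nat_mult by (rule c) simp
 then show "real (I $ k + 1) * tc W (I + axis k 1) e x v = tc W I (Dex W k e) x v"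
  "real (I $ k + 1) * tc W (I + axis k 1) e x v = ev (Dex W k (Dmi W I e)) x v / real (mi_fact I)"
  using eveq_Dmi_add_axis[of W I k e] assms by (simp_all add: eveq_def tc_def)
qed

lemma tc_step': "v ~= 0 ==> tc W (I + axis k 1) e x v = tc W I (Dex W k e) x v / real (I $ k + 1)"
 using tc_step(1)[of v I k W e x] by (simp add: field_simps del: of_nat_Suc of_nat_add)

lemma tc_Add: "v ~= 0 ==> tc W I (Add e f) x v = tc W I e x v + tc W I f x v"
proof (induction I arbitrary: e f rule: mi_induct)
 case zero
 then show ?case by (simp add: tc_0)
next
 case (step I k)
 show ?case unfolding tc_step'[OF step(2)] Dex.simps step(1)[OF step(2)] by (rule add_divide_distrib)
qed

lemma tc_Mul: "v ~= 0 ==> tc W I (Mul e f) x v = (\<Sum>(A, E)\<in>antidiag I. tc W A e x v * tc W E f x v)"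
proof (induction I arbitrary: e f rule: mi_induct)
 case zero
 then show ?case by (simp add: tc_0 antidiag_0)
next
 case (step I k)
 let ?h = "\<lambda>A E. tc W A e x v * tc W E f x v"
 have "real (I $ k + 1) * tc W (I + axis k 1) (Mul e f) x v =
  (\<Sum>(A, E)\<in>antidiag I. tc W A (Dex W k e) x v * tc W E f x v) + (\<Sum>(A, E)\<in>antidiag I. tc W A e x v * tc W E (Dex W k f) x v)"
  unfolding tc_step(1)[OF step(2)] Dex.simps tc_Add[OF step(2)] step(1)[OF step(2)] ..
 also have "\<dots> = (\<Sum>(A, E)\<in>antidiag I. real (A $ k + 1) * ?h (A + axis k 1) E + real (E $ k + 1) * ?h A (E + axis k 1))"
  unfolding tc_step(1)[OF step(2), symmetric] case_prod_unfold sum.distrib[symmetric]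
  by (intro sum.cong refl) (simp only: mult_ac)
 also have "\<dots> = real (I $ k + 1) * (\<Sum>(A, E)\<in>antidiag (I + axis k 1). ?h A E)"
  using sum_antidiag_derivation[where h = ?h and J = I and k = k] by (simp only: real_scaleR_def)
 finally show ?case by (simp only: mult_cancel_left) simp
qed

lemma tc_Con: "v ~= 0 ==> tc W I (Con f) x v = (if I = 0 then f x else 0)"
proof (induction I arbitrary: f rule: mi_induct)
 case zero
 then show ?case by (simp add: tc_0)
next
 case (step I k)
 have "I + axis k 1 ~= 0"
 proof
  assume "I + axis k 1 = 0"
  then have "(I + axis k 1) $ k = 0" by simp
  then show False by (simp add: axis_def)
 qed
 then show ?case unfolding tc_step'[OF step(2)] Dex.simps step(1)[OF step(2)] by simp
qed

lemma tc_Con_Mul: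
 assumes v: "v ~= 0"
 shows "tc W I (Mul (Con f) e) x v = f x * tc W I e x v"
proof -
 have "(\<Sum>(A, E)\<in>antidiag I - {(0, I)}. (if A = 0 then f x else 0) * tc W E e x v) = 0"
  by (intro sum.neutral) (auto simp: antidiag_def split: if_splits)
 then show ?thesis unfolding tc_Mul[OF v] tc_Con[OF v] by (subst sum_antidiag_remove0) simp
qed

lemma tc_Dt_step: "v ~= 0 ==> tc W (I + axis k 1) (Dt w) x v = (if I = 0 then W k x \<bullet> w x else 0) / real (I $ k + 1)"
 unfolding tc_step' Dex.simps tc_Con by simp

lemma tc_Sq_step: "v ~= 0 ==> tc W (I + axis k 1) Sq x v = 2 / real (I $ k + 1) * tc W I (Dt (W k)) x v"
 unfolding tc_step' Dex.simps tc_Con_Mul by simp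

text \<open>\<open>power_coefficient_recursion\<close> in the parameter, for s = |v|^2 and q = -1/2:
  the inverse norm \<rho> satisfies s \<partial>\<rho> = -1/2 (\<partial>s) \<rho>. Dividing by s
  puts the two inverse norms in front.\<close>

lemma tc_Rh_recursion:
 fixes v :: "'v::real_inner"
 assumes v: "v ~= 0" and b: "b = J + axis k 1"
 shows "tc W b Rh x v = inverse (norm v) * inverse (norm v) *
  (\<Sum>(A, E)\<in>antidiag b - {(0, b)}. (((-1/2) * real (A $ k) - real (E $ k)) / real (b $ k)) * (tc W A Sq x v * tc W E Rh x v))"
proof -
 have n: "v \<bullet> v = norm v * norm v" "norm v ~= 0" using v by (simp_all add: power2_norm_eq_inner[symmetric] power2_eq_square)
 have "eveq (Mul Sq (Dex W k Rh)) (Mul (Con (\<lambda>_. -1/2)) (Mul (Dex W k Sq) Rh))"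
  unfolding eveq_def
 proof (intro allI impI)
  fix x and v :: 'v assume "v ~= 0"
  then have "v \<bullet> v = norm v * norm v" "norm v ~= 0" by (simp_all add: power2_norm_eq_inner[symmetric] power2_eq_square)
  then show "ev (Mul Sq (Dex W k Rh)) x v = ev (Mul (Con (\<lambda>_. -1/2)) (Mul (Dex W k Sq) Rh)) x v" by (simp add: field_simps)
 qed
 from tc_cong[OF this v, of W J x]
 have "(\<Sum>(A, E)\<in>antidiag J. tc W A Sq x v * tc W E (Dex W k Rh) x v) =
   (-1/2) * (\<Sum>(A, E)\<in>antidiag J. tc W A (Dex W k Sq) x v * tc W E Rh x v)"
  unfolding tc_Con_Mul[OF v] tc_Mul[OF v, of W J Sq] tc_Mul[OF v, of W J "Dex W k Sq"] .
 then have "(\<Sum>(A, E)\<in>antidiag J. real (E $ k + 1) * (tc W A Sq x v * tc W (E + axis k 1) Rh x v)) =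
   (-1/2) * (\<Sum>(A, E)\<in>antidiag J. real (A $ k + 1) * (tc W (A + axis k 1) Sq x v * tc W E Rh x v))"
  unfolding tc_step(1)[OF v, symmetric] by (simp only: mult_ac)
 from power_coefficient_recursion[OF this b]
 have "(norm v * norm v) * tc W b Rh x v = (\<Sum>(A, E)\<in>antidiag b - {(0, b)}. (((-1/2) * real (A $ k) - real (E $ k)) / real (b $ k)) * (tc W A Sq x v * tc W E Rh x v))"
  unfolding tc_0 ev.simps n(1) .
 moreover have "T = inverse m * inverse m * S" if "m * m * T = S" "m ~= 0" for m T S :: real
  using that(2) unfolding that(1)[symmetric] by (simp add: field_simps)
 ultimately show ?thesis using n(2) by blast
qed

section \<open>Bounds for the coefficient\<close>

text \<open>In \<open>V_bounds\<close> the exceptional set of x is the same for all y, so pointwise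
  identities for nonzero V hold at every parameter outside one null set. W k stands for \<sigma>_k
  \<psi>_k.\<close>

locale random_field = open_domain D for D :: "(real^'d::finite) set" +
 fixes \<kappa> :: nat and \<psi>0 :: "real^'d => real^'d" and W :: "'m::finite => real^'d => real^'d"
  and V :: "real^'m => real^'d => real^'d" and a_lo a_hi c :: real and \<gamma> :: "'m => real"
 assumes \<psi>0: "\<psi>0 \<in> sobolev D \<kappa> \<infinity>" and W: "!!k. W k \<in> sobolev D \<kappa> \<infinity>"
  and V_def: "!!y x. V y x = \<psi>0 x + (\<Sum>k\<in>UNIV. y $ k *\<^sub>R W k x)"
  and V_bounds: "AE x in lebesgue_on D. \<forall>y\<in>param_box. a_lo \<le> norm (V y x) \<and> norm (V y x) \<le> a_hi"
  and a_lo: "0 < a_lo" "a_lo \<le> 1"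
  and \<gamma>_def: "!!k. \<gamma> k = wnorm D \<kappa> \<infinity> 1 (W k)"
  and c: "wnorm D \<kappa> \<infinity> 1 \<psi>0 + (\<Sum>k\<in>UNIV. \<gamma> k) \<le> c" "2 \<le> c"
begin

abbreviation "N \<theta> f \<equiv> wnorm D \<kappa> \<infinity> \<theta> f"

text \<open>The weight with \<theta> c^2 = a_lo^2 / 2. As V \<bullet> V has norm at most c^2 and is
  at least a_lo^2, this is the condition of \<open>wnorm_powr_le\<close> for s = V \<bullet>
  V.\<close>

definition \<theta> :: real where "\<theta> = a_lo\<^sup>2 / (2 * c\<^sup>2)"

lemma \<theta>_pos: "0 < \<theta>" and \<theta>_le_1: "\<theta> \<le> 1"
proof -
 show "0 < \<theta>" using a_lo c by (simp add: \<theta>_def)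
 have "a_lo\<^sup>2 \<le> 1" using a_lo by (simp add: power_le_one)
 moreover have "1 \<le> c\<^sup>2" using c by (simp add: one_le_power)
 ultimately show "\<theta> \<le> 1" by (simp add: \<theta>_def divide_le_eq)
qed

lemma inf_mem: "\<infinity> \<in> {2, \<infinity>::ereal}" by simp

text \<open>Membership and bound in one predicate, so that estimates of composite expressions
  assemble by \<open>intro\<close> along their syntax.\<close>

definition bd :: "real => (real^'d => 'b::euclidean_space) => real => bool" where
 "bd \<tau> f C \<longleftrightarrow> f \<in> sobolev D \<kappa> \<infinity> \<and> N \<tau> f \<le> C"

lemma bd_sobolev: "bd \<tau> f C ==> f \<in> sobolev D \<kappa> \<infinity>" by (simp add: bd_def)

lemma bd_norm: "bd \<tau> f C ==> N \<tau> f \<le> C" by (simp add: bd_def)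

lemma bd_mono: "bd \<tau> f C ==> C \<le> C' ==> bd \<tau> f C'" by (simp add: bd_def)

lemma bd_nonneg: "0 \<le> \<tau> ==> bd \<tau> f C ==> 0 \<le> C"
 unfolding bd_def using wnorm_nonneg[OF inf_mem] order_trans by blast

lemma bd_add: "0 \<le> \<tau> ==> bd \<tau> f C ==> bd \<tau> g C' ==> bd \<tau> (\<lambda>x. f x + g x) (C + C')"
 unfolding bd_def using sobolev_add(1)[OF inf_mem, of f \<kappa> g] sobolev_add(2)[OF inf_mem, of f \<kappa> g \<tau>] by auto

lemma bd_scaleR: "0 \<le> \<tau> ==> bd \<tau> f C ==> bd \<tau> (\<lambda>x. r *\<^sub>R f x) (\<bar>r\<bar> * C)"
 unfolding bd_def using sobolev_scaleR(1)[OF inf_mem, of f \<kappa> r] sobolev_scaleR(2)[OF inf_mem, of f \<kappa> \<tau> r] mult_left_mono[of "N \<tau> f" C "\<bar>r\<bar>"] by auto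

lemma bd_diff: "0 \<le> \<tau> ==> bd \<tau> f C ==> bd \<tau> g C' ==> bd \<tau> (\<lambda>x. f x - g x) (C + C')"
 using bd_add[OF _ _ bd_scaleR[of \<tau> g C' "-1"]] by simp

lemma bd_mult:
 fixes f g :: "real^'d => real"
 assumes "0 \<le> \<tau>" "bd \<tau> f C" "bd \<tau> g C'"
 shows "bd \<tau> (\<lambda>x. f x * g x) (C * C')"
proof -
 have s: "f \<in> sobolev D \<kappa> \<infinity>" "g \<in> sobolev D \<kappa> \<infinity>" using assms bd_sobolev by auto
 have "N \<tau> (\<lambda>x. f x * g x) \<le> N \<tau> f * N \<tau> g" by (rule sobolev_mult(2)[OF inf_mem s assms(1)])
 also have "\<dots> \<le> C * C'" using assms bd_nonneg[OF assms(1,2)]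
  by (intro mult_mono) (auto simp: bd_def wnorm_nonneg)
 finally show ?thesis using sobolev_mult(1)[OF inf_mem s] by (simp add: bd_def)
qed

lemma bd_inner:
 fixes f g :: "real^'d => real^'n::finite"
 assumes "0 \<le> \<tau>" "bd \<tau> f C" "bd \<tau> g C'"
 shows "bd \<tau> (\<lambda>x. f x \<bullet> g x) (C * C')"
proof -
 have s: "f \<in> sobolev D \<kappa> \<infinity>" "g \<in> sobolev D \<kappa> \<infinity>" using assms bd_sobolev by auto
 have "N \<tau> (\<lambda>x. f x \<bullet> g x) \<le> N \<tau> f * N \<tau> g" by (rule sobolev_inner(2)[OF s assms(1)])
 also have "\<dots> \<le> C * C'" using assms bd_nonneg[OF assms(1,2)]
  by (intro mult_mono) (auto simp: bd_def wnorm_nonneg)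
 finally show ?thesis using sobolev_inner(1)[OF s] by (simp add: bd_def)
qed

lemma bd_zero: "bd \<tau> (\<lambda>x. 0) 0"
 by (simp add: bd_def sobolev_zero[OF inf_mem])

lemma bd_sum:
 assumes "0 \<le> \<tau>" "finite S" "!!s. s \<in> S ==> bd \<tau> (f s) (C s)"
 shows "bd \<tau> (\<lambda>x. \<Sum>s\<in>S. f s x) (\<Sum>s\<in>S. C s)"
 using assms(2,3) by (induction rule: finite_induct) (auto intro: bd_zero bd_add[OF assms(1)])

lemma bd_cong_AE:
 fixes f g :: "real^'d => 'b::euclidean_space"
 assumes f: "bd \<tau> f C" and ae: "AE x in lebesgue_on D. f x = g x"
 shows "bd \<tau> g C"
proof -
 have s: "f \<in> sobolev D \<kappa> \<infinity>" by (rule bd_sobolev[OF f])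
 have "g \<in> Lp_space D \<infinity>" by (rule Lp_space_cong_AE[OF inf_mem sobolev_Lp[OF inf_mem s] ae])
 then have "locally_integrable D g" by (rule Lp_locally_integrable[OF open_D inf_mem])
 from wnorm_cong_AE[OF inf_mem s this ae] f show ?thesis by (simp add: bd_def)
qed

lemma bd_self: "f \<in> sobolev D \<kappa> \<infinity> ==> bd \<tau> f (N \<tau> f)" by (simp add: bd_def)

lemma bd_nth: "0 \<le> \<tau> ==> bd \<tau> f C ==> bd \<tau> (\<lambda>x. f x $ i) C" for f :: "real^'d => real^'n::finite"
 unfolding bd_def using sobolev_nth(1)[of f \<kappa> i] sobolev_nth(2)[of f \<kappa> \<tau> i] by auto

lemma \<gamma>_nonneg: "0 \<le> \<gamma> k"
 unfolding \<gamma>_def by (rule wnorm_nonneg[OF inf_mem]) simp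

lemma param_box_nth: "y \<in> param_box ==> \<bar>y $ k\<bar> \<le> 1"
 by (auto simp: param_box_def mem_box_cart abs_le_iff)

lemma bd_W: "bd 1 (W k) (\<gamma> k)" "0 \<le> \<tau> ==> \<tau> \<le> 1 ==> bd \<tau> (W k) (\<gamma> k)"
 using W[of k] wnorm_weight_mono[OF inf_mem] unfolding bd_def \<gamma>_def by auto

lemma bd_V:
 assumes y: "y \<in> param_box"
 shows "0 \<le> \<tau> ==> \<tau> \<le> 1 ==> bd \<tau> (V y) c"
proof -
 have "bd 1 (\<lambda>x. \<psi>0 x + (\<Sum>k\<in>UNIV. y $ k *\<^sub>R W k x)) (N 1 \<psi>0 + (\<Sum>k\<in>UNIV. \<bar>y $ k\<bar> * \<gamma> k))"
  by (intro bd_add bd_sum bd_scaleR bd_W bd_self[OF \<psi>0]) auto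
 then have 1: "bd 1 (V y) (N 1 \<psi>0 + (\<Sum>k\<in>UNIV. \<bar>y $ k\<bar> * \<gamma> k))" unfolding V_def .
 have "(\<Sum>k\<in>UNIV. \<bar>y $ k\<bar> * \<gamma> k) \<le> (\<Sum>k\<in>UNIV. \<gamma> k)"
  using param_box_nth[OF y] \<gamma>_nonneg by (intro sum_mono mult_left_le_one_le) auto
 then have "bd 1 (V y) c" using c(1) by (intro bd_mono[OF 1]) simp
 then show "0 \<le> \<tau> ==> \<tau> \<le> 1 ==> bd \<tau> (V y) c"
  using wnorm_weight_mono[OF inf_mem, of \<tau> \<kappa> "V y"] unfolding bd_def by auto
qed

lemma bd_V_diff: "bd 1 (\<lambda>x. V y' x - V y x) ((\<Sum>k\<in>UNIV. \<gamma> k) * norm (y' - y))"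
proof -
 have "(\<lambda>x. V y' x - V y x) = (\<lambda>x. \<Sum>k\<in>UNIV. (y' $ k - y $ k) *\<^sub>R W k x)"
  by (simp add: V_def sum_subtractf[symmetric] scaleR_diff_left)
 moreover have "bd 1 (\<lambda>x. \<Sum>k\<in>UNIV. (y' $ k - y $ k) *\<^sub>R W k x) (\<Sum>k\<in>UNIV. \<bar>y' $ k - y $ k\<bar> * \<gamma> k)"
  by (intro bd_sum bd_scaleR bd_W) auto
 moreover have "(\<Sum>k\<in>UNIV. \<bar>y' $ k - y $ k\<bar> * \<gamma> k) \<le> (\<Sum>k\<in>UNIV. \<gamma> k) * norm (y' - y)"
  unfolding sum_distrib_right
 proof (rule sum_mono)
  fix k show "\<bar>y' $ k - y $ k\<bar> * \<gamma> k \<le> \<gamma> k * norm (y' - y)"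
   using component_le_norm_cart[of "y' - y" k] \<gamma>_nonneg[of k] by (simp add: mult.commute mult_left_mono)
 qed
 ultimately show ?thesis by (auto intro: bd_mono)
qed

lemma V_axis: "V (y + t *\<^sub>R axis k 1) x = V y x + t *\<^sub>R W k x"
proof -
 have "(\<Sum>j\<in>UNIV. (y + t *\<^sub>R axis k 1) $ j *\<^sub>R W j x) = (\<Sum>j\<in>UNIV. y $ j *\<^sub>R W j x + (if j = k then t else 0) *\<^sub>R W j x)"
  by (intro sum.cong) (auto simp: axis_def scaleR_add_left)
 also have "\<dots> = (\<Sum>j\<in>UNIV. y $ j *\<^sub>R W j x) + t *\<^sub>R W k x"
  by (simp add: sum.distrib if_distrib[of "\<lambda>z. z *\<^sub>R _"] cong: if_cong)
 finally show ?thesis by (simp add: V_def)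
qed

lemma powr_minus_half: "0 \<le> x ==> x powr (-1/2) = inverse (sqrt x)" for x :: real
 using powr_minus[of x "1/2"] by (simp add: powr_half_sqrt)

lemma inverse_norm_powr: "inverse (norm v) = (v \<bullet> v) powr (-1/2)" for v :: "real^'d"
 by (simp only: powr_minus_half[OF inner_ge_zero] norm_eq_sqrt_inner)

lemma bd_Rh:
 assumes y: "y \<in> param_box"
 shows "bd \<theta> (\<lambda>x. inverse (norm (V y x))) (2 / a_lo)"
proof -
 let ?s = "\<lambda>x. V y x \<bullet> V y x"
 have s: "bd 1 ?s (c * c)" by (intro bd_inner bd_V[OF y]) auto
 have ge: "AE x in lebesgue_on D. a_lo\<^sup>2 \<le> ?s x"
  using V_bounds
 proof eventually_elim
  case (elim x)
  then have "a_lo\<^sup>2 \<le> (norm (V y x))\<^sup>2" using y a_lo by (intro power_mono) auto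
  then show ?case by (simp add: power2_norm_eq_inner)
 qed
 have p: "(0::real) < a_lo\<^sup>2" using a_lo by simp
 have t: "\<theta> * N 1 ?s \<le> a_lo\<^sup>2 / 2"
 proof -
  have "\<theta> * N 1 ?s \<le> \<theta> * (c * c)" using bd_norm[OF s] \<theta>_pos by (intro mult_left_mono) auto
  also have "\<dots> = a_lo\<^sup>2 / 2" using c by (simp add: \<theta>_def power2_eq_square)
  finally show ?thesis .
 qed
 have "N \<theta> (\<lambda>x. ?s x powr (-1/2)) \<le> 2 * (a_lo\<^sup>2) powr (-1/2)"
  by (rule wnorm_powr_le[OF p bd_sobolev[OF s] ge _ _ _ \<theta>_le_1 t]) (use \<theta>_pos in auto)
 moreover have "(a_lo\<^sup>2) powr (-1/2) = 1 / a_lo"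
  using a_lo by (subst powr_minus_half) (simp_all add: inverse_eq_divide)
 moreover have "(\<lambda>x. ?s x powr (-1/2)) \<in> sobolev D \<kappa> \<infinity>" by (rule sobolev_powr[OF p bd_sobolev[OF s] ge])
 ultimately show ?thesis unfolding inverse_norm_powr bd_def by simp
qed

lemma bd_weight: "bd \<theta> f C ==> bd 1 f ((1 / \<theta>) ^ \<kappa> * C)"
proof -
 assume f: "bd \<theta> f C"
 have "N 1 f \<le> (1 / \<theta>) ^ \<kappa> * N \<theta> f" by (rule wnorm_weight_le[OF inf_mem \<theta>_pos \<theta>_le_1])
 also have "\<dots> \<le> (1 / \<theta>) ^ \<kappa> * C" using bd_norm[OF f] \<theta>_pos by (intro mult_left_mono) auto
 finally show ?thesis using f by (simp add: bd_def)
qed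

lemma bd_Rh': "y \<in> param_box ==> bd 1 (\<lambda>x. inverse (norm (V y x))) ((1 / \<theta>) ^ \<kappa> * (2 / a_lo))"
 by (rule bd_weight[OF bd_Rh])

section \<open>Uniform and Lipschitz bounds for expressions in the field\<close>

primrec wf :: "(real^'d, real^'d) expr => bool" where
 "wf (Con f) \<longleftrightarrow> f \<in> sobolev D \<kappa> \<infinity>"
| "wf (Dt w) \<longleftrightarrow> w \<in> sobolev D \<kappa> \<infinity>"
| "wf Rh \<longleftrightarrow> True"
| "wf Sq \<longleftrightarrow> True"
| "wf (Add e f) \<longleftrightarrow> wf e \<and> wf f"
| "wf (Mul e f) \<longleftrightarrow> wf e \<and> wf f"

lemma wf_Dex: "wf e ==> wf (Dex W k e)"
 by (induction e) (auto intro: sobolev_const sobolev_inner W)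

lemma wf_Dmi: "wf e ==> wf (Dmi W I e)"
proof -
 have "wf e ==> wf (foldr (Dex W) xs e)" for xs by (induction xs) (auto intro: wf_Dex)
 then show "wf e ==> wf (Dmi W I e)" by (simp add: Dmi_def)
qed

lemma bd_ev: "wf e ==> \<exists>C. \<forall>y\<in>param_box. bd 1 (\<lambda>x. ev e x (V y x)) C"
proof (induction e)
 case (Con f)
 then show ?case using bd_self by auto
next
 case (Dt w)
 then have w: "bd 1 w (N 1 w)" using bd_self by auto
 show ?case by (intro exI[of _ "c * N 1 w"] ballI) (simp add: bd_inner[OF _ bd_V w])
next
 case Rh
 show ?case using bd_Rh' by auto
next
 case Sq
 show ?case by (intro exI[of _ "c * c"] ballI) (simp add: bd_inner[OF _ bd_V bd_V])
next
 case (Add e f)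
 then obtain C C' where "\<forall>y\<in>param_box. bd 1 (\<lambda>x. ev e x (V y x)) C" "\<forall>y\<in>param_box. bd 1 (\<lambda>x. ev f x (V y x)) C'" by auto
 then show ?case by (intro exI[of _ "C + C'"]) (auto intro: bd_add)
next
 case (Mul e f)
 then obtain C C' where "\<forall>y\<in>param_box. bd 1 (\<lambda>x. ev e x (V y x)) C" "\<forall>y\<in>param_box. bd 1 (\<lambda>x. ev f x (V y x)) C'" by auto
 then show ?case by (intro exI[of _ "C * C'"]) (auto intro: bd_mult)
qed

text \<open>Differences of inverse norms will be rationalised with this denominator. The norm itself
  is controlled as V \<bullet> V times the inverse norm, for which a bound exists.\<close>

lemma bd_inverse_norm_sum:
 "\<exists>C. \<forall>y\<in>param_box. \<forall>y'\<in>param_box. bd 1 (\<lambda>x. inverse (norm (V y x) + norm (V y' x))) C"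
proof -
 let ?R = "(1 / \<theta>) ^ \<kappa> * (2 / a_lo)"
 have n: "bd 1 (\<lambda>x. norm (V y x)) ((c * c) * ?R)" if y: "y \<in> param_box" for y
 proof -
  have "bd 1 (\<lambda>x. (V y x \<bullet> V y x) * inverse (norm (V y x))) ((c * c) * ?R)"
   by (intro bd_mult bd_inner bd_V[OF y] bd_Rh'[OF y]) auto
  moreover have "(v \<bullet> v) * inverse (norm v) = norm v" for v :: "real^'d"
   by (cases "v = 0") (simp_all add: power2_norm_eq_inner[symmetric] power2_eq_square)
  ultimately show ?thesis by simp
 qed
 let ?K = "(c * c) * ?R + (c * c) * ?R"
 have K: "0 \<le> ?K" using c a_lo \<theta>_pos by simp
 obtain C where C: "!!g. g \<in> sobolev D \<kappa> \<infinity> ==> (AE x in lebesgue_on D. a_lo \<le> g x) ==> N 1 g \<le> ?K ==>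
  (\<lambda>x. inverse (g x)) \<in> sobolev D \<kappa> \<infinity> \<and> N 1 (\<lambda>x. inverse (g x)) \<le> C"
  using wnorm_inverse_bounded[OF a_lo(1) K, of \<kappa>] by auto
 show ?thesis
 proof (intro exI[of _ C] ballI)
  fix y y' :: "real^'m" assume y: "y \<in> param_box" "y' \<in> param_box"
  have b: "bd 1 (\<lambda>x. norm (V y x) + norm (V y' x)) ?K" by (intro bd_add n y) auto
  have "AE x in lebesgue_on D. a_lo \<le> norm (V y x) + norm (V y' x)"
   using V_bounds by eventually_elim (use y in \<open>auto intro: add_increasing2\<close>)
  from C[OF bd_sobolev[OF b] this bd_norm[OF b]]
  show "bd 1 (\<lambda>x. inverse (norm (V y x) + norm (V y' x))) C" by (simp add: bd_def)
 qed
qed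

lemma V_nonzero: "AE x in lebesgue_on D. \<forall>y\<in>param_box. V y x ~= 0"
 using V_bounds by eventually_elim (use a_lo in force)

text \<open>The difference of the norms is traded for (v' - v) \<bullet> (v' + v), so that only
  inner products and inverses remain, all of them within reach of \<open>bd\<close>.\<close>

lemma inverse_norm_diff:
 fixes v v' :: "real^'d"
 assumes "v ~= 0" "v' ~= 0"
 shows "inverse (norm v') - inverse (norm v) =
  - ((v' - v) \<bullet> (v' + v)) * (inverse (norm v + norm v') * (inverse (norm v) * inverse (norm v')))"
proof -
 have e: "(v' - v) \<bullet> (v' + v) = (norm v' - norm v) * (norm v + norm v')"
  by (simp add: inner_diff_left inner_add_right inner_commute dot_square_norm power2_eq_square algebra_simps)
 have "norm v ~= 0" "norm v' ~= 0" "norm v + norm v' ~= 0" using assms by (auto simp: add_nonneg_eq_0_iff)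
 moreover have "inverse n' - inverse n = - ((n' - n) * (n + n')) * (inverse (n + n') * (inverse n * inverse n'))"
  if "n ~= 0" "n' ~= 0" "n + n' ~= 0" for n n' :: real
 proof -
  have "(n + n') * inverse (n + n') = 1" using that(3) by simp
  then have "- ((n' - n) * (n + n')) * (inverse (n + n') * (inverse n * inverse n')) = - (n' - n) * (inverse n * inverse n')" by algebra
  then show ?thesis using that by (simp add: field_simps)
 qed
 ultimately show ?thesis unfolding e by blast
qed

lemma bd_ev_Lipschitz: "wf e ==> \<exists>C\<ge>0. \<forall>y\<in>param_box. \<forall>y'\<in>param_box. bd 1 (\<lambda>x. ev e x (V y' x) - ev e x (V y x)) (C * norm (y' - y))"
proof (induction e)
 case (Con f)
 show ?case by (intro exI[of _ 0]) (simp add: bd_zero)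
next
 case (Dt w)
 then have w: "bd 1 w (N 1 w)" using bd_self by auto
 let ?G = "\<Sum>k\<in>UNIV. \<gamma> k"
 have "bd 1 (\<lambda>x. ev (Dt w) x (V y' x) - ev (Dt w) x (V y x)) ((?G * N 1 w) * norm (y' - y))" for y y'
  using bd_inner[OF _ bd_V_diff w, of y' y] by (simp add: inner_diff_left mult_ac)
 moreover have "0 \<le> ?G * N 1 w" by (intro mult_nonneg_nonneg sum_nonneg \<gamma>_nonneg wnorm_nonneg[OF inf_mem]) auto
 ultimately show ?case by blast
next
 case Rh
 obtain M where M: "\<forall>y\<in>param_box. \<forall>y'\<in>param_box. bd 1 (\<lambda>x. inverse (norm (V y x) + norm (V y' x))) M"
  using bd_inverse_norm_sum by blast
 let ?G = "\<Sum>k\<in>UNIV. \<gamma> k" and ?R = "(1 / \<theta>) ^ \<kappa> * (2 / a_lo)"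
 have "bd 1 (\<lambda>x. ev Rh x (V y' x) - ev Rh x (V y x)) (((?G * (c + c)) * (M * (?R * ?R))) * norm (y' - y))"
  if y: "y \<in> param_box" "y' \<in> param_box" for y y'
 proof -
  have "bd 1 (\<lambda>x. (-1) *\<^sub>R (((V y' x - V y x) \<bullet> (V y' x + V y x)) * (inverse (norm (V y x) + norm (V y' x)) * (inverse (norm (V y x)) * inverse (norm (V y' x))))))
   (\<bar>-1\<bar> * (((?G * norm (y' - y)) * (c + c)) * (M * (?R * ?R))))"
   by (intro bd_scaleR bd_mult bd_inner bd_V_diff bd_add bd_V bd_Rh' y M[rule_format]) auto
  then have "bd 1 (\<lambda>x. (-1) *\<^sub>R (((V y' x - V y x) \<bullet> (V y' x + V y x)) * (inverse (norm (V y x) + norm (V y' x)) * (inverse (norm (V y x)) * inverse (norm (V y' x))))))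
   (((?G * (c + c)) * (M * (?R * ?R))) * norm (y' - y))" by (simp add: mult_ac)
  then show ?thesis
  proof (rule bd_cong_AE)
   show "AE x in lebesgue_on D. (-1) *\<^sub>R (((V y' x - V y x) \<bullet> (V y' x + V y x)) * (inverse (norm (V y x) + norm (V y' x)) * (inverse (norm (V y x)) * inverse (norm (V y' x))))) =
     ev Rh x (V y' x) - ev Rh x (V y x)"
    using V_nonzero
   proof eventually_elim
    case (elim x)
    then have "V y x ~= 0" "V y' x ~= 0" using y by auto
    from inverse_norm_diff[OF this] show ?case by simp
   qed
  qed
 qed
 moreover have "0 \<le> (?G * (c + c)) * (M * (?R * ?R))"
 proof -
  have "(0::real^'m) \<in> param_box" by (simp add: param_box_def mem_box_cart)
  then have "0 \<le> M" using M bd_nonneg[of 1] by fastforce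
  then show ?thesis using \<gamma>_nonneg c a_lo \<theta>_pos by (intro mult_nonneg_nonneg sum_nonneg) auto
 qed
 ultimately show ?case by blast
next
 case Sq
 let ?G = "\<Sum>k\<in>UNIV. \<gamma> k"
 have "bd 1 (\<lambda>x. ev Sq x (V y' x) - ev Sq x (V y x)) ((?G * (c + c)) * norm (y' - y))"
  if y: "y \<in> param_box" "y' \<in> param_box" for y y'
 proof -
  have "bd 1 (\<lambda>x. (V y' x - V y x) \<bullet> (V y' x + V y x)) ((?G * norm (y' - y)) * (c + c))"
   by (intro bd_inner bd_V_diff bd_add bd_V y) auto
  moreover have "(v' - v) \<bullet> (v' + v) = v' \<bullet> v' - v \<bullet> v" for v v' :: "real^'d"
   by (simp add: inner_diff_left inner_add_right inner_commute algebra_simps)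
  ultimately show ?thesis by (simp add: mult_ac)
 qed
 moreover have "0 \<le> ?G * (c + c)" using \<gamma>_nonneg c by (intro mult_nonneg_nonneg sum_nonneg) auto
 ultimately show ?case by blast
next
 case (Add e f)
 then obtain C C' where C: "C \<ge> 0" "\<forall>y\<in>param_box. \<forall>y'\<in>param_box. bd 1 (\<lambda>x. ev e x (V y' x) - ev e x (V y x)) (C * norm (y' - y))"
  and C': "C' \<ge> 0" "\<forall>y\<in>param_box. \<forall>y'\<in>param_box. bd 1 (\<lambda>x. ev f x (V y' x) - ev f x (V y x)) (C' * norm (y' - y))" by auto
 have "bd 1 (\<lambda>x. ev (Add e f) x (V y' x) - ev (Add e f) x (V y x)) ((C + C') * norm (y' - y))"
  if y: "y \<in> param_box" "y' \<in> param_box" for y y'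
  using bd_add[OF _ C(2)[rule_format, OF y] C'(2)[rule_format, OF y]] by (simp add: algebra_simps)
 then show ?case using C(1) C'(1) by (intro exI[of _ "C + C'"]) auto
next
 case (Mul e f)
 then obtain C C' where C: "C \<ge> 0" "\<forall>y\<in>param_box. \<forall>y'\<in>param_box. bd 1 (\<lambda>x. ev e x (V y' x) - ev e x (V y x)) (C * norm (y' - y))"
  and C': "C' \<ge> 0" "\<forall>y\<in>param_box. \<forall>y'\<in>param_box. bd 1 (\<lambda>x. ev f x (V y' x) - ev f x (V y x)) (C' * norm (y' - y))" by auto
 obtain B B' where B: "\<forall>y\<in>param_box. bd 1 (\<lambda>x. ev e x (V y x)) B" "\<forall>y\<in>param_box. bd 1 (\<lambda>x. ev f x (V y x)) B'"
  using bd_ev Mul.prems by fastforce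
 have "(0::real^'m) \<in> param_box" by (simp add: param_box_def mem_box_cart)
 then have B0: "0 \<le> B" "0 \<le> B'" using B bd_nonneg[of 1] by fastforce+
 have "bd 1 (\<lambda>x. ev (Mul e f) x (V y' x) - ev (Mul e f) x (V y x)) ((C * B' + B * C') * norm (y' - y))"
  if y: "y \<in> param_box" "y' \<in> param_box" for y y'
  using bd_add[OF _ bd_mult[OF _ C(2)[rule_format, OF y] B(2)[rule_format, OF y(2)]] bd_mult[OF _ B(1)[rule_format, OF y(1)] C'(2)[rule_format, OF y]]]
  by (simp add: algebra_simps)
 then show ?case using C(1) C'(1) B0 by (intro exI[of _ "C * B' + B * C'"]) auto
qed

end

section \<open>First order expansion of expressions in a parameter\<close>

context random_field
begin

text \<open>Taylor's formula at each x would say nothing about the x-derivatives of the remainder.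
  The remainder is instead written, expression by expression, as an algebraic combination of
  quantities already bounded in W^(\<kappa>,\<infinity>).\<close>

lemma bd_ev_second_order:
 assumes "wf e"
 shows "\<exists>C\<ge>0. \<forall>y\<in>param_box. \<forall>t. y + t *\<^sub>R axis k 1 \<in> param_box -->
  bd 1 (\<lambda>x. ev e x (V (y + t *\<^sub>R axis k 1) x) - ev e x (V y x) - t * ev (Dex W k e) x (V y x)) (C * t\<^sup>2)"
  (is "\<exists>C\<ge>0. \<forall>y\<in>param_box. \<forall>t. ?y t y \<in> param_box --> bd 1 (?f e y t) (C * t\<^sup>2)")
 using assms
proof (induction e)
 case (Con f)
 show ?case by (intro exI[of _ 0]) (simp add: bd_zero)
next
 case (Dt w)
 show ?case by (intro exI[of _ 0]) (simp add: bd_zero V_axis[simplified] inner_add_left)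
next
 case Rh
 obtain M where M: "\<forall>y\<in>param_box. \<forall>y'\<in>param_box. bd 1 (\<lambda>x. inverse (norm (V y x) + norm (V y' x))) M"
  using bd_inverse_norm_sum by blast
 let ?R = "(1 / \<theta>) ^ \<kappa> * (2 / a_lo)"
 have wfs: "wf Sq" "wf Rh" by simp_all
 obtain S where S: "S \<ge> 0" "\<forall>y\<in>param_box. \<forall>y'\<in>param_box. bd 1 (\<lambda>x. ev Sq x (V y' x) - ev Sq x (V y x)) (S * norm (y' - y))"
  using bd_ev_Lipschitz[OF wfs(1)] by blast
 obtain T where T: "T \<ge> 0" "\<forall>y\<in>param_box. \<forall>y'\<in>param_box. bd 1 (\<lambda>x. ev Rh x (V y' x) - ev Rh x (V y x)) (T * norm (y' - y))"
  using bd_ev_Lipschitz[OF wfs(2)] by blast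
 have M0: "0 \<le> M"
 proof -
  have "(0::real^'m) \<in> param_box" by (simp add: param_box_def mem_box_cart)
  then show "0 \<le> M" using M bd_nonneg[of 1] by fastforce
 qed
 let ?C = "\<bar>-1\<bar> * ((\<gamma> k * \<gamma> k) * (M * (?R * ?R))) + \<bar>-2\<bar> * ((c * \<gamma> k) * (?R * (M * T + \<bar>1/2\<bar> * (S * ((M * M) * (?R * ?R))))))"
 have C0: "0 \<le> ?C" using M0 S(1) T(1) \<gamma>_nonneg c a_lo \<theta>_pos by (intro add_nonneg_nonneg mult_nonneg_nonneg) auto
 have "bd 1 (?f Rh y t) (?C * t\<^sup>2)" if y: "y \<in> param_box" "?y t y \<in> param_box" for y t
 proof -
  let ?y' = "?y t y"
  let ?m = "\<lambda>x. inverse (norm (V y x) + norm (V ?y' x))" and ?r = "\<lambda>x. inverse (norm (V y x))" and ?r' = "\<lambda>x. inverse (norm (V ?y' x))"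
  have n: "norm (?y' - y) = \<bar>t\<bar>" by simp
  have Sy: "bd 1 (\<lambda>x. V ?y' x \<bullet> V ?y' x - V y x \<bullet> V y x) (S * \<bar>t\<bar>)" using S(2)[rule_format, OF y] by simp
  have Ty: "bd 1 (\<lambda>x. ?r' x - ?r x) (T * \<bar>t\<bar>)" using T(2)[rule_format, OF y] by simp
  \<comment> \<open>The order t^2 is visible here: the first summand carries t^2, the second carries
    t and a bracket in which each term contains a difference between the two parameters.\<close>
  let ?g = "\<lambda>x. (t\<^sup>2) *\<^sub>R ((-1) *\<^sub>R ((W k x \<bullet> W k x) * (?m x * (?r x * ?r' x)))) +
    (t *\<^sub>R ((-2) *\<^sub>R ((V y x \<bullet> W k x) * (?r x * (?m x * (?r' x - ?r x) - (1/2) *\<^sub>R ((V ?y' x \<bullet> V ?y' x - V y x \<bullet> V y x) * ((?m x * ?m x) * (?r x * ?r x))))))))"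
  have "bd 1 ?g
   (\<bar>t\<^sup>2\<bar> * (\<bar>-1\<bar> * ((\<gamma> k * \<gamma> k) * (M * (?R * ?R)))) +
   \<bar>t\<bar> * (\<bar>-2\<bar> * ((c * \<gamma> k) * (?R * (M * (T * \<bar>t\<bar>) + \<bar>1/2\<bar> * ((S * \<bar>t\<bar>) * ((M * M) * (?R * ?R))))))))"
   by (intro bd_add bd_diff bd_scaleR bd_mult bd_inner bd_W bd_V bd_Rh' y M[rule_format] Sy Ty) auto
  moreover have "\<bar>t\<^sup>2\<bar> * (\<bar>-1\<bar> * ((\<gamma> k * \<gamma> k) * (M * (?R * ?R)))) +
   \<bar>t\<bar> * (\<bar>-2\<bar> * ((c * \<gamma> k) * (?R * (M * (T * \<bar>t\<bar>) + \<bar>1/2\<bar> * ((S * \<bar>t\<bar>) * ((M * M) * (?R * ?R))))))) = ?C * t\<^sup>2"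
  proof -
   have "t\<^sup>2 * p + \<bar>t\<bar> * (q * (r * (Q * (M * (T * \<bar>t\<bar>) + h * ((S * \<bar>t\<bar>) * z))))) = (p + q * (r * (Q * (M * T + h * (S * z))))) * t\<^sup>2"
    for p q r Q h z :: real
   proof -
    have "t\<^sup>2 = \<bar>t\<bar> * \<bar>t\<bar>" by (simp add: power2_eq_square)
    then show ?thesis by algebra
   qed
   then show ?thesis by (simp only: abs_power2)
  qed
  ultimately have "bd 1 ?g (?C * t\<^sup>2)" by simp
  then show ?thesis
  proof (rule bd_cong_AE)
   show "AE x in lebesgue_on D. ?g x = ?f Rh y t x"
    using V_nonzero
   proof eventually_elim
    case (elim x)
    let ?v = "V y x" and ?v' = "V ?y' x"
    have v: "?v ~= 0" "?v' ~= 0" using elim y by auto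
    let ?n = "norm ?v" and ?n' = "norm ?v'"
    have s: "?n' * ?n' - ?n * ?n = 2 * t * (?v \<bullet> W k x) + t * t * (W k x \<bullet> W k x)"
     unfolding norm_eq_sqrt_inner real_sqrt_mult_self abs_of_nonneg[OF inner_ge_zero] V_axis
     by (simp add: inner_add_left inner_add_right inner_commute algebra_simps)
    have id: "(t\<^sup>2) * ((-1) * (q * (m * (r * r')))) + t * ((-2) * (p * (r * (m * (r' - r) - (1/2) * ((n' * n' - n * n) * ((m * m) * (r * r)))))))
      = r' - r - t * ((-1) * ((r * (r * r)) * p))"
     if n: "n' * n' - n * n = 2 * t * p + t * t * q" and i: "r * n = 1" "r' * n' = 1" "m * (n + n') = 1" for n n' p q r r' m :: real
    proof -
     have d: "r' - r = - (n' * n' - n * n) * (m * (r * r'))" using i by algebra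
     have m: "m - r / 2 = - (n' * n' - n * n) * (m * m) * (r / 2)"
     proof -
      have "2 * m - r = - (n' * n' - n * n) * (m * m) * r" using i by algebra
      then show ?thesis by simp
     qed
     have "r' - r - t * ((-1) * ((r * (r * r)) * p)) = - (t * t * q) * (m * (r * r')) - 2 * t * p * r * (m * r' - r / 2 * r)"
      unfolding d n by algebra
     also have "m * r' - r / 2 * r = m * (r' - r) + r * (m - r / 2)" by algebra
     finally show ?thesis unfolding m power2_eq_square by (simp add: algebra_simps)
    qed
    have "?n ~= 0" "?n' ~= 0" "?n + ?n' ~= 0" using v by (auto simp: add_nonneg_eq_0_iff)
    then have i: "inverse ?n * ?n = 1" "inverse ?n' * ?n' = 1" "inverse (?n + ?n') * (?n + ?n') = 1" by simp_all
    have sq: "?v \<bullet> ?v = ?n * ?n" "?v' \<bullet> ?v' = ?n' * ?n'" by (simp_all add: power2_norm_eq_inner[symmetric] power2_eq_square)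
    show ?case unfolding sq real_scaleR_def ev.simps Dex.simps by (rule id[OF s i])
   qed
  qed
 qed
 then show ?case using C0 by blast
next
 case Sq
 have "bd 1 (?f Sq y t) ((\<gamma> k * \<gamma> k) * t\<^sup>2)" if y: "y \<in> param_box" for y t
 proof -
  have "bd 1 (\<lambda>x. (t\<^sup>2) *\<^sub>R (W k x \<bullet> W k x)) (\<bar>t\<^sup>2\<bar> * (\<gamma> k * \<gamma> k))" by (intro bd_scaleR bd_inner bd_W) auto
  moreover have "(\<lambda>x. (t\<^sup>2) *\<^sub>R (W k x \<bullet> W k x)) = ?f Sq y t"
   by (simp add: V_axis[simplified] fun_eq_iff inner_add_left inner_add_right inner_commute power2_eq_square algebra_simps)
  ultimately show ?thesis by (simp add: mult.commute)
 qed
 then show ?case using \<gamma>_nonneg[of k] by (intro exI[of _ "\<gamma> k * \<gamma> k"]) simp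
next
 case (Add e f)
 then obtain C C' where C: "C \<ge> 0" "\<forall>y\<in>param_box. \<forall>t. ?y t y \<in> param_box --> bd 1 (?f e y t) (C * t\<^sup>2)"
  and C': "C' \<ge> 0" "\<forall>y\<in>param_box. \<forall>t. ?y t y \<in> param_box --> bd 1 (?f f y t) (C' * t\<^sup>2)" by auto
 have "bd 1 (?f (Add e f) y t) ((C + C') * t\<^sup>2)" if y: "y \<in> param_box" "?y t y \<in> param_box" for y t
  using bd_add[OF _ C(2)[rule_format, OF y] C'(2)[rule_format, OF y]] by (simp add: algebra_simps)
 then show ?case using C(1) C'(1) by (intro exI[of _ "C + C'"]) auto
next
 case (Mul e f)
 then have wfs: "wf e" "wf f" by auto
 from Mul obtain C C' where C: "C \<ge> 0" "\<forall>y\<in>param_box. \<forall>t. ?y t y \<in> param_box --> bd 1 (?f e y t) (C * t\<^sup>2)"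
  and C': "C' \<ge> 0" "\<forall>y\<in>param_box. \<forall>t. ?y t y \<in> param_box --> bd 1 (?f f y t) (C' * t\<^sup>2)" by auto
 obtain B B' where B: "\<forall>y\<in>param_box. bd 1 (\<lambda>x. ev e x (V y x)) B" "\<forall>y\<in>param_box. bd 1 (\<lambda>x. ev (Dex W k e) x (V y x)) B'"
  using bd_ev[OF wfs(1)] bd_ev[OF wf_Dex[OF wfs(1)]] by blast
 obtain F where F: "\<forall>y\<in>param_box. bd 1 (\<lambda>x. ev f x (V y x)) F" using bd_ev[OF wfs(2)] by blast
 obtain L where L: "L \<ge> 0" "\<forall>y\<in>param_box. \<forall>y'\<in>param_box. bd 1 (\<lambda>x. ev f x (V y' x) - ev f x (V y x)) (L * norm (y' - y))"
  using bd_ev_Lipschitz[OF wfs(2)] by blast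
 have "(0::real^'m) \<in> param_box" by (simp add: param_box_def mem_box_cart)
 then have B0: "0 \<le> B" "0 \<le> B'" "0 \<le> F" using B F bd_nonneg[of 1] by fastforce+
 have "bd 1 (?f (Mul e f) y t) ((C * F + B * C' + B' * L) * t\<^sup>2)" if y: "y \<in> param_box" "?y t y \<in> param_box" for y t
 proof -
  have Ly: "bd 1 (\<lambda>x. ev f x (V (?y t y) x) - ev f x (V y x)) (L * \<bar>t\<bar>)" using L(2)[rule_format, OF y] by simp
  \<comment> \<open>The remainder of a product: remainder of e times the new f, plus e times
    remainder of f, plus t times the derivative of e times the increment of f.\<close>
  have "bd 1 (\<lambda>x. (?f e y t x * ev f x (V (?y t y) x) + ev e x (V y x) * ?f f y t x) + t *\<^sub>R (ev (Dex W k e) x (V y x) * (ev f x (V (?y t y) x) - ev f x (V y x))))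
   ((C * t\<^sup>2) * F + B * (C' * t\<^sup>2) + \<bar>t\<bar> * (B' * (L * \<bar>t\<bar>)))"
   by (intro bd_add bd_mult bd_scaleR C(2)[rule_format, OF y] C'(2)[rule_format, OF y] B[rule_format, OF y(1)] F[rule_format, OF y(2)] Ly) auto
  moreover have "(C * t\<^sup>2) * F + B * (C' * t\<^sup>2) + \<bar>t\<bar> * (B' * (L * \<bar>t\<bar>)) = (C * F + B * C' + B' * L) * t\<^sup>2"
  proof -
   have "t\<^sup>2 = \<bar>t\<bar> * \<bar>t\<bar>" by (simp add: power2_eq_square)
   then show ?thesis by algebra
  qed
  moreover have "(\<lambda>x. (?f e y t x * ev f x (V (?y t y) x) + ev e x (V y x) * ?f f y t x) + t *\<^sub>R (ev (Dex W k e) x (V y x) * (ev f x (V (?y t y) x) - ev f x (V y x)))) = ?f (Mul e f) y t"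
   by (simp add: fun_eq_iff algebra_simps)
  ultimately show ?thesis by simp
 qed
 then show ?case using C(1) C'(1) B0 L(1) by (intro exI[of _ "C * F + B * C' + B' * L"]) auto
qed

end

section \<open>Majorants for the Taylor coefficients in the parameter\<close>

context random_field
begin

text \<open>F is the coefficient sequence of a one-variable majorant of e in s = \<Sum> \<gamma>_k
  z_k, uniform over the box and measured in the \<theta>-weighted norm in x.\<close>

definition mj :: "(real^'d, real^'d) expr => (nat => real) => bool" where
 "mj e F \<longleftrightarrow> (\<forall>J. \<forall>y\<in>param_box. bd \<theta> (\<lambda>x. tc W J e x (V y x)) (F (mi_size J) * mw \<gamma> J))"

lemma mjD: "mj e F ==> y \<in> param_box ==> bd \<theta> (\<lambda>x. tc W J e x (V y x)) (F (mi_size J) * mw \<gamma> J)"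
 by (simp add: mj_def)

lemma \<theta>_nonneg: "0 \<le> \<theta>" using \<theta>_pos by simp

lemma mw_\<gamma>_nonneg: "0 \<le> mw \<gamma> J" by (rule mw_nonneg[OF \<gamma>_nonneg])

lemma mj_mono: "mj e F ==> (!!n. F n \<le> G n) ==> mj e G"
 unfolding mj_def by (blast intro: bd_mono mult_right_mono mw_\<gamma>_nonneg)

text \<open>The identities for \<^const>\<open>tc\<close> hold almost everywhere, where \<open>V y x\<close> does not vanish.\<close>

lemma bd_tc_eq:
 assumes "bd \<theta> (\<lambda>x. f x (V y x)) C" "y \<in> param_box" "!!x v. v ~= 0 ==> f x v = tc W J e x v"
 shows "bd \<theta> (\<lambda>x. tc W J e x (V y x)) C"
 using assms(1)
proof (rule bd_cong_AE)
 show "AE x in lebesgue_on D. f x (V y x) = tc W J e x (V y x)"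
  using V_nonzero by eventually_elim (use assms(2,3) in auto)
qed

lemma mj_Add:
 assumes "mj e F" "mj f G"
 shows "mj (Add e f) (\<lambda>n. F n + G n)"
 unfolding mj_def
proof (intro allI ballI)
 fix J y assume y: "(y :: real^'m) \<in> param_box"
 have "bd \<theta> (\<lambda>x. tc W J e x (V y x) + tc W J f x (V y x)) ((F (mi_size J) + G (mi_size J)) * mw \<gamma> J)"
  using bd_add[OF \<theta>_nonneg mjD[OF assms(1) y, of J] mjD[OF assms(2) y, of J]] by (simp add: distrib_right)
 then show "bd \<theta> (\<lambda>x. tc W J (Add e f) x (V y x)) ((F (mi_size J) + G (mi_size J)) * mw \<gamma> J)"
  by (rule bd_tc_eq[OF _ y]) (simp add: tc_Add)
qed

lemma mj_Con: "mj (Con (\<lambda>_. r)) (\<lambda>n. if n = 0 then \<bar>r\<bar> * B else 0)" if "bd \<theta> (\<lambda>_. 1 :: real) B"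
 unfolding mj_def
proof (intro allI ballI)
 fix J y assume y: "(y :: real^'m) \<in> param_box"
 have "bd \<theta> (\<lambda>x. if J = 0 then r else 0) ((if mi_size J = 0 then \<bar>r\<bar> * B else 0) * mw \<gamma> J)"
  using bd_scaleR[OF \<theta>_nonneg that, of r] bd_zero by (auto simp: mi_size_eq_0)
 then show "bd \<theta> (\<lambda>x. tc W J (Con (\<lambda>_. r)) x (V y x)) ((if mi_size J = 0 then \<bar>r\<bar> * B else 0) * mw \<gamma> J)"
  by (rule bd_tc_eq[OF _ y]) (simp add: tc_Con)
qed

lemma mj_Con_Mul:
 assumes "mj e F"
 shows "mj (Mul (Con (\<lambda>_. r)) e) (\<lambda>n. \<bar>r\<bar> * F n)"
 unfolding mj_def
proof (intro allI ballI)
 fix J y assume y: "(y :: real^'m) \<in> param_box"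
 have "bd \<theta> (\<lambda>x. r * tc W J e x (V y x)) (\<bar>r\<bar> * F (mi_size J) * mw \<gamma> J)"
  using bd_scaleR[OF \<theta>_nonneg mjD[OF assms y, of J], of r] by (simp add: mult.assoc)
 then show "bd \<theta> (\<lambda>x. tc W J (Mul (Con (\<lambda>_. r)) e) x (V y x)) (\<bar>r\<bar> * F (mi_size J) * mw \<gamma> J)"
  by (rule bd_tc_eq[OF _ y]) (simp add: tc_Con_Mul)
qed

lemma mj_Mul:
 assumes "mj e F" "mj f G"
 shows "mj (Mul e f) (\<lambda>n. \<Sum>j\<le>n. F j * G (n - j))"
 unfolding mj_def
proof (intro allI ballI)
 fix J y assume y: "(y :: real^'m) \<in> param_box"
 have "bd \<theta> (\<lambda>x. \<Sum>p\<in>antidiag J. tc W (fst p) e x (V y x) * tc W (snd p) f x (V y x))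
  (\<Sum>p\<in>antidiag J. (F (mi_size (fst p)) * mw \<gamma> (fst p)) * (G (mi_size (snd p)) * mw \<gamma> (snd p)))"
  by (intro bd_sum bd_mult mjD[OF assms(1) y] mjD[OF assms(2) y] \<theta>_nonneg finite_antidiag)
 then have "bd \<theta> (\<lambda>x. \<Sum>(A, E)\<in>antidiag J. tc W A e x (V y x) * tc W E f x (V y x))
   ((\<Sum>j\<le>mi_size J. F j * G (mi_size J - j)) * mw \<gamma> J)"
  by (simp add: mw_convolution[symmetric] case_prod_beta)
 then show "bd \<theta> (\<lambda>x. tc W J (Mul e f) x (V y x)) ((\<Sum>j\<le>mi_size J. F j * G (mi_size J - j)) * mw \<gamma> J)"
  by (rule bd_tc_eq[OF _ y]) (simp add: tc_Mul)
qed

lemma mi_size_add_axis: "mi_size (I + axis k (1::nat)) = mi_size I + 1"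
 unfolding mi_size_add mi_size_axis ..

lemma mw_divide: "mw \<gamma> I / real (I $ k + 1) * \<gamma> k = mw \<gamma> (I + axis k 1) / real (mi_size I + 1)"
proof -
 have "q / A * g = p / B" if "A * p = B * (g * q)" "A ~= 0" "B ~= 0" for A B p g q :: real
  using that by (simp add: field_simps)
 from this[OF mw_step[of I k \<gamma>]] show ?thesis by simp
qed

text \<open>\<open>V y x \<bullet> w x\<close> is affine in y, so only orders 0 and 1 survive; the
  majorant is g (c + s).\<close>

lemma mj_Dt:
 assumes g: "0 \<le> g" "!!y. y \<in> param_box ==> bd \<theta> (\<lambda>x. V y x \<bullet> w x) (c * g)" "!!k. bd \<theta> (\<lambda>x. W k x \<bullet> w x) (\<gamma> k * g)"
 shows "mj (Dt w) (\<lambda>n. if n = 0 then c * g else if n = 1 then g else 0)"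
 unfolding mj_def
proof (intro allI ballI)
 fix J y assume y: "(y :: real^'m) \<in> param_box"
 show "bd \<theta> (\<lambda>x. tc W J (Dt w) x (V y x)) ((if mi_size J = 0 then c * g else if mi_size J = 1 then g else 0) * mw \<gamma> J)"
 proof (cases "J = 0")
  case True
  have "bd \<theta> (\<lambda>x. V y x \<bullet> w x) ((if mi_size J = 0 then c * g else if mi_size J = 1 then g else 0) * mw \<gamma> J)"
   using g(2)[OF y] True by simp
  then show ?thesis by (rule bd_tc_eq[OF _ y]) (simp add: tc_0 True)
 next
  case False
  then obtain k where "J $ k ~= 0" by (auto simp: vec_eq_iff)
  then obtain I where b: "J = I + axis k 1" by (rule mi_decompose)
  have "bd \<theta> (\<lambda>x. (if I = 0 then W k x \<bullet> w x else 0) / real (I $ k + 1)) ((if mi_size J = 0 then c * g else if mi_size J = 1 then g else 0) * mw \<gamma> J)"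
  proof (cases "I = 0")
   case True
   then show ?thesis using g(3)[of k] mw_divide[of 0 k] unfolding b by (simp add: mi_size_axis[simplified] mult.commute)
  next
   case False
   then show ?thesis unfolding b by (simp add: mi_size_add_axis[simplified] mi_size_eq_0 bd_zero)
  qed
  then show ?thesis unfolding b by (rule bd_tc_eq[OF _ y]) (erule tc_Dt_step[symmetric])
 qed
qed

lemma mj_Sq: "mj Sq (\<lambda>n. if n = 0 then c * c else if n = 1 then 2 * c else if n = 2 then 1 else 0)" (is "mj Sq ?F")
 unfolding mj_def
proof (intro allI ballI)
 fix J y assume y: "(y :: real^'m) \<in> param_box"
 show "bd \<theta> (\<lambda>x. tc W J Sq x (V y x)) (?F (mi_size J) * mw \<gamma> J)"
 proof (cases "J = 0")
  case True
  have "bd \<theta> (\<lambda>x. V y x \<bullet> V y x) (c * c)" by (intro bd_inner bd_V y \<theta>_nonneg \<theta>_le_1)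
  then have "bd \<theta> (\<lambda>x. V y x \<bullet> V y x) (?F (mi_size J) * mw \<gamma> J)" using True by simp
  then show ?thesis by (rule bd_tc_eq[OF _ y]) (simp add: tc_0 True)
 next
  case False
  then obtain k where "J $ k ~= 0" by (auto simp: vec_eq_iff)
  then obtain I where b: "J = I + axis k 1" by (rule mi_decompose)
  let ?G = "\<lambda>n. if n = 0 then c * \<gamma> k else if n = 1 then \<gamma> k else 0"
  \<comment> \<open>The k-th derivative of the square is 2 V \<bullet> W k, affine in y; division by
    I_k + 1 turns its weight into that of J (\<open>mw_divide\<close>).\<close>
  have "mj (Dt (W k)) ?G" by (intro mj_Dt bd_inner bd_V bd_W \<gamma>_nonneg \<theta>_nonneg \<theta>_le_1)
  from bd_scaleR[OF \<theta>_nonneg mjD[OF this y, of I], of "2 / real (I $ k + 1)"]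
  have 1: "bd \<theta> (\<lambda>x. 2 / real (I $ k + 1) * tc W I (Dt (W k)) x (V y x)) (\<bar>2 / real (I $ k + 1)\<bar> * (?G (mi_size I) * mw \<gamma> I))" by simp
  have "\<bar>2 / real (I $ k + 1)\<bar> * (?G (mi_size I) * mw \<gamma> I) = 2 * (if mi_size I = 0 then c else if mi_size I = 1 then 1 else 0) * (mw \<gamma> I / real (I $ k + 1) * \<gamma> k)"
   by simp
  also have "\<dots> = ?F (mi_size J) * mw \<gamma> J" unfolding mw_divide b mi_size_add_axis by simp
  finally show ?thesis using 1 unfolding b by (intro bd_tc_eq[OF _ y, where f = "\<lambda>x v. 2 / real (I $ k + 1) * tc W I (Dt (W k)) x v"]) (simp only:, erule tc_Sq_step[symmetric])
 qed
qed

text \<open>The geometric rate for 1/|V|, three quarters of the rate \<open>m\<close> behind \<mu>.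
  The ratio pays for the factor n + 1 that squaring 1/|V| creates.\<close>

definition L :: real where "L = 3 * c\<^sup>2 / (a_lo\<^sup>2 * ln 2)"

lemma ln2_less: "ln 2 < (7/10::real)" using ln2_le_25_over_36 by simp

text \<open>The fractions come from ln 2 < 7/10 and c \<ge> 2. Together they give 2 c / L + 1 / L^2
  \<le> a_lo^2 / 4, which closes the recursion in \<open>mj_Rh\<close>.\<close>

lemma L_bounds: "0 < L" "2 * c / L \<le> 7/15 * (a_lo\<^sup>2 / 2)" "1 / L\<^sup>2 \<le> 1/60 * (a_lo\<^sup>2 / 4)" "a_lo\<^sup>2 \<le> 1"
proof -
 have l: "0 < ln (2::real)" by simp
 show 0: "0 < L" using a_lo c l by (simp add: L_def)
 show a: "a_lo\<^sup>2 \<le> 1" using a_lo by (simp add: power_le_one)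
 have "2 * c / L = 2/3 * (a_lo\<^sup>2 * (ln 2 / c))" using c a_lo l by (simp add: L_def field_simps power2_eq_square)
 also have "ln 2 / c \<le> (7/10) / 2" using ln2_less c l by (intro frac_le) auto
 finally show "2 * c / L \<le> 7/15 * (a_lo\<^sup>2 / 2)" using a_lo by (simp add: mult_left_mono)
 have c2: "4 \<le> c\<^sup>2" using c power_mono[of 2 c 2] by simp
 have "1 / L = 1/3 * (a_lo\<^sup>2 * (ln 2 / c\<^sup>2))" using c a_lo l by (simp add: L_def field_simps)
 also have "ln 2 / c\<^sup>2 \<le> (7/10) / 4" using ln2_less c2 l by (intro frac_le) auto
 finally have le: "1 / L \<le> 7/120 * a_lo\<^sup>2" using a_lo by (simp add: mult_left_mono)
 then have "1 / L * (1 / L) \<le> (7/120 * a_lo\<^sup>2) * (7/120 * 1)" using 0 a a_lo by (intro mult_mono order_trans[OF le]) auto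
 also have "\<dots> \<le> 1/60 * (a_lo\<^sup>2 / 4)" using a_lo by simp
 finally show "1 / L\<^sup>2 \<le> 1/60 * (a_lo\<^sup>2 / 4)" by (simp add: power2_eq_square)
qed

lemma sum_quadratic_majorant:
 fixes F :: "nat => real"
 assumes F: "!!n. 2 < n ==> F n = 0"
 shows "(\<Sum>j\<le>n. F j * h (n - j)) = F 0 * h n + (if 1 \<le> n then F 1 * h (n - 1) else 0) + (if 2 \<le> n then F 2 * h (n - 2) else 0)"
proof -
 have "(\<Sum>j\<le>n. F j * h (n - j)) = (\<Sum>j\<in>{0,1,2} \<inter> {..n}. F j * h (n - j))"
 proof (intro sum.mono_neutral_right ballI)
  fix j assume j: "j \<in> {..n} - {0,1,2} \<inter> {..n}"
  have "2 < j" if "j ~= 0" "j ~= 1" "j ~= 2" using that by linarith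
  then show "F j * h (n - j) = 0" using j F[of j] by auto
 qed auto
 also have "\<dots> = (\<Sum>j\<in>{0,1,2}. if j \<in> {..n} then F j * h (n - j) else 0)" by (rule sum.inter_restrict) simp
 finally show ?thesis by simp
qed

text \<open>Strong induction along \<open>tc_Rh_recursion\<close>. The factor 1/|V|^2 costs
  (2/a_lo)^2, the recursion coefficients at most 1, and the convolution with the positive-order part
  of V \<bullet> V costs a_lo^2 / 4; the product is 1, so the bound reproduces itself.\<close>

lemma mj_Rh: "mj Rh (\<lambda>n. 2 / a_lo * L ^ n)"
proof -
 have "\<forall>y\<in>param_box. bd \<theta> (\<lambda>x. tc W J Rh x (V y x)) (2 / a_lo * L ^ mi_size J * mw \<gamma> J)" for J
 proof (induction "mi_size J" arbitrary: J rule: less_induct)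
  case less
  show ?case
  proof
   fix y :: "real^'m" assume y: "y \<in> param_box"
   show "bd \<theta> (\<lambda>x. tc W J Rh x (V y x)) (2 / a_lo * L ^ mi_size J * mw \<gamma> J)"
   proof (cases "J = 0")
    case True
    have "bd \<theta> (\<lambda>x. inverse (norm (V y x))) (2 / a_lo * L ^ mi_size J * mw \<gamma> J)" using bd_Rh[OF y] True by simp
    then show ?thesis by (rule bd_tc_eq[OF _ y]) (simp add: tc_0 True)
   next
    case False
    then obtain k where k: "J $ k ~= 0" by (auto simp: vec_eq_iff)
    then obtain I where b: "J = I + axis k 1" by (rule mi_decompose)
    \<comment> \<open>The majorant of V \<bullet> V without its order 0, since the pair (0, J) is
      the one solved for.\<close>
    let ?F = "\<lambda>n::nat. if n = 1 then 2 * c else if n = 2 then 1 else (0::real)" and ?G = "\<lambda>n. 2 / a_lo * L ^ n"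
    let ?q = "\<lambda>p. ((-1/2) * real (fst p $ k) - real (snd p $ k)) / real (J $ k)"
    let ?S = "antidiag J - {(0, J)}"
    let ?f = "\<lambda>p x. ?q p *\<^sub>R (tc W (fst p) Sq x (V y x) * tc W (snd p) Rh x (V y x))"
    have p: "bd \<theta> (?f p) ((?F (mi_size (fst p)) * mw \<gamma> (fst p)) * (?G (mi_size (snd p)) * mw \<gamma> (snd p)))"
     (is "bd \<theta> _ ?B") if p: "p \<in> ?S" for p
    proof -
     have ad: "fst p + snd p = J" using p by (simp add: antidiag_def)
     have "fst p ~= 0" using p ad by (cases p) auto
     then have s: "mi_size (fst p) ~= 0" by (simp add: mi_size_eq_0)
     have "mi_size (fst p) + mi_size (snd p) = mi_size J" unfolding ad[symmetric] by (rule mi_size_add[symmetric])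
     then have lt: "mi_size (snd p) < mi_size J" using s by simp
     have "bd \<theta> (\<lambda>x. tc W (fst p) Sq x (V y x)) (?F (mi_size (fst p)) * mw \<gamma> (fst p))"
      using mjD[OF mj_Sq y, of "fst p"] s by simp
     from bd_mult[OF \<theta>_nonneg this less(1)[OF lt, rule_format, OF y]]
     have B: "bd \<theta> (\<lambda>x. tc W (fst p) Sq x (V y x) * tc W (snd p) Rh x (V y x)) ?B" .
     have "\<bar>?q p\<bar> \<le> 1" using power_coefficient_le[of "fst p" "snd p" J k "-1/2"] p k by simp
     then have "\<bar>?q p\<bar> * ?B \<le> ?B" using bd_nonneg[OF \<theta>_nonneg B] by (intro mult_left_le_one_le) auto
     then show ?thesis by (rule bd_mono[OF bd_scaleR[OF \<theta>_nonneg B]])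
    qed
    have 1: "bd \<theta> (\<lambda>x. inverse (norm (V y x)) * inverse (norm (V y x)) * (\<Sum>p\<in>?S. ?f p x))
     (2 / a_lo * (2 / a_lo) * (\<Sum>p\<in>?S. (?F (mi_size (fst p)) * mw \<gamma> (fst p)) * (?G (mi_size (snd p)) * mw \<gamma> (snd p))))"
     by (intro bd_mult bd_sum bd_Rh y \<theta>_nonneg p) (auto intro: finite_antidiag)
    have "(\<Sum>p\<in>?S. (?F (mi_size (fst p)) * mw \<gamma> (fst p)) * (?G (mi_size (snd p)) * mw \<gamma> (snd p))) =
      (\<Sum>(A, E)\<in>antidiag J. (?F (mi_size A) * mw \<gamma> A) * (?G (mi_size E) * mw \<gamma> E))"
     by (subst sum_antidiag_remove0) (simp add: case_prod_beta)
    also have "\<dots> = (\<Sum>j\<le>mi_size J. ?F j * ?G (mi_size J - j)) * mw \<gamma> J" by (rule mw_convolution)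
    also have "\<dots> \<le> ((a_lo\<^sup>2 / 4) * ?G (mi_size J)) * mw \<gamma> J"
    proof (rule mult_right_mono[OF _ mw_\<gamma>_nonneg])
     let ?n = "mi_size J"
     have n: "1 \<le> ?n" using False mi_size_eq_0[of J] by linarith
     have e1: "2 * c * ?G (?n - 1) = (2 * c / L) * ?G ?n"
     proof -
      have "L ^ ?n = L * L ^ (?n - 1)" using n by (cases ?n) auto
      then show ?thesis using L_bounds(1) by simp
     qed
     have e2: "(if 2 \<le> ?n then ?G (?n - 2) else 0) \<le> (1 / L\<^sup>2) * ?G ?n"
     proof (cases "2 \<le> ?n")
      case True
      then have "2 + (?n - 2) = ?n" by simp
      then have "L ^ ?n = L\<^sup>2 * L ^ (?n - 2)" by (metis power_add)
      then show ?thesis using L_bounds(1) True by simp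
     qed (use L_bounds(1) a_lo in simp)
     have "(\<Sum>j\<le>?n. ?F j * ?G (?n - j)) = 2 * c * ?G (?n - 1) + (if 2 \<le> ?n then ?G (?n - 2) else 0)"
      using n by (subst sum_quadratic_majorant) auto
     also have "\<dots> \<le> (2 * c / L + 1 / L\<^sup>2) * ?G ?n" unfolding distrib_right using e1 e2 by linarith
     also have "\<dots> \<le> (a_lo\<^sup>2 / 4) * ?G ?n"
     proof (rule mult_right_mono)
      show "2 * c / L + 1 / L\<^sup>2 \<le> a_lo\<^sup>2 / 4" using L_bounds zero_le_power2[of a_lo] by linarith
     qed (use L_bounds(1) a_lo in simp)
     finally show "(\<Sum>j\<le>?n. ?F j * ?G (?n - j)) \<le> (a_lo\<^sup>2 / 4) * ?G ?n" .
    qed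
    finally have "2 / a_lo * (2 / a_lo) * (\<Sum>p\<in>?S. (?F (mi_size (fst p)) * mw \<gamma> (fst p)) * (?G (mi_size (snd p)) * mw \<gamma> (snd p))) \<le>
      2 / a_lo * (2 / a_lo) * (((a_lo\<^sup>2 / 4) * ?G (mi_size J)) * mw \<gamma> J)" using a_lo by (intro mult_left_mono) auto
    also have "\<dots> = 2 / a_lo * L ^ mi_size J * mw \<gamma> J"
    proof -
     have "2 / a_lo * (2 / a_lo) * (a_lo\<^sup>2 / 4) = 1" using a_lo by (simp add: power2_eq_square)
     moreover have "q * q * (r * g * w) = g * w" if "q * q * r = 1" for q r g w :: real using that by algebra
     ultimately show ?thesis by blast
    qed
    finally have "bd \<theta> (\<lambda>x. inverse (norm (V y x)) * inverse (norm (V y x)) * (\<Sum>p\<in>?S. ?f p x)) (2 / a_lo * L ^ mi_size J * mw \<gamma> J)"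
     by (rule bd_mono[OF 1])
    then show ?thesis
    proof (rule bd_cong_AE)
     show "AE x in lebesgue_on D. inverse (norm (V y x)) * inverse (norm (V y x)) * (\<Sum>p\<in>?S. ?f p x) = tc W J Rh x (V y x)"
      using V_nonzero
     proof eventually_elim
      case (elim x)
      then have "V y x ~= 0" using y by auto
      from tc_Rh_recursion[OF this b, of W x] show ?case unfolding case_prod_beta real_scaleR_def by (rule sym)
     qed
    qed
   qed
  qed
 qed
 then show ?thesis by (simp add: mj_def)
qed

text \<open>If h grows at least at rate L, then h (n - 1) \<le> h n / L, and the lower terms of (c +
  s)^2 add at most 2 c / L + 1 / L^2 \<le> 1/4 \<le> c^2 / 16.\<close>

lemma convolution_quadratic_le:
 assumes h: "!!n. 0 \<le> h n" "!!n. L * h n \<le> h (Suc n)"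
 shows "(\<Sum>j\<le>n. (if j = 0 then c * c else if j = 1 then 2 * c else if j = 2 then 1 else 0) * h (n - j)) \<le> 17/16 * c\<^sup>2 * h n"
proof -
 have c2: "4 \<le> c\<^sup>2" using c power_mono[of 2 c 2] by simp
 have s: "h k \<le> h (Suc k) / L" for k using h(2)[of k] L_bounds(1) by (simp add: field_simps)
 have 1: "(if 1 \<le> n then 2 * c * h (n - 1) else 0) \<le> (2 * c / L) * h n"
 proof (cases n)
  case (Suc k)
  then show ?thesis using mult_left_mono[OF s[of k], of "2 * c"] c by simp
 qed (use h(1)[of 0] c L_bounds(1) in simp)
 have 2: "(if 2 \<le> n then 1 * h (n - 2) else 0) \<le> (1 / L\<^sup>2) * h n"
 proof (cases "2 \<le> n")
  case True
  then obtain k where n: "n = Suc (Suc k)" by (metis add_2_eq_Suc le_Suc_ex)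
  have "h k \<le> h n / L / L" unfolding n using s[of k] divide_right_mono[OF s[of "Suc k"], of L] L_bounds(1) by linarith
  then show ?thesis using True n by (simp add: power2_eq_square)
 qed (use h(1)[of n] in simp)
 have "(\<Sum>j\<le>n. (if j = 0 then c * c else if j = 1 then 2 * c else if j = 2 then 1 else 0) * h (n - j)) =
   c * c * h n + (if 1 \<le> n then 2 * c * h (n - 1) else 0) + (if 2 \<le> n then 1 * h (n - 2) else 0)"
  by (subst sum_quadratic_majorant) auto
 also have "\<dots> \<le> (c\<^sup>2 + 2 * c / L + 1 / L\<^sup>2) * h n" unfolding distrib_right power2_eq_square[of c] using 1 2 by linarith
 also have "\<dots> \<le> 17/16 * c\<^sup>2 * h n"
 proof (rule mult_right_mono[OF _ h(1)])
  show "c\<^sup>2 + 2 * c / L + 1 / L\<^sup>2 \<le> 17/16 * c\<^sup>2" using L_bounds c2 zero_le_power2[of a_lo] by linarith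
 qed
 finally show ?thesis .
qed

text \<open>All n + 1 terms of the convolution of two geometric sequences of the same rate are
  equal.\<close>

lemma mj_Rh_Rh: "mj (Mul Rh Rh) (\<lambda>n. 4 / a_lo\<^sup>2 * (real n + 1) * L ^ n)"
proof (rule mj_mono[OF mj_Mul[OF mj_Rh mj_Rh]])
 fix n
 have "(\<Sum>j\<le>n. 2 / a_lo * L ^ j * (2 / a_lo * L ^ (n - j))) = (\<Sum>j\<le>n. 4 / a_lo\<^sup>2 * L ^ n)"
 proof (rule sum.cong)
  fix j assume "j \<in> {..n}"
  then have "L ^ n = L ^ j * L ^ (n - j)" by (subst power_add[symmetric]) simp
  then show "2 / a_lo * L ^ j * (2 / a_lo * L ^ (n - j)) = 4 / a_lo\<^sup>2 * L ^ n" by (simp add: power2_eq_square)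
 qed simp
 then show "(\<Sum>j\<le>n. 2 / a_lo * L ^ j * (2 / a_lo * L ^ (n - j))) \<le> 4 / a_lo\<^sup>2 * (real n + 1) * L ^ n" by (simp add: algebra_simps)
qed

abbreviation De :: "'d => (real^'d, real^'d) expr" where "De i \<equiv> Dt (\<lambda>_. axis i 1)"

lemma mj_De: "mj (De i) (\<lambda>n. if n = 0 then c * 1 else if n = 1 then 1 else 0)"
proof (rule mj_Dt)
 show "bd \<theta> (\<lambda>x. V y x \<bullet> axis i 1) (c * 1)" if "y \<in> param_box" for y
  using bd_nth[OF \<theta>_nonneg bd_V[OF that \<theta>_nonneg \<theta>_le_1], of i] by (simp add: inner_axis)
 show "bd \<theta> (\<lambda>x. W k x \<bullet> axis i 1) (\<gamma> k * 1)" for k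
  using bd_nth[OF \<theta>_nonneg bd_W(2)[OF \<theta>_nonneg \<theta>_le_1], of k i] by (simp add: inner_axis)
qed simp

lemma mj_De_De: "mj (Mul (De i) (De j)) (\<lambda>n. if n = 0 then c * c else if n = 1 then 2 * c else if n = 2 then 1 else 0)"
proof (rule mj_mono[OF mj_Mul[OF mj_De mj_De]])
 fix n :: nat
 let ?F = "\<lambda>n::nat. if n = 0 then c * 1 else if n = 1 then 1 else 0"
 show "(\<Sum>j\<le>n. ?F j * ?F (n - j)) \<le> (if n = 0 then c * c else if n = 1 then 2 * c else if n = 2 then 1 else 0)"
  by (subst sum_quadratic_majorant) auto
qed

definition m :: real where "m = 4 * c\<^sup>2 / (a_lo\<^sup>2 * ln 2)"

lemma m_pos: "0 < m" using a_lo c by (simp add: m_def)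

lemma L_m: "L ^ n = (3/4) ^ n * m ^ n"
 unfolding power_mult_distrib[symmetric] by (simp add: L_def m_def)

text \<open>The maximum is attained at n = 2 and n = 3. From n = 2 on, the ratio of consecutive
  terms is at most 1.\<close>

lemma linear_times_power_le: "(real n + 1) * (3/4) ^ n \<le> 27/16"
proof -
 have *: "(real (n + 2) + 1) * (3/4) ^ (n + 2) \<le> 27/16" for n
 proof (induction n)
  case (Suc n)
  have "(real (Suc n + 2) + 1) * (3/4) ^ (Suc n + 2) = ((real n + 4) * (3/4)) * (3/4) ^ (n + 2)" by (simp add: algebra_simps)
  also have "\<dots> \<le> (real (n + 2) + 1) * (3/4) ^ (n + 2)" by (intro mult_right_mono) auto
  also note Suc
  finally show ?case .
 qed (simp add: power2_eq_square)
 show ?thesis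
 proof (cases "2 \<le> n")
  case True
  then have n: "n - 2 + 2 = n" by simp
  show ?thesis using *[of "n - 2"] unfolding n .
 next
  case False
  then have "n = 0 \<or> n = 1" by linarith
  then show ?thesis by auto
 qed
qed

lemma mw_scale: "mw (\<lambda>k. r * \<gamma> k) J = r ^ mi_size J * mw \<gamma> J"
 by (simp add: mw_def mi_power_def mi_size_def power_mult_distrib prod.distrib power_sum)

end

section \<open>The diffusion matrix and its Taylor coefficients\<close>

locale random_coefficient = random_field +
 fixes a :: real
 assumes a: "a_lo \<le> a" "a \<le> a_hi" and a_hi: "1 \<le> a_hi"
begin

text \<open>The entries of a I + (|v| - a) v v^T / |v|^2, multiplied out so that only the inverse
  norm and the coordinates of v occur.\<close>

definition Aex :: "'a => 'a => (real^'a, real^'a) expr" where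
 "Aex i j = Add (Con (\<lambda>_. if i = j then a else 0)) (Add (Mul (Mul (De i) (De j)) Rh) (Mul (Con (\<lambda>_. - a)) (Mul (Mul (De i) (De j)) (Mul Rh Rh))))"

text \<open>The 11 rounds up 17/16 times 6 times 27/16, contributed by
  \<open>convolution_quadratic_le\<close>, by the two products in \<open>Aex\<close> and by
  \<open>linear_times_power_le\<close>. The power of 1/\<theta> removes the weight.\<close>

definition k1 :: real where "k1 = 11 * (1 / \<theta>) ^ \<kappa> * (a_hi * c\<^sup>2 / a_lo\<^sup>2)"

definition Am :: "nat^'b => real^'b => real^'a => real^'a^'a" where
 "Am J y x = (\<chi> i j. tc W J (Aex i j) x (V y x))"

lemma wf_Aex: "wf (Aex i j)"
proof -
 have b: "bounded_linear (\<lambda>r. r *\<^sub>R axis k 1 :: real^'a)" for k by (rule bounded_linear_scaleR_left)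
 have "(\<lambda>_. (1::real) *\<^sub>R (axis k 1 :: real^'a)) \<in> sobolev D \<kappa> \<infinity>" for k
  by (rule sobolev_linear(1)[OF inf_mem sobolev_const b, where K = 1]) simp
 then show ?thesis by (simp add: Aex_def sobolev_const)
qed

text \<open>Correct also where V vanishes: all products v_i v_j are 0 there and both sides are a
  I.\<close>

lemma Am_0: "Am 0 y x = diffusion_matrix a (V y x)"
proof -
 let ?v = "V y x"
 have "(if i = j then a else 0) + (?v $ i * ?v $ j * inverse (norm ?v) + (- a) * (?v $ i * ?v $ j * (inverse (norm ?v) * inverse (norm ?v))))
   = a * (if i = j then 1 else 0) + (norm ?v - a) * (1 / (norm ?v * norm ?v) * (?v $ i * ?v $ j))" for i j
  by (cases "norm ?v = 0") (simp_all add: field_simps)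
 then show ?thesis
  by (simp add: Am_def vec_eq_iff tc_0 Aex_def diffusion_matrix_def inner_axis mat_def power2_norm_eq_inner[symmetric] power2_eq_square)
qed

text \<open>J \<noteq> 0 removes the constant part a I. The two products contribute 2/a_lo and 4 a
  (n + 1) / a_lo^2, together at most 6 (n + 1) a_hi / a_lo^2, and L^n = (3/4)^n m^n absorbs the n +
  1.\<close>

lemma bd_Am:
 assumes b: "J ~= 0" and y: "y \<in> param_box"
 shows "bd 1 (\<lambda>x. Am J y x $ i $ j) (k1 * mw (\<lambda>k. m * \<gamma> k) J)"
proof -
 let ?Q = "\<lambda>n::nat. if n = 0 then c * c else if n = 1 then 2 * c else if n = 2 then 1 else 0"
 have Lp: "0 < L" by (rule L_bounds)
 have 1: "mj (Mul (Mul (De i) (De j)) Rh) (\<lambda>n. 17/16 * c\<^sup>2 * (2 / a_lo * L ^ n))"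
  by (rule mj_mono[OF mj_Mul[OF mj_De_De mj_Rh]], rule convolution_quadratic_le) (use Lp a_lo in \<open>auto simp: mult.left_commute\<close>)
 have 2: "mj (Mul (Mul (De i) (De j)) (Mul Rh Rh)) (\<lambda>n. 17/16 * c\<^sup>2 * (4 / a_lo\<^sup>2 * (real n + 1) * L ^ n))"
 proof (rule mj_mono[OF mj_Mul[OF mj_De_De mj_Rh_Rh]], rule convolution_quadratic_le)
  fix n
  have "L * (4 / a_lo\<^sup>2 * (real n + 1) * L ^ n) = 4 / a_lo\<^sup>2 * (real n + 1) * L ^ Suc n" by simp
  also have "\<dots> \<le> 4 / a_lo\<^sup>2 * (real (Suc n) + 1) * L ^ Suc n" using Lp by (intro mult_right_mono mult_left_mono) auto
  finally show "L * (4 / a_lo\<^sup>2 * (real n + 1) * L ^ n) \<le> 4 / a_lo\<^sup>2 * (real (Suc n) + 1) * L ^ Suc n" .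
 qed (use Lp in simp)
 let ?n = "mi_size J" and ?r = "if i = j then a else 0"
 have n: "?n ~= 0" using b by (simp add: mi_size_eq_0)
 have e: "bd \<theta> (\<lambda>x. Am J y x $ i $ j) (((if ?n = 0 then \<bar>?r\<bar> * N \<theta> (\<lambda>_. 1::real) else 0) +
  (17/16 * c\<^sup>2 * (2 / a_lo * L ^ ?n) + \<bar>- a\<bar> * (17/16 * c\<^sup>2 * (4 / a_lo\<^sup>2 * (real ?n + 1) * L ^ ?n)))) * mw \<gamma> J)"
  using mjD[OF mj_Add[OF mj_Con[OF bd_self[OF sobolev_const], of ?r] mj_Add[OF 1 mj_Con_Mul[OF 2, of "- a"]]] y, of J]
  by (simp add: Am_def Aex_def)
 have "(if ?n = 0 then \<bar>?r\<bar> * N \<theta> (\<lambda>_. 1::real) else 0) + (17/16 * c\<^sup>2 * (2 / a_lo * L ^ ?n) + \<bar>- a\<bar> * (17/16 * c\<^sup>2 * (4 / a_lo\<^sup>2 * (real ?n + 1) * L ^ ?n)))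
  = 17/16 * c\<^sup>2 * L ^ ?n * (2 / a_lo + a * (4 / a_lo\<^sup>2 * (real ?n + 1)))"
 proof -
  have "0 + (k * (p * X) + a * (k * (Q * s * X))) = k * X * (p + a * (Q * s))" for k p X Q s :: real by algebra
  then show ?thesis using n a a_lo by (simp only: abs_minus_cancel abs_of_pos if_False order.strict_trans2)
 qed
 also have "\<dots> \<le> 17/16 * c\<^sup>2 * L ^ ?n * (a_hi / a_lo\<^sup>2 * (6 * (real ?n + 1)))"
 proof (rule mult_left_mono)
  have "1 / a_lo = a_lo / a_lo\<^sup>2" using a_lo by (simp add: power2_eq_square)
  also have "\<dots> \<le> a_hi / a_lo\<^sup>2" using a by (intro divide_right_mono) auto
  finally have "1 / a_lo \<le> a_hi / a_lo\<^sup>2" .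
  then have "2 / a_lo \<le> a_hi / a_lo\<^sup>2 * 2" using mult_right_mono[of "1 / a_lo" "a_hi / a_lo\<^sup>2" 2] by simp
  also have "\<dots> \<le> a_hi / a_lo\<^sup>2 * (2 * (real ?n + 1))" using a_lo a_hi by (intro mult_left_mono) auto
  moreover have "a * (4 / a_lo\<^sup>2 * (real ?n + 1)) \<le> a_hi * (4 / a_lo\<^sup>2 * (real ?n + 1))" using a by (intro mult_right_mono) auto
  ultimately have "2 / a_lo + a * (4 / a_lo\<^sup>2 * (real ?n + 1)) \<le> a_hi / a_lo\<^sup>2 * (2 * (real ?n + 1)) + a_hi * (4 / a_lo\<^sup>2 * (real ?n + 1))" by linarith
  also have "\<dots> = a_hi / a_lo\<^sup>2 * (6 * (real ?n + 1))"
  proof -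
   have "A / q * (2 * s) + A * (4 / q * s) = A / q * (6 * s)" for A q s :: real by (simp add: divide_inverse algebra_simps)
   then show ?thesis .
  qed
  finally show "2 / a_lo + a * (4 / a_lo\<^sup>2 * (real ?n + 1)) \<le> a_hi / a_lo\<^sup>2 * (6 * (real ?n + 1))" .
 qed (use Lp in simp)
 also have "\<dots> = (51/8 * (a_hi * c\<^sup>2 / a_lo\<^sup>2) * m ^ ?n) * ((real ?n + 1) * (3/4) ^ ?n)"
 proof -
  have "17/16 * C * (p * q) * (A / Q * (6 * s)) = (51/8 * (A * C / Q) * q) * (s * p)" for A C Q p q s :: real
   by (cases "Q = 0") (simp_all add: field_simps)
  then show ?thesis unfolding L_m .
 qed
 also have "\<dots> \<le> (51/8 * (a_hi * c\<^sup>2 / a_lo\<^sup>2) * m ^ ?n) * (27/16)"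
  using m_pos a_hi by (intro mult_left_mono linear_times_power_le) auto
 also have "\<dots> = 1377/128 * (a_hi * c\<^sup>2 / a_lo\<^sup>2 * m ^ ?n)" by simp
 also have "\<dots> \<le> 11 * (a_hi * c\<^sup>2 / a_lo\<^sup>2 * m ^ ?n)" using m_pos a_hi by (intro mult_right_mono) auto
 finally have "bd \<theta> (\<lambda>x. Am J y x $ i $ j) (11 * (a_hi * c\<^sup>2 / a_lo\<^sup>2 * m ^ ?n) * mw \<gamma> J)"
  by (intro bd_mono[OF e] mult_right_mono mw_\<gamma>_nonneg)
 from bd_weight[OF this] show ?thesis unfolding k1_def mw_scale by (simp add: mult_ac)
qed

text \<open>The sum of the constants of all entries serves every entry.\<close>

lemma uniform_const:
 assumes "!!i j. \<exists>C\<ge>0. P i j C" "!!i j C C'. P i j C ==> C \<le> C' ==> P i j C'"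
 shows "\<exists>C\<ge>0::real. \<forall>(i::'i::finite) (j::'j::finite). P i j C"
proof -
 obtain F where F: "!!i j. 0 \<le> F i j \<and> P i j (F i j)" using assms(1) by metis
 have "F i j \<le> (\<Sum>i\<in>UNIV. \<Sum>j\<in>UNIV. F i j)" for i j
  by (rule order_trans[OF member_le_sum[of j UNIV "F i"] member_le_sum[of i UNIV "\<lambda>i. \<Sum>j\<in>UNIV. F i j"]]) (auto intro: sum_nonneg F[THEN conjunct1])
 then have "\<forall>i j. P i j (\<Sum>i\<in>UNIV. \<Sum>j\<in>UNIV. F i j)" using assms(2) F by blast
 moreover have "0 \<le> (\<Sum>i\<in>UNIV. \<Sum>j\<in>UNIV. F i j)" using F by (intro sum_nonneg) auto
 ultimately show ?thesis by blast
qed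

lemma Am_bounded: "\<exists>C\<ge>0. \<forall>i j. \<forall>y\<in>param_box. bd 1 (\<lambda>x. Am J y x $ i $ j) C"
proof (rule uniform_const)
 fix i j
 obtain C where C: "\<forall>y\<in>param_box. bd 1 (\<lambda>x. ev (Dmi W J (Aex i j)) x (V y x)) C"
  using bd_ev[OF wf_Dmi[OF wf_Aex]] by blast
 have "bd 1 (\<lambda>x. Am J y x $ i $ j) (\<bar>1 / real (mi_fact J)\<bar> * \<bar>C\<bar>)" if "y \<in> param_box" for y
  using bd_scaleR[OF _ bd_mono[OF C[rule_format, OF that] abs_ge_self], of "1 / real (mi_fact J)"] by (simp add: Am_def tc_def)
 then show "\<exists>C\<ge>0. \<forall>y\<in>param_box. bd 1 (\<lambda>x. Am J y x $ i $ j) C" by (intro exI[of _ "\<bar>1 / real (mi_fact J)\<bar> * \<bar>C\<bar>"]) simp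
qed (blast intro: bd_mono)

lemma Am_Lipschitz: "\<exists>C\<ge>0. \<forall>i j. \<forall>y\<in>param_box. \<forall>y'\<in>param_box. bd 1 (\<lambda>x. Am J y' x $ i $ j - Am J y x $ i $ j) (C * norm (y' - y))"
proof (rule uniform_const)
 fix i j
 obtain C where C: "C \<ge> 0" "\<forall>y\<in>param_box. \<forall>y'\<in>param_box. bd 1 (\<lambda>x. ev (Dmi W J (Aex i j)) x (V y' x) - ev (Dmi W J (Aex i j)) x (V y x)) (C * norm (y' - y))"
  using bd_ev_Lipschitz[OF wf_Dmi[OF wf_Aex]] by blast
 have "bd 1 (\<lambda>x. Am J y' x $ i $ j - Am J y x $ i $ j) ((\<bar>1 / real (mi_fact J)\<bar> * C) * norm (y' - y))" if "y \<in> param_box" "y' \<in> param_box" for y y'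
  using bd_scaleR[OF _ C(2)[rule_format, OF that], of "1 / real (mi_fact J)"] by (simp add: Am_def tc_def diff_divide_distrib)
 then show "\<exists>C\<ge>0. \<forall>y\<in>param_box. \<forall>y'\<in>param_box. bd 1 (\<lambda>x. Am J y' x $ i $ j - Am J y x $ i $ j) (C * norm (y' - y))"
  using C(1) by (intro exI[of _ "\<bar>1 / real (mi_fact J)\<bar> * C"]) simp
next
 fix i j C C' assume "\<forall>y\<in>param_box. \<forall>y'\<in>param_box. bd 1 (\<lambda>x. Am J y' x $ i $ j - Am J y x $ i $ j) (C * norm (y' - y))" "C \<le> (C'::real)"
 then show "\<forall>y\<in>param_box. \<forall>y'\<in>param_box. bd 1 (\<lambda>x. Am J y' x $ i $ j - Am J y x $ i $ j) (C' * norm (y' - y))"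
  by (blast intro: bd_mono mult_right_mono norm_ge_zero)
qed

lemma Am_second_order:
 "\<exists>C\<ge>0. \<forall>i j. \<forall>y\<in>param_box. \<forall>t. y + t *\<^sub>R axis k 1 \<in> param_box -->
  bd 1 (\<lambda>x. Am J (y + t *\<^sub>R axis k 1) x $ i $ j - Am J y x $ i $ j - t * (real (J $ k + 1) * Am (J + axis k 1) y x $ i $ j)) (C * t\<^sup>2)"
proof (rule uniform_const)
 fix i j
 let ?e = "Dmi W J (Aex i j)" and ?f = "1 / real (mi_fact J)"
 let ?g = "\<lambda>y t x. Am J (y + t *\<^sub>R axis k 1) x $ i $ j - Am J y x $ i $ j - t * (real (J $ k + 1) * Am (J + axis k 1) y x $ i $ j)"
 obtain C where C: "C \<ge> 0" "\<forall>y\<in>param_box. \<forall>t. y + t *\<^sub>R axis k 1 \<in> param_box -->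
  bd 1 (\<lambda>x. ev ?e x (V (y + t *\<^sub>R axis k 1) x) - ev ?e x (V y x) - t * ev (Dex W k ?e) x (V y x)) (C * t\<^sup>2)"
  using bd_ev_second_order[OF wf_Dmi[OF wf_Aex]] by blast
 have "bd 1 (?g y t) ((\<bar>?f\<bar> * C) * t\<^sup>2)" if y: "y \<in> param_box" "y + t *\<^sub>R axis k 1 \<in> param_box" for y t
 proof -
  have "bd 1 (\<lambda>x. ?f *\<^sub>R (ev ?e x (V (y + t *\<^sub>R axis k 1) x) - ev ?e x (V y x) - t * ev (Dex W k ?e) x (V y x))) (\<bar>?f\<bar> * (C * t\<^sup>2))"
   by (rule bd_scaleR[OF _ C(2)[rule_format, OF y]]) simp
  then have "bd 1 (?g y t) (\<bar>?f\<bar> * (C * t\<^sup>2))"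
  proof (rule bd_cong_AE)
   show "AE x in lebesgue_on D. ?f *\<^sub>R (ev ?e x (V (y + t *\<^sub>R axis k 1) x) - ev ?e x (V y x) - t * ev (Dex W k ?e) x (V y x)) = ?g y t x"
    using V_nonzero
   proof eventually_elim
    case (elim x)
    then have "V y x ~= 0" using y by auto
    from tc_step(2)[OF this, of J k W "Aex i j" x]
    have "real (J $ k + 1) * Am (J + axis k 1) y x $ i $ j = ev (Dex W k ?e) x (V y x) / real (mi_fact J)" by (simp add: Am_def)
    then show ?case by (simp add: Am_def tc_def diff_divide_distrib)
   qed
  qed
  then show ?thesis by (simp add: mult.assoc)
 qed
 then show "\<exists>C\<ge>0. \<forall>y\<in>param_box. \<forall>t. y + t *\<^sub>R axis k 1 \<in> param_box --> bd 1 (?g y t) (C * t\<^sup>2)"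
  using C(1) by (intro exI[of _ "\<bar>?f\<bar> * C"]) simp
qed (blast intro: bd_mono mult_right_mono zero_le_power2)

end

section \<open>The bilinear form\<close>

lemma null_sequence_le: "(!!n. 0 \<le> f n) ==> (!!n. f n \<le> g n) ==> g \<longlonglongrightarrow> 0 ==> f \<longlonglongrightarrow> 0" for f g :: "nat => real"
 by (rule tendsto_sandwich[OF _ _ tendsto_const]) auto

context open_domain
begin

definition L2 :: "(real^'d => real) set" where "L2 = Lp_space D 2"
definition n2 :: "(real^'d => real) => real" where "n2 f = Lp_norm D 2 f"
definition Hs :: "nat => (real^'d => real) set" where "Hs H = sobolev D H 2"
definition nm :: "nat => (real^'d => real) => real" where "nm H v = wnorm D H 2 1 v"

lemma two_mem: "2 \<in> {2, \<infinity>::ereal}" and inf_mem2: "\<infinity> \<in> {2, \<infinity>::ereal}" by simp_all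

lemma L2_lin: "f \<in> L2 ==> g \<in> L2 ==> (\<lambda>x. f x + r * g x) \<in> L2"
 using Lp_add(1)[OF two_mem, of f D "\<lambda>x. r *\<^sub>R g x"] Lp_scaleR(1)[OF two_mem, of g D r] unfolding L2_def real_scaleR_def by blast

lemma Hs_lin: "v \<in> Hs H ==> w \<in> Hs H ==> (\<lambda>x. v x + r * w x) \<in> Hs H"
 using sobolev_add(1)[OF two_mem, of v H "\<lambda>x. r *\<^sub>R w x"] sobolev_scaleR(1)[OF two_mem, of w H r] unfolding Hs_def real_scaleR_def by blast

lemma Hs_zero: "(\<lambda>x. 0) \<in> Hs H" and nm_zero: "nm H (\<lambda>x. 0) = 0"
 using sobolev_zero[OF two_mem] unfolding Hs_def nm_def by blast+

lemma nm_nonneg: "0 \<le> nm H v"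
 unfolding nm_def by (rule wnorm_nonneg[OF two_mem]) simp

lemma nm_scale: "v \<in> Hs H ==> nm H (\<lambda>x. r * v x) \<le> \<bar>r\<bar> * nm H v"
 using sobolev_scaleR(2)[OF two_mem, of v H 1 r] unfolding Hs_def nm_def real_scaleR_def by simp

lemma Hs_scale: "v \<in> Hs H ==> (\<lambda>x. r * v x) \<in> Hs H"
 using sobolev_scaleR(1)[OF two_mem, of v H r] unfolding Hs_def real_scaleR_def .

lemma nm_add: "v \<in> Hs H ==> w \<in> Hs H ==> nm H (\<lambda>x. v x + w x) \<le> nm H v + nm H w"
 using sobolev_add(2)[OF two_mem, of v H w 1] unfolding Hs_def nm_def by simp

lemma nm_lin: "v \<in> Hs H ==> w \<in> Hs H ==> nm H (\<lambda>x. v x + r * w x) \<le> nm H v + \<bar>r\<bar> * nm H w"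
 using nm_add[of v H "\<lambda>x. r * w x"] nm_scale[of w H r] Hs_scale[of w H r] by linarith

lemma Hs_diff: "v \<in> Hs H ==> w \<in> Hs H ==> (\<lambda>x. v x - w x) \<in> Hs H"
 using Hs_lin[of v H w "-1"] by simp

lemma nm_minus_commute: "v \<in> Hs H ==> w \<in> Hs H ==> nm H (\<lambda>x. v x - w x) \<le> nm H (\<lambda>x. w x - v x)"
 using nm_scale[OF Hs_diff[of w H v], of "-1"] by simp

lemma nm_triangle: "u \<in> Hs H ==> v \<in> Hs H ==> w \<in> Hs H ==> nm H (\<lambda>x. u x - w x) \<le> nm H (\<lambda>x. u x - v x) + nm H (\<lambda>x. v x - w x)"
 using nm_add[OF Hs_diff[of u H v] Hs_diff[of v H w]] by simp

lemma Hs_sum: "finite S ==> (!!s. s \<in> S ==> v s \<in> Hs H) ==> (\<lambda>x. \<Sum>s\<in>S. v s x) \<in> Hs H"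
 using sobolev_sum[OF two_mem zero_le_one, of S v H] unfolding Hs_def by blast

lemma nm_sum: "finite S ==> (!!s. s \<in> S ==> v s \<in> Hs H) ==> nm H (\<lambda>x. \<Sum>s\<in>S. v s x) \<le> (\<Sum>s\<in>S. nm H (v s))"
 using sobolev_sum[OF two_mem zero_le_one, of S v H] unfolding Hs_def nm_def by blast

lemma Hs_mono: "v \<in> Hs H ==> H' \<le> H ==> v \<in> Hs H'"
 unfolding Hs_def by (rule sobolev_mono)

lemma nm_mono: "H' \<le> H ==> nm H' v \<le> nm H v"
 unfolding nm_def by (rule wnorm_mono_order[OF two_mem]) auto

lemma Hs_L2: "v \<in> Hs H ==> v \<in> L2" and n2_le_nm: "v \<in> Hs H ==> n2 v \<le> nm H v"
 using sobolev_Lp[OF two_mem, of v H] Lp_norm_le_wnorm[OF two_mem, of v H 1] unfolding Hs_def nm_def n2_def L2_def by auto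

lemma Hs_cong_AE:
 assumes "v \<in> Hs H" "w \<in> L2" "AE x in lebesgue_on D. v x = w x"
 shows "w \<in> Hs H" "nm H w = nm H v"
 using wnorm_cong_AE[OF two_mem _ Lp_locally_integrable[OF open_D two_mem], of v H w] assms unfolding Hs_def nm_def L2_def by blast+

subsection \<open>Partial derivatives and the \<open>L\<^sup>2\<close> pairing\<close>

definition ip :: "(real^'d => real) => (real^'d => real) => real" where
 "ip f g = (LINT x|lebesgue_on D. f x * g x)"

lemma L2_square: "f \<in> L2 ==> f \<in> borel_measurable (lebesgue_on D)" "f \<in> L2 ==> integrable (lebesgue_on D) (\<lambda>x. (f x)\<^sup>2)"
 and n2_eq: "n2 f = sqrt (LINT x|lebesgue_on D. (f x)\<^sup>2)"
 unfolding L2_def n2_def Lp_space_2 Lp_norm_2 real_norm_def power2_abs by auto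

lemma ip_integrable: "f \<in> L2 ==> g \<in> L2 ==> integrable (lebesgue_on D) (\<lambda>x. f x * g x)"
 by (intro integrable_mult_square L2_square)

lemma ip_bound: "f \<in> L2 ==> g \<in> L2 ==> \<bar>ip f g\<bar> \<le> n2 f * n2 g"
 unfolding ip_def n2_eq by (intro Cauchy_Schwarz_integral L2_square)

lemma ip_commute: "ip f g = ip g f"
 unfolding ip_def by (simp add: mult.commute)

lemma ip_lin: "f \<in> L2 ==> f' \<in> L2 ==> g \<in> L2 ==> ip (\<lambda>x. f x + r * f' x) g = ip f g + r * ip f' g"
 unfolding ip_def using ip_integrable[of f g] ip_integrable[of f' g] by (simp add: distrib_right mult.assoc)

lemma ip_sum: "finite S ==> (!!s. s \<in> S ==> f s \<in> L2) ==> g \<in> L2 ==> ip (\<lambda>x. \<Sum>s\<in>S. f s x) g = (\<Sum>s\<in>S. ip (f s) g)"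
 unfolding ip_def sum_distrib_right by (subst Bochner_Integration.integral_sum) (auto intro: ip_integrable)

lemma ip_cong_AE: "f \<in> L2 ==> f' \<in> L2 ==> g \<in> L2 ==> AE x in lebesgue_on D. f x = f' x ==> ip f g = ip f' g"
 unfolding ip_def by (intro integral_cong_AE borel_measurable_times L2_square) (auto elim: eventually_mono)

lemma ip_limit:
 assumes "!!n. f n \<in> L2" "f' \<in> L2" "g \<in> L2" "(\<lambda>n. n2 (\<lambda>x. f n x - f' x)) \<longlonglongrightarrow> 0"
 shows "(\<lambda>n. ip (f n) g) \<longlonglongrightarrow> ip f' g"
proof -
 have "\<bar>ip (f n) g - ip f' g\<bar> \<le> n2 (\<lambda>x. f n x - f' x) * n2 g" for n
  using ip_bound[OF L2_lin[OF assms(1,2), of n "-1"] assms(3)] ip_lin[OF assms(1)[of n] assms(2,3), of "-1"] by simp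
 moreover have "(\<lambda>n. n2 (\<lambda>x. f n x - f' x) * n2 g) \<longlonglongrightarrow> 0" using tendsto_mult_right[OF assms(4), of "n2 g"] by simp
 ultimately have "(\<lambda>n. \<bar>ip (f n) g - ip f' g\<bar>) \<longlonglongrightarrow> 0" by (intro null_sequence_le[OF abs_ge_zero])
 then show ?thesis by (simp add: LIM_zero_iff tendsto_rabs_zero_iff)
qed

definition pd :: "'d => (real^'d => real) => real^'d => real" where
 "pd i w = weak_deriv D (axis i 1) w"

lemma pd_weak:
 assumes "w \<in> Hs (Suc H)"
 shows "is_weak_deriv D (axis i 1) w (pd i w)"
proof -
 have w: "w \<in> sobolev D (Suc H) 2" using assms by (simp only: Hs_def)
 show ?thesis unfolding pd_def by (rule sobolevD(1)[OF two_mem w]) (simp add: mi_size_axis[simplified])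
qed

lemma pd_AE: "is_weak_deriv D (axis i 1) w g ==> AE x in lebesgue_on D. pd i w x = g x"
 unfolding pd_def by (rule weak_deriv_AE)

lemma pd_Hs: "w \<in> Hs (Suc H) ==> pd i w \<in> Hs H" and nm_pd: "w \<in> Hs (Suc H) ==> nm H (pd i w) \<le> real (Suc H) * nm (Suc H) w"
 using sobolev_weak_deriv[OF two_mem, of w H i] unfolding pd_def Hs_def nm_def sob_norm_eq_wnorm by auto

lemma pd_L2: "w \<in> Hs (Suc H) ==> pd i w \<in> L2"
 by (rule Hs_L2[OF pd_Hs])

lemma n2_pd: "w \<in> Hs (Suc H) ==> n2 (pd i w) \<le> nm 1 w"
 using n2_le_nm[OF pd_Hs, of w 0 i] nm_pd[of w 0 i] Hs_mono[of w "Suc H" "Suc 0"] by simp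

lemma pd_lin:
 assumes "w \<in> Hs (Suc H)" "w' \<in> Hs (Suc H)"
 shows "AE x in lebesgue_on D. pd i (\<lambda>x. w x + r * w' x) x = pd i w x + r * pd i w' x"
 using pd_AE[OF is_weak_deriv_add[OF open_D pd_weak[OF assms(1)] is_weak_deriv_scaleR[OF open_D pd_weak[OF assms(2)], where c = r]], of i] by simp

lemma test_fun_L2: "test_fun D \<phi> ==> \<phi> \<in> L2"
proof -
 assume \<phi>: "test_fun D \<phi>"
 have m: "\<psi> \<in> borel_measurable (lebesgue_on D)" if "test_fun D \<psi>" for \<psi>
  using test_fun_borel[OF that] by (simp add: measurable_completion measurable_restrict_space1)
 have t: "test_fun D (\<lambda>x. \<phi> x * \<phi> x)" by (intro test_fun_smooth_mult \<phi> test_fun_smooth[OF \<phi>])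
 have "integrable lebesgue (\<lambda>x. \<phi> x * \<phi> x)"
  using integrable_completion[of "\<lambda>x. \<phi> x * \<phi> x" lborel] test_fun_borel[OF t] test_fun_integrable[OF t] by simp
 then have "integrable (lebesgue_on D) (\<lambda>x. \<phi> x * \<phi> x)"
  using open_D by (intro integrable_restrict_space[THEN iffD2] integrable_mult_indicator) (auto simp: borel_open)
 then show ?thesis unfolding L2_def Lp_space_2 using m[OF \<phi>] by (simp add: power2_eq_square)
qed

lemma test_fun_Hs: "test_fun D \<phi> ==> \<phi> \<in> Hs 1"
proof -
 assume \<phi>: "test_fun D \<phi>"
 have l: "locally_integrable D \<psi>" if "test_fun D \<psi>" for \<psi>
  using Lp_locally_integrable[OF open_D two_mem] test_fun_L2[OF that] unfolding L2_def by blast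
 have 0: "\<psi> \<in> sobolev D 0 2" if "test_fun D \<psi>" for \<psi>
  using test_fun_L2[OF that] is_weak_deriv_0[OF l[OF that]] unfolding sobolev_def L2_def by (auto simp: mi_size_eq_0)
 have "\<phi> \<in> sobolev D (Suc 0) 2"
  using test_fun_L2[OF \<phi>] unfolding L2_def
  by (rule sobolev_SucI[OF _ l[OF \<phi>] is_weak_deriv_test_fun[OF open_D \<phi>] 0[OF test_fun_partial[OF \<phi>]]])
 then show ?thesis by (simp add: Hs_def)
qed

subsection \<open>The space \<open>H\<^sup>1\<^sub>0\<close>\<close>

lemma H10_iff: "v \<in> H10 D \<longleftrightarrow> v \<in> Hs 1 \<and> (\<exists>\<phi>. (\<forall>n. test_fun D (\<phi> n)) \<and> (\<lambda>n. nm 1 (\<lambda>x. v x - \<phi> n x)) \<longlonglongrightarrow> 0)"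
 unfolding H10_def Hs_def nm_def sob_norm_eq_wnorm by simp

lemma H10_Hs: "v \<in> H10 D ==> v \<in> Hs 1"
 by (simp add: H10_iff)

lemma H10_L2: "v \<in> H10 D ==> v \<in> L2"
 using H10_Hs Hs_L2 by blast

lemma H10_lin:
 assumes "v \<in> H10 D" "w \<in> H10 D"
 shows "(\<lambda>x. v x + r * w x) \<in> H10 D"
proof -
 obtain \<phi> \<psi> where t: "!!n. test_fun D (\<phi> n)" "!!n. test_fun D (\<psi> n)"
  and lim: "(\<lambda>n. nm 1 (\<lambda>x. v x - \<phi> n x)) \<longlonglongrightarrow> 0" "(\<lambda>n. nm 1 (\<lambda>x. w x - \<psi> n x)) \<longlonglongrightarrow> 0"
  using assms unfolding H10_iff by blast
 note s = H10_Hs[OF assms(1)] H10_Hs[OF assms(2)]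
 have "nm 1 (\<lambda>x. (v x + r * w x) - (\<phi> n x + r * \<psi> n x)) \<le> nm 1 (\<lambda>x. v x - \<phi> n x) + \<bar>r\<bar> * nm 1 (\<lambda>x. w x - \<psi> n x)" for n
  using nm_lin[OF Hs_diff[OF s(1) test_fun_Hs[OF t(1)[of n]]] Hs_diff[OF s(2) test_fun_Hs[OF t(2)[of n]]], of r] by (simp add: algebra_simps)
 moreover have "(\<lambda>n. nm 1 (\<lambda>x. v x - \<phi> n x) + \<bar>r\<bar> * nm 1 (\<lambda>x. w x - \<psi> n x)) \<longlonglongrightarrow> 0"
  using tendsto_add[OF lim(1) tendsto_mult_left[OF lim(2), of "\<bar>r\<bar>"]] by simp
 ultimately have "(\<lambda>n. nm 1 (\<lambda>x. (v x + r * w x) - (\<phi> n x + r * \<psi> n x))) \<longlonglongrightarrow> 0"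
  by (rule null_sequence_le[OF nm_nonneg])
 moreover have "test_fun D (\<lambda>x. \<phi> n x + r * \<psi> n x)" for n by (intro test_fun_add test_fun_scale t)
 ultimately show ?thesis unfolding H10_iff using Hs_lin[OF s, of r]
  by (intro conjI exI[of _ "\<lambda>n x. \<phi> n x + r * \<psi> n x"] allI)
qed

lemma H10_zero: "(\<lambda>x. 0) \<in> H10 D"
 unfolding H10_iff by (intro conjI exI[of _ "\<lambda>n x. 0"] allI test_fun_zero Hs_zero) (simp add: nm_zero)

text \<open>A diagonal choice: each w n is replaced by a test function within 1/(n+1) of it in
  H^1.\<close>

lemma H10_closed:
 assumes v: "v \<in> Hs 1" and w: "!!n. w n \<in> H10 D" and lim: "(\<lambda>n. nm 1 (\<lambda>x. v x - w n x)) \<longlonglongrightarrow> 0"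
 shows "v \<in> H10 D"
proof -
 have "\<exists>\<phi>. test_fun D \<phi> \<and> nm 1 (\<lambda>x. w n x - \<phi> x) < 1 / real (Suc n)" for n
 proof -
  obtain \<phi> where \<phi>: "!!k. test_fun D (\<phi> k)" "(\<lambda>k. nm 1 (\<lambda>x. w n x - \<phi> k x)) \<longlonglongrightarrow> 0" using w[of n] unfolding H10_iff by blast
  have "eventually (\<lambda>k. nm 1 (\<lambda>x. w n x - \<phi> k x) < 1 / real (Suc n)) sequentially" by (rule order_tendstoD(2)[OF \<phi>(2)]) simp
  then show ?thesis using \<phi>(1) unfolding eventually_sequentially by blast
 qed
 then obtain \<phi> where \<phi>: "!!n. test_fun D (\<phi> n) \<and> nm 1 (\<lambda>x. w n x - \<phi> n x) < 1 / real (Suc n)" by metis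
 have "nm 1 (\<lambda>x. v x - \<phi> n x) \<le> nm 1 (\<lambda>x. v x - w n x) + 1 / real (Suc n)" for n
  using nm_triangle[OF v H10_Hs[OF w] test_fun_Hs, of "\<phi> n" n] \<phi>[of n] by force
 moreover have "(\<lambda>n. nm 1 (\<lambda>x. v x - w n x) + 1 / real (Suc n)) \<longlonglongrightarrow> 0"
  using tendsto_add[OF lim LIMSEQ_inverse_real_of_nat] by (simp add: inverse_eq_divide)
 ultimately have "(\<lambda>n. nm 1 (\<lambda>x. v x - \<phi> n x)) \<longlonglongrightarrow> 0"
  by (rule null_sequence_le[OF nm_nonneg])
 then show ?thesis unfolding H10_iff using v \<phi> by blast
qed

text \<open>With a test function in place of v this is the definition of the weak derivative of g,
  and both sides are continuous in v for the H^1 norm.\<close>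

lemma integration_by_parts:
 assumes g: "g \<in> Hs 1" and v: "v \<in> H10 D"
 shows "ip g (pd i v) = - ip (pd i g) v"
proof -
 obtain \<phi> where \<phi>: "!!n. test_fun D (\<phi> n)" and lim: "(\<lambda>n. nm 1 (\<lambda>x. v x - \<phi> n x)) \<longlonglongrightarrow> 0"
  using v unfolding H10_iff by blast
 have vS: "v \<in> Hs (Suc 0)" and gS: "g \<in> Hs (Suc 0)" and \<phi>S: "\<phi> n \<in> Hs (Suc 0)" for n
  using H10_Hs[OF v] g test_fun_Hs[OF \<phi>[of n]] by simp_all
 have L: "pd i v \<in> L2" "pd i g \<in> L2" "v \<in> L2" "g \<in> L2" "pd i (\<phi> n) \<in> L2" "\<phi> n \<in> L2" for n
  using pd_L2[OF vS] pd_L2[OF gS] pd_L2[OF \<phi>S] Hs_L2[OF vS] Hs_L2[OF gS] Hs_L2[OF \<phi>S] by auto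
 have 1: "ip (pd i (\<phi> n)) g = - ip (\<phi> n) (pd i g)" for n
 proof -
  have "ip (pd i (\<phi> n)) g = ip (partial i (\<phi> n)) g"
   by (intro ip_cong_AE L test_fun_L2 test_fun_partial \<phi> pd_AE is_weak_deriv_test_fun open_D)
  also have "\<dots> = - ip (\<phi> n) (pd i g)" unfolding ip_def by (rule is_weak_deriv_axisD[OF pd_weak[OF gS] \<phi>])
  finally show ?thesis .
 qed
 have b: "n2 (\<lambda>x. \<phi> n x - v x) \<le> nm 1 (\<lambda>x. v x - \<phi> n x)" "n2 (\<lambda>x. pd i (\<phi> n) x - pd i v x) \<le> nm 1 (\<lambda>x. v x - \<phi> n x)" for n
 proof -
  have c: "nm 1 (\<lambda>x. \<phi> n x - v x) \<le> nm 1 (\<lambda>x. v x - \<phi> n x)" by (rule nm_minus_commute) (use vS \<phi>S in auto)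
  show "n2 (\<lambda>x. \<phi> n x - v x) \<le> nm 1 (\<lambda>x. v x - \<phi> n x)" using n2_le_nm[OF Hs_diff[OF \<phi>S[of n] vS]] c by simp
  have "n2 (\<lambda>x. pd i (\<phi> n) x - pd i v x) = n2 (pd i (\<lambda>x. \<phi> n x - v x))"
   unfolding n2_def
  proof (rule Lp_norm_cong_AE[OF two_mem])
   show "(\<lambda>x. pd i (\<phi> n) x - pd i v x) \<in> Lp_space D 2" "pd i (\<lambda>x. \<phi> n x - v x) \<in> Lp_space D 2"
    using L2_lin[OF L(5,1), of n "-1"] pd_L2[OF Hs_diff[OF \<phi>S vS]] by (auto simp: L2_def)
   show "AE x in lebesgue_on D. pd i (\<phi> n) x - pd i v x = pd i (\<lambda>x. \<phi> n x - v x) x"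
    using pd_lin[OF \<phi>S[of n] vS, of i "-1"] by (auto elim: eventually_mono)
  qed
  then show "n2 (\<lambda>x. pd i (\<phi> n) x - pd i v x) \<le> nm 1 (\<lambda>x. v x - \<phi> n x)" using n2_pd[OF Hs_diff[OF \<phi>S[of n] vS], of i] c by simp
 qed
 have l: "(\<lambda>n. n2 (\<lambda>x. \<phi> n x - v x)) \<longlonglongrightarrow> 0" "(\<lambda>n. n2 (\<lambda>x. pd i (\<phi> n) x - pd i v x)) \<longlonglongrightarrow> 0"
  by (rule null_sequence_le[OF _ _ lim], simp add: n2_eq, rule b)+
 have "(\<lambda>n. - ip (\<phi> n) (pd i g)) \<longlonglongrightarrow> - ip v (pd i g)" by (intro tendsto_minus ip_limit L l)
 moreover have "(\<lambda>n. - ip (\<phi> n) (pd i g)) \<longlonglongrightarrow> ip (pd i v) g" unfolding 1[symmetric] by (intro ip_limit L l)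
 ultimately have "ip (pd i v) g = - ip v (pd i g)" using LIMSEQ_unique by blast
 then show ?thesis by (simp only: ip_commute)
qed

text \<open>Each weak derivative converges in L^2 by \<open>L2_complete\<close>, and
  \<open>is_weak_deriv_limit\<close> recognises the limits as the weak derivatives of the limit of
  order 0.\<close>

lemma Hs_complete:
 assumes w: "!!n. w n \<in> Hs H" and C: "!!e. e > 0 ==> \<exists>N. \<forall>m\<ge>N. \<forall>n\<ge>N. nm H (\<lambda>x. w m x - w n x) < e"
 shows "\<exists>v\<in>Hs H. (\<lambda>n. nm H (\<lambda>x. w n x - v x)) \<longlonglongrightarrow> 0"
proof -
 let ?d = "\<lambda>I n. weak_deriv D I (w n)"
 have wS: "w n \<in> sobolev D H 2" for n using w by (simp add: Hs_def)
 have d: "is_weak_deriv D I (w n) (?d I n)" "?d I n \<in> L2" if "mi_size I \<le> H" for I n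
  using sobolevD[OF two_mem wS that] by (auto simp: L2_def)
 have "\<forall>I\<in>{I. mi_size I \<le> H}. \<exists>g. g \<in> L2 \<and> (\<lambda>n. n2 (\<lambda>x. ?d I n x - g x)) \<longlonglongrightarrow> 0"
 proof
  fix I :: "nat^'d" assume "I \<in> {I. mi_size I \<le> H}"
  then have I: "mi_size I \<le> H" by simp
  have le: "sqrt (LINT x|lebesgue_on D. (?d I m x - ?d I n x)\<^sup>2) \<le> real (mi_fact I) * nm H (\<lambda>x. w m x - w n x)" for m n
  proof -
   let ?z = "\<lambda>x. w m x - w n x"
   have z: "?z \<in> sobolev D H 2" using Hs_diff[OF w w] by (simp add: Hs_def)
   have "Lp_norm D 2 (\<lambda>x. ?d I m x - ?d I n x) = Lp_norm D 2 (weak_deriv D I ?z)"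
   proof (rule Lp_norm_cong_AE[OF two_mem])
    show "(\<lambda>x. ?d I m x - ?d I n x) \<in> Lp_space D 2" using L2_lin[OF d(2)[OF I] d(2)[OF I], of m "-1" n] by (simp add: L2_def)
    show "weak_deriv D I ?z \<in> Lp_space D 2" by (rule sobolevD(2)[OF two_mem z I])
    show "AE x in lebesgue_on D. ?d I m x - ?d I n x = weak_deriv D I ?z x"
     using weak_deriv_AE[OF is_weak_deriv_diff[OF open_D d(1)[OF I] d(1)[OF I]], of m n] by eventually_elim simp
   qed
   also have "\<dots> = real (mi_fact I) * (1 ^ mi_size I / real (mi_fact I) * Lp_norm D 2 (weak_deriv D I ?z))"
    using mi_fact_pos[of I] by simp
   also have "\<dots> \<le> real (mi_fact I) * nm H ?z"
    unfolding nm_def wnorm_def using I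
    by (intro mult_left_mono member_le_sum finite_mi_size) (auto intro: Lp_norm_nonneg simp: Lp_norm_2)
   finally show ?thesis unfolding n2_def[symmetric] n2_eq .
  qed
  have "\<exists>g. g \<in> borel_measurable (lebesgue_on D) \<and> integrable (lebesgue_on D) (\<lambda>x. (g x)\<^sup>2) \<and>
    (\<lambda>n. sqrt (LINT x|lebesgue_on D. (?d I n x - g x)\<^sup>2)) \<longlonglongrightarrow> 0"
  proof (rule L2_complete)
   fix e :: real assume "e > 0"
   moreover have F: "0 < real (mi_fact I)" using mi_fact_pos[of I] by simp
   ultimately obtain N where N: "\<forall>m\<ge>N. \<forall>n\<ge>N. nm H (\<lambda>x. w m x - w n x) < e / real (mi_fact I)" using C[of "e / real (mi_fact I)"] by auto
   have "sqrt (LINT x|lebesgue_on D. (?d I m x - ?d I n x)\<^sup>2) < e" if "m \<ge> N" "n \<ge> N" for m n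
   proof -
    have "real (mi_fact I) * nm H (\<lambda>x. w m x - w n x) < e" using N that F by (simp add: pos_less_divide_eq mult.commute)
    then show ?thesis using le[of m n] by linarith
   qed
   then show "\<exists>N. \<forall>m\<ge>N. \<forall>n\<ge>N. sqrt (LINT x|lebesgue_on D. (?d I m x - ?d I n x)\<^sup>2) < e" by blast
  qed (use d(2)[OF I] L2_square in blast)+
  then show "\<exists>g. g \<in> L2 \<and> (\<lambda>n. n2 (\<lambda>x. ?d I n x - g x)) \<longlonglongrightarrow> 0" unfolding L2_def Lp_space_2 n2_eq by simp
 qed
 from bchoice[OF this] obtain G where "\<forall>I\<in>{I. mi_size I \<le> H}. G I \<in> L2 \<and> (\<lambda>n. n2 (\<lambda>x. ?d I n x - G I x)) \<longlonglongrightarrow> 0" ..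
 then have G: "G I \<in> L2 \<and> (\<lambda>n. n2 (\<lambda>x. ?d I n x - G I x)) \<longlonglongrightarrow> 0" if "mi_size I \<le> H" for I using that by simp
 have lG: "locally_integrable D (G I)" if "mi_size I \<le> H" for I
  using Lp_locally_integrable[OF open_D two_mem] G[OF that] unfolding L2_def by blast
 have tl: "(\<lambda>n. LINT x|lebesgue_on D. \<psi> x *\<^sub>R ?d I n x) \<longlonglongrightarrow> (LINT x|lebesgue_on D. \<psi> x *\<^sub>R G I x)"
  if I: "mi_size I \<le> H" and \<psi>: "test_fun D \<psi>" for I \<psi>
 proof -
  have "(\<lambda>n. ip (?d I n) \<psi>) \<longlonglongrightarrow> ip (G I) \<psi>" by (rule ip_limit) (use d(2)[OF I] G[OF I] test_fun_L2[OF \<psi>] in auto)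
  then show ?thesis by (simp add: ip_def mult.commute)
 qed
 have zero: "mi_size (0::nat^'d) \<le> H" by simp
 have tl0: "(\<lambda>n. LINT x|lebesgue_on D. \<psi> x *\<^sub>R w n x) \<longlonglongrightarrow> (LINT x|lebesgue_on D. \<psi> x *\<^sub>R G 0 x)" if \<psi>: "test_fun D \<psi>" for \<psi>
 proof -
  have "(LINT x|lebesgue_on D. \<psi> x *\<^sub>R w n x) = (LINT x|lebesgue_on D. \<psi> x *\<^sub>R ?d 0 n x)" for n
  proof (rule integral_test_cong_AE[OF open_D _ _ \<psi>])
   show "locally_integrable D (w n)" "locally_integrable D (?d 0 n)" using d(1)[OF zero, of n] by (auto simp: is_weak_deriv_def)
   then show "AE x in lebesgue_on D. w n x = ?d 0 n x" using weak_deriv_AE[OF is_weak_deriv_0, of "w n"] by (auto elim: eventually_mono)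
  qed
  then show ?thesis using tl[OF zero \<psi>] by simp
 qed
 have v: "is_weak_deriv D I (G 0) (G I)" if "mi_size I \<le> H" for I
  by (rule is_weak_deriv_limit[OF lG[OF zero] lG[OF that] d(1)[OF that] tl0 tl[OF that]])
 have vS: "G 0 \<in> Hs H" unfolding Hs_def by (rule sobolevI[OF v]) (use G in \<open>auto simp: L2_def\<close>)
 have "nm H (\<lambda>x. w n x - G 0 x) = (\<Sum>I | mi_size I \<le> H. 1 ^ mi_size I / real (mi_fact I) * n2 (\<lambda>x. ?d I n x - G I x))" for n
  unfolding nm_def n2_def
 proof (rule wnorm_eqI[OF two_mem])
  fix I :: "nat^'d" assume I: "mi_size I \<le> H"
  show "is_weak_deriv D I (\<lambda>x. w n x - G 0 x) (\<lambda>x. ?d I n x - G I x)" by (rule is_weak_deriv_diff[OF open_D d(1)[OF I] v[OF I]])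
  show "(\<lambda>x. ?d I n x - G I x) \<in> Lp_space D 2" using L2_lin[OF d(2)[OF I] conjunct1[OF G[OF I]], of n "-1"] by (simp add: L2_def)
 qed
 moreover have "(\<lambda>n. \<Sum>I | mi_size I \<le> H. 1 ^ mi_size I / real (mi_fact I) * n2 (\<lambda>x. ?d I n x - G I x)) \<longlonglongrightarrow> (\<Sum>I :: nat^'d | mi_size I \<le> H. 1 ^ mi_size I / real (mi_fact I) * 0)"
 proof (rule tendsto_sum)
  fix I :: "nat^'d" assume "I \<in> {I. mi_size I \<le> H}"
  then have "(\<lambda>n. n2 (\<lambda>x. ?d I n x - G I x)) \<longlonglongrightarrow> 0" using G by simp
  then show "(\<lambda>n. 1 ^ mi_size I / real (mi_fact I) * n2 (\<lambda>x. ?d I n x - G I x)) \<longlonglongrightarrow> 1 ^ mi_size I / real (mi_fact I) * 0"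
   by (rule tendsto_mult_left)
 qed
 ultimately have "(\<lambda>n. nm H (\<lambda>x. w n x - G 0 x)) \<longlonglongrightarrow> 0" by simp
 then show ?thesis using vS by blast
qed

subsection \<open>Divergence form operators\<close>

definition fm :: "(real^'d => real^'d^'d) => (real^'d => real) => (real^'d => real) => real" where
 "fm B w v = (\<Sum>i\<in>UNIV. \<Sum>j\<in>UNIV. ip (\<lambda>x. B x $ i $ j * pd j w x) (pd i v))"

text \<open>The divergence of B \<nabla>w.\<close>

definition dv :: "(real^'d => real^'d^'d) => (real^'d => real) => real^'d => real" where
 "dv B w x = (\<Sum>i\<in>UNIV. \<Sum>j\<in>UNIV. pd i (\<lambda>x. B x $ i $ j * pd j w x) x)"

definition MB :: "nat => (real^'d => real^'d^'d) set" where
 "MB H = {B. \<forall>i j. (\<lambda>x. B x $ i $ j) \<in> sobolev D H \<infinity>}"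

lemma MB_flux: "B \<in> MB H ==> w \<in> Hs (Suc H) ==> (\<lambda>x. B x $ i $ j * pd j w x) \<in> Hs H"
 using sobolev_mult(1)[OF two_mem, of "\<lambda>x. B x $ i $ j" H "pd j w"] pd_Hs[of w H j] unfolding MB_def Hs_def by blast

lemma MB_mono: "B \<in> MB H ==> H' \<le> H ==> B \<in> MB H'"
 unfolding MB_def using sobolev_mono by blast

lemma MB_flux_L2: "B \<in> MB H ==> w \<in> Hs (Suc H') ==> (\<lambda>x. B x $ i $ j * pd j w x) \<in> L2"
 by (rule Hs_L2[OF MB_flux[OF MB_mono Hs_mono, where H = 0]]) auto

lemma MB_lin: "B \<in> MB H ==> B' \<in> MB H ==> (\<lambda>x. B x + r *\<^sub>R B' x) \<in> MB H"
 unfolding MB_def mem_Collect_eq vector_add_component vector_scaleR_component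
 by (intro allI sobolev_add(1)[OF inf_mem2] sobolev_scaleR(1)[OF inf_mem2]) blast+

lemma fm_integrable:
 assumes "B \<in> MB H" "w \<in> Hs (Suc H')" "v \<in> Hs (Suc H'')"
 shows "integrable (lebesgue_on D) (\<lambda>x. (B x *v weak_grad D w x) \<bullet> weak_grad D v x)"
  and fm_eq: "(LINT x|lebesgue_on D. (B x *v weak_grad D w x) \<bullet> weak_grad D v x) = fm B w v"
proof -
 have i: "integrable (lebesgue_on D) (\<lambda>x. B x $ i $ j * pd j w x * pd i v x)" for i j
  by (intro ip_integrable MB_flux_L2[OF assms(1,2)] pd_L2[OF assms(3)])
 have "(B x *v weak_grad D w x) \<bullet> weak_grad D v x = (\<Sum>i\<in>UNIV. \<Sum>j\<in>UNIV. B x $ i $ j * pd j w x * pd i v x)" for x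
  by (simp add: inner_vec_def matrix_vector_mult_def weak_grad_def pd_def sum_distrib_right)
 then show "integrable (lebesgue_on D) (\<lambda>x. (B x *v weak_grad D w x) \<bullet> weak_grad D v x)"
  "(LINT x|lebesgue_on D. (B x *v weak_grad D w x) \<bullet> weak_grad D v x) = fm B w v"
  unfolding fm_def ip_def using i by (simp_all add: Bochner_Integration.integral_sum Bochner_Integration.integrable_sum)
qed

lemma fm_lin_left:
 assumes "B \<in> MB H" "B' \<in> MB H" "w \<in> Hs (Suc H')" "v \<in> Hs (Suc H'')"
 shows "fm (\<lambda>x. B x + r *\<^sub>R B' x) w v = fm B w v + r * fm B' w v"
proof -
 have "ip (\<lambda>x. (B x + r *\<^sub>R B' x) $ i $ j * pd j w x) (pd i v) = ip (\<lambda>x. B x $ i $ j * pd j w x) (pd i v) + r * ip (\<lambda>x. B' x $ i $ j * pd j w x) (pd i v)" for i j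
  using ip_lin[OF MB_flux_L2[OF assms(1,3), of i j] MB_flux_L2[OF assms(2,3), of i j] pd_L2[OF assms(4), of i], of r] by (simp add: algebra_simps)
 then show ?thesis by (simp add: fm_def sum.distrib sum_distrib_left)
qed

lemma fm_lin_right:
 assumes "B \<in> MB H" "w \<in> Hs (Suc H')" "w' \<in> Hs (Suc H')" "v \<in> Hs (Suc H'')"
 shows "fm B (\<lambda>x. w x + r * w' x) v = fm B w v + r * fm B w' v"
proof -
 have "ip (\<lambda>x. B x $ i $ j * pd j (\<lambda>x. w x + r * w' x) x) (pd i v) = ip (\<lambda>x. B x $ i $ j * pd j w x) (pd i v) + r * ip (\<lambda>x. B x $ i $ j * pd j w' x) (pd i v)" for i j
 proof -
  have "ip (\<lambda>x. B x $ i $ j * pd j (\<lambda>x. w x + r * w' x) x) (pd i v) = ip (\<lambda>x. B x $ i $ j * pd j w x + r * (B x $ i $ j * pd j w' x)) (pd i v)"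
  proof (rule ip_cong_AE)
   show "AE x in lebesgue_on D. B x $ i $ j * pd j (\<lambda>x. w x + r * w' x) x = B x $ i $ j * pd j w x + r * (B x $ i $ j * pd j w' x)"
    using pd_lin[OF assms(2,3), of j r] by eventually_elim (simp add: algebra_simps)
  qed (rule MB_flux_L2[OF assms(1) Hs_lin[OF assms(2,3)]], rule L2_lin[OF MB_flux_L2[OF assms(1,2)] MB_flux_L2[OF assms(1,3)]], rule pd_L2[OF assms(4)])
  then show ?thesis using ip_lin[OF MB_flux_L2[OF assms(1,2)] MB_flux_L2[OF assms(1,3)] pd_L2[OF assms(4)]] by simp
 qed
 then show ?thesis by (simp add: fm_def sum.distrib sum_distrib_left)
qed

text \<open>Taking the derivative off v turns the form into an L^2 pairing with a function, the type
  of right hand side that the regularity assumption covers.\<close>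

lemma fm_dv:
 assumes "B \<in> MB (Suc H)" "w \<in> Hs (Suc (Suc H))" "v \<in> H10 D"
 shows "fm B w v = - ip (dv B w) v"
proof -
 have f: "(\<lambda>x. B x $ i $ j * pd j w x) \<in> Hs (Suc H)" for i j by (rule MB_flux[OF assms(1,2)])
 note p = pd_L2[OF f]
 have s: "(\<lambda>x. \<Sum>j\<in>UNIV. pd i (\<lambda>x. B x $ i $ j * pd j w x) x) \<in> L2" for i
  by (rule Hs_L2[OF Hs_sum[OF finite pd_Hs[OF f]]])
 have "ip (dv B w) v = (\<Sum>i\<in>UNIV. \<Sum>j\<in>UNIV. ip (pd i (\<lambda>x. B x $ i $ j * pd j w x)) v)"
  unfolding dv_def[abs_def] using p s by (simp add: ip_sum H10_L2[OF assms(3)])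
 also have "\<dots> = (\<Sum>i\<in>UNIV. \<Sum>j\<in>UNIV. - ip (\<lambda>x. B x $ i $ j * pd j w x) (pd i v))"
  by (intro sum.cong refl) (simp add: integration_by_parts[OF Hs_mono[OF f] assms(3)])
 finally show ?thesis by (simp add: fm_def sum_negf)
qed

text \<open>There are d^2 terms, and each of the two derivatives contributes its order factor from
  \<open>nm_pd\<close>; for H = \<kappa> - 1 these are \<kappa> and \<kappa> + 1.\<close>

lemma dv_bound:
 assumes B: "B \<in> MB (Suc H)" "!!i j. wnorm D (Suc H) \<infinity> 1 (\<lambda>x. B x $ i $ j) \<le> b" and w: "w \<in> Hs (Suc (Suc H))"
 shows "dv B w \<in> Hs H" "nm H (dv B w) \<le> (real CARD('d))\<^sup>2 * real (Suc H) * real (Suc (Suc H)) * (b * nm (Suc (Suc H)) w)"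
proof -
 have f: "(\<lambda>x. B x $ i $ j * pd j w x) \<in> Hs (Suc H)" for i j by (rule MB_flux[OF B(1) w])
 note p = pd_Hs[OF f]
 have s: "(\<lambda>x. \<Sum>j\<in>UNIV. pd i (\<lambda>x. B x $ i $ j * pd j w x) x) \<in> Hs H" for i by (rule Hs_sum[OF finite p])
 show "dv B w \<in> Hs H" unfolding dv_def[abs_def] by (rule Hs_sum[OF finite s])
 let ?K = "real (Suc H) * (b * (real (Suc (Suc H)) * nm (Suc (Suc H)) w))"
 have 1: "nm H (pd i (\<lambda>x. B x $ i $ j * pd j w x)) \<le> ?K" for i j
 proof -
  have "nm (Suc H) (\<lambda>x. B x $ i $ j * pd j w x) \<le> wnorm D (Suc H) \<infinity> 1 (\<lambda>x. B x $ i $ j) * nm (Suc H) (pd j w)"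
   unfolding nm_def by (rule sobolev_mult(2)[OF two_mem]) (use B(1) pd_Hs[OF w] in \<open>auto simp: MB_def Hs_def\<close>)
  also have "\<dots> \<le> b * (real (Suc (Suc H)) * nm (Suc (Suc H)) w)"
   by (intro mult_mono B(2) nm_pd[OF w] order_trans[OF wnorm_nonneg[OF inf_mem2] B(2)] nm_nonneg) simp
  finally have "real (Suc H) * nm (Suc H) (\<lambda>x. B x $ i $ j * pd j w x) \<le> ?K" by (intro mult_left_mono) auto
  then show ?thesis using nm_pd[OF f, of i i j] by linarith
 qed
 have "nm H (dv B w) \<le> (\<Sum>i\<in>UNIV. nm H (\<lambda>x. \<Sum>j\<in>UNIV. pd i (\<lambda>x. B x $ i $ j * pd j w x) x))"
  unfolding dv_def[abs_def] by (rule nm_sum[OF finite s])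
 also have "\<dots> \<le> (\<Sum>i\<in>(UNIV::'d set). \<Sum>j\<in>(UNIV::'d set). ?K)"
  by (intro sum_mono order_trans[OF nm_sum[OF finite p]] 1)
 also have "\<dots> = (real CARD('d))\<^sup>2 * real (Suc H) * real (Suc (Suc H)) * (b * nm (Suc (Suc H)) w)"
  by (simp add: power2_eq_square mult_ac del: of_nat_Suc)
 finally show "nm H (dv B w) \<le> (real CARD('d))\<^sup>2 * real (Suc H) * real (Suc (Suc H)) * (b * nm (Suc (Suc H)) w)" .
qed

end

section \<open>Parametric solutions\<close>

lemma diffusion_matrix_mult:
 "diffusion_matrix a v *v e = a *\<^sub>R e + ((norm v - a) * ((v \<bullet> e) / (v \<bullet> v))) *\<^sub>R v" for v :: "real^'d::finite"
proof -
 have "(\<chi> i j. v $ i * v $ j) *v e = (v \<bullet> e) *\<^sub>R v"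
  by (simp add: vec_eq_iff matrix_vector_mult_def inner_vec_def sum_distrib_right sum_distrib_left mult_ac)
 then show ?thesis unfolding diffusion_matrix_def
  by (simp add: matrix_vector_mult_add_rdistrib scaleR_matrix_vector_assoc[symmetric])
qed

text \<open>G collects parameters where existence, uniqueness and the a priori bound come straight
  from the regularity assumption; it is only dense in the box. K bounds the elliptic constant
  there.\<close>

locale random_elliptic = random_coefficient +
 fixes n :: nat and K :: real and f and G
 assumes \<kappa>: "\<kappa> = Suc n" and G: "G \<subseteq> param_box" "param_box \<subseteq> closure G" and K: "0 \<le> K" and f: "f \<in> Hs n"
  and good_ex: "!!y h. y \<in> G ==> h \<in> Hs n ==> \<exists>w. weak_solution D (Am 0 y) h w"
  and good_unique: "!!y h w w'. y \<in> G ==> h \<in> Hs n ==> weak_solution D (Am 0 y) h w ==> weak_solution D (Am 0 y) h w' ==>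
   AE x in lebesgue_on D. w x = w' x"
  and good_bound: "!!y h w. y \<in> G ==> h \<in> Hs n ==> weak_solution D (Am 0 y) h w ==> w \<in> Hs (Suc \<kappa>) \<and> nm (Suc \<kappa>) w \<le> K * nm n h"
begin

abbreviation "X \<equiv> Hs (Suc \<kappa>)"
abbreviation "xn \<equiv> nm (Suc \<kappa>)"

definition bdm :: "(real^'a => real^'a^'a) => real => bool" where
 "bdm B b \<longleftrightarrow> (\<forall>i j. bd 1 (\<lambda>x. B x $ i $ j) b)"

definition Q :: real where "Q = (real CARD('a))\<^sup>2 * real \<kappa> * real (Suc \<kappa>)"

lemma Q_nonneg: "0 \<le> Q" by (simp add: Q_def)

lemma bdm_MB: "bdm B b ==> B \<in> MB \<kappa>"
 by (auto simp: bdm_def MB_def bd_def)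

lemma bdm_nonneg: "bdm B b ==> 0 \<le> b"
 unfolding bdm_def using bd_nonneg[of 1] by force

text \<open>Functionals on H10 that are L^2 pairings with an H^(\<kappa>-1) function of controlled
  norm. Hiding that function behind an existential lets functionals be added and rescaled without
  naming right hand sides.\<close>

definition fb :: "((real^'a => real) => real) => real => bool" where
 "fb \<phi> C \<longleftrightarrow> (\<exists>h\<in>Hs n. nm n h \<le> C \<and> (\<forall>v\<in>H10 D. \<phi> v = ip h v))"

lemma fb_ip: "h \<in> Hs n ==> fb (ip h) (nm n h)"
 unfolding fb_def by auto

lemma fb_cong: "fb \<phi> C ==> (!!v. v \<in> H10 D ==> \<psi> v = \<phi> v) ==> fb \<psi> C"
 unfolding fb_def by auto

lemma fb_add: "fb \<phi> C ==> fb \<psi> C' ==> fb (\<lambda>v. \<phi> v + \<psi> v) (C + C')"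
proof -
 assume "fb \<phi> C" "fb \<psi> C'"
 then obtain h h' where h: "h \<in> Hs n" "nm n h \<le> C" "!!v. v \<in> H10 D ==> \<phi> v = ip h v"
  and h': "h' \<in> Hs n" "nm n h' \<le> C'" "!!v. v \<in> H10 D ==> \<psi> v = ip h' v" unfolding fb_def by auto
 have "nm n (\<lambda>x. h x + 1 * h' x) \<le> C + C'" using nm_lin[OF h(1) h'(1), of 1] h(2) h'(2) by linarith
 moreover have "\<phi> v + \<psi> v = ip (\<lambda>x. h x + 1 * h' x) v" if "v \<in> H10 D" for v
  using ip_lin[OF Hs_L2[OF h(1)] Hs_L2[OF h'(1)] H10_L2[OF that], of 1] h(3)[OF that] h'(3)[OF that] by simp
 ultimately show ?thesis unfolding fb_def using Hs_lin[OF h(1) h'(1), of 1] by blast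
qed

lemma fb_scale: "fb \<phi> C ==> fb (\<lambda>v. r * \<phi> v) (\<bar>r\<bar> * C)"
proof -
 assume "fb \<phi> C"
 then obtain h where h: "h \<in> Hs n" "nm n h \<le> C" "!!v. v \<in> H10 D ==> \<phi> v = ip h v" unfolding fb_def by auto
 have "nm n (\<lambda>x. r * h x) \<le> \<bar>r\<bar> * C" by (rule order_trans[OF nm_scale[OF h(1)] mult_left_mono[OF h(2)]]) simp
 moreover have "r * \<phi> v = ip (\<lambda>x. r * h x) v" if "v \<in> H10 D" for v
  unfolding h(3)[OF that] ip_def by (simp add: mult.assoc)
 ultimately show ?thesis unfolding fb_def using Hs_scale[OF h(1), of r] by blast
qed

lemma fb_zero: "fb (\<lambda>v. 0) 0"
 unfolding fb_def using Hs_zero nm_zero by (intro bexI[of _ "\<lambda>x. 0"]) (auto simp: ip_def)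

lemma fb_sum: "finite S ==> (!!s. s \<in> S ==> fb (\<phi> s) (C s)) ==> fb (\<lambda>v. \<Sum>s\<in>S. \<phi> s v) (\<Sum>s\<in>S. C s)"
 by (induction rule: finite_induct) (auto intro: fb_zero fb_add)

lemma fb_fm: "bdm B b ==> w \<in> X ==> xn w \<le> e ==> fb (fm B w) (Q * (b * e))"
proof -
 assume B: "bdm B b" and w: "w \<in> X" "xn w \<le> e"
 have M: "B \<in> MB (Suc n)" and b: "wnorm D (Suc n) \<infinity> 1 (\<lambda>x. B x $ i $ j) \<le> b" and w': "w \<in> Hs (Suc (Suc n))" for i j
  using bdm_MB[OF B] B w unfolding bdm_def bd_def unfolding \<kappa> by blast+
 have "nm n (\<lambda>x. (-1) * dv B w x) \<le> nm n (dv B w)" using nm_scale[OF dv_bound(1)[OF M b w'], of "-1"] by simp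
 also have "\<dots> \<le> Q * (b * xn w)" using dv_bound(2)[OF M b w'] unfolding Q_def unfolding \<kappa> .
 also have "\<dots> \<le> Q * (b * e)" using w(2) Q_nonneg bdm_nonneg[OF B] by (intro mult_left_mono)
 finally have "nm n (\<lambda>x. (-1) * dv B w x) \<le> Q * (b * e)" .
 moreover have "fm B w v = ip (\<lambda>x. (-1) * dv B w x) v" if "v \<in> H10 D" for v
  using fm_dv[OF M w' that] by (simp add: ip_def)
 ultimately show ?thesis unfolding fb_def using Hs_scale[OF dv_bound(1)[OF M b w'], of "-1"] by blast
qed

lemma fb_abs: "fb \<phi> C ==> v \<in> H10 D ==> \<bar>\<phi> v\<bar> \<le> C * n2 v"
proof -
 assume "fb \<phi> C" and v: "v \<in> H10 D"
 then obtain h where h: "h \<in> Hs n" "nm n h \<le> C" "\<phi> v = ip h v" unfolding fb_def by auto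
 have "\<bar>ip h v\<bar> \<le> n2 h * n2 v" by (rule ip_bound[OF Hs_L2[OF h(1)] H10_L2[OF v]])
 also have "\<dots> \<le> C * n2 v" using n2_le_nm[OF h(1)] h(2) by (intro mult_right_mono) (auto simp: n2_eq)
 finally show ?thesis using h(3) by simp
qed

definition CA :: "nat^'b => real" where
 "CA J = (SOME C. C \<ge> 0 \<and> (\<forall>i j. \<forall>y\<in>param_box. bd 1 (\<lambda>x. Am J y x $ i $ j) C))"

lemma CA: "y \<in> param_box ==> bdm (Am J y) (CA J)"
 using someI_ex[OF Am_bounded[unfolded], of J] unfolding CA_def[symmetric] bdm_def by blast

definition CL :: "nat^'b => real" where
 "CL J = (SOME C. C \<ge> 0 \<and> (\<forall>i j. \<forall>y\<in>param_box. \<forall>y'\<in>param_box. bd 1 (\<lambda>x. Am J y' x $ i $ j - Am J y x $ i $ j) (C * norm (y' - y))))"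

lemma CL: "0 \<le> CL J" "y \<in> param_box ==> y' \<in> param_box ==> bdm (\<lambda>x. Am J y' x + (-1) *\<^sub>R Am J y x) (CL J * norm (y' - y))"
proof -
 have "CL J \<ge> 0 \<and> (\<forall>i j. \<forall>y\<in>param_box. \<forall>y'\<in>param_box. bd 1 (\<lambda>x. Am J y' x $ i $ j - Am J y x $ i $ j) (CL J * norm (y' - y)))"
  unfolding CL_def by (rule someI_ex[OF Am_Lipschitz])
 then show "0 \<le> CL J" "y \<in> param_box ==> y' \<in> param_box ==> bdm (\<lambda>x. Am J y' x + (-1) *\<^sub>R Am J y x) (CL J * norm (y' - y))"
  unfolding bdm_def by auto
qed

section \<open>Uniqueness and regularity at every parameter\<close>

definition sol :: "real^'b => (real^'a => real) => (real^'a => real) => bool" where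
 "sol y h w \<longleftrightarrow> w \<in> H10 D \<and> (\<forall>v\<in>H10 D. fm (Am 0 y) w v = ip h v)"

lemma H10_Hs_Suc: "v \<in> H10 D ==> v \<in> Hs (Suc 0)"
 using H10_Hs by simp

lemma weak_solution_iff: "y \<in> param_box ==> weak_solution D (Am 0 y) h w \<longleftrightarrow> sol y h w"
proof -
 assume y: "y \<in> param_box"
 have "(LINT x|lebesgue_on D. (Am 0 y x *v weak_grad D w x) \<bullet> weak_grad D v x) = fm (Am 0 y) w v" if "w \<in> H10 D" "v \<in> H10 D" for v
  by (rule fm_eq[OF bdm_MB[OF CA[OF y]] H10_Hs_Suc[OF that(1)] H10_Hs_Suc[OF that(2)]])
 then show ?thesis unfolding weak_solution_def sol_def ip_def[symmetric] by (auto simp: ip_def)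
qed

lemma G_box: "y \<in> G ==> y \<in> param_box"
 using G by blast

text \<open>The eigenvalues are |V| along V and a orthogonally to it. If |V| \<ge> a the rank one
  part is dropped, otherwise it is bounded by Cauchy-Schwarz.\<close>

lemma coercive:
 assumes y: "y \<in> param_box"
 shows "AE x in lebesgue_on D. \<forall>e. a_lo * (e \<bullet> e) \<le> (Am 0 y x *v e) \<bullet> e"
 using V_bounds
proof eventually_elim
 case (elim x)
 then have v: "a_lo \<le> norm (V y x)" using y by blast
 let ?v = "V y x"
 show ?case
 proof
  fix e :: "real^'a"
  have n: "?v \<bullet> ?v = (norm ?v)\<^sup>2" "0 < norm ?v" using v a_lo by (auto simp: power2_norm_eq_inner)
  have eq: "(Am 0 y x *v e) \<bullet> e = a * (e \<bullet> e) + (norm ?v - a) * ((?v \<bullet> e)\<^sup>2 / (?v \<bullet> ?v))"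
   unfolding Am_0 diffusion_matrix_mult by (simp add: inner_add_left power2_eq_square)
  have le: "(?v \<bullet> e)\<^sup>2 / (?v \<bullet> ?v) \<le> e \<bullet> e"
   using Cauchy_Schwarz_ineq[of ?v e] n by (simp add: divide_le_eq mult.commute)
  have nn: "0 \<le> (?v \<bullet> e)\<^sup>2 / (?v \<bullet> ?v)" by simp
  show "a_lo * (e \<bullet> e) \<le> (Am 0 y x *v e) \<bullet> e"
  proof -
   have "a_lo * E \<le> a * E + (N - a) * F" if "0 \<le> F" "F \<le> E" "a_lo \<le> N" for E F N :: real
   proof (cases "N \<ge> a")
    case True
    then have "0 \<le> (N - a) * F" "a_lo * E \<le> a * E" using that a by (auto intro: mult_right_mono)
    then show ?thesis by linarith
   next
    case False
    then have "(N - a) * E \<le> (N - a) * F" "a_lo * E \<le> N * E" using that by (auto intro: mult_left_mono_neg mult_right_mono)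
    then show ?thesis by (simp add: algebra_simps)
   qed
   from this[OF nn le v] show ?thesis unfolding eq .
  qed
 qed
qed

text \<open>Testing with the difference z, coercivity gives only that the gradient of z vanishes.
  Then z solves the homogeneous problem for every coefficient, in particular at some y0 in G, where
  uniqueness is assumed.\<close>

lemma sol_unique:
 assumes y: "y \<in> param_box" and w: "sol y h w" "sol y h w'"
 shows "AE x in lebesgue_on D. w x = w' x"
proof -
 let ?z = "\<lambda>x. w x + (-1) * w' x"
 have z: "?z \<in> H10 D" using w by (intro H10_lin) (auto simp: sol_def)
 note zS = H10_Hs_Suc[OF z]
 have "fm (Am 0 y) ?z v = 0" if v: "v \<in> H10 D" for v
  using fm_lin_right[OF bdm_MB[OF CA[OF y]] H10_Hs_Suc H10_Hs_Suc H10_Hs_Suc[OF v], of w w' 0 "-1"] w v by (simp add: sol_def)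
 then have 0: "(LINT x|lebesgue_on D. (Am 0 y x *v weak_grad D ?z x) \<bullet> weak_grad D ?z x) = 0"
  using fm_eq[OF bdm_MB[OF CA[OF y]] zS zS] z by metis
 have "AE x in lebesgue_on D. (Am 0 y x *v weak_grad D ?z x) \<bullet> weak_grad D ?z x = 0"
 proof (rule integral_nonneg_eq_0_iff_AE[THEN iffD1, OF _ _ 0])
  show "integrable (lebesgue_on D) (\<lambda>x. (Am 0 y x *v weak_grad D ?z x) \<bullet> weak_grad D ?z x)"
   by (rule fm_integrable[OF bdm_MB[OF CA[OF y]] zS zS])
  show "AE x in lebesgue_on D. 0 \<le> (Am 0 y x *v weak_grad D ?z x) \<bullet> weak_grad D ?z x"
   using coercive[OF y]
  proof eventually_elim
   case (elim x)
   have "0 \<le> a_lo * (weak_grad D ?z x \<bullet> weak_grad D ?z x)" using a_lo by simp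
   then show ?case using elim[rule_format, of "weak_grad D ?z x"] by linarith
  qed
 qed
 then have g: "AE x in lebesgue_on D. weak_grad D ?z x = 0"
  using coercive[OF y]
 proof eventually_elim
  case (elim x)
  then have "a_lo * (weak_grad D ?z x \<bullet> weak_grad D ?z x) \<le> 0" by metis
  then have "weak_grad D ?z x \<bullet> weak_grad D ?z x \<le> 0" using a_lo by (simp add: mult_le_0_iff)
  then show ?case using inner_ge_zero[of "weak_grad D ?z x"] inner_eq_zero_iff[of "weak_grad D ?z x"] by linarith
 qed
 have "(0::real^'b) \<in> closure G" using G(2) by (auto simp: param_box_def mem_box_cart)
 then have "G ~= {}" by auto
 then obtain y0 where y0: "y0 \<in> G" by blast
 have "sol y0 (\<lambda>x. 0) ?z"
  unfolding sol_def
 proof (intro conjI ballI z)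
  fix v assume v: "v \<in> H10 D"
  have "ip (\<lambda>x. Am 0 y0 x $ i $ j * pd j ?z x) (pd i v) = ip (\<lambda>x. 0) (pd i v)" for i j
  proof (rule ip_cong_AE)
   show "(\<lambda>x. Am 0 y0 x $ i $ j * pd j ?z x) \<in> L2" by (rule MB_flux_L2[OF bdm_MB[OF CA[OF G_box[OF y0]]] zS])
   show "pd i v \<in> L2" by (rule pd_L2[OF H10_Hs_Suc[OF v]])
   show "(\<lambda>x. 0) \<in> L2" by (rule Hs_L2[OF Hs_zero])
   show "AE x in lebesgue_on D. Am 0 y0 x $ i $ j * pd j ?z x = 0"
    using g by eventually_elim (simp add: weak_grad_def pd_def vec_eq_iff)
  qed
  then show "fm (Am 0 y0) ?z v = ip (\<lambda>x. 0) v" by (simp add: fm_def ip_def)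
 qed
 moreover have "sol y0 (\<lambda>x. 0) (\<lambda>x. 0)"
  unfolding sol_def
 proof (intro conjI ballI H10_zero)
  fix v assume v: "v \<in> H10 D"
  have "fm (Am 0 y0) (\<lambda>x. (\<lambda>x. 0) x + (-1) * (\<lambda>x. 0) x) v = fm (Am 0 y0) (\<lambda>x. 0) v + (-1) * fm (Am 0 y0) (\<lambda>x. 0) v"
   by (rule fm_lin_right[OF bdm_MB[OF CA[OF G_box[OF y0]]] Hs_zero Hs_zero H10_Hs_Suc[OF v]])
  then show "fm (Am 0 y0) (\<lambda>x. 0) v = ip (\<lambda>x. 0) v" by (simp add: ip_def)
 qed
 ultimately have "AE x in lebesgue_on D. ?z x = 0"
  using good_unique[OF y0 Hs_zero] unfolding weak_solution_iff[OF G_box[OF y0]] by blast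
 then show ?thesis by eventually_elim simp
qed

text \<open>The a priori estimate for any z whose equation has an admissible right hand side. Stated
  through \<open>fb\<close>, it applies directly to differences and Taylor remainders of
  solutions.\<close>

definition regular :: "real^'b => bool" where
 "regular y \<longleftrightarrow> (\<forall>z C. z \<in> H10 D --> fb (fm (Am 0 y) z) C --> z \<in> X \<and> xn z \<le> K * C)"

lemma regularI:
 assumes y: "!!h w. h \<in> Hs n ==> sol y h w ==> w \<in> X \<and> xn w \<le> K * nm n h"
 shows "regular y"
 unfolding regular_def
proof (intro allI impI)
 fix z C assume z: "z \<in> H10 D" "fb (fm (Am 0 y) z) C"
 then obtain h where h: "h \<in> Hs n" "nm n h \<le> C" "\<forall>v\<in>H10 D. fm (Am 0 y) z v = ip h v" unfolding fb_def by auto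
 then have "z \<in> X \<and> xn z \<le> K * nm n h" using z by (intro y) (auto simp: sol_def)
 moreover have "K * nm n h \<le> K * C" using h(2) K by (rule mult_left_mono)
 ultimately show "z \<in> X \<and> xn z \<le> K * C" by linarith
qed

lemma regular_good: "y \<in> G ==> regular y"
 by (rule regularI) (use good_bound weak_solution_iff[OF G_box] in blast)

lemma regularD: "regular y ==> z \<in> H10 D ==> fb (fm (Am 0 y) z) C ==> z \<in> X" "regular y ==> z \<in> H10 D ==> fb (fm (Am 0 y) z) C ==> xn z \<le> K * C"
 by (auto simp: regular_def)

lemma fm_expand:
 assumes "B \<in> MB \<kappa>" "B' \<in> MB \<kappa>" "w \<in> X" "w' \<in> X" "v \<in> H10 D"
 shows "fm B' w' v - fm B w v = fm (\<lambda>x. B' x + (-1) *\<^sub>R B x) w' v + fm B (\<lambda>x. w' x + (-1) * w x) v"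
 using fm_lin_left[OF assms(2,1,4) H10_Hs_Suc[OF assms(5)], of "-1"] fm_lin_right[OF assms(1,4,3) H10_Hs_Suc[OF assms(5)], of "-1"] by simp

lemma X_Hs: "w \<in> X ==> w \<in> Hs 1" and nm_xn: "nm 1 w \<le> xn w"
 using Hs_mono[of w "Suc \<kappa>" 1] nm_mono[of 1 "Suc \<kappa>" w] by auto

text \<open>Solutions at parameters of \<open>G\<close> that converge to \<open>y\<close> form a Cauchy sequence in \<open>H\<^sup>\<kappa>\<^sup>+\<^sup>1\<close>.\<close>

lemma solution_exists:
 assumes y: "y \<in> param_box" and h: "h \<in> Hs n"
 shows "\<exists>w\<in>X. sol y h w \<and> xn w \<le> K * nm n h"
proof -
 obtain g where g: "!!k. g k \<in> G" "g \<longlonglongrightarrow> y" using y G(2) closure_sequential[of y G] by blast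
 note gb = G_box[OF g(1)]
 let ?E = "K * nm n h"
 have "\<forall>k. \<exists>w. sol (g k) h w" using good_ex[OF g(1) h] weak_solution_iff[OF gb] by blast
 from choice[OF this] obtain w where w: "!!k. sol (g k) h (w k)" by blast
 have wX: "w k \<in> X" "xn (w k) \<le> ?E" and wH: "w k \<in> H10 D" for k
  using good_bound[OF g(1) h] weak_solution_iff[OF gb] w unfolding sol_def by blast+
 note MA = bdm_MB[OF CA]
 let ?c = "K * (Q * (CL 0 * ?E))"
 have E0: "0 \<le> ?E" using K nm_nonneg by simp
 then have c0: "0 \<le> ?c" using K Q_nonneg CL(1) by simp
 \<comment> \<open>The difference w k - w l solves the problem at g k with right hand side div
   ((A[g k] - A[g l]) \<nabla>(w l)), which is of size |g k - g l|.\<close>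
 have le: "xn (\<lambda>x. w k x - w l x) \<le> ?c * norm (g k - g l)" for k l
 proof -
  let ?z = "\<lambda>x. w k x + (-1) * w l x" and ?B = "\<lambda>x. Am 0 (g k) x + (-1) *\<^sub>R Am 0 (g l) x"
  have "fb (fm ?B (w l)) (Q * ((CL 0 * norm (g k - g l)) * ?E))" by (rule fb_fm[OF CL(2)[OF gb gb] wX])
  from fb_scale[OF this, of "-1"] have "fb (fm (Am 0 (g k)) ?z) (\<bar>-1\<bar> * (Q * ((CL 0 * norm (g k - g l)) * ?E)))"
  proof (rule fb_cong)
   fix v assume v: "v \<in> H10 D"
   note l = fm_lin_left[OF MA[OF gb[of k], of 0] MA[OF gb[of l], of 0] wX(1)[of l] H10_Hs_Suc[OF v], of "-1"]
   note r = fm_lin_right[OF MA[OF gb[of k], of 0] wX(1)[of k] wX(1)[of l] H10_Hs_Suc[OF v], of "-1"]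
   have "fm (Am 0 (g k)) (w k) v = fm (Am 0 (g l)) (w l) v" using w v by (simp add: sol_def)
   then show "fm (Am 0 (g k)) ?z v = -1 * fm ?B (w l) v" unfolding l r by simp
  qed
  from regularD(2)[OF regular_good[OF g(1)] H10_lin[OF wH wH] this] show ?thesis by (simp add: mult_ac)
 qed
 have "\<exists>v\<in>X. (\<lambda>k. xn (\<lambda>x. w k x - v x)) \<longlonglongrightarrow> 0"
 proof (rule Hs_complete[OF wX(1)])
  fix e :: real assume e: "e > 0"
  have "Cauchy g" using g(2) by (rule LIMSEQ_imp_Cauchy)
  then obtain N where N: "!!k l. k \<ge> N ==> l \<ge> N ==> norm (g k - g l) < e / (?c + 1)"
   using e c0 unfolding Cauchy_def dist_norm by (metis add_nonneg_pos divide_pos_pos zero_less_one)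
  have "xn (\<lambda>x. w k x - w l x) < e" if "k \<ge> N" "l \<ge> N" for k l
  proof -
   have "?c * norm (g k - g l) \<le> ?c * (e / (?c + 1))" using N[OF that] c0 by (intro mult_left_mono) auto
   also have "\<dots> < e"
   proof -
    have "c * (e / (c + 1)) < e" if "0 \<le> c" for c :: real using that e by (simp add: field_simps)
    then show ?thesis using c0 by blast
   qed
   finally show ?thesis using le[of k l] by linarith
  qed
  then show "\<exists>N. \<forall>k\<ge>N. \<forall>l\<ge>N. xn (\<lambda>x. w k x - w l x) < e" by blast
 qed
 then obtain v where v: "v \<in> X" and lim: "(\<lambda>k. xn (\<lambda>x. w k x - v x)) \<longlonglongrightarrow> 0" by blast
 have lim': "(\<lambda>k. xn (\<lambda>x. v x - w k x)) \<longlonglongrightarrow> 0"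
  by (rule null_sequence_le[OF nm_nonneg nm_minus_commute[OF v wX(1)] lim])
 have vH: "v \<in> H10 D"
  by (rule H10_closed[OF X_Hs[OF v] wH null_sequence_le[OF nm_nonneg nm_xn lim']])
 have "fm (Am 0 y) v t = ip h t" if t: "t \<in> H10 D" for t
 proof -
  \<comment> \<open>Compared with the equation at g k there is one error from the coefficient and
    one from v - w k.\<close>
  have le: "\<bar>fm (Am 0 y) v t - ip h t\<bar> \<le> Q * ((CL 0 * norm (y - g k)) * ?E) * n2 t + Q * (CA 0 * xn (\<lambda>x. v x - w k x)) * n2 t" for k
  proof -
   let ?B = "\<lambda>x. Am 0 y x + (-1) *\<^sub>R Am 0 (g k) x"
   have "fm (Am 0 y) v t - fm (Am 0 (g k)) (w k) t = fm ?B (w k) t + fm (Am 0 y) (\<lambda>x. v x + (-1) * w k x) t"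
    using fm_lin_left[OF MA[OF y, of 0] MA[OF gb[of k], of 0] wX(1)[of k] H10_Hs_Suc[OF t], of "-1"]
     fm_lin_right[OF MA[OF y, of 0] v wX(1)[of k] H10_Hs_Suc[OF t], of "-1"] by simp
   moreover have "fm (Am 0 (g k)) (w k) t = ip h t" using w t by (simp add: sol_def)
   moreover have "\<bar>fm ?B (w k) t\<bar> \<le> Q * ((CL 0 * norm (y - g k)) * ?E) * n2 t"
    by (rule fb_abs[OF fb_fm[OF CL(2)[OF gb y] wX] t])
   moreover have "\<bar>fm (Am 0 y) (\<lambda>x. v x + (-1) * w k x) t\<bar> \<le> Q * (CA 0 * xn (\<lambda>x. v x - w k x)) * n2 t"
    by (rule fb_abs[OF fb_fm[OF CA[OF y] Hs_lin[OF v wX(1)]] t]) simp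
   ultimately show ?thesis by linarith
  qed
  have "(\<lambda>k. norm (y - g k)) \<longlonglongrightarrow> norm (y - y)" by (intro tendsto_intros g(2))
  then have "(\<lambda>k. Q * ((CL 0 * norm (y - g k)) * ?E) * n2 t + Q * (CA 0 * xn (\<lambda>x. v x - w k x)) * n2 t) \<longlonglongrightarrow>
   Q * ((CL 0 * norm (y - y)) * ?E) * n2 t + Q * (CA 0 * 0) * n2 t"
   by (intro tendsto_add tendsto_mult tendsto_const lim')
  from null_sequence_le[OF abs_ge_zero le this[unfolded diff_self norm_zero mult_zero_right mult_zero_left add_0_right]]
  have "(\<lambda>k::nat. \<bar>fm (Am 0 y) v t - ip h t\<bar>) \<longlonglongrightarrow> 0" .
  from LIMSEQ_unique[OF this tendsto_const] show ?thesis by simp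
 qed
 then have "sol y h v" using vH by (simp add: sol_def)
 moreover have "xn v \<le> ?E"
 proof (rule LIMSEQ_le_const)
  show "(\<lambda>k. ?E + xn (\<lambda>x. v x - w k x)) \<longlonglongrightarrow> ?E" using tendsto_add[OF tendsto_const lim'] by simp
  have "xn v \<le> ?E + xn (\<lambda>x. v x - w k x)" for k
   using nm_add[OF wX(1) Hs_diff[OF v wX(1)], of k k] wX(2)[of k] by simp
  then show "\<exists>N. \<forall>k\<ge>N. xn v \<le> ?E + xn (\<lambda>x. v x - w k x)" by blast
 qed
 ultimately show ?thesis using v by blast
qed

text \<open>By uniqueness every solution agrees almost everywhere with the one from
  \<open>solution_exists\<close> and inherits its regularity.\<close>

lemma regular: "y \<in> param_box ==> regular y"
proof (rule regularI)
 fix h w assume y: "y \<in> param_box" and h: "h \<in> Hs n" and w: "sol y h w"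
 obtain w' where w': "w' \<in> X" "sol y h w'" "xn w' \<le> K * nm n h" using solution_exists[OF y h] by blast
 have "w \<in> L2" using w H10_L2 by (simp add: sol_def)
 from Hs_cong_AE[OF w'(1) this sol_unique[OF y w'(2) w]] w'(3) show "w \<in> X \<and> xn w \<le> K * nm n h" by simp
qed

end

section \<open>Taylor coefficients of the solution\<close>

context random_elliptic
begin

definition sl :: "real^'b => (real^'a => real) => real^'a => real" where
 "sl y h = (SOME w. w \<in> X \<and> sol y h w)"

lemma sl: "y \<in> param_box ==> h \<in> Hs n ==> sl y h \<in> X" "y \<in> param_box ==> h \<in> Hs n ==> sol y h (sl y h)"
proof -
 assume "y \<in> param_box" "h \<in> Hs n"
 then have "\<exists>w. w \<in> X \<and> sol y h w" using solution_exists by blast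
 then have "sl y h \<in> X \<and> sol y h (sl y h)" unfolding sl_def by (rule someI_ex)
 then show "sl y h \<in> X" "sol y h (sl y h)" by auto
qed

lemma antidiag_size:
 assumes "p \<in> antidiag I - {(0, I)}"
 shows "mi_size (snd p) < mi_size I" "fst p ~= 0" "mi_size (fst p) ~= 0"
proof -
 have ad: "fst p + snd p = I" using assms by (simp add: antidiag_def)
 show 0: "fst p ~= 0" using assms ad by (cases p) auto
 then show s: "mi_size (fst p) ~= 0" by (simp add: mi_size_eq_0)
 have "mi_size (fst p) + mi_size (snd p) = mi_size I" unfolding ad[symmetric] by (rule mi_size_add[symmetric])
 then show "mi_size (snd p) < mi_size I" using s by simp
qed

text \<open>\<open>uc I y\<close> is the Taylor coefficient \<open>\<partial>\<^sup>I u[y] / I!\<close>.\<close>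

function uc :: "nat^'b => real^'b => real^'a => real" where
 "uc I y = sl y (\<lambda>x. (if I = 0 then f x else 0) + (\<Sum>p\<in>antidiag I - {(0, I)}. dv (Am (fst p) y) (uc (snd p) y) x))"
 by auto
termination
proof (relation "Wellfounded.measure (\<lambda>(I, y). mi_size I)")
 show "((snd p, y), I, y) \<in> Wellfounded.measure (\<lambda>(I, y). mi_size I)" if "p \<in> antidiag I - {(0, I)}" for I :: "nat^'b" and y :: "real^'b" and p
  using antidiag_size(1)[OF that] by simp
qed simp

declare uc.simps [simp del]

lemma finite_antidiag_diff: "finite (antidiag I - {(0, I)})"
 by (simp add: finite_antidiag)

lemma antidiag_split: "(\<Sum>p\<in>antidiag I. h p) = h (0, I) + (\<Sum>p\<in>antidiag I - {(0, I)}. h p)" for h :: "_ => real"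
 by (subst sum.remove[OF finite_antidiag, of "(0, I)"]) (auto simp: antidiag_def)

text \<open>The system says that the coefficient of index I of the weak equation is satisfied. The
  induction carries membership in X, which makes \<open>dv\<close> of the lower coefficients an
  admissible right hand side.\<close>

lemma uc_solution:
 assumes y: "y \<in> param_box"
 shows "uc I y \<in> X" "uc I y \<in> H10 D"
  "v \<in> H10 D ==> (\<Sum>p\<in>antidiag I. fm (Am (fst p) y) (uc (snd p) y) v) = (if I = 0 then ip f v else 0)"
proof -
 have "uc I y \<in> X \<and> uc I y \<in> H10 D \<and>
  (\<forall>v\<in>H10 D. (\<Sum>p\<in>antidiag I. fm (Am (fst p) y) (uc (snd p) y) v) = (if I = 0 then ip f v else 0))"
 proof (induction "mi_size I" arbitrary: I rule: less_induct)
  case less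
  let ?S = "antidiag I - {(0, I)}"
  have M: "Am J y \<in> MB (Suc n)" for J using bdm_MB[OF CA[OF y, of J]] unfolding \<kappa> .
  have b: "wnorm D (Suc n) \<infinity> 1 (\<lambda>x. Am J y x $ i $ j) \<le> CA J" for J i j
   using CA[OF y, of J] unfolding bdm_def bd_def unfolding \<kappa> by blast
  have uX: "uc (snd p) y \<in> Hs (Suc (Suc n))" if "p \<in> ?S" for p
   using less(1)[OF antidiag_size(1)[OF that]] unfolding \<kappa> by blast
  have d: "dv (Am (fst p) y) (uc (snd p) y) \<in> Hs n" if "p \<in> ?S" for p
   by (rule dv_bound(1)[OF M b uX[OF that]])
  let ?h0 = "\<lambda>x. if I = 0 then f x else 0" and ?h1 = "\<lambda>x. \<Sum>p\<in>?S. dv (Am (fst p) y) (uc (snd p) y) x"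
  have h0: "?h0 \<in> Hs n" using f Hs_zero by (cases "I = 0") auto
  have h1: "?h1 \<in> Hs n" by (rule Hs_sum[OF finite_antidiag_diff d])
  have u: "uc I y = sl y (\<lambda>x. ?h0 x + 1 * ?h1 x)" by (subst uc.simps) simp
  note s = sl[OF y Hs_lin[OF h0 h1, of 1], folded u]
  have "(\<Sum>p\<in>antidiag I. fm (Am (fst p) y) (uc (snd p) y) v) = (if I = 0 then ip f v else 0)" if v: "v \<in> H10 D" for v
  proof -
   have "fm (Am 0 y) (uc I y) v = ip (\<lambda>x. ?h0 x + 1 * ?h1 x) v" using s(2) v by (simp add: sol_def)
   also have "\<dots> = ip ?h0 v + ip ?h1 v" using ip_lin[OF Hs_L2[OF h0] Hs_L2[OF h1] H10_L2[OF v], of 1] by simp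
   also have "ip ?h1 v = (\<Sum>p\<in>?S. ip (dv (Am (fst p) y) (uc (snd p) y)) v)"
    by (rule ip_sum[OF finite_antidiag_diff Hs_L2[OF d] H10_L2[OF v]])
   also have "\<dots> = (\<Sum>p\<in>?S. - fm (Am (fst p) y) (uc (snd p) y) v)"
    by (intro sum.cong refl) (simp add: fm_dv[OF M uX v])
   finally show ?thesis unfolding antidiag_split[of _ I] by (auto simp: sum_negf ip_def)
  qed
  then show ?case using s by (simp add: sol_def)
 qed
 then show "uc I y \<in> X" "uc I y \<in> H10 D"
  "v \<in> H10 D ==> (\<Sum>p\<in>antidiag I. fm (Am (fst p) y) (uc (snd p) y) v) = (if I = 0 then ip f v else 0)" by auto
qed

text \<open>The sum is M + ... + M^l, at most twice its last term as soon as M \<ge> 2; this is the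
  role of the 2 in the maximum of the theorem.\<close>

lemma geometric_sum_le:
 assumes "2 \<le> (M::real)"
 shows "(\<Sum>j\<le>l. (if j = 0 then 0 else 1) * M ^ (l - j + 1)) \<le> 2 * M ^ l"
proof (induction l)
 case (Suc l)
 have "(\<Sum>j\<le>Suc l. (if j = 0 then 0 else 1) * M ^ (Suc l - j + 1)) = (\<Sum>j\<le>l. M ^ (l - j + 1))"
  by (subst sum.atMost_Suc_shift) simp
 also have "\<dots> = (\<Sum>j\<le>l. (if j = 0 then M ^ (l + 1) else 0) + (if j = 0 then 0 else 1) * M ^ (l - j + 1))"
  by (intro sum.cong) auto
 also have "\<dots> \<le> M ^ (l + 1) + 2 * M ^ l" using Suc.IH by (simp add: sum.distrib)
 also have "\<dots> \<le> 2 * M ^ Suc l" using mult_right_mono[OF assms, of "M ^ l"] assms by simp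
 finally show ?case .
qed simp

text \<open>The lower coefficients enter with K Q k1 times a convolution of weights, which
  \<open>mw_convolution\<close> turns into a geometric sum of at most 2 M^l. With K Q k1 \<le> M/2
  this gives M^(l+1); order 0 is the elliptic estimate for f.\<close>

lemma uc_bound:
 assumes y: "y \<in> param_box" and M: "2 \<le> M" "2 * (K * Q * k1) \<le> M" "K * nm n f \<le> M"
 shows "xn (uc I y) \<le> mw (\<lambda>k. m * \<gamma> k) I * M ^ (mi_size I + 1)"
proof (induction "mi_size I" arbitrary: I rule: less_induct)
 case less
 let ?S = "antidiag I - {(0, I)}" and ?w = "mw (\<lambda>k. m * \<gamma> k)" and ?N = "mi_size I"
 have w0: "0 \<le> ?w J" for J by (intro mw_nonneg mult_nonneg_nonneg \<gamma>_nonneg) (use m_pos in simp)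
 show ?case
 proof (cases "I = 0")
  case True
  have "fb (fm (Am 0 y) (uc 0 y)) (nm n f)"
   by (rule fb_cong[OF fb_ip[OF f]]) (use uc_solution(3)[OF y, of _ 0] in \<open>simp add: antidiag_0\<close>)
  from regularD(2)[OF regular[OF y] uc_solution(2)[OF y] this] M(3) show ?thesis by (simp add: True)
 next
  case False
  let ?f = "\<lambda>p. Q * ((k1 * ?w (fst p)) * (?w (snd p) * M ^ (mi_size (snd p) + 1)))"
  have "fb (\<lambda>v. \<Sum>p\<in>?S. fm (Am (fst p) y) (uc (snd p) y) v) (\<Sum>p\<in>?S. ?f p)"
  proof (rule fb_sum[OF finite_antidiag_diff])
   fix p assume p: "p \<in> ?S"
   have "bdm (Am (fst p) y) (k1 * ?w (fst p))" using bd_Am[OF antidiag_size(2)[OF p] y] by (simp add: bdm_def)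
   then show "fb (fm (Am (fst p) y) (uc (snd p) y)) (?f p)"
    by (rule fb_fm[OF _ uc_solution(1)[OF y] less(1)[OF antidiag_size(1)[OF p]]])
  qed
  from fb_scale[OF this, of "-1"] have "fb (fm (Am 0 y) (uc I y)) (\<bar>-1\<bar> * (\<Sum>p\<in>?S. ?f p))"
  proof (rule fb_cong)
   fix v assume "v \<in> H10 D"
   from uc_solution(3)[OF y this, of I] False
   show "fm (Am 0 y) (uc I y) v = -1 * (\<Sum>p\<in>?S. fm (Am (fst p) y) (uc (snd p) y) v)"
    unfolding antidiag_split[of _ I] by simp
  qed
  from regularD(2)[OF regular[OF y] uc_solution(2)[OF y] this]
  have "xn (uc I y) \<le> K * (\<Sum>p\<in>?S. ?f p)" by simp
  also have "\<dots> = (K * Q * k1) * (\<Sum>p\<in>?S. ?w (fst p) * (?w (snd p) * M ^ (mi_size (snd p) + 1)))"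
   by (simp add: sum_distrib_left mult_ac)
  also have "(\<Sum>p\<in>?S. ?w (fst p) * (?w (snd p) * M ^ (mi_size (snd p) + 1))) =
    (\<Sum>(A, E)\<in>antidiag I. ((if mi_size A = 0 then 0 else 1) * ?w A) * (M ^ (mi_size E + 1) * ?w E))"
  proof -
   have "(\<Sum>p\<in>?S. ?w (fst p) * (?w (snd p) * M ^ (mi_size (snd p) + 1))) =
     (\<Sum>p\<in>?S. ((if mi_size (fst p) = 0 then 0 else 1) * ?w (fst p)) * (M ^ (mi_size (snd p) + 1) * ?w (snd p)))"
   proof (rule sum.cong[OF refl])
    fix p assume "p \<in> ?S"
    from antidiag_size(3)[OF this] show "?w (fst p) * (?w (snd p) * M ^ (mi_size (snd p) + 1)) =
     ((if mi_size (fst p) = 0 then 0 else 1) * ?w (fst p)) * (M ^ (mi_size (snd p) + 1) * ?w (snd p))" by simp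
   qed
   then show ?thesis unfolding case_prod_beta antidiag_split[of _ I] by simp
  qed
  also have "\<dots> = (\<Sum>j\<le>?N. (if j = 0 then 0 else 1) * M ^ (?N - j + 1)) * ?w I" by (rule mw_convolution)
  also have "(K * Q * k1) * \<dots> \<le> (M / 2) * ((2 * M ^ ?N) * ?w I)"
   using M geometric_sum_le[OF M(1), of ?N] w0 by (intro mult_mono mult_right_mono mult_nonneg_nonneg sum_nonneg) auto
  finally show ?thesis by (simp add: mult_ac)
 qed
qed

lemma uc_bounded: "\<exists>C. \<forall>y\<in>param_box. xn (uc I y) \<le> C"
proof -
 have "xn (uc I y) \<le> mw (\<lambda>k. m * \<gamma> k) I * max 2 (max (2 * (K * Q * k1)) (K * nm n f)) ^ (mi_size I + 1)" if "y \<in> param_box" for y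
  by (rule uc_bound[OF that]) auto
 then show ?thesis by blast
qed

text \<open>Subtracting the systems at y' and y leaves an equation with coefficient
  \<open>Am 0 y\<close> for the increment. Its right hand side consists of increments of the
  coefficients and of increments of lower order, already controlled.\<close>

lemma uc_Lipschitz: "\<exists>C\<ge>0. \<forall>y\<in>param_box. \<forall>y'\<in>param_box. xn (\<lambda>x. uc I y' x + (-1) * uc I y x) \<le> C * norm (y' - y)"
proof (induction "mi_size I" arbitrary: I rule: less_induct)
 case less
 let ?S = "antidiag I - {(0, I)}"
 have "\<forall>E. \<exists>C. mi_size E < mi_size I --> C \<ge> 0 \<and> (\<forall>y\<in>param_box. \<forall>y'\<in>param_box. xn (\<lambda>x. uc E y' x + (-1) * uc E y x) \<le> C * norm (y' - y))"
  using less by blast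
 from choice[OF this] obtain CI where CI: "!!E. mi_size E < mi_size I ==> CI E \<ge> 0"
  "!!E y y'. mi_size E < mi_size I ==> y \<in> param_box ==> y' \<in> param_box ==> xn (\<lambda>x. uc E y' x + (-1) * uc E y x) \<le> CI E * norm (y' - y)" by blast
 have "\<forall>E. \<exists>C. \<forall>y\<in>param_box. xn (uc E y) \<le> C" using uc_bounded by blast
 from choice[OF this] obtain CU where CU: "!!E y. y \<in> param_box ==> xn (uc E y) \<le> CU E" by blast
 have z: "(0::real^'b) \<in> param_box" by (simp add: param_box_def mem_box_cart)
 have CU0: "0 \<le> CU E" for E using order_trans[OF nm_nonneg CU[OF z]] .
 have CA0: "0 \<le> CA J" for J by (rule bdm_nonneg[OF CA[OF z]])
 let ?C = "(\<Sum>p\<in>antidiag I. Q * (CL (fst p) * CU (snd p))) + (\<Sum>p\<in>?S. Q * (CA (fst p) * CI (snd p)))"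
 have C0: "0 \<le> ?C" using Q_nonneg CL(1) CU0 CA0 CI(1)[OF antidiag_size(1)]
  by (intro add_nonneg_nonneg sum_nonneg mult_nonneg_nonneg) auto
 have "xn (\<lambda>x. uc I y' x + (-1) * uc I y x) \<le> (K * ?C) * norm (y' - y)" if y: "y \<in> param_box" and y': "y' \<in> param_box" for y y'
 proof -
  let ?r = "norm (y' - y)"
  let ?B = "\<lambda>p x. Am (fst p) y' x + (-1) *\<^sub>R Am (fst p) y x" and ?d = "\<lambda>E x. uc E y' x + (-1) * uc E y x"
  let ?\<phi> = "\<lambda>v. (\<Sum>p\<in>antidiag I. fm (?B p) (uc (snd p) y') v) + (\<Sum>p\<in>?S. fm (Am (fst p) y) (?d (snd p)) v)"
  have "fb ?\<phi> ((\<Sum>p\<in>antidiag I. Q * ((CL (fst p) * ?r) * CU (snd p))) + (\<Sum>p\<in>?S. Q * (CA (fst p) * (CI (snd p) * ?r))))"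
  proof (intro fb_add fb_sum finite_antidiag finite_antidiag_diff)
   show "fb (fm (?B p) (uc (snd p) y')) (Q * ((CL (fst p) * ?r) * CU (snd p)))" for p
    by (rule fb_fm[OF CL(2)[OF y y'] uc_solution(1)[OF y'] CU[OF y']])
   show "fb (fm (Am (fst p) y) (?d (snd p))) (Q * (CA (fst p) * (CI (snd p) * ?r)))" if "p \<in> ?S" for p
    by (rule fb_fm[OF CA[OF y] Hs_lin[OF uc_solution(1)[OF y'] uc_solution(1)[OF y]] CI(2)[OF antidiag_size(1)[OF that] y y']])
  qed
  moreover have "(\<Sum>p\<in>antidiag I. Q * ((CL (fst p) * ?r) * CU (snd p))) + (\<Sum>p\<in>?S. Q * (CA (fst p) * (CI (snd p) * ?r))) = ?C * ?r"
   unfolding distrib_right sum_distrib_right by (intro arg_cong2[where f = "(+)"] sum.cong refl) (simp_all add: mult_ac)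
  ultimately have "fb ?\<phi> (?C * ?r)" by simp
  from fb_scale[OF this, of "-1"] have "fb (fm (Am 0 y) (?d I)) (\<bar>-1\<bar> * (?C * ?r))"
  proof (rule fb_cong)
   fix v assume v: "v \<in> H10 D"
   have e: "fm (Am (fst p) y') (uc (snd p) y') v - fm (Am (fst p) y) (uc (snd p) y) v = fm (?B p) (uc (snd p) y') v + fm (Am (fst p) y) (?d (snd p)) v" for p
    by (rule fm_expand[OF bdm_MB[OF CA[OF y]] bdm_MB[OF CA[OF y']] uc_solution(1)[OF y] uc_solution(1)[OF y'] v])
   have "(\<Sum>p\<in>antidiag I. fm (?B p) (uc (snd p) y') v + fm (Am (fst p) y) (?d (snd p)) v) = 0"
    unfolding e[symmetric] sum_subtractf uc_solution(3)[OF y v] uc_solution(3)[OF y' v] by simp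
   then show "fm (Am 0 y) (?d I) v = -1 * ?\<phi> v"
    unfolding sum.distrib antidiag_split[of "\<lambda>p. fm (Am (fst p) y) (?d (snd p)) v" I] by simp
  qed
  from regularD(2)[OF regular[OF y] H10_lin[OF uc_solution(2)[OF y'] uc_solution(2)[OF y]] this]
  show ?thesis by (simp add: mult_ac)
 qed
 then show ?case using C0 K by (intro exI[of _ "K * ?C"]) auto
qed

text \<open>The remainder of the first order expansion of \<open>uc I\<close> in y_k. The factor I_k
  + 1 reflects that the y_k-derivative of a normalised coefficient is I_k + 1 times the one of index
  I + e_k.\<close>

definition ue :: "'b => nat^'b => real^'b => real => real^'a => real" where
 "ue k I y t x = (uc I (y + t *\<^sub>R axis k 1) x + (-1) * uc I y x) + (- (t * real (I $ k + 1))) * uc (I + axis k 1) y x"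

text \<open>From the system at y + t e_k subtract the one at y and t (I_k + 1) times the system of
  index I + e_k at y. What remains is quadratic in t: remainders of the coefficients, products of
  two increments, and remainders of lower order.\<close>

lemma uc_second_order:
 "\<exists>C\<ge>0. \<forall>y\<in>param_box. \<forall>t. y + t *\<^sub>R axis k 1 \<in> param_box --> xn (ue k I y t) \<le> C * t\<^sup>2"
proof (induction "mi_size I" arbitrary: I rule: less_induct)
 case less
 let ?S = "antidiag I - {(0, I)}" and ?y = "\<lambda>y t. y + t *\<^sub>R axis k (1::real)"
 have "\<forall>E. \<exists>C. mi_size E < mi_size I --> C \<ge> 0 \<and> (\<forall>y\<in>param_box. \<forall>t. ?y y t \<in> param_box --> xn (ue k E y t) \<le> C * t\<^sup>2)"
  using less by blast
 from choice[OF this] obtain CI where CI: "!!E. mi_size E < mi_size I ==> CI E \<ge> 0"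
  "!!E y t. mi_size E < mi_size I ==> y \<in> param_box ==> ?y y t \<in> param_box ==> xn (ue k E y t) \<le> CI E * t\<^sup>2" by blast
 have "\<forall>E. \<exists>C. \<forall>y\<in>param_box. xn (uc E y) \<le> C" using uc_bounded by blast
 from choice[OF this] obtain CU where CU: "!!E y. y \<in> param_box ==> xn (uc E y) \<le> CU E" by blast
 have "\<forall>E. \<exists>C\<ge>0. \<forall>y\<in>param_box. \<forall>y'\<in>param_box. xn (\<lambda>x. uc E y' x + (-1) * uc E y x) \<le> C * norm (y' - y)" using uc_Lipschitz by blast
 from choice[OF this] obtain CV where CV: "!!E. 0 \<le> CV E"
  "!!E y y'. y \<in> param_box ==> y' \<in> param_box ==> xn (\<lambda>x. uc E y' x + (-1) * uc E y x) \<le> CV E * norm (y' - y)" by blast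
 let ?R = "\<lambda>J y t x. (Am J (?y y t) x + (-1) *\<^sub>R Am J y x) + (- (t * real (J $ k + 1))) *\<^sub>R Am (J + axis k 1) y x"
 have "\<forall>J. \<exists>C\<ge>0. \<forall>y\<in>param_box. \<forall>t. ?y y t \<in> param_box --> bdm (?R J y t) (C * t\<^sup>2)"
 proof
  fix J
  obtain C where "C \<ge> 0" "\<forall>i j. \<forall>y\<in>param_box. \<forall>t. ?y y t \<in> param_box -->
   bd 1 (\<lambda>x. Am J (?y y t) x $ i $ j - Am J y x $ i $ j - t * (real (J $ k + 1) * Am (J + axis k 1) y x $ i $ j)) (C * t\<^sup>2)"
   using Am_second_order by blast
  then show "\<exists>C\<ge>0. \<forall>y\<in>param_box. \<forall>t. ?y y t \<in> param_box --> bdm (?R J y t) (C * t\<^sup>2)"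
   unfolding bdm_def by (intro exI[of _ C]) (simp add: mult.assoc)
 qed
 from choice[OF this] obtain CS where CS: "!!J. 0 \<le> CS J"
  "!!J y t. y \<in> param_box ==> ?y y t \<in> param_box ==> bdm (?R J y t) (CS J * t\<^sup>2)" by blast
 have z: "(0::real^'b) \<in> param_box" by (simp add: param_box_def mem_box_cart)
 have CU0: "0 \<le> CU E" for E using order_trans[OF nm_nonneg CU[OF z]] .
 have CA0: "0 \<le> CA J" for J by (rule bdm_nonneg[OF CA[OF z]])
 let ?c2 = "\<lambda>p. real (fst p $ k + 1) * (Q * (CA (fst p + axis k 1) * CV (snd p)))"
 let ?C = "(\<Sum>p\<in>antidiag I. Q * (CS (fst p) * CU (snd p)) + ?c2 p) + (\<Sum>p\<in>?S. Q * (CA (fst p) * CI (snd p)))"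
 have C0: "0 \<le> ?C" using Q_nonneg CS(1) CU0 CA0 CV(1) CI(1)[OF antidiag_size(1)]
  by (intro add_nonneg_nonneg sum_nonneg mult_nonneg_nonneg) auto
 have "xn (ue k I y t) \<le> (K * ?C) * t\<^sup>2" if y: "y \<in> param_box" and y': "?y y t \<in> param_box" for y t
 proof -
  note u = uc_solution(1)[OF y] and u' = uc_solution(1)[OF y']
  note MA = bdm_MB[OF CA[OF y]] and MA' = bdm_MB[OF CA[OF y']]
  let ?s = "\<lambda>p. t * real (fst p $ k + 1)"
  let ?d = "\<lambda>E x. uc E (?y y t) x + (-1) * uc E y x"
  have d: "?d E \<in> X" "xn (?d E) \<le> CV E * \<bar>t\<bar>" for E
   by (rule Hs_lin[OF u' u]) (use CV(2)[OF y y', of E] in simp)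
  have eX: "ue k E y t \<in> X" for E unfolding ue_def[abs_def] by (intro Hs_lin u u')
  let ?\<phi> = "\<lambda>v. (\<Sum>p\<in>antidiag I. fm (?R (fst p) y t) (uc (snd p) (?y y t)) v + ?s p * fm (Am (fst p + axis k 1) y) (?d (snd p)) v)
    + (\<Sum>p\<in>?S. fm (Am (fst p) y) (ue k (snd p) y t) v)"
  have "fb ?\<phi> ((\<Sum>p\<in>antidiag I. Q * ((CS (fst p) * t\<^sup>2) * CU (snd p)) + \<bar>?s p\<bar> * (Q * (CA (fst p + axis k 1) * (CV (snd p) * \<bar>t\<bar>))))
    + (\<Sum>p\<in>?S. Q * (CA (fst p) * (CI (snd p) * t\<^sup>2))))"
  proof (intro fb_add fb_sum finite_antidiag finite_antidiag_diff fb_scale)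
   show "fb (fm (?R (fst p) y t) (uc (snd p) (?y y t))) (Q * ((CS (fst p) * t\<^sup>2) * CU (snd p)))" for p
    by (rule fb_fm[OF CS(2)[OF y y'] u' CU[OF y']])
   show "fb (fm (Am (fst p + axis k 1) y) (?d (snd p))) (Q * (CA (fst p + axis k 1) * (CV (snd p) * \<bar>t\<bar>)))" for p
    by (rule fb_fm[OF CA[OF y] d])
   show "fb (fm (Am (fst p) y) (ue k (snd p) y t)) (Q * (CA (fst p) * (CI (snd p) * t\<^sup>2)))" if "p \<in> ?S" for p
    by (rule fb_fm[OF CA[OF y] eX CI(2)[OF antidiag_size(1)[OF that] y y']])
  qed
  moreover have "(\<Sum>p\<in>antidiag I. Q * ((CS (fst p) * t\<^sup>2) * CU (snd p)) + \<bar>?s p\<bar> * (Q * (CA (fst p + axis k 1) * (CV (snd p) * \<bar>t\<bar>))))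
    + (\<Sum>p\<in>?S. Q * (CA (fst p) * (CI (snd p) * t\<^sup>2))) = ?C * t\<^sup>2"
  proof -
   have t2: "\<bar>t\<bar> * \<bar>t\<bar> = t\<^sup>2" by (simp add: power2_eq_square)
   have s1: "Q * ((CS (fst p) * t\<^sup>2) * CU (snd p)) + \<bar>?s p\<bar> * (Q * (CA (fst p + axis k 1) * (CV (snd p) * \<bar>t\<bar>))) = (Q * (CS (fst p) * CU (snd p)) + ?c2 p) * t\<^sup>2" for p
   proof -
    have "\<bar>?s p\<bar> = \<bar>t\<bar> * real (fst p $ k + 1)" by (simp add: abs_mult)
    then show ?thesis unfolding t2[symmetric] by algebra
   qed
   show ?thesis unfolding s1 distrib_right sum_distrib_right
    by (intro arg_cong2[where f = "(+)"] sum.cong refl) (simp_all add: mult_ac)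
  qed
  ultimately have "fb ?\<phi> (?C * t\<^sup>2)" by simp
  from fb_scale[OF this, of "-1"] have "fb (fm (Am 0 y) (ue k I y t)) (\<bar>-1\<bar> * (?C * t\<^sup>2))"
  proof (rule fb_cong)
   fix v assume v: "v \<in> H10 D"
   note vS = H10_Hs_Suc[OF v]
   let ?h = "\<lambda>J E. fm (Am J y) (uc E y) v"
   let ?P = "\<lambda>p. fm (?R (fst p) y t) (uc (snd p) (?y y t)) v + ?s p * fm (Am (fst p + axis k 1) y) (?d (snd p)) v"
   \<comment> \<open>For one pair: remainder of A with the new u, plus t times the derivative of A
     with the increment of u, plus A with the remainder of u.\<close>
   have e: "fm (Am (fst p) (?y y t)) (uc (snd p) (?y y t)) v - ?h (fst p) (snd p)
     - t * (real (fst p $ k + 1) * ?h (fst p + axis k 1) (snd p) + real (snd p $ k + 1) * ?h (fst p) (snd p + axis k 1))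
     = ?P p + fm (Am (fst p) y) (ue k (snd p) y t) v" for p
   proof -
    have 1: "fm (?R (fst p) y t) (uc (snd p) (?y y t)) v = fm (\<lambda>x. Am (fst p) (?y y t) x + (-1) *\<^sub>R Am (fst p) y x) (uc (snd p) (?y y t)) v
      + - (?s p) * fm (Am (fst p + axis k 1) y) (uc (snd p) (?y y t)) v"
     by (rule fm_lin_left[OF MB_lin[OF MA' MA] MA u' vS])
    have 2: "fm (\<lambda>x. Am (fst p) (?y y t) x + (-1) *\<^sub>R Am (fst p) y x) (uc (snd p) (?y y t)) v =
      fm (Am (fst p) (?y y t)) (uc (snd p) (?y y t)) v + (-1) * fm (Am (fst p) y) (uc (snd p) (?y y t)) v"
     by (rule fm_lin_left[OF MA' MA u' vS])
    have 3: "fm (Am (fst p + axis k 1) y) (?d (snd p)) v = fm (Am (fst p + axis k 1) y) (uc (snd p) (?y y t)) v + (-1) * ?h (fst p + axis k 1) (snd p)"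
     by (rule fm_lin_right[OF MA u' u vS])
    have 4: "fm (Am (fst p) y) (ue k (snd p) y t) v = fm (Am (fst p) y) (?d (snd p)) v + (- (t * real (snd p $ k + 1))) * ?h (fst p) (snd p + axis k 1)"
     unfolding ue_def[abs_def] by (rule fm_lin_right[OF MA d(1) u vS])
    have 5: "fm (Am (fst p) y) (?d (snd p)) v = fm (Am (fst p) y) (uc (snd p) (?y y t)) v + (-1) * ?h (fst p) (snd p)"
     by (rule fm_lin_right[OF MA u' u vS])
    show ?thesis unfolding 1 2 3 4 5 by algebra
   qed
   \<comment> \<open>By the derivation rule the terms linear in t add up to the system of index I +
     e_k, whose right hand side is 0 because the index is nonzero.\<close>
   have der: "real (I $ k + 1) * (\<Sum>p\<in>antidiag (I + axis k 1). ?h (fst p) (snd p)) =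
     (\<Sum>p\<in>antidiag I. real (fst p $ k + 1) * ?h (fst p + axis k 1) (snd p) + real (snd p $ k + 1) * ?h (fst p) (snd p + axis k 1))"
    using sum_antidiag_derivation[of I k ?h] unfolding case_prod_beta real_scaleR_def .
   have ne: "I + axis k 1 ~= 0"
   proof
    assume "I + axis k 1 = 0"
    then have "(I + axis k 1) $ k = 0" by simp
    then show False by (simp add: axis_def)
   qed
   have "(\<Sum>p\<in>antidiag (I + axis k 1). ?h (fst p) (snd p)) = 0" unfolding uc_solution(3)[OF y v] by (simp only: ne if_False)
   with der have "(\<Sum>p\<in>antidiag I. real (fst p $ k + 1) * ?h (fst p + axis k 1) (snd p) + real (snd p $ k + 1) * ?h (fst p) (snd p + axis k 1)) = 0" by simp
   then have "(\<Sum>p\<in>antidiag I. ?P p + fm (Am (fst p) y) (ue k (snd p) y t) v) = 0"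
    unfolding e[symmetric] sum_subtractf sum_distrib_left[symmetric] uc_solution(3)[OF y v] uc_solution(3)[OF y' v] by simp
   then show "fm (Am 0 y) (ue k I y t) v = -1 * ?\<phi> v"
    unfolding sum.distrib[of ?P] antidiag_split[of "\<lambda>p. fm (Am (fst p) y) (ue k (snd p) y t) v" I] by simp
  qed
  moreover have "ue k I y t \<in> H10 D" unfolding ue_def[abs_def] by (intro H10_lin uc_solution(2) y y')
  ultimately show ?thesis using regularD(2)[OF regular[OF y]] by (fastforce simp: mult_ac)
 qed
 then show ?case using C0 K by (intro exI[of _ "K * ?C"]) auto
qed

end

section \<open>The parameter measure\<close>

lemma space_param_measure: "space (param_measure :: (real^'m::finite) measure) = param_box"
 by (simp add: param_measure_def uniform_measure_def space_restrict_space)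

lemma sets_param_measure: "sets (param_measure :: (real^'m::finite) measure) = sets (lebesgue_on param_box)"
 by (simp add: param_measure_def uniform_measure_def)

lemma AE_param_measureD:
 assumes "AE y in param_measure. P (y :: real^'m::finite)"
 shows "AE y in lebesgue. y \<in> param_box --> P y"
proof -
 let ?M = "lebesgue_on (param_box :: (real^'m) set)"
 have b: "(param_box :: (real^'m) set) \<in> sets lebesgue" by (simp add: param_box_def)
 have "emeasure ?M param_box = emeasure lborel (param_box :: (real^'m) set)"
  using b by (subst emeasure_restrict_space) (auto simp: param_box_def)
 then have "emeasure ?M param_box < \<infinity>" using emeasure_lborel_cbox_finite unfolding param_box_def by metis
 then have pos: "0 < (1::ennreal) / emeasure ?M param_box" by (simp add: ennreal_zero_less_divide)
 have "(\<lambda>x. indicator param_box x / emeasure ?M param_box) \<in> borel_measurable ?M"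
  using b by (intro borel_measurable_divide_ennreal borel_measurable_indicator borel_measurable_const) (auto simp: sets_restrict_space)
 from AE_density[OF this] assms have "AE y in ?M. 0 < indicator param_box y / emeasure ?M param_box --> P y"
  unfolding param_measure_def uniform_measure_def by simp
 then have "AE y in lebesgue. y \<in> param_box --> 0 < indicator param_box y / emeasure ?M param_box --> P y"
  using b by (subst (asm) AE_restrict_space_iff) auto
 then show ?thesis by eventually_elim (use pos in auto)
qed

text \<open>The box is the closure of its interior, and an open subset of a null set is
  empty.\<close>

lemma param_box_closure:
 assumes "AE y in param_measure. P (y :: real^'m::finite)"
 shows "param_box \<subseteq> closure {y \<in> param_box. P y}"
proof -
 let ?S = "{y \<in> param_box. P y}" and ?B = "box (\<chi> k. -1) (\<chi> k. 1) :: (real^'m) set"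
 obtain N where N: "N \<in> null_sets lebesgue" "{y. \<not> (y \<in> param_box --> P y)} \<subseteq> N"
  using AE_param_measureD[OF assms] unfolding eventually_ae_filter by auto
 have "?B \<subseteq> closure ?S"
 proof
  fix y assume y: "y \<in> ?B"
  show "y \<in> closure ?S"
  proof (rule ccontr)
   assume n: "y \<notin> closure ?S"
   have "?B - closure ?S \<subseteq> N" using N(2) closure_subset[of ?S] box_subset_cbox[of "\<chi> k. -1" "\<chi> k. 1 :: real^'m"] unfolding param_box_def by blast
   then have "negligible (?B - closure ?S)" using N(1) negligible_iff_null_sets negligible_subset by blast
   moreover have "open (?B - closure ?S)" by (intro open_Diff) auto
   ultimately show False using y n open_not_negligible[of "?B - closure ?S"] by blast
  qed
 qed
 then have "closure ?B \<subseteq> closure ?S" by (simp add: closure_minimal)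
 moreover have "(0::real^'m) \<in> ?B" by (simp add: mem_box_cart)
 then have "closure ?B = param_box" unfolding param_box_def by (intro closure_box) blast
 ultimately show ?thesis by simp
qed

text \<open>Simple approximations of the identity, with values retracted into the box by
  \<open>closest_point\<close>, so that maps controlled only on the box can be composed with
  them.\<close>

lemma param_measure_simple_approximation:
 "\<exists>s. (\<forall>i. simple_function (param_measure :: (real^'m::finite) measure) (s i) \<and> (\<forall>y. s i y \<in> param_box)) \<and>
  (\<forall>y\<in>param_box. (\<lambda>i. s i y) \<longlonglongrightarrow> y)"
proof -
 have m: "(\<lambda>y. y) \<in> borel_measurable (param_measure :: (real^'m) measure)"
  unfolding measurable_cong_sets[OF sets_param_measure refl]
  by (intro continuous_imp_measurable_on_sets_lebesgue continuous_on_id) (simp add: param_box_def)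
 obtain F where F: "!!i. simple_function (param_measure :: (real^'m) measure) (F i)" "!!y. y \<in> param_box ==> (\<lambda>i. F i y) \<longlonglongrightarrow> y"
  using borel_measurable_implies_sequence_metric[OF m, of 0] unfolding space_param_measure by blast
 have b: "convex (param_box :: (real^'m) set)" "closed (param_box :: (real^'m) set)" "(param_box :: (real^'m) set) ~= {}"
  using mem_box_cart[of 0 "\<chi> k. -1" "\<chi> k. 1 :: real^'m"] by (auto simp: param_box_def)
 have "(\<lambda>i. closest_point param_box (F i y)) \<longlonglongrightarrow> y" if y: "y \<in> param_box" for y
 proof -
  have "isCont (closest_point (param_box :: (real^'m) set)) y"
   using continuous_on_closest_point[OF b, of UNIV] by (simp add: continuous_on_eq_continuous_at)
  from isCont_tendsto_compose[OF this F(2)[OF y]] show ?thesis by (simp add: closest_point_self[OF y])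
 qed
 then show ?thesis using F(1) closest_point_in_set[OF b(2,3)]
  by (intro exI[of _ "\<lambda>i y. closest_point param_box (F i y)"]) (auto intro: simple_function_compose1)
qed

lemma continuous_on_if_Lipschitz_abs:
 fixes g :: "'a::real_normed_vector => real"
 assumes "!!y y'. y \<in> S ==> y' \<in> S ==> \<bar>g y' - g y\<bar> \<le> L * norm (y' - y)"
 shows "continuous_on S g"
proof (rule lipschitz_on_continuous_on)
 show "\<bar>L\<bar>-lipschitz_on S g"
 proof (rule lipschitz_onI)
  fix y y' assume "y \<in> S" "y' \<in> S"
  from assms[OF this(2,1)] mult_right_mono[OF abs_ge_self norm_ge_zero, of L "y - y'"]
  show "dist (g y) (g y') \<le> \<bar>L\<bar> * dist y y'" by (simp add: dist_norm)
 qed simp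
qed

text \<open>Composing U with simple approximations of the identity gives simple functions with
  values in S. The Lipschitz bound makes them converge to U and makes the norm of U measurable in y,
  as \<open>esssup\<close> demands.\<close>

lemma Linf_space_bounded:
 fixes U :: "real^'m::finite => 'x => 'b::real_vector"
 assumes U: "!!y. y \<in> param_box ==> U y \<in> S" and B: "!!y. y \<in> param_box ==> N (U y) \<le> B" "0 \<le> B"
  and L: "!!y y'. y \<in> param_box ==> y' \<in> param_box ==> N (\<lambda>x. U y' x - U y x) \<le> L * norm (y' - y)"
  and N: "!!F. 0 \<le> N F" "!!y y'. y \<in> param_box ==> y' \<in> param_box ==> N (U y') \<le> N (U y) + N (\<lambda>x. U y' x - U y x)"
 shows "U \<in> Linf_space param_measure S N" "Linf_norm param_measure N U \<le> B"
proof -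
 let ?M = "param_measure :: (real^'m) measure"
 obtain s where s: "!!i. simple_function ?M (s i)" "!!i y. s i y \<in> param_box" "!!y. y \<in> param_box ==> (\<lambda>i. s i y) \<longlonglongrightarrow> y"
  using param_measure_simple_approximation by blast
 have "strongly_measurable ?M S N U"
  unfolding strongly_measurable_def
 proof (intro exI[of _ "\<lambda>i y. U (s i y)"] conjI allI ballI AE_I2)
  show "simple_function ?M (\<lambda>y. U (s i y))" for i by (rule simple_function_compose1[OF s(1)])
  show "U (s i y) \<in> S" for i y by (rule U[OF s(2)])
  fix y assume "y \<in> space ?M"
  then have y: "y \<in> param_box" by (simp add: space_param_measure)
  show "U y \<in> S" by (rule U[OF y])
  have "(\<lambda>i. L * norm (s i y - y)) \<longlonglongrightarrow> L * norm (y - y)" by (intro tendsto_intros s(3) y)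
  then have lim: "(\<lambda>i. L * norm (s i y - y)) \<longlonglongrightarrow> 0" by simp
  show "(\<lambda>i. N (\<lambda>x. U (s i y) x - U y x)) \<longlonglongrightarrow> 0"
   by (rule null_sequence_le[OF N(1) L[OF y s(2)] lim])
 qed
 moreover have e: "esssup ?M (\<lambda>y. ereal (N (U y))) \<le> ereal B"
 proof (rule esssup_I)
  have "continuous_on param_box (\<lambda>y. N (U y))"
  proof (rule continuous_on_if_Lipschitz_abs)
   fix y y' :: "real^'m" assume y: "y \<in> param_box" "y' \<in> param_box"
   show "\<bar>N (U y') - N (U y)\<bar> \<le> L * norm (y' - y)"
    using N(2)[OF y] N(2)[OF y(2,1)] L[OF y] L[OF y(2,1)] by (simp add: norm_minus_commute abs_le_iff)
  qed
  then show "(\<lambda>y. ereal (N (U y))) \<in> borel_measurable ?M"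
   unfolding measurable_cong_sets[OF sets_param_measure refl]
   by (intro borel_measurable_ereal continuous_imp_measurable_on_sets_lebesgue) (simp_all add: param_box_def)
  show "AE y in ?M. ereal (N (U y)) \<le> ereal B"
   by (rule AE_I2) (simp add: B space_param_measure)
 qed
 moreover have "esssup ?M (\<lambda>y. ereal (N (U y))) < \<infinity>" using e by (auto intro: le_less_trans)
 ultimately show "U \<in> Linf_space ?M S N" by (simp add: Linf_space_def)
 show "Linf_norm ?M N U \<le> B"
  unfolding Linf_norm_def using e B(2) by (cases "esssup ?M (\<lambda>y. ereal (N (U y)))") auto
qed

section \<open>Parametric regularity\<close>

context random_elliptic
begin

definition U :: "nat^'b => real^'b => real^'a => real" where
 "U I y x = real (mi_fact I) * uc I y x"

lemma U_mem: "y \<in> param_box ==> U I y \<in> X" "y \<in> param_box ==> U I y \<in> H10 D"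
 using Hs_scale[OF uc_solution(1)] H10_lin[OF H10_zero uc_solution(2)] unfolding U_def[abs_def] by simp_all

lemma U_Lipschitz: "\<exists>C. \<forall>y\<in>param_box. \<forall>y'\<in>param_box. xn (\<lambda>x. U I y' x - U I y x) \<le> C * norm (y' - y)"
proof -
 obtain C where C: "\<forall>y\<in>param_box. \<forall>y'\<in>param_box. xn (\<lambda>x. uc I y' x + (-1) * uc I y x) \<le> C * norm (y' - y)" using uc_Lipschitz by blast
 have "xn (\<lambda>x. U I y' x - U I y x) \<le> (real (mi_fact I) * C) * norm (y' - y)" if "y \<in> param_box" "y' \<in> param_box" for y y'
 proof -
  have "xn (\<lambda>x. real (mi_fact I) * (uc I y' x + (-1) * uc I y x)) \<le> \<bar>real (mi_fact I)\<bar> * xn (\<lambda>x. uc I y' x + (-1) * uc I y x)"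
   by (rule nm_scale[OF Hs_lin[OF uc_solution(1)[OF that(2)] uc_solution(1)[OF that(1)]]])
  also have "\<dots> \<le> \<bar>real (mi_fact I)\<bar> * (C * norm (y' - y))" using C that by (intro mult_left_mono) auto
  finally show ?thesis by (simp add: U_def right_diff_distrib mult.assoc)
 qed
 then show ?thesis by blast
qed

lemma U_bound:
 assumes y: "y \<in> param_box" and M: "2 \<le> M" "2 * (K * Q * k1) \<le> M" "K * nm n f \<le> M"
 shows "xn (U I y) \<le> fact (mi_size I) * mi_power (\<lambda>k. m * \<gamma> k) I * M ^ (mi_size I + 1)"
proof -
 have "xn (U I y) \<le> \<bar>real (mi_fact I)\<bar> * xn (uc I y)" unfolding U_def[abs_def] by (rule nm_scale[OF uc_solution(1)[OF y]])
 also have "\<dots> \<le> \<bar>real (mi_fact I)\<bar> * (mw (\<lambda>k. m * \<gamma> k) I * M ^ (mi_size I + 1))" by (intro mult_left_mono uc_bound[OF assms]) simp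
 also have "\<dots> = fact (mi_size I) * mi_power (\<lambda>k. m * \<gamma> k) I * M ^ (mi_size I + 1)"
  using mi_fact_pos[of I] by (simp add: mw_def)
 finally show ?thesis .
qed

text \<open>Since (I + e_k)! = (I_k + 1) I!, the error of the quotient is I!/t times the remainder
  \<open>ue\<close>, hence of order |t|. The estimate even holds in H^(\<kappa>+1).\<close>

lemma U_difference_quotient:
 assumes y: "y \<in> param_box"
 shows "((\<lambda>t. nm 1 (\<lambda>x. (U I (y + t *\<^sub>R axis k 1) x - U I y x) / t - U (I + axis k 1) y x)) \<longlongrightarrow> 0)
  (at 0 within {t. y + t *\<^sub>R axis k 1 \<in> param_box})"
proof -
 let ?T = "{t. y + t *\<^sub>R axis k 1 \<in> param_box}" and ?F = "real (mi_fact I)"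
 let ?g = "\<lambda>t x. (U I (y + t *\<^sub>R axis k 1) x - U I y x) / t - U (I + axis k 1) y x"
 obtain C where C: "C \<ge> 0" "\<forall>t. y + t *\<^sub>R axis k 1 \<in> param_box --> xn (ue k I y t) \<le> C * t\<^sup>2" using uc_second_order y by blast
 have le: "nm 1 (?g t) \<le> ?F * C * \<bar>t\<bar>" if t: "t \<in> ?T" "t ~= 0" for t
 proof -
  have y': "y + t *\<^sub>R axis k 1 \<in> param_box" using t by simp
  have eX: "ue k I y t \<in> X" unfolding ue_def[abs_def] by (intro Hs_lin uc_solution(1) y y')
  have "?g t = (\<lambda>x. (?F / t) * ue k I y t x)"
  proof
   fix x
   have "(F * p - F * q) / t - (s * F) * r = F / t * (p + (-1) * q + (- (t * s)) * r)" for F p q r s :: real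
    using t(2) by (simp add: field_simps)
   then show "?g t x = (?F / t) * ue k I y t x"
    unfolding U_def ue_def mi_fact_add_axis of_nat_mult .
  qed
  then have "nm 1 (?g t) \<le> xn (\<lambda>x. (?F / t) * ue k I y t x)" using nm_xn by simp
  also have "\<dots> \<le> \<bar>?F / t\<bar> * xn (ue k I y t)" by (rule nm_scale[OF eX])
  also have "\<dots> \<le> \<bar>?F / t\<bar> * (C * t\<^sup>2)" using C(2) y' by (intro mult_left_mono) auto
  also have "\<dots> = ?F * C * \<bar>t\<bar>"
  proof -
   have "\<bar>?F / t\<bar> = ?F / \<bar>t\<bar>" "t\<^sup>2 = \<bar>t\<bar> * \<bar>t\<bar>" by (simp_all add: power2_eq_square)
   then show ?thesis using t(2) by (simp only:) (simp add: field_simps)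
  qed
  finally show ?thesis .
 qed
 have "((\<lambda>t. ?F * C * \<bar>t\<bar>) \<longlongrightarrow> ?F * C * \<bar>0\<bar>) (at 0 within ?T)" by (intro tendsto_intros)
 then have lim: "((\<lambda>t. ?F * C * \<bar>t\<bar>) \<longlongrightarrow> 0) (at 0 within ?T)" by simp
 show ?thesis
 proof (rule tendsto_sandwich[OF _ _ tendsto_const lim])
  show "\<forall>\<^sub>F t in at 0 within ?T. nm 1 (?g t) \<le> ?F * C * \<bar>t\<bar>"
   unfolding eventually_at_filter by (intro always_eventually allI impI le)
 qed (simp add: nm_nonneg)
qed

lemma U_0: "y \<in> param_box ==> weak_solution D (Am 0 y) f w ==> AE x in lebesgue_on D. U 0 y x = w x"
proof -
 assume y: "y \<in> param_box" and w: "weak_solution D (Am 0 y) f w"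
 have "sol y f (uc 0 y)" unfolding sol_def using uc_solution(2)[OF y] uc_solution(3)[OF y, of _ 0] by (simp add: antidiag_0)
 from sol_unique[OF y this] w show ?thesis by (simp add: weak_solution_iff[OF y] U_def mi_fact_0)
qed

end

section \<open>From the assumptions of the theorem to the locales\<close>

lemma diffusion_matrix_eigenvalue:
 assumes v: "(v :: real^'d::finite) ~= 0" and e: "e ~= 0" "diffusion_matrix a v *v e = r *\<^sub>R e"
 shows "r = a \<or> r = norm v"
proof (cases "v \<bullet> e = 0")
 case True
 then have "a *\<^sub>R e = r *\<^sub>R e" using e(2) by (simp add: diffusion_matrix_mult)
 then show ?thesis using e(1) by simp
next
 case False
 have "v \<bullet> (diffusion_matrix a v *v e) = norm v * (v \<bullet> e)"
  using v unfolding diffusion_matrix_mult inner_add_right inner_scaleR_right by simp (simp add: algebra_simps)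
 then show ?thesis using e(2) False by simp
qed

lemma transpose_diffusion_matrix: "transpose (diffusion_matrix a v) = diffusion_matrix a v"
 by (simp add: diffusion_matrix_def transpose_def vec_eq_iff mat_def mult.commute)

lemma (in open_domain) sobolev_matrix:
 fixes B :: "real^'d => real^'n::finite^'k::finite"
 assumes B: "!!i j. (\<lambda>x. B x $ i $ j) \<in> sobolev D H \<infinity>"
 shows "B \<in> sobolev D H \<infinity>"
proof -
 have p: "\<infinity> \<in> {2, \<infinity>::ereal}" by simp
 let ?E = "\<lambda>i j. axis i (axis j 1) :: real^'n^'k"
 have E: "bounded_linear (\<lambda>r. r *\<^sub>R ?E i j)" for i j by (rule bounded_linear_scaleR_left)
 have e: "(\<lambda>x. B x $ i $ j *\<^sub>R ?E i j) \<in> sobolev D H \<infinity>" for i j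
  by (rule sobolev_linear(1)[OF p B E, where K = "norm (?E i j)"]) (simp add: mult.commute)
 have s: "(\<lambda>x. \<Sum>j\<in>UNIV. B x $ i $ j *\<^sub>R ?E i j) \<in> sobolev D H \<infinity>" for i
  by (rule sobolev_sum[OF p zero_le_one finite, THEN conjunct1]) (rule e)
 have "(\<lambda>x. \<Sum>i\<in>UNIV. \<Sum>j\<in>UNIV. B x $ i $ j *\<^sub>R ?E i j) \<in> sobolev D H \<infinity>"
  by (rule sobolev_sum[OF p zero_le_one finite, THEN conjunct1]) (rule s)
 moreover have "(\<Sum>i\<in>UNIV. \<Sum>j\<in>UNIV. B x $ i $ j *\<^sub>R ?E i j) = B x" for x
 proof -
  have "(\<Sum>i\<in>UNIV. \<Sum>j\<in>UNIV. B x $ i $ j *\<^sub>R ?E i j) $ k $ l = (\<Sum>i\<in>UNIV. \<Sum>j\<in>UNIV. if i = k then if j = l then B x $ i $ j else 0 else 0)" for k l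
   unfolding sum_component by (intro sum.cong refl) (auto simp: axis_def)
  also have "\<dots> k l = (\<Sum>i\<in>UNIV. if i = k then B x $ i $ l else 0)" for k l by (intro sum.cong refl) auto
  finally show ?thesis by (simp add: vec_eq_iff)
 qed
 ultimately show ?thesis by simp
qed

text \<open>The recursion produces d^2 \<kappa> (\<kappa> + 1) times \<open>k1\<close>, the theorem
  allows \<kappa>^2 d^2 times \<open>k_const\<close>. The power T = (2 c^2 / a_lo^2)^\<kappa> occurs
  twice in \<open>k_const\<close> and once in \<open>k1\<close>; the spare T is at least 8, and with
  the factor 3 it exceeds the 11.\<close>

lemma k_const_ge:
 assumes "1 \<le> \<kappa>" "0 < a_lo" "a_lo \<le> 1" "1 \<le> a_hi" "2 \<le> c"
 shows "(real \<kappa> + 1) * (11 * (2 * c\<^sup>2 / a_lo\<^sup>2) ^ \<kappa> * (a_hi * c\<^sup>2 / a_lo\<^sup>2)) \<le> real \<kappa> * k_const \<kappa> a_lo a_hi c"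
proof -
 let ?T = "(2 * c\<^sup>2 / a_lo\<^sup>2) ^ \<kappa>" and ?H = "a_hi * c\<^sup>2 / a_lo\<^sup>2" and ?s = "real \<kappa> + 1"
 have a2: "a_lo\<^sup>2 \<le> 1" "0 < a_lo\<^sup>2" using assms by (auto simp: power_le_one)
 have c2: "4 \<le> c\<^sup>2" using power_mono[OF assms(5), of 2] by simp
 have "8 \<le> 2 * c\<^sup>2 / a_lo\<^sup>2" using a2 c2 by (simp add: le_divide_eq)
 then have T: "8 \<le> ?T" using power_increasing[of 1 \<kappa> "2 * c\<^sup>2 / a_lo\<^sup>2"] assms(1) by simp
 have H: "0 \<le> ?H" using assms by simp
 have "?s * (11 * ?T * ?H) \<le> ?s * (24 * ?s * ?T * ?H)"
 proof -
  have "11 * ?T \<le> 24 * ?s * ?T" using T by (intro mult_right_mono) auto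
  then show ?thesis using H by (intro mult_left_mono mult_right_mono) auto
 qed
 also have "\<dots> = (3 * ?s\<^sup>2 * ?T * ?H) * 8" by (simp add: power2_eq_square)
 also have "\<dots> \<le> (3 * ?s\<^sup>2 * ?T * ?H) * ?T" using T by (intro mult_left_mono mult_nonneg_nonneg[OF _ H] mult_nonneg_nonneg) auto
 also have "\<dots> = (?s * a_hi * ?T) * (3 * ?s * (1 / a_lo\<^sup>2) * ?T * c\<^sup>2)" by (simp add: power2_eq_square)
 also have "\<dots> \<le> (?s * a_hi * ?T + a_hi) * (3 * ?s * (1 / a_lo\<^sup>2) * ?T * c\<^sup>2)"
  using assms T by (intro mult_right_mono mult_nonneg_nonneg) auto
 also have "\<dots> \<le> k_const \<kappa> a_lo a_hi c" using assms(4) by (simp add: k_const_def)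
 also have "\<dots> \<le> real \<kappa> * k_const \<kappa> a_lo a_hi c"
 proof -
  have "0 \<le> k_const \<kappa> a_lo a_hi c" unfolding k_const_def using assms by (intro add_nonneg_nonneg mult_nonneg_nonneg) auto
  then show ?thesis using assms(1) mult_right_mono[of 1 "real \<kappa>" "k_const \<kappa> a_lo a_hi c"] by simp
 qed
 finally show ?thesis .
qed

theorem theorem3p18:
  fixes D :: "(real^'d::finite) set"
    and \<kappa> :: nat
    and \<psi>0 :: "real^'d \<Rightarrow> real^'d"
    and \<sigma> :: "'m::finite \<Rightarrow> real"
    and \<psi> :: "'m \<Rightarrow> real^'d \<Rightarrow> real^'d"
    and a_lo a_hi a :: real
    and V :: "real^'m \<Rightarrow> real^'d \<Rightarrow> real^'d"
    and A :: "real^'m \<Rightarrow> real^'d \<Rightarrow> real^'d^'d"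
    and R :: "(real^'d \<Rightarrow> real^'d^'d) set"
    and normR :: "(real^'d \<Rightarrow> real^'d^'d) \<Rightarrow> real"
    and C :: "real \<Rightarrow> real"
    and f :: "real^'d \<Rightarrow> real"
    and u :: "real^'m \<Rightarrow> real^'d \<Rightarrow> real"
    and \<gamma> \<mu> :: "'m \<Rightarrow> real"
    and c C_er :: real
  assumes D: "lipschitz_domain D"
    and \<kappa>: "\<kappa> \<ge> 1"
    and \<psi>0: "\<psi>0 \<in> sobolev D \<kappa> \<infinity>"
    and \<psi>: "\<And>k. \<psi> k \<in> sobolev D \<kappa> \<infinity>"
    and V: "V = vector_field \<psi>0 \<sigma> \<psi>"
    and a_lo: "0 < a_lo" "a_lo \<le> 1"
    and a_hi: "1 \<le> a_hi"
    and V_bounds: "AE y in param_measure. AE x in lebesgue_on D. norm (V y x) \<in> {a_lo..a_hi}"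
    and a: "a \<in> {a_lo..a_hi}"
    and A: "A = (\<lambda>y x. diffusion_matrix a (V y x))"
    and regularity: "elliptic_regularity D \<kappa> a_lo a_hi R normR C"
    and A_R: "A \<in> Linf_space param_measure R normR"
    and f: "f \<in> sobolev D (\<kappa> - 1) 2"
    and u: "u \<in> Linf_space param_measure (H10 D) (sob_norm D 1 2)"
    and u_sol: "AE y in param_measure. weak_solution D (A y) f (u y)"
    and \<gamma>: "\<gamma> = gamma_const D \<kappa> \<sigma> \<psi>"
    and c: "c = max (gamma0_const D \<kappa> \<psi>0 + (\<Sum>k\<in>UNIV. \<gamma> k)) 2"
    and \<mu>: "\<mu> = (\<lambda>k. 4 * c\<^sup>2 / (a_lo\<^sup>2 * ln 2) * \<gamma> k)"
    and C_er: "C_er = (SUP s\<in>{0..Linf_norm param_measure normR A}. C s)"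
  shows "\<exists>U. param_derivs D u U \<and>
    (\<forall>\<alpha>. U \<alpha> \<in> Linf_space param_measure (sobolev D (\<kappa> + 1) 2) (sob_norm D (\<kappa> + 1) 2) \<and>
      Linf_norm param_measure (sob_norm D (\<kappa> + 1) 2) (U \<alpha>)
        \<le> fact (mi_size \<alpha>) * mi_power \<mu> \<alpha> *
          Max {2,
               2 * C_er * real \<kappa> ^ 2 * real CARD('d) ^ 2 * k_const \<kappa> a_lo a_hi c,
               C_er * sob_norm D (\<kappa> - 1) 2 f} ^ (mi_size \<alpha> + 1))"
proof -
 have "open D" using D by (simp add: lipschitz_domain_def)
 then interpret od: open_domain D by unfold_locales
 obtain n where n: "\<kappa> = Suc n" using \<kappa> by (cases \<kappa>) auto
 define W where "W = (\<lambda>k x. \<sigma> k *\<^sub>R \<psi> k x)"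
 have inf: "\<infinity> \<in> {2, \<infinity>::ereal}" by simp
 have W: "W k \<in> sobolev D \<kappa> \<infinity>" for k unfolding W_def by (rule od.sobolev_scaleR(1)[OF inf \<psi>])
 have V_eq: "V y x = \<psi>0 x + (\<Sum>k\<in>UNIV. y $ k *\<^sub>R W k x)" for y x
  unfolding V vector_field_def W_def by (simp add: mult.commute)
 have \<gamma>': "\<gamma> k = wnorm D \<kappa> \<infinity> 1 (W k)" for k unfolding \<gamma> gamma_const_def W_def sob_norm_eq_wnorm ..
 have c': "wnorm D \<kappa> \<infinity> 1 \<psi>0 + (\<Sum>k\<in>UNIV. \<gamma> k) \<le> c" "2 \<le> c" unfolding c gamma0_const_def sob_norm_eq_wnorm by auto
 let ?L = "Linf_norm param_measure normR A"
 \<comment> \<open>The parameters at which the regularity assumption applies; almost every one,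
   hence a dense set.\<close>
 define G where "G = {y \<in> param_box. (AE x in lebesgue_on D. norm (V y x) \<in> {a_lo..a_hi}) \<and> A y \<in> R \<and> normR (A y) \<le> ?L}"
 note reg = regularity[unfolded elliptic_regularity_def]
 have "param_box \<subseteq> closure G"
  unfolding G_def
 proof (rule param_box_closure)
  have R: "AE y in param_measure. A y \<in> R" using A_R unfolding Linf_space_def strongly_measurable_def by (auto elim: eventually_mono)
  have fin: "esssup param_measure (\<lambda>y. ereal (normR (A y))) < \<infinity>" using A_R by (simp add: Linf_space_def)
  show "AE y in param_measure. (AE x in lebesgue_on D. norm (V y x) \<in> {a_lo..a_hi}) \<and> A y \<in> R \<and> normR (A y) \<le> ?L"
   using V_bounds R esssup_AE[of "\<lambda>y. ereal (normR (A y))" param_measure]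
  proof eventually_elim
   case (elim y)
   then show ?case unfolding Linf_norm_def using fin by (cases "esssup param_measure (\<lambda>y. ereal (normR (A y)))") auto
  qed
 qed
 have G_box: "G \<subseteq> param_box" by (auto simp: G_def)
 \<comment> \<open>A countable dense set of parameters merges the null sets that depend on y into
   one; continuity of V in y then carries the bounds to the whole box.\<close>
 obtain T where T: "countable T" "T \<subseteq> G" "G \<subseteq> closure T" using separable by blast
 have box_T: "param_box \<subseteq> closure T" using \<open>param_box \<subseteq> closure G\<close> closure_mono[OF T(3)] by auto
 have "AE x in lebesgue_on D. \<forall>y\<in>T. norm (V y x) \<in> {a_lo..a_hi}"
  by (rule AE_ball_countable'[OF _ T(1)]) (use T(2) in \<open>auto simp: G_def\<close>)
 then have Vb: "AE x in lebesgue_on D. \<forall>y\<in>param_box. a_lo \<le> norm (V y x) \<and> norm (V y x) \<le> a_hi"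
 proof eventually_elim
  case (elim x)
  have "continuous_on UNIV (\<lambda>y. norm (V y x))" unfolding V_eq by (intro continuous_intros)
  from closed_vimage[OF closed_atLeastAtMost this] have "closed {y. norm (V y x) \<in> {a_lo..a_hi}}" by (simp add: vimage_def)
  then have "closure T \<subseteq> {y. norm (V y x) \<in> {a_lo..a_hi}}" using elim by (intro closure_minimal) auto
  then show ?case using box_T by auto
 qed
 interpret rc: random_coefficient D \<kappa> \<psi>0 W V a_lo a_hi c \<gamma> a
  by unfold_locales (use \<psi>0 W V_eq Vb a_lo \<gamma>' c' a a_hi in auto)
 have A_eq: "A y = rc.Am 0 y" for y unfolding A rc.Am_0 ..
 have A_sob: "A y \<in> sobolev D \<kappa> \<infinity>" if y: "y \<in> param_box" for y
 proof -
  obtain B where "\<forall>i j. \<forall>y\<in>param_box. rc.bd 1 (\<lambda>x. rc.Am 0 y x $ i $ j) B" using rc.Am_bounded by blast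
  then show ?thesis unfolding A_eq using y by (intro od.sobolev_matrix) (auto intro: rc.bd_sobolev)
 qed
 \<comment> \<open>\<open>C_er\<close> may be negative, while the estimates need a nonnegative
   constant.\<close>
 define K where "K = max C_er 0"
 have K: "0 \<le> K" "C_er \<le> K" by (auto simp: K_def)
 have good: "A y \<in> sobolev D \<kappa> \<infinity> \<and> A y \<in> R \<and> (AE x in lebesgue_on D. transpose (A y x) = A y x \<and>
   (\<forall>\<theta> e. e \<noteq> 0 \<and> A y x *v e = \<theta> *\<^sub>R e \<longrightarrow> \<theta> \<in> {a_lo..a_hi}))" "C (normR (A y)) \<le> K" if y: "y \<in> G" for y
 proof -
  have "AE x in lebesgue_on D. transpose (A y x) = A y x \<and> (\<forall>\<theta> e. e \<noteq> 0 \<and> A y x *v e = \<theta> *\<^sub>R e \<longrightarrow> \<theta> \<in> {a_lo..a_hi})"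
   using Vb
  proof eventually_elim
   case (elim x)
   then have v: "a_lo \<le> norm (V y x)" "norm (V y x) \<le> a_hi" using y G_box by auto
   then have "V y x \<noteq> 0" using a_lo by auto
   then show ?case unfolding A using diffusion_matrix_eigenvalue[of "V y x" _ a] v a by (auto simp: transpose_diffusion_matrix)
  qed
  then show "A y \<in> sobolev D \<kappa> \<infinity> \<and> A y \<in> R \<and> (AE x in lebesgue_on D. transpose (A y x) = A y x \<and>
   (\<forall>\<theta> e. e \<noteq> 0 \<and> A y x *v e = \<theta> *\<^sub>R e \<longrightarrow> \<theta> \<in> {a_lo..a_hi}))" using A_sob y by (auto simp: G_def)
  have "0 \<le> normR (A y)" using reg y by (simp add: banach_fun_space_def G_def)
  then have "normR (A y) \<in> {0..?L}" using y by (simp add: G_def)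
  \<comment> \<open>Continuity on a compact interval makes the supremum \<open>C_er\<close> an upper
    bound.\<close>
  moreover have "bdd_above (C ` {0..?L})"
   using reg by (intro bounded_imp_bdd_above compact_imp_bounded compact_continuous_image) (auto intro: continuous_on_subset)
  ultimately have "C (normR (A y)) \<le> C_er" unfolding C_er by (intro cSUP_upper)
  then show "C (normR (A y)) \<le> K" using K(2) by simp
 qed
 have reg': "(\<exists>w. weak_solution D (A y) h w) \<and>
    (\<forall>w w'. weak_solution D (A y) h w \<and> weak_solution D (A y) h w' \<longrightarrow> (AE x in lebesgue_on D. w x = w' x)) \<and>
    (\<forall>w. weak_solution D (A y) h w \<longrightarrow> w \<in> sobolev D (\<kappa> + 1) 2 \<and>
     sob_norm D (\<kappa> + 1) 2 w \<le> C (normR (A y)) * sob_norm D (\<kappa> - 1) 2 h)" if "y \<in> G" "h \<in> sobolev D (\<kappa> - 1) 2" for y h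
  using reg good(1)[OF that(1)] that(2) by blast
 have Hs_eq: "sobolev D (\<kappa> + 1) 2 = od.Hs (Suc \<kappa>)" "sobolev D (\<kappa> - 1) 2 = od.Hs n"
  and nm_eq: "sob_norm D (\<kappa> + 1) 2 = od.nm (Suc \<kappa>)" "sob_norm D (\<kappa> - 1) 2 = od.nm n" "sob_norm D 1 2 = od.nm 1"
  by (simp_all only: od.Hs_def od.nm_def[abs_def] sob_norm_eq_wnorm[abs_def] Suc_eq_plus1 n diff_add_inverse2)
 interpret re: random_elliptic D \<kappa> \<psi>0 W V a_lo a_hi c \<gamma> a n K f G
 proof unfold_locales
  fix y h assume y: "y \<in> G" and h: "h \<in> od.Hs n"
  note r = reg'[OF y, unfolded Hs_eq, OF h, unfolded nm_eq A_eq]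
  show "\<exists>w. weak_solution D (rc.Am 0 y) h w" using r by blast
  show "AE x in lebesgue_on D. w x = w' x" if "weak_solution D (rc.Am 0 y) h w" "weak_solution D (rc.Am 0 y) h w'" for w w'
   using r that by blast
  show "w \<in> od.Hs (Suc \<kappa>) \<and> od.nm (Suc \<kappa>) w \<le> K * od.nm n h" if "weak_solution D (rc.Am 0 y) h w" for w
  proof -
   have "C (normR (A y)) * od.nm n h \<le> K * od.nm n h" by (rule mult_right_mono[OF good(2)[OF y] od.nm_nonneg])
   then show ?thesis using r that unfolding A_eq by (meson order_trans)
  qed
 qed (use n G_box \<open>param_box \<subseteq> closure G\<close> K f Hs_eq in auto)
 define M where "M = Max {2, 2 * C_er * real \<kappa> ^ 2 * real CARD('d) ^ 2 * k_const \<kappa> a_lo a_hi c, C_er * sob_norm D (\<kappa> - 1) 2 f}"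
 have M2: "2 \<le> M" "2 * C_er * real \<kappa> ^ 2 * real CARD('d) ^ 2 * k_const \<kappa> a_lo a_hi c \<le> M" "C_er * od.nm n f \<le> M"
  unfolding M_def nm_eq by auto
 have Mf: "K * od.nm n f \<le> M" using M2 by (cases "C_er \<le> 0") (auto simp: K_def max_def)
 \<comment> \<open>For \<open>C_er\<close> at most 0 the constant K is 0 and M \<ge> 2 suffices;
   otherwise \<open>k_const_ge\<close> compares the constants.\<close>
 have Mk: "2 * (K * re.Q * rc.k1) \<le> M"
 proof (cases "C_er \<le> 0")
  case True
  then show ?thesis using M2(1) by (simp add: K_def)
 next
  case False
  have T: "1 / rc.\<theta> = 2 * c\<^sup>2 / a_lo\<^sup>2" by (simp add: rc.\<theta>_def)
  have "2 * (K * re.Q * rc.k1) = 2 * C_er * real CARD('d) ^ 2 * real \<kappa> * ((real \<kappa> + 1) * rc.k1)"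
   using False by (simp add: K_def re.Q_def algebra_simps)
  also have "\<dots> \<le> 2 * C_er * real CARD('d) ^ 2 * real \<kappa> * (real \<kappa> * k_const \<kappa> a_lo a_hi c)"
   unfolding rc.k1_def T using k_const_ge[OF \<kappa> a_lo a_hi c'(2)] False by (intro mult_left_mono) auto
  also have "\<dots> \<le> M" using M2(2) by (simp add: power2_eq_square mult_ac)
  finally show ?thesis .
 qed
 have \<mu>': "\<mu> = (\<lambda>k. rc.m * \<gamma> k)" unfolding \<mu> rc.m_def ..
 have pd: "param_derivs D u re.U"
  unfolding param_derivs_def nm_eq
 proof (intro conjI allI ballI)
  \<comment> \<open>The given u solves the problem at almost every y, and uniqueness there
    identifies it with the constructed representative.\<close>
  show "AE y in param_measure. AE x in lebesgue_on D. re.U 0 y x = u y x"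
   using u_sol AE_space
   by eventually_elim (simp add: space_param_measure A_eq re.U_0)
 qed (rule re.U_mem(2), assumption, rule re.U_difference_quotient)
 have "re.U \<alpha> \<in> Linf_space param_measure (od.Hs (Suc \<kappa>)) (od.nm (Suc \<kappa>)) \<and>
   Linf_norm param_measure (od.nm (Suc \<kappa>)) (re.U \<alpha>) \<le> fact (mi_size \<alpha>) * mi_power \<mu> \<alpha> * M ^ (mi_size \<alpha> + 1)" for \<alpha>
 proof -
  obtain L where L: "\<forall>y\<in>param_box. \<forall>y'\<in>param_box. od.nm (Suc \<kappa>) (\<lambda>x. re.U \<alpha> y' x - re.U \<alpha> y x) \<le> L * norm (y' - y)"
   using re.U_Lipschitz by blast
  have B: "od.nm (Suc \<kappa>) (re.U \<alpha> y) \<le> fact (mi_size \<alpha>) * mi_power \<mu> \<alpha> * M ^ (mi_size \<alpha> + 1)" if "y \<in> param_box" for y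
   unfolding \<mu>' by (rule re.U_bound[OF that M2(1) Mk Mf])
  have "(0::real^'m) \<in> param_box" by (simp add: param_box_def mem_box_cart)
  from order_trans[OF od.nm_nonneg B[OF this]] have B0: "0 \<le> fact (mi_size \<alpha>) * mi_power \<mu> \<alpha> * M ^ (mi_size \<alpha> + 1)" .
  have tri: "od.nm (Suc \<kappa>) (re.U \<alpha> y') \<le> od.nm (Suc \<kappa>) (re.U \<alpha> y) + od.nm (Suc \<kappa>) (\<lambda>x. re.U \<alpha> y' x - re.U \<alpha> y x)"
   if "y \<in> param_box" "y' \<in> param_box" for y y'
   using od.nm_add[OF re.U_mem(1)[OF that(1)] od.Hs_diff[OF re.U_mem(1)[OF that(2)] re.U_mem(1)[OF that(1)]], of \<alpha> \<alpha> \<alpha>] by simp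
  show ?thesis
   using Linf_space_bounded[where S = "od.Hs (Suc \<kappa>)" and N = "od.nm (Suc \<kappa>)", OF re.U_mem(1) B B0 L[rule_format] od.nm_nonneg tri] by blast
 qed
 then show ?thesis using pd unfolding M_def Hs_eq nm_eq by blast
qed

end
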